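(* Let $\mu$ be a non-negative Radon measure on $\mathbb{R}^d$. Then $$\mathrm{BV}(\mathbb{R}^d,\mu)=\mathrm{BV}_{\mathrm{Der}}(\mathbb{R}^d,\mu)=\mathrm{BV}_{\mathrm{Lip}}(\mathbb{R}^d,\mu)=\mathrm{BV}_{C^\infty}(\mathbb{R}^d,\mu)$$ as subsets of $L^1_\mu(\mathbb{R}^d)$. Moreover, for every $f\in\mathrm{BV}(\mathbb{R}^d,\mu)$ it holds that $$|D_\mu f|=|D_\mu f|_{\mathrm{Der}}=|D_\mu f|_{\mathrm{Lip}}=|D_\mu f|_{C^\infty}$$ as Borel measures on $\mathbb{R}^d$.
   Context: Setting: $\mathbb{R}^d$ with the Euclidean distance and an arbitrary non-negative Radon measure $\mu$. $L^p_\mu$ denotes Lebesgue spaces with respect to $\mu$; $L^0_\mu(\mathbb{R}^d)$ is the space of $\mu$-measurable functions modulo $\mu$-a.e. equality. $\mathrm{LIP}_c(\mathbb{R}^d)$ is the space of compactly supported real-valued Lipschitz functions; for $\Omega\subseteq\mathbb{R}^d$ open, $\mathrm{LIP}_{loc}(\Omega)$ is the space of locally Lipschitz functions on $\Omega$ (Lipschitz on some ball around each point). $\mathrm{Lip}(f;E)$ is the Lipschitz constant of $f|_E$, and $\mathrm{lip}_a(f)(x):=\lim_{r\to0}\mathrm{Lip}(f;B_r(x))$ is the asymptotic Lipschitz constant. $\mathscr{M}(\mathbb{R}^d)$ is the Banach space of finite signed Borel measures with the total variation norm. (1) Vector fields. $\mathrm{D}_\infty(\mathrm{div}_\mu)$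 is the set of $v\in L^\infty_\mu(\mathbb{R}^d;\mathbb{R}^d)$ for which there exists a (necessarily unique) $\mathrm{div}_\mu(v)\in L^\infty_\mu(\mathbb{R}^d)$ with $\int\nabla f\cdot v\,d\mu=-\int f\,\mathrm{div}_\mu(v)\,d\mu$ for all $f\in C^\infty_c(\mathbb{R}^d)$. $\mathrm{BV}(\mathbb{R}^d,\mu)$ is the set of $f\in L^1_\mu(\mathbb{R}^d)$ such that $\|D_\mu f\|:=\sup\{\int f\,\mathrm{div}_\mu(v)\,d\mu: v\in\mathrm{D}_\infty(\mathrm{div}_\mu),\ |v|\le1\ \mu\text{-a.e.}\}<\infty$. For such $f$ and $\Omega$ open, $|D_\mu f|(\Omega):=\sup\{\int_\Omega f\,\mathrm{div}_\mu(v)\,d\mu: v\in\mathrm{D}_\infty(\mathrm{div}_\mu),\ \mathrm{supp}(v)\Subset\Omega,\ |v|\le1\ \mu\text{-a.e.}\}$, and for $B$ Borel $|D_\mu f|(B):=\inf\{|D_\mu f|(\Omega):\Omega\supseteq B\text{ open}\}$. (That $|D_\mu f|$ is a finite Borel measure is part of the assertion.) (2) Derivations. A derivation is a linear map $\mathbf b:\mathrm{LIP}_c(\mathbb{R}^d)\to L^0_\mu(\mathbb{R}^d)$ with $\mathbf b(fg)=\mathbf b(f)g+f\mathbf b(g)$ for all $f,g$, and such that for some non-negative $G\in L^0_\mu(\mathbb{R}^d)$ one has $|\mathbf b(f)|\le G\,\mathrm{lip}_a(f)$ $\mu$-a.e. for all $f\in\mathrm{LIP}_c(\mathbb{R}^d)$;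 the least such $G$ (in the $\mu$-a.e. sense) is denoted $|\mathbf b|$, and $\mathrm{supp}(\mathbf b):=\mathrm{supp}(|\mathbf b|)$. $\mathrm{Der}_b(\mathbb{R}^d,\mu)$ is the set of derivations with $|\mathbf b|\in L^\infty_\mu(\mathbb{R}^d)$ for which there exists $\mathrm{div}(\mathbf b)\in L^\infty_\mu(\mathbb{R}^d)$ with $\int\mathbf b(f)\,d\mu=-\int f\,\mathrm{div}(\mathbf b)\,d\mu$ for all $f\in\mathrm{LIP}_c(\mathbb{R}^d)$. Set $\|\mathbf b\|_b:=\||\mathbf b|\|_{L^\infty_\mu}$. $\mathrm{Der}_b(\mathbb{R}^d,\mu)$ is closed under multiplication by $h\in\mathrm{LIP}_c(\mathbb{R}^d)$, where $(h\mathbf b)(f)=h\,\mathbf b(f)$. $\mathrm{BV}_{\mathrm{Der}}(\mathbb{R}^d,\mu)$ is the set of $f\in L^1_\mu(\mathbb{R}^d)$ for which there is a map $Df:\mathrm{Der}_b(\mathbb{R}^d,\mu)\to\mathscr{M}(\mathbb{R}^d)$ that is $\mathrm{LIP}_c(\mathbb{R}^d)$-linear (linear, with $Df(h\mathbf b)=h\,Df(\mathbf b)$ for $h\in\mathrm{LIP}_c(\mathbb{R}^d)$), continuous with respect to $\|\cdot\|_b$, and satisfies $Df(\mathbf b)(\mathbb{R}^d)=-\int f\,\mathrm{div}(\mathbf b)\,d\mu$ for all $\mathbf b$. For such $f$, $|D_\mu f|_{\mathrm{Der}}$ is the unique finite Borel measure with $|D_\mu f|_{\mathrm{Der}}(\Omega)=\sup\{\int_\Omega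 f\,\mathrm{div}(\mathbf b)\,d\mu:\mathbf b\in\mathrm{Der}_b(\mathbb{R}^d,\mu),\ \mathrm{supp}(\mathbf b)\Subset\Omega,\ |\mathbf b|\le1\ \mu\text{-a.e.}\}$ for every open $\Omega$. (3) Lipschitz relaxation. $\mathrm{BV}_{\mathrm{Lip}}(\mathbb{R}^d,\mu)$ is the set of $f\in L^1_\mu(\mathbb{R}^d)$ for which there is $(f_n)_n\subseteq\mathrm{LIP}_{loc}(\mathbb{R}^d)\cap L^1_\mu(\mathbb{R}^d)$ with $f_n\to f$ in $L^1_\mu(\mathbb{R}^d)$ and $\sup_n\int\mathrm{lip}_a(f_n)\,d\mu<\infty$ (equivalently, such a sequence can be found in $\mathrm{LIP}_c(\mathbb{R}^d)$). For $\Omega$ open, $|D_\mu f|_{\mathrm{Lip}}(\Omega):=\inf\{\liminf_n\int_\Omega\mathrm{lip}_a(f_n)\,d\mu:(f_n)_n\subseteq\mathrm{LIP}_{loc}(\Omega)\cap L^1_\mu(\Omega),\ f_n\to f\text{ in }L^1_\mu(\Omega)\}$, extended to Borel sets by $|D_\mu f|_{\mathrm{Lip}}(B):=\inf\{|D_\mu f|_{\mathrm{Lip}}(\Omega):\Omega\supseteq B\text{ open}\}$; this is a finite Borel measure. (4) Smooth relaxation. For $f\in L^1_\mu(\mathbb{R}^d)$ and $\Omega$ open, $|D_\mu f|_{C^\infty}(\Omega):=\inf\{\liminf_n\int_\Omega|\nabla f_n|\,d\mu:(f_n)_n\subseteq C^\infty(\Omega)\cap L^1_\mu(\Omega),\ f_n\to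 f\text{ in }L^1_\mu(\Omega)\}$, extended to Borel sets by $|D_\mu f|_{C^\infty}(B):=\inf\{|D_\mu f|_{C^\infty}(\Omega):\Omega\supseteq B\text{ open}\}$. $\mathrm{BV}_{C^\infty}(\mathbb{R}^d,\mu):=\{f\in L^1_\mu(\mathbb{R}^d):|D_\mu f|_{C^\infty}(\mathbb{R}^d)<\infty\}$. *)

theory Defs
  imports "HOL-Analysis.Analysis"
begin

(* The space R^d is an arbitrary type 'a of class euclidean_space.  Elements of L^0, L^1, L^infinity
   with respect to M are represented by Borel functions 'a => _, identified up to equality a.e.;
   the sets of BV functions and their variations do not depend on the representatives. *)

(* Regularity is automatic for Borel measures on R^d that are finite on compact sets. *)
definition radon_measure :: "'a::euclidean_space measure \<Rightarrow> bool" where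
  "radon_measure M \<longleftrightarrow> sets M = sets borel \<and> (\<forall>K. compact K \<longrightarrow> emeasure M K < \<infinity>)"

definition Linf :: "'a::euclidean_space measure \<Rightarrow> ('a \<Rightarrow> 'b::euclidean_space) set" where
  "Linf M = {v \<in> borel_measurable M. \<exists>C. AE x in M. norm (v x) \<le> C}"

definition Linf_norm :: "'a::euclidean_space measure \<Rightarrow> ('a \<Rightarrow> 'b::euclidean_space) \<Rightarrow> real" where
  "Linf_norm M v = Inf {C. 0 \<le> C \<and> (AE x in M. norm (v x) \<le> C)}"

text \<open>Support of an a.e. equivalence class: the complement of the largest open set on which
  the function vanishes a.e.\<close>

definition ess_supp :: "'a::euclidean_space measure \<Rightarrow> ('a \<Rightarrow> 'b::euclidean_space) \<Rightarrow> 'a set" where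
  "ess_supp M v = - \<Union>{U. open U \<and> (AE x in M. x \<in> U \<longrightarrow> v x = 0)}"

definition compactly_inside :: "'a::euclidean_space set \<Rightarrow> 'a set \<Rightarrow> bool" (infix "\<Subset>" 50) where
  "S \<Subset> \<Omega> \<longleftrightarrow> compact (closure S) \<and> closure S \<subseteq> \<Omega>"

definition L1_converges ::
  "'a::euclidean_space measure \<Rightarrow> 'a set \<Rightarrow> (nat \<Rightarrow> 'a \<Rightarrow> real) \<Rightarrow> ('a \<Rightarrow> real) \<Rightarrow> bool" where
  "L1_converges M \<Omega> F f \<longleftrightarrow>
     (\<forall>n. set_integrable M \<Omega> (F n)) \<and> (\<lambda>n. LINT x:\<Omega>|M. \<bar>F n x - f x\<bar>) \<longlonglongrightarrow> 0"

definition outer_ext :: "('a::euclidean_space set \<Rightarrow> ennreal) \<Rightarrow> 'a set \<Rightarrow> ennreal" where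
  "outer_ext \<phi> B = (INF \<Omega>\<in>{\<Omega>. open \<Omega> \<and> B \<subseteq> \<Omega>}. \<phi> \<Omega>)"

definition finite_borel_measure :: "('a::euclidean_space set \<Rightarrow> ennreal) \<Rightarrow> bool" where
  "finite_borel_measure \<phi> \<longleftrightarrow> measure_space UNIV (sets borel) \<phi> \<and> \<phi> UNIV < \<infinity>"

text \<open>For open \<open>S\<close>, \<open>Ck_on S n f\<close> says that \<open>f\<close> is of class \<open>C\<^sup>n\<close> on \<open>S\<close>; the values of \<open>f\<close>
  outside \<open>S\<close> are irrelevant.\<close>

primrec Ck_on :: "'a::euclidean_space set \<Rightarrow> nat \<Rightarrow> ('a \<Rightarrow> real) \<Rightarrow> bool" where
  "Ck_on S 0 f \<longleftrightarrow> continuous_on S f"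
| "Ck_on S (Suc n) f \<longleftrightarrow> (\<forall>x\<in>S. f differentiable (at x)) \<and>
     (\<forall>v. Ck_on S n (\<lambda>x. frechet_derivative f (at x) v))"

definition Cinf :: "'a::euclidean_space set \<Rightarrow> ('a \<Rightarrow> real) set" where
  "Cinf \<Omega> = {f. \<forall>n. Ck_on \<Omega> n f}"

definition Cinf_c :: "('a::euclidean_space \<Rightarrow> real) set" where
  "Cinf_c = {f \<in> Cinf UNIV. compact (closure {x. f x \<noteq> 0})}"

definition grad :: "('a::euclidean_space \<Rightarrow> real) \<Rightarrow> 'a \<Rightarrow> 'a" where
  "grad f x = (\<Sum>b\<in>Basis. frechet_derivative f (at x) b *\<^sub>R b)"

definition LIP_c :: "('a::euclidean_space \<Rightarrow> real) set" where
  "LIP_c = {f. (\<exists>L. L-lipschitz_on UNIV f) \<and> compact (closure {x. f x \<noteq> 0})}"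

definition LIP_loc :: "'a::euclidean_space set \<Rightarrow> ('a \<Rightarrow> real) set" where
  "LIP_loc \<Omega> = {f. \<forall>x\<in>\<Omega>. \<exists>r>0. \<exists>L. ball x r \<subseteq> \<Omega> \<and> L-lipschitz_on (ball x r) f}"

definition Lip :: "('a::euclidean_space \<Rightarrow> real) \<Rightarrow> 'a set \<Rightarrow> ennreal" where
  "Lip f E = (SUP (x, y)\<in>{(x, y). x \<in> E \<and> y \<in> E \<and> x \<noteq> y}. ennreal (\<bar>f x - f y\<bar> / dist x y))"

definition lip_a :: "('a::euclidean_space \<Rightarrow> real) \<Rightarrow> 'a \<Rightarrow> ennreal" where
  "lip_a f x = Lim (at_right 0) (\<lambda>r. Lip f (ball x r))"

definition is_div ::
  "'a::euclidean_space measure \<Rightarrow> ('a \<Rightarrow> 'a) \<Rightarrow> ('a \<Rightarrow> real) \<Rightarrow> bool" where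
  "is_div M v g \<longleftrightarrow> g \<in> Linf M \<and>
     (\<forall>f\<in>Cinf_c. (LINT x|M. grad f x \<bullet> v x) = - (LINT x|M. f x * g x))"

definition D_inf :: "'a::euclidean_space measure \<Rightarrow> ('a \<Rightarrow> 'a) set" where
  "D_inf M = {v \<in> Linf M. \<exists>g. is_div M v g}"

definition div_field :: "'a::euclidean_space measure \<Rightarrow> ('a \<Rightarrow> 'a) \<Rightarrow> 'a \<Rightarrow> real" where
  "div_field M v = (SOME g. is_div M v g)"

(* The zero field is always admissible, so truncating the integrals at 0 (by ennreal) does not
   change the suprema here; likewise for derivations and for signed measures below. *)
definition BV_seminorm :: "'a::euclidean_space measure \<Rightarrow> ('a \<Rightarrow> real) \<Rightarrow> ennreal" where
  "BV_seminorm M f =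
     (SUP v\<in>{v \<in> D_inf M. AE x in M. norm (v x) \<le> 1}. ennreal (LINT x|M. f x * div_field M v x))"

definition BV :: "'a::euclidean_space measure \<Rightarrow> ('a \<Rightarrow> real) set" where
  "BV M = {f. integrable M f \<and> BV_seminorm M f < \<infinity>}"

definition var_open :: "'a::euclidean_space measure \<Rightarrow> ('a \<Rightarrow> real) \<Rightarrow> 'a set \<Rightarrow> ennreal" where
  "var_open M f \<Omega> =
     (SUP v\<in>{v \<in> D_inf M. ess_supp M v \<Subset> \<Omega> \<and> (AE x in M. norm (v x) \<le> 1)}.
        ennreal (LINT x:\<Omega>|M. f x * div_field M v x))"

definition var :: "'a::euclidean_space measure \<Rightarrow> ('a \<Rightarrow> real) \<Rightarrow> 'a set \<Rightarrow> ennreal" where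
  "var M f = outer_ext (var_open M f)"

(* A signed measure is represented by its set function; only its values on Borel sets matter. *)
definition signed_measure :: "('a::euclidean_space set \<Rightarrow> real) \<Rightarrow> bool" where
  "signed_measure \<nu> \<longleftrightarrow> \<nu> {} = 0 \<and>
     (\<forall>A :: nat \<Rightarrow> 'a set. range A \<subseteq> sets borel \<longrightarrow> disjoint_family A \<longrightarrow>
        (\<lambda>n. \<nu> (A n)) sums \<nu> (\<Union>n. A n))"

definition tv_norm :: "('a::euclidean_space set \<Rightarrow> real) \<Rightarrow> ennreal" where
  "tv_norm \<nu> = (SUP P\<in>{P. finite P \<and> P \<subseteq> sets borel \<and> disjoint P}. \<Sum>A\<in>P. ennreal \<bar>\<nu> A\<bar>)"

text \<open>Integration against a signed measure is defined through its Jordan decomposition.\<close>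

definition pos_variation :: "('a::euclidean_space set \<Rightarrow> real) \<Rightarrow> 'a measure" where
  "pos_variation \<nu> =
     measure_of UNIV (sets borel) (\<lambda>A. SUP B\<in>{B \<in> sets borel. B \<subseteq> A}. ennreal (\<nu> B))"

definition neg_variation :: "('a::euclidean_space set \<Rightarrow> real) \<Rightarrow> 'a measure" where
  "neg_variation \<nu> = pos_variation (\<lambda>A. - \<nu> A)"

definition signed_density ::
  "('a::euclidean_space \<Rightarrow> real) \<Rightarrow> ('a set \<Rightarrow> real) \<Rightarrow> 'a set \<Rightarrow> real" where
  "signed_density h \<nu> A = (LINT x:A|pos_variation \<nu>. h x) - (LINT x:A|neg_variation \<nu>. h x)"

definition der_bound ::
  "'a::euclidean_space measure \<Rightarrow> (('a \<Rightarrow> real) \<Rightarrow> 'a \<Rightarrow> real) \<Rightarrow> ('a \<Rightarrow> real) \<Rightarrow> bool" where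
  "der_bound M b G \<longleftrightarrow> G \<in> borel_measurable M \<and> (AE x in M. 0 \<le> G x) \<and>
     (\<forall>f\<in>LIP_c. AE x in M. ennreal \<bar>b f x\<bar> \<le> ennreal (G x) * lip_a f x)"

(* Only the values b f for f in LIP_c matter. *)
definition derivation ::
  "'a::euclidean_space measure \<Rightarrow> (('a \<Rightarrow> real) \<Rightarrow> 'a \<Rightarrow> real) \<Rightarrow> bool" where
  "derivation M b \<longleftrightarrow>
     (\<forall>f\<in>LIP_c. b f \<in> borel_measurable M) \<and>
     (\<forall>f\<in>LIP_c. \<forall>g\<in>LIP_c. AE x in M. b (\<lambda>y. f y + g y) x = b f x + b g x) \<and>
     (\<forall>f\<in>LIP_c. \<forall>c::real. AE x in M. b (\<lambda>y. c * f y) x = c * b f x) \<and>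
     (\<forall>f\<in>LIP_c. \<forall>g\<in>LIP_c. AE x in M. b (\<lambda>y. f y * g y) x = b f x * g x + f x * b g x) \<and>
     (\<exists>G. der_bound M b G)"

definition der_abs ::
  "'a::euclidean_space measure \<Rightarrow> (('a \<Rightarrow> real) \<Rightarrow> 'a \<Rightarrow> real) \<Rightarrow> 'a \<Rightarrow> real" where
  "der_abs M b =
     (SOME G. der_bound M b G \<and> (\<forall>G'. der_bound M b G' \<longrightarrow> (AE x in M. G x \<le> G' x)))"

definition der_supp ::
  "'a::euclidean_space measure \<Rightarrow> (('a \<Rightarrow> real) \<Rightarrow> 'a \<Rightarrow> real) \<Rightarrow> 'a set" where
  "der_supp M b = ess_supp M (der_abs M b)"

definition is_der_div ::
  "'a::euclidean_space measure \<Rightarrow> (('a \<Rightarrow> real) \<Rightarrow> 'a \<Rightarrow> real) \<Rightarrow> ('a \<Rightarrow> real) \<Rightarrow> bool" where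
  "is_der_div M b g \<longleftrightarrow> g \<in> Linf M \<and>
     (\<forall>f\<in>LIP_c. (LINT x|M. b f x) = - (LINT x|M. f x * g x))"

definition Der_b ::
  "'a::euclidean_space measure \<Rightarrow> (('a \<Rightarrow> real) \<Rightarrow> 'a \<Rightarrow> real) set" where
  "Der_b M = {b. derivation M b \<and> der_abs M b \<in> Linf M \<and> (\<exists>g. is_der_div M b g)}"

definition der_div ::
  "'a::euclidean_space measure \<Rightarrow> (('a \<Rightarrow> real) \<Rightarrow> 'a \<Rightarrow> real) \<Rightarrow> 'a \<Rightarrow> real" where
  "der_div M b = (SOME g. is_der_div M b g)"

definition der_norm ::
  "'a::euclidean_space measure \<Rightarrow> (('a \<Rightarrow> real) \<Rightarrow> 'a \<Rightarrow> real) \<Rightarrow> real" where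
  "der_norm M b = Linf_norm M (der_abs M b)"

(* The second conjunct says that Df depends only on the derivation, not on its representative. *)
definition is_Der_differential ::
  "'a::euclidean_space measure \<Rightarrow> ('a \<Rightarrow> real) \<Rightarrow>
     ((('a \<Rightarrow> real) \<Rightarrow> 'a \<Rightarrow> real) \<Rightarrow> 'a set \<Rightarrow> real) \<Rightarrow> bool" where
  "is_Der_differential M f Df \<longleftrightarrow>
     (\<forall>b\<in>Der_b M. signed_measure (Df b)) \<and>
     (\<forall>b\<in>Der_b M. \<forall>c\<in>Der_b M. (\<forall>g\<in>LIP_c. AE x in M. b g x = c g x) \<longrightarrow>
        (\<forall>A\<in>sets borel. Df b A = Df c A)) \<and>
     (\<forall>b\<in>Der_b M. \<forall>c\<in>Der_b M. \<forall>A\<in>sets borel. Df (\<lambda>g x. b g x + c g x) A = Df b A + Df c A) \<and>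
     (\<forall>b\<in>Der_b M. \<forall>t::real. \<forall>A\<in>sets borel. Df (\<lambda>g x. t * b g x) A = t * Df b A) \<and>
     (\<forall>b\<in>Der_b M. \<forall>h\<in>LIP_c. \<forall>A\<in>sets borel.
        Df (\<lambda>g x. h x * b g x) A = signed_density h (Df b) A) \<and>
     (\<forall>b\<in>Der_b M. \<forall>\<epsilon>>0. \<exists>\<delta>>0. \<forall>c\<in>Der_b M. der_norm M (\<lambda>g x. c g x - b g x) < \<delta> \<longrightarrow>
        tv_norm (\<lambda>A. Df c A - Df b A) < ennreal \<epsilon>) \<and>
     (\<forall>b\<in>Der_b M. Df b UNIV = - (LINT x|M. f x * der_div M b x))"

definition BV_Der :: "'a::euclidean_space measure \<Rightarrow> ('a \<Rightarrow> real) set" where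
  "BV_Der M = {f. integrable M f \<and> (\<exists>Df. is_Der_differential M f Df)}"

definition is_var_Der :: "'a::euclidean_space measure \<Rightarrow> ('a \<Rightarrow> real) \<Rightarrow> 'a measure \<Rightarrow> bool" where
  "is_var_Der M f N \<longleftrightarrow> sets N = sets borel \<and> emeasure N UNIV < \<infinity> \<and>
     (\<forall>\<Omega>. open \<Omega> \<longrightarrow> emeasure N \<Omega> =
        (SUP b\<in>{b \<in> Der_b M. der_supp M b \<Subset> \<Omega> \<and> (AE x in M. der_abs M b x \<le> 1)}.
           ennreal (LINT x:\<Omega>|M. f x * der_div M b x)))"

definition var_Der :: "'a::euclidean_space measure \<Rightarrow> ('a \<Rightarrow> real) \<Rightarrow> 'a measure" where
  "var_Der M f = (THE N. is_var_Der M f N)"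

definition BV_Lip :: "'a::euclidean_space measure \<Rightarrow> ('a \<Rightarrow> real) set" where
  "BV_Lip M = {f. integrable M f \<and>
     (\<exists>F. (\<forall>n. F n \<in> LIP_loc UNIV) \<and> L1_converges M UNIV F f \<and>
        (SUP n. \<integral>\<^sup>+x. lip_a (F n) x \<partial>M) < \<infinity>)}"

definition var_Lip_open :: "'a::euclidean_space measure \<Rightarrow> ('a \<Rightarrow> real) \<Rightarrow> 'a set \<Rightarrow> ennreal" where
  "var_Lip_open M f \<Omega> =
     (INF F\<in>{F. (\<forall>n. F n \<in> LIP_loc \<Omega>) \<and> L1_converges M \<Omega> F f}.
        liminf (\<lambda>n. \<integral>\<^sup>+x\<in>\<Omega>. lip_a (F n) x \<partial>M))"

definition var_Lip :: "'a::euclidean_space measure \<Rightarrow> ('a \<Rightarrow> real) \<Rightarrow> 'a set \<Rightarrow> ennreal" where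
  "var_Lip M f = outer_ext (var_Lip_open M f)"

definition var_Cinf_open :: "'a::euclidean_space measure \<Rightarrow> ('a \<Rightarrow> real) \<Rightarrow> 'a set \<Rightarrow> ennreal" where
  "var_Cinf_open M f \<Omega> =
     (INF F\<in>{F. (\<forall>n. F n \<in> Cinf \<Omega>) \<and> L1_converges M \<Omega> F f}.
        liminf (\<lambda>n. \<integral>\<^sup>+x\<in>\<Omega>. ennreal (norm (grad (F n) x)) \<partial>M))"

definition var_Cinf :: "'a::euclidean_space measure \<Rightarrow> ('a \<Rightarrow> real) \<Rightarrow> 'a set \<Rightarrow> ennreal" where
  "var_Cinf M f = outer_ext (var_Cinf_open M f)"

definition BV_Cinf :: "'a::euclidean_space measure \<Rightarrow> ('a \<Rightarrow> real) set" where
  "BV_Cinf M = {f. integrable M f \<and> var_Cinf M f UNIV < \<infinity>}"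

end

theory Submission
  imports Defs
begin

text \<open>
  A field \<open>v\<close> in \<open>D_inf M\<close> differentiates Lipschitz functions: smooth approximations of \<open>f\<close> have
  derivatives in direction \<open>v\<close> whose convex combinations converge a.e. to a function bounded by
  \<open>\<bar>v\<bar> lip_a f\<close>, and the limit is unique because \<open>v\<close> has a divergence. Integration by parts then
  shows that the variation by vector fields is at most the Lipschitz relaxation, which is at most
  the smooth one.

  Conversely, let \<open>\<phi>\<close> almost minimize a smooth approximation of \<open>\<integral> \<bar>grad \<phi>\<bar> + k \<integral> \<bar>\<phi> - f\<bar>\<close> over test
  functions. In the limit, the Euler--Lagrange equation says that the weak limit of
  \<open>grad \<phi> / \<bar>grad \<phi>\<bar>\<close> is a field of norm at most 1 whose divergence is the weak limit of
  \<open>k (\<phi> - f) / \<bar>\<phi> - f\<bar>\<close>, so the infimum is at most the variation of \<open>f\<close>. Letting \<open>k\<close> tend to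
  infinity gives test functions converging to \<open>f\<close> in \<open>L\<^sup>1\<close> with converging energies. Their energy
  measures converge weakly to the variation, and gluing with a partition of unity yields the
  statement on every open set.

  Finally, every derivation in \<open>Der_b M\<close> is the differentiation along a field \<open>v\<close> in \<open>D_inf M\<close> with
  the same divergence and with \<open>\<bar>b\<bar> = \<bar>v\<bar>\<close>. By the weak convergence of the energies, the functional
  sending \<open>\<phi>\<close> to minus the integral of \<open>f\<close> times the divergence of \<open>\<phi> b\<close> is bounded by
  \<open>\<parallel>b\<parallel> \<integral> \<bar>\<phi>\<bar> d\<bar>Df\<bar>\<close>, so it has a density with respect to \<open>\<bar>Df\<bar>\<close>, which defines \<open>Df(b)\<close>.
\<close>

subsection \<open>Smooth functions and gradients\<close>

text \<open>The measure is arbitrary, so a Lipschitz function may fail to be differentiable on a set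
  of positive measure, and different smooth approximations may have different limit gradients. Only
  pairings with fields that possess a divergence are stable, and every object is phrased through
  them. The construction of approximations of small energy is a duality statement: the optimal field
  is read off from almost minimizers of an energy. The integrand \<open>\<bar>p\<bar>\<close> has no
  gradient at \<open>0\<close>, so it is smoothed to \<open>soft_norm s p\<close>. As the total mass
  may be infinite, the smoothing parameter depends on the point: it has to be integrable to keep the
  total error small, and bounded below on compact sets to keep second variations of test functions
  finite. The weight of \<open>radon_weight\<close> has both properties. Limits of bounded sequences
  are taken through convex combinations because these preserve exactly what is asked of the limits:
  linear identities and convex bounds.\<close>

lemma Ck_on_local:
  assumes "\<And>x. x \<in> S \<Longrightarrow> \<exists>V g. open V \<and> x \<in> V \<and> Ck_on V n g \<and> (\<forall>y\<in>V. f y = g y)"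
  shows "Ck_on S n f"
  using assms
proof (induction n arbitrary: f)
  case 0
  show ?case
    unfolding Ck_on.simps
  proof (rule continuous_at_imp_continuous_on, rule ballI)
    fix x assume "x \<in> S"
    then obtain V g where V: "open V" "x \<in> V" "continuous_on V g" "\<forall>y\<in>V. f y = g y"
      using 0 by force
    have "continuous_on V f"
      using V by (metis continuous_on_cong)
    then show "isCont f x"
      using V continuous_on_eq_continuous_at by blast
  qed
next
  case (Suc n)
  \<comment> \<open>\<open>frechet_derivative\<close> is a choice, so it is pinned down on a whole
    neighbourhood of each point before the induction hypothesis is applied to the
    derivatives.\<close>
  have key: "\<exists>V g. open V \<and> x \<in> V \<and> Ck_on V (Suc n) g \<and>
     (\<forall>y\<in>V. (f has_derivative frechet_derivative g (at y)) (at y))" if "x \<in> S" for x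
  proof -
    obtain V g where V: "open V" "x \<in> V" "Ck_on V (Suc n) g" "\<forall>y\<in>V. f y = g y"
      using Suc.prems[OF \<open>x \<in> S\<close>] by (elim exE conjE)
    have "(f has_derivative frechet_derivative g (at y)) (at y)" if "y \<in> V" for y
    proof (rule has_derivative_transform_within_open[of g])
      show "(g has_derivative frechet_derivative g (at y)) (at y)"
        using V that by (simp add: frechet_derivative_works[symmetric])
    qed (use V that in auto)
    then show ?thesis using V(1-3) by (intro exI[of _ V] exI[of _ g] conjI ballI)
  qed
  show ?case
    unfolding Ck_on.simps
  proof (intro conjI ballI allI)
    fix x assume "x \<in> S"
    then show "f differentiable at x" using key[of x] by (auto intro: differentiableI)
  next
    fix v
    show "Ck_on S n (\<lambda>x. frechet_derivative f (at x) v)"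
    proof (rule Suc.IH)
      fix x assume "x \<in> S"
      then obtain V g where V: "open V" "x \<in> V" "Ck_on V (Suc n) g"
         "\<forall>y\<in>V. (f has_derivative frechet_derivative g (at y)) (at y)"
        using key[OF \<open>x \<in> S\<close>] by (elim exE conjE)
      have "frechet_derivative f (at y) = frechet_derivative g (at y)" if "y \<in> V" for y
        using V(4) that by (metis frechet_derivative_at)
      then show "\<exists>V g. open V \<and> x \<in> V \<and> Ck_on V n g \<and> (\<forall>y\<in>V. frechet_derivative f (at y) v = g y)"
        using V by (intro exI[of _ V] exI[of _ "\<lambda>y. frechet_derivative g (at y) v"]) auto
    qed
  qed
qed

lemma Ck_on_cong: "open S \<Longrightarrow> Ck_on S n g \<Longrightarrow> (\<And>x. x \<in> S \<Longrightarrow> f x = g x) \<Longrightarrow> Ck_on S n f"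
  by (rule Ck_on_local) blast

lemma Ck_on_subset:
  assumes "Ck_on T n f" "S \<subseteq> T"
  shows "Ck_on S n f"
  using assms by (induction n arbitrary: f) (auto intro: continuous_on_subset)

text \<open>On an open set any explicit derivative \<open>D\<close> agrees with the chosen
  \<open>frechet_derivative\<close> at every point, so smoothness may be read off from
  \<open>D\<close>.\<close>

lemma Ck_on_SucI:
  assumes "open S" "\<And>x. x \<in> S \<Longrightarrow> (f has_derivative D x) (at x)" "\<And>v. Ck_on S n (\<lambda>x. D x v)"
  shows "Ck_on S (Suc n) f"
proof -
  have "frechet_derivative f (at x) = D x" if "x \<in> S" for x
    using assms(2)[OF that] by (metis frechet_derivative_at)
  then have "Ck_on S n (\<lambda>x. frechet_derivative f (at x) v)" for v
    by (intro Ck_on_cong[OF assms(1) assms(3)[of v]]) simp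
  then show ?thesis
    using assms(2) by (auto intro: differentiableI)
qed

lemma Ck_on_SucD: "Ck_on S (Suc n) f \<Longrightarrow> Ck_on S n f"
proof (induction n arbitrary: f)
  case 0
  then show ?case
    by (auto intro!: continuous_at_imp_continuous_on differentiable_imp_continuous_within)
qed auto

lemma Ck_on_has_derivative:
  "Ck_on S (Suc n) f \<Longrightarrow> x \<in> S \<Longrightarrow> (f has_derivative frechet_derivative f (at x)) (at x)"
  by (simp add: frechet_derivative_works[symmetric])

lemma Ck_on_const: "open S \<Longrightarrow> Ck_on S n (\<lambda>x. c)"
proof (induction n arbitrary: c)
  case (Suc n)
  show ?case
    by (rule Ck_on_SucI[where D = "\<lambda>x v. 0"]) (use Suc in auto)
qed auto

lemma Ck_on_linear:
  assumes "open S" "bounded_linear f"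
  shows "Ck_on S n f"
proof (cases n)
  case 0
  then show ?thesis using assms by (simp add: linear_continuous_on)
next
  case (Suc m)
  show ?thesis unfolding Suc
    by (rule Ck_on_SucI[where D = "\<lambda>x. f"])
      (use assms in \<open>auto intro!: bounded_linear_imp_has_derivative Ck_on_const\<close>)
qed

lemma Ck_on_add: "open S \<Longrightarrow> Ck_on S n f \<Longrightarrow> Ck_on S n g \<Longrightarrow> Ck_on S n (\<lambda>x. f x + g x)"
proof (induction n arbitrary: f g)
  case (Suc n)
  show ?case
    by (rule Ck_on_SucI[where D = "\<lambda>x v. frechet_derivative f (at x) v + frechet_derivative g (at x) v"])
      (use Suc in \<open>auto intro!: has_derivative_add simp: frechet_derivative_works[symmetric]\<close>)
qed (auto intro: continuous_intros)

lemma Ck_on_mult: "open S \<Longrightarrow> Ck_on S n f \<Longrightarrow> Ck_on S n g \<Longrightarrow> Ck_on S n (\<lambda>x. f x * g x)"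
proof (induction n arbitrary: f g)
  case (Suc n)
  note f = Ck_on_SucD[OF Suc.prems(2)] and g = Ck_on_SucD[OF Suc.prems(3)]
  show ?case
    by (rule Ck_on_SucI[where D = "\<lambda>x v. f x * frechet_derivative g (at x) v + frechet_derivative f (at x) v * g x"])
      (use Suc f g in \<open>auto intro!: has_derivative_mult Ck_on_add simp: frechet_derivative_works[symmetric]\<close>)
qed (auto intro: continuous_intros)

lemma Ck_on_sum:
  assumes "finite I" "open S" "\<And>i. i \<in> I \<Longrightarrow> Ck_on S n (f i)"
  shows "Ck_on S n (\<lambda>x. \<Sum>i\<in>I. f i x)"
  using assms by (induction I) (auto intro: Ck_on_const Ck_on_add)

text \<open>The derivative of \<open>H k (f x)\<close> involves \<open>H (Suc k)\<close>, so all
  successive derivatives of the outer function are given at once and the induction runs for every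
  \<open>k\<close>.\<close>

lemma Ck_on_compose:
  fixes H :: "nat \<Rightarrow> real \<Rightarrow> real"
  assumes H: "\<And>k t. (H k has_real_derivative H (Suc k) t) (at t)" and S: "open S"
  shows "Ck_on S n f \<Longrightarrow> Ck_on S n (\<lambda>x. H k (f x))"
proof (induction n arbitrary: k)
  case 0
  have "continuous_on UNIV (H k)"
    using H by (meson DERIV_isCont continuous_at_imp_continuous_on)
  then show ?case using 0 by (auto intro: continuous_on_compose2[of UNIV "H k"])
next
  case (Suc n)
  note f = Ck_on_SucD[OF Suc.prems]
  show ?case
  proof (rule Ck_on_SucI[where D = "\<lambda>x v. H (Suc k) (f x) * frechet_derivative f (at x) v"])
    fix x assume "x \<in> S"
    then have "(f has_derivative frechet_derivative f (at x)) (at x)"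
      using Suc.prems by (rule Ck_on_has_derivative[rotated])
    then show "((\<lambda>x. H k (f x)) has_derivative (\<lambda>v. H (Suc k) (f x) * frechet_derivative f (at x) v)) (at x)"
      using has_derivative_compose[OF _ has_field_derivative_imp_has_derivative[OF H]] by blast
  qed (use Suc S f in \<open>auto intro!: Ck_on_mult\<close>)
qed

lemma Cinf_D: "f \<in> Cinf S \<Longrightarrow> Ck_on S n f"
  by (simp add: Cinf_def)

lemma Cinf_differentiable: "f \<in> Cinf S \<Longrightarrow> x \<in> S \<Longrightarrow> f differentiable (at x)"
  using Cinf_D[of f S "Suc 0"] by simp

lemma Cinf_continuous: "f \<in> Cinf S \<Longrightarrow> continuous_on S f"
  using Cinf_D[of f S 0] by simp

lemma grad_inner:
  assumes "f differentiable (at x)"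
  shows "grad f x \<bullet> v = frechet_derivative f (at x) v"
proof -
  have "linear (frechet_derivative f (at x))"
    using assms linear_frechet_derivative by blast
  then have "frechet_derivative f (at x) (\<Sum>b\<in>Basis. (v \<bullet> b) *\<^sub>R b) =
      (\<Sum>b\<in>Basis. (v \<bullet> b) *\<^sub>R frechet_derivative f (at x) b)"
    by (simp only: linear_sum linear_scale)
  then show ?thesis
    unfolding euclidean_representation
    by (simp add: grad_def inner_sum_left) (simp add: inner_commute mult.commute)
qed

lemma has_derivative_grad:
  assumes "f differentiable (at x)"
  shows "(f has_derivative (\<lambda>v. grad f x \<bullet> v)) (at x)"
proof -
  have "(\<lambda>v. grad f x \<bullet> v) = frechet_derivative f (at x)"
    by (rule ext) (simp add: grad_inner[OF assms])
  then show ?thesis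
    using assms by (simp add: frechet_derivative_works)
qed

lemma grad_unique:
  assumes "(f has_derivative (\<lambda>v. w \<bullet> v)) (at x)"
  shows "grad f x = w"
proof -
  have "frechet_derivative f (at x) = (\<lambda>v. w \<bullet> v)"
    using assms by (metis frechet_derivative_at)
  then show ?thesis by (simp add: grad_def euclidean_representation)
qed

lemma Cinf_grad_continuous:
  assumes "f \<in> Cinf S"
  shows "continuous_on S (grad f)"
proof -
  have "continuous_on S (\<lambda>x. frechet_derivative f (at x) b)" for b
    using Cinf_D[OF assms, of "Suc 0"] by simp
  then show ?thesis unfolding grad_def by (intro continuous_intros)
qed

lemma grad_add:
  "f differentiable (at x) \<Longrightarrow> g differentiable (at x) \<Longrightarrow> grad (\<lambda>x. f x + g x) x = grad f x + grad g x"
  by (rule grad_unique)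
    (auto intro!: derivative_eq_intros has_derivative_grad simp: inner_add_left)

lemma grad_mult:
  "f differentiable (at x) \<Longrightarrow> g differentiable (at x) \<Longrightarrow>
     grad (\<lambda>x. f x * g x) x = f x *\<^sub>R grad g x + g x *\<^sub>R grad f x"
  by (rule grad_unique)
    (auto intro!: derivative_eq_intros has_derivative_grad simp: inner_add_left mult.commute)

lemma grad_cmult: "f differentiable (at x) \<Longrightarrow> grad (\<lambda>x. c * f x) x = c *\<^sub>R grad f x"
  by (rule grad_unique) (auto intro!: derivative_eq_intros has_derivative_grad)

lemma grad_sum:
  assumes "finite I" "\<And>i. i \<in> I \<Longrightarrow> f i differentiable (at x)"
  shows "grad (\<lambda>x. \<Sum>i\<in>I. f i x) x = (\<Sum>i\<in>I. grad (f i) x)"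
  by (rule grad_unique)
    (use assms in \<open>auto intro!: has_derivative_grad has_derivative_sum simp: inner_sum_left\<close>)

lemma grad_cong:
  assumes "open V" "x \<in> V" "\<And>y. y \<in> V \<Longrightarrow> f y = g y" "g differentiable (at x)"
  shows "grad f x = grad g x"
  by (rule grad_unique, rule has_derivative_transform_within_open[of g])
    (use assms in \<open>auto intro: has_derivative_grad\<close>)

lemma grad_eq_0:
  assumes "open V" "x \<in> V" "\<And>y. y \<in> V \<Longrightarrow> f y = c"
  shows "grad f x = 0"
  by (rule grad_unique, rule has_derivative_transform_within_open[of "\<lambda>_. c"])
    (use assms in auto)

lemma Cinf_add: "open S \<Longrightarrow> f \<in> Cinf S \<Longrightarrow> g \<in> Cinf S \<Longrightarrow> (\<lambda>x. f x + g x) \<in> Cinf S"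
  by (simp add: Cinf_def Ck_on_add)

lemma Cinf_mult: "open S \<Longrightarrow> f \<in> Cinf S \<Longrightarrow> g \<in> Cinf S \<Longrightarrow> (\<lambda>x. f x * g x) \<in> Cinf S"
  by (simp add: Cinf_def Ck_on_mult)

lemma Cinf_const: "open S \<Longrightarrow> (\<lambda>x. c) \<in> Cinf S"
  by (simp add: Cinf_def Ck_on_const)

lemma Cinf_sum: "finite I \<Longrightarrow> open S \<Longrightarrow> (\<And>i. i \<in> I \<Longrightarrow> f i \<in> Cinf S) \<Longrightarrow> (\<lambda>x. \<Sum>i\<in>I. f i x) \<in> Cinf S"
  by (simp add: Cinf_def Ck_on_sum)

lemma Cinf_subset: "f \<in> Cinf T \<Longrightarrow> S \<subseteq> T \<Longrightarrow> f \<in> Cinf S"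
  by (auto simp: Cinf_def intro: Ck_on_subset)

text \<open>A compact set outside of which \<open>f\<close> vanishes is easier to carry through sums
  and products than the closure of the support.\<close>

lemma compact_support_iff:
  fixes f :: "'a::euclidean_space \<Rightarrow> real"
  shows "compact (closure {x. f x \<noteq> 0}) \<longleftrightarrow> (\<exists>K. compact K \<and> (\<forall>x. x \<notin> K \<longrightarrow> f x = 0))"
proof
  assume "\<exists>K. compact K \<and> (\<forall>x. x \<notin> K \<longrightarrow> f x = 0)"
  then obtain K where "compact K" "{x. f x \<noteq> 0} \<subseteq> K" by auto
  then show "compact (closure {x. f x \<noteq> 0})"
    using bounded_subset compact_closure compact_imp_bounded by blast
next
  assume "compact (closure {x. f x \<noteq> 0})"
  moreover have "{x. f x \<noteq> 0} \<subseteq> closure {x. f x \<noteq> 0}"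
    by (rule closure_subset)
  ultimately show "\<exists>K. compact K \<and> (\<forall>x. x \<notin> K \<longrightarrow> f x = 0)"
    by blast
qed

lemma Cinf_c_iff: "f \<in> Cinf_c \<longleftrightarrow> f \<in> Cinf UNIV \<and> (\<exists>K. compact K \<and> (\<forall>x. x \<notin> K \<longrightarrow> f x = 0))"
  unfolding Cinf_c_def mem_Collect_eq compact_support_iff ..

lemma Cinf_c_Cinf: "f \<in> Cinf_c \<Longrightarrow> f \<in> Cinf S"
  by (auto simp: Cinf_c_iff intro: Cinf_subset)

lemma Cinf_c_differentiable: "f \<in> Cinf_c \<Longrightarrow> f differentiable (at x)"
  by (auto simp: Cinf_c_iff intro: Cinf_differentiable)

lemma Cinf_c_continuous: "f \<in> Cinf_c \<Longrightarrow> continuous_on S f"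
  by (rule Cinf_continuous[OF Cinf_c_Cinf])

lemma Cinf_c_grad_continuous: "f \<in> Cinf_c \<Longrightarrow> continuous_on S (grad f)"
  by (rule Cinf_grad_continuous[OF Cinf_c_Cinf])

lemma Cinf_c_0: "(\<lambda>x. 0) \<in> Cinf_c"
  by (auto simp: Cinf_c_iff Cinf_const)

lemma Cinf_c_add:
  assumes "f \<in> Cinf_c" "g \<in> Cinf_c" shows "(\<lambda>x. f x + g x) \<in> Cinf_c"
proof -
  obtain K L where "compact K" "\<forall>x. x \<notin> K \<longrightarrow> f x = 0" "compact L" "\<forall>x. x \<notin> L \<longrightarrow> g x = 0"
    using assms by (auto simp: Cinf_c_iff)
  then show ?thesis
    using assms by (auto simp: Cinf_c_iff Cinf_add intro!: exI[of _ "K \<union> L"] compact_Un)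
qed

lemma Cinf_c_mult:
  assumes "f \<in> Cinf_c" "g \<in> Cinf UNIV" shows "(\<lambda>x. f x * g x) \<in> Cinf_c"
  using assms by (force simp: Cinf_c_iff Cinf_mult)

lemma Cinf_c_cmult: "f \<in> Cinf_c \<Longrightarrow> (\<lambda>x. c * f x) \<in> Cinf_c"
  using Cinf_c_mult[of f "\<lambda>_. c"] by (simp add: Cinf_const mult.commute)

lemma Cinf_c_diff: "f \<in> Cinf_c \<Longrightarrow> g \<in> Cinf_c \<Longrightarrow> (\<lambda>x. f x - g x) \<in> Cinf_c"
  using Cinf_c_add[of f "\<lambda>x. -1 * g x"] Cinf_c_cmult[of g "-1"] by simp

lemma grad_diff:
  "f differentiable (at x) \<Longrightarrow> g differentiable (at x) \<Longrightarrow> grad (\<lambda>x. f x - g x) x = grad f x - grad g x"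
  by (rule grad_unique)
    (auto intro!: derivative_eq_intros has_derivative_grad simp: inner_diff_left)

lemma Cinf_c_sum:
  "finite I \<Longrightarrow> (\<And>i. i \<in> I \<Longrightarrow> f i \<in> Cinf_c) \<Longrightarrow> (\<lambda>x. \<Sum>i\<in>I. f i x) \<in> Cinf_c"
  by (induction I rule: finite_induct) (auto intro: Cinf_c_0 Cinf_c_add)

lemma grad_outside_support:
  assumes "closed K" "\<And>x. x \<notin> K \<Longrightarrow> f x = 0" "x \<notin> K"
  shows "grad f x = 0"
  by (rule grad_eq_0[of "- K" _ _ 0]) (use assms in auto)

lemma compact_support_bounded:
  fixes f :: "'a::euclidean_space \<Rightarrow> 'b::real_normed_vector"
  assumes "compact K" "\<And>x. x \<notin> K \<Longrightarrow> f x = 0" "continuous_on K f"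
  obtains B where "0 \<le> B" "\<And>x. norm (f x) \<le> B"
proof -
  have "bounded (f ` K)"
    using assms compact_continuous_image compact_imp_bounded by blast
  then obtain B where "0 < B" "\<forall>x\<in>K. norm (f x) \<le> B"
    by (auto simp: bounded_pos)
  then show ?thesis using that[of B] assms by (metis less_imp_le norm_zero)
qed

lemma Cinf_c_bounded:
  assumes "f \<in> Cinf_c"
  obtains K B where "compact K" "0 \<le> B" "\<And>x. x \<notin> K \<Longrightarrow> f x = 0" "\<And>x. x \<notin> K \<Longrightarrow> grad f x = 0"
    "\<And>x. \<bar>f x\<bar> \<le> B" "\<And>x. norm (grad f x) \<le> B"
proof -
  obtain K where K: "compact K" "\<And>x. x \<notin> K \<Longrightarrow> f x = 0"
    using assms by (auto simp: Cinf_c_iff)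
  have g: "\<And>x. x \<notin> K \<Longrightarrow> grad f x = 0"
    using K by (meson compact_imp_closed grad_outside_support)
  obtain B1 where B1: "0 \<le> B1" "\<And>x. norm (f x) \<le> B1"
    using compact_support_bounded[of K f, OF K Cinf_c_continuous[OF assms]] by blast
  obtain B2 where B2: "0 \<le> B2" "\<And>x. norm (grad f x) \<le> B2"
    using compact_support_bounded[of K "grad f", OF K(1) g Cinf_c_grad_continuous[OF assms]] by blast
  show ?thesis
    using that[of K "max B1 B2"] K g B1 B2 by (metis le_max_iff_disj real_norm_def)
qed

subsection \<open>Bump functions, mollification and cutoffs\<close>

text \<open>The derivatives of \<open>exp (- 1 / t)\<close> are of the form \<open>p (1 / t) exp (- 1 / t)\<close> with
  polynomials \<open>p\<close>; all of them vanish at the origin.\<close>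

definition flat :: "real poly \<Rightarrow> real \<Rightarrow> real" where
  "flat p t = (if 0 < t then poly p (1 / t) * exp (- (1 / t)) else 0)"

text \<open>With \<open>y = 1 / t\<close> the derivative of \<open>p y * exp (- y)\<close> in
  \<open>t\<close> is \<open>y * y * (p y - p' y) * exp (- y)\<close>.\<close>

definition flat_next :: "real poly \<Rightarrow> real poly" where
  "flat_next p = [:0, 0, 1:] * (p - pderiv p)"

lemma poly_exp_tendsto_0: "((\<lambda>y. poly p y * exp (- y)) \<longlongrightarrow> (0::real)) at_top"
proof -
  have "((\<lambda>y. \<Sum>i\<le>degree p. coeff p i * (y ^ i / exp y)) \<longlongrightarrow> (\<Sum>i\<le>degree p. coeff p i * 0)) at_top"
    by (intro tendsto_sum tendsto_mult tendsto_const tendsto_power_div_exp_0)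
  then show ?thesis
    by (simp add: poly_altdef sum_distrib_right exp_minus divide_inverse mult.assoc)
qed

lemma flat_tendsto_0: "(flat p \<longlongrightarrow> 0) (at 0)"
proof -
  have "((\<lambda>t. poly p (1 / t) * exp (- (1 / t))) \<longlongrightarrow> 0) (at_right (0::real))"
    using filterlim_compose[OF poly_exp_tendsto_0 filterlim_inverse_at_top_right]
    by (simp add: divide_inverse)
  then have "(flat p \<longlongrightarrow> 0) (at_right 0)"
    by (rule Lim_transform_eventually)
      (auto simp: flat_def eventually_at_filter intro!: always_eventually)
  moreover have "(flat p \<longlongrightarrow> 0) (at_left 0)"
    by (rule Lim_transform_eventually[OF tendsto_const])
      (auto simp: flat_def eventually_at_filter intro!: always_eventually)
  ultimately show ?thesis using filterlim_split_at by blast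
qed

lemma flat_has_derivative: "(flat p has_real_derivative flat (flat_next p) t) (at t)"
proof -
  consider "t > 0" | "t < 0" | "t = 0" by linarith
  then show ?thesis
  proof cases
    case 1
    have "((\<lambda>t. poly p (1 / t) * exp (- (1 / t))) has_real_derivative flat (flat_next p) t) (at t)"
      using 1 by (auto intro!: derivative_eq_intros DERIV_chain'[OF _ poly_DERIV]
          simp: flat_def flat_next_def field_simps power2_eq_square)
    then show ?thesis
      by (rule has_field_derivative_transform_within_open[of _ _ _ "{0<..}"])
        (use 1 in \<open>auto simp: flat_def\<close>)
  next
    case 2
    have "((\<lambda>t. 0) has_real_derivative flat (flat_next p) t) (at t)"
      using 2 by (auto simp: flat_def)
    then show ?thesis
      by (rule has_field_derivative_transform_within_open[of _ _ _ "{..<0}"])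
        (use 2 in \<open>auto simp: flat_def\<close>)
  next
    case 3
    \<comment> \<open>The difference quotient at \<open>0\<close> is again of the form
      \<open>flat\<close>, with the polynomial multiplied by its variable.\<close>
    have "(\<lambda>h. (flat p (0 + h) - flat p 0) / h) = flat (pCons 0 p)"
      by (auto simp: flat_def)
    then show ?thesis
      using 3 flat_tendsto_0[of "pCons 0 p"] unfolding DERIV_def by (simp add: flat_def)
  qed
qed

text \<open>A function of the squared norm, hence smooth at the origin as well. It is left
  unnormalized; \<open>mollify\<close> divides by its mass.\<close>

definition bump :: "real \<Rightarrow> 'a::euclidean_space \<Rightarrow> real" where
  "bump e x = flat 1 (e\<^sup>2 - x \<bullet> x)"

lemma Ck_on_bump: "Ck_on UNIV n (bump e)"
proof -
  have 1: "Ck_on UNIV n (\<lambda>x::'a. e\<^sup>2 + (-1) * (\<Sum>b\<in>Basis. (x \<bullet> b) * (x \<bullet> b)))"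
    by (intro Ck_on_add Ck_on_mult Ck_on_sum Ck_on_const Ck_on_linear)
      (auto intro: bounded_linear_inner_left)
  have "(\<lambda>x::'a. e\<^sup>2 + (-1) * (\<Sum>b\<in>Basis. (x \<bullet> b) * (x \<bullet> b))) = (\<lambda>x. e\<^sup>2 - x \<bullet> x)"
    by (auto simp: euclidean_inner[symmetric])
  then have "Ck_on UNIV n (\<lambda>x::'a. flat ((flat_next ^^ 0) 1) (e\<^sup>2 - x \<bullet> x))"
    using 1 by (intro Ck_on_compose[where H = "\<lambda>k. flat ((flat_next ^^ k) 1)"])
      (auto simp: flat_has_derivative)
  then show ?thesis by (simp add: bump_def[abs_def])
qed

lemma bump_nonneg: "0 \<le> bump e x"
  by (simp add: bump_def flat_def)

lemma bump_eq_0: "0 < e \<Longrightarrow> e \<le> norm x \<Longrightarrow> bump e x = 0"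
  using power_mono[of e "norm x" 2] by (simp add: bump_def flat_def power2_norm_eq_inner)

text \<open>All derivatives fall on the kernel \<open>g\<close>, so continuity of \<open>f\<close>
  suffices and the induction generalizes over \<open>g\<close>.\<close>

lemma Ck_on_convolution:
  fixes f :: "'a::euclidean_space \<Rightarrow> real"
  assumes f: "continuous_on (cbox a b) f"
  shows "(\<And>m. Ck_on UNIV m g) \<Longrightarrow> Ck_on UNIV n (\<lambda>x. integral (cbox a b) (\<lambda>y. f y * g (x - y)))"
proof (induction n arbitrary: g)
  case 0
  have g: "continuous_on UNIV g" using 0[of 0] by simp
  have "continuous_on (UNIV \<times> cbox a b) (\<lambda>(x, y). f y * g (x - y))"
    unfolding split_beta
    by (intro continuous_intros continuous_on_compose2[OF g] continuous_on_compose2[OF f]) auto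
  then show ?case
    by (simp add: integral_continuous_on_param)
next
  case (Suc n)
  have diff: "(g has_derivative frechet_derivative g (at z)) (at z)" for z
    using Suc.prems[of "Suc 0"] by (rule Ck_on_has_derivative) simp
  have bl: "bounded_linear (frechet_derivative g (at z))" for z
    using diff has_derivative_bounded_linear by blast
  have cg: "continuous_on UNIV g" using Suc.prems[of 0] by simp
  have cd: "continuous_on UNIV (\<lambda>z. frechet_derivative g (at z) v)" for v
    using Suc.prems[of "Suc 0"] by simp
  \<comment> \<open>\<open>leibniz_rule\<close> takes the derivative as an element of the space of
    bounded linear maps, jointly continuous in the parameter and the integration variable.\<close>
  define G where "G = (\<lambda>z. Blinfun (frechet_derivative g (at z)))"
  have G: "blinfun_apply (G z) = frechet_derivative g (at z)" for z
    by (simp add: G_def bounded_linear_Blinfun_apply bl)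
  define fx where "fx = (\<lambda>x y. f y *\<^sub>R G (x - y))"
  have cG: "continuous_on UNIV G"
    by (rule continuous_on_blinfun_componentwise) (simp add: G cd)
  have cfx: "continuous_on (UNIV \<times> cbox a b) (\<lambda>(x, y). fx x y)"
    unfolding split_beta fx_def
    by (intro continuous_intros continuous_on_compose2[OF cG] continuous_on_compose2[OF f]) auto
  have cfx1: "continuous_on (cbox a b) (fx x)" for x
    unfolding fx_def
    by (intro continuous_intros continuous_on_compose2[OF cG] f) auto
  have der: "((\<lambda>x. f y * g (x - y)) has_derivative blinfun_apply (fx x y)) (at x)" for x y
  proof -
    have "((\<lambda>x. g (x - y)) has_derivative frechet_derivative g (at (x - y))) (at x)"
      using has_derivative_compose[of "\<lambda>x. x - y" "\<lambda>x. x" x UNIV g, OF _ diff]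
      by (simp add: has_derivative_diff[OF has_derivative_ident has_derivative_const, simplified])
    then show ?thesis
      by (auto simp: fx_def G blinfun.scaleR_left intro!: derivative_eq_intros)
  qed
  have int: "(\<lambda>y. f y * g (x - y)) integrable_on cbox a b" for x
    by (intro integrable_continuous continuous_intros continuous_on_compose2[OF cg] f) auto
  have ap: "blinfun_apply (integral (cbox a b) (fx x)) v =
      integral (cbox a b) (\<lambda>y. f y * frechet_derivative g (at (x - y)) v)" for x v
    using integral_linear[OF integrable_continuous[OF cfx1] blinfun.bounded_linear_left[of v]]
    by (simp add: o_def fx_def blinfun.scaleR_left G)
  show ?case
  proof (rule Ck_on_SucI[where D = "\<lambda>x. blinfun_apply (integral (cbox a b) (fx x))"])
    show "((\<lambda>x. integral (cbox a b) (\<lambda>y. f y * g (x - y))) has_derivative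
        blinfun_apply (integral (cbox a b) (fx x))) (at x)" for x
      using leibniz_rule[of UNIV a b "\<lambda>x y. f y * g (x - y)" fx x] der int cfx by simp
    show "Ck_on UNIV n (\<lambda>x. blinfun_apply (integral (cbox a b) (fx x)) v)" for v
      unfolding ap
    proof (rule Suc.IH)
      show "Ck_on UNIV m (\<lambda>z. frechet_derivative g (at z) v)" for m
        using Suc.prems[of "Suc m"] by simp
    qed
  qed simp
qed

text \<open>The derivative in the direction of the gradient \<open>w\<close> itself is
  \<open>w \<bullet> w\<close>, and the Lipschitz bound makes it at most
  \<open>L * norm w\<close>.\<close>

lemma norm_grad_le:
  assumes d: "f differentiable (at x)" and r: "0 < r" and L: "0 \<le> L"
    and lip: "\<And>y. y \<in> ball x r \<Longrightarrow> \<bar>f y - f x\<bar> \<le> L * dist y x"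
  shows "norm (grad f x) \<le> L"
proof (cases "grad f x = 0")
  case False
  define w where "w = grad f x"
  have w: "norm w > 0" using False by (simp add: w_def)
  have "((\<lambda>t. f (x + t *\<^sub>R w)) has_derivative (\<lambda>t. w \<bullet> (t *\<^sub>R w))) (at (0::real))"
    by (rule has_derivative_compose[of "\<lambda>t. x + t *\<^sub>R w" "\<lambda>t. t *\<^sub>R w" 0 UNIV f])
      (use has_derivative_grad[OF d] in \<open>auto simp: w_def intro!: derivative_eq_intros\<close>)
  then have "((\<lambda>t. f (x + t *\<^sub>R w)) has_real_derivative (w \<bullet> w)) (at 0)"
    unfolding has_field_derivative_def
    by (rule has_derivative_eq_rhs) (simp add: fun_eq_iff mult.commute)
  then have lim: "((\<lambda>t. (f (x + t *\<^sub>R w) - f x) / t) \<longlongrightarrow> w \<bullet> w) (at 0)"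
    by (simp add: DERIV_def)
  have "\<forall>\<^sub>F t in at 0. (f (x + t *\<^sub>R w) - f x) / t \<le> L * norm w"
    unfolding eventually_at
  proof (intro exI[of _ "r / norm w"] conjI ballI impI)
    fix t :: real assume t: "t \<noteq> 0 \<and> dist t 0 < r / norm w"
    then have "x + t *\<^sub>R w \<in> ball x r" using w by (simp add: dist_norm pos_less_divide_eq)
    from lip[OF this] have "\<bar>f (x + t *\<^sub>R w) - f x\<bar> \<le> L * norm w * \<bar>t\<bar>"
      by (simp add: dist_norm mult.commute mult.left_commute)
    then have "\<bar>(f (x + t *\<^sub>R w) - f x) / t\<bar> \<le> L * norm w"
      using t by (simp add: abs_divide divide_le_eq)
    then show "(f (x + t *\<^sub>R w) - f x) / t \<le> L * norm w" by linarith
  qed (use r w in auto)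
  then have "w \<bullet> w \<le> L * norm w"
    using tendsto_upperbound[OF lim] by simp
  then show ?thesis
    using w by (simp add: w_def power2_norm_eq_inner[symmetric] power2_eq_square)
qed (use L in simp)

lemma bump_continuous: "continuous_on S (bump e)"
  by (rule continuous_on_subset[of UNIV]) (use Ck_on_bump[of 0] in auto)

lemma integrable_mult_bump:
  fixes f :: "'a::euclidean_space \<Rightarrow> real"
  assumes "continuous_on UNIV f" "0 < e"
  shows "integrable lborel (\<lambda>z. f z * bump e z)"
proof -
  have "integrable lborel (\<lambda>z. indicator (cball 0 e) z *\<^sub>R (f z * bump e z))"
    by (rule borel_integrable_compact) (auto intro!: continuous_intros bump_continuous continuous_on_subset[OF assms(1)])
  moreover have "(\<lambda>z. indicator (cball 0 e) z *\<^sub>R (f z * bump e z)) = (\<lambda>z. f z * bump e z)"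
  proof
    show "indicator (cball 0 e) z *\<^sub>R (f z * bump e z) = f z * bump e z" for z
      using bump_eq_0[OF assms(2), of z] by (cases "norm z \<le> e") (auto simp: indicator_def)
  qed
  ultimately show ?thesis by simp
qed

lemma bump_mass_pos:
  assumes "0 < e"
  shows "0 < (LINT z|lborel. bump e (z::'a::euclidean_space))"
proof -
  have int: "integrable lborel (bump e :: 'a \<Rightarrow> real)"
    using integrable_mult_bump[of "\<lambda>_. 1" e] assms by simp
  have "\<not> (AE z in lborel. bump e (z::'a) = 0)"
  proof
    assume "AE z in lborel. bump e (z::'a) = 0"
    moreover have "bump e z \<noteq> 0" if "z \<in> ball 0 e" for z :: 'a
      using that power_strict_mono[of "norm z" e 2]
      by (simp add: bump_def flat_def power2_norm_eq_inner)
    ultimately have "AE z in lborel. z \<notin> ball (0::'a) e" by (auto elim: eventually_mono)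
    then have "ball (0::'a) e \<in> null_sets lborel"
      by (subst (asm) AE_iff_null_sets[symmetric]) auto
    then have "negligible (ball (0::'a) e)"
      by (simp add: negligible_iff_null_sets null_sets_completionI)
    then show False using open_not_negligible[of "ball (0::'a) e"] assms by auto
  qed
  then have "(LINT z|lborel. bump e (z::'a)) \<noteq> 0"
    using integral_nonneg_eq_0_iff_AE[OF int] by (simp add: bump_nonneg)
  moreover have "0 \<le> (LINT z|lborel. bump e (z::'a))"
    by (simp add: bump_nonneg)
  ultimately show ?thesis by linarith
qed

section \<open>Mollification\<close>

definition mollify :: "real \<Rightarrow> ('a::euclidean_space \<Rightarrow> real) \<Rightarrow> 'a \<Rightarrow> real" where
  "mollify e f x = (LINT z|lborel. f (x - z) * bump e z) / (LINT z|lborel. bump e (z::'a))"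

context
  fixes f :: "'a::euclidean_space \<Rightarrow> real" and e :: real
  assumes f: "continuous_on UNIV f" and e: "0 < e"
begin

lemma continuous_shift: "continuous_on UNIV (\<lambda>z. f (x - z))"
  by (intro continuous_on_compose2[OF f] continuous_intros) auto

lemma mollify_le:
  assumes "\<And>y. y \<in> cball x e \<Longrightarrow> f y \<le> a"
  shows "mollify e f x \<le> a"
proof -
  have "f (x - z) * bump e z \<le> a * bump e z" for z
  proof (cases "norm z \<le> e")
    case True
    then show ?thesis using assms[of "x - z"] bump_nonneg[of e z]
      by (intro mult_right_mono) (auto simp: dist_norm)
  qed (use e in \<open>simp add: bump_eq_0\<close>)
  then have "(LINT z|lborel. f (x - z) * bump e z) \<le> (LINT z|lborel. a * bump e (z::'a))"
    by (rule Bochner_Integration.integral_mono[OF integrable_mult_bump[OF continuous_shift e]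
          integrable_mult_bump[OF continuous_on_const e]])
  then show ?thesis
    using bump_mass_pos[OF e, where 'a = 'a] by (simp add: mollify_def divide_le_eq)
qed

lemma mollify_diff_le:
  assumes "\<And>z. norm z \<le> e \<Longrightarrow> f (x - z) - f (y - z) \<le> L"
  shows "mollify e f x - mollify e f y \<le> L"
proof -
  have "f (x - z) * bump e z - f (y - z) * bump e z \<le> L * bump e z" for z
  proof (cases "norm z \<le> e")
    case True
    then show ?thesis using assms[of z] bump_nonneg[of e z]
      by (metis left_diff_distrib mult_right_mono)
  qed (use e in \<open>simp add: bump_eq_0\<close>)
  then have "(LINT z|lborel. f (x - z) * bump e z - f (y - z) * bump e z) \<le> (LINT z|lborel. L * bump e (z::'a))"
    by (rule Bochner_Integration.integral_mono[OF Bochner_Integration.integrable_diff[OF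
          integrable_mult_bump[OF continuous_shift e] integrable_mult_bump[OF continuous_shift e]]
          integrable_mult_bump[OF continuous_on_const e]])
  then show ?thesis
    using bump_mass_pos[OF e, where 'a = 'a]
    by (simp add: mollify_def diff_divide_distrib[symmetric] divide_le_eq
        Bochner_Integration.integral_diff[OF integrable_mult_bump integrable_mult_bump, OF continuous_shift e continuous_shift e])
qed

text \<open>The substitution \<open>y = x - z\<close> moves \<open>x\<close> from \<open>f\<close>
  into the smooth kernel; the compact support of \<open>f\<close> reduces the integral to a box,
  where \<open>Ck_on_convolution\<close> applies.\<close>

lemma mollify_Cinf:
  assumes K: "compact K" "\<And>x. x \<notin> K \<Longrightarrow> f x = 0"
  shows "mollify e f \<in> Cinf UNIV"
proof -
  obtain a b where ab: "K \<subseteq> cbox a b"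
    using K(1) bounded_subset_cbox_symmetric compact_imp_bounded by metis
  have eq: "(LINT z|lborel. f (x - z) * bump e z) = integral (cbox a b) (\<lambda>y. f y * bump e (x - y))" for x
  proof -
    have c: "continuous_on S (\<lambda>y. f y * bump e (x - y))" for S
      by (intro continuous_intros continuous_on_compose2[OF bump_continuous] continuous_on_subset[OF f]) auto
    have meas: "(\<lambda>y. f y * bump e (x - y)) \<in> borel_measurable borel"
      by (rule borel_measurable_continuous_onI[OF c])
    have "lborel = distr lborel borel (\<lambda>z. x - z)"
      using lborel_affine[of "-1" x] by (simp add: density_1)
    then have "(LINT y|lborel. f y * bump e (x - y)) =
        (LINT y|distr lborel borel (\<lambda>z. x - z). f y * bump e (x - y))"
      by (rule arg_cong)
    also have "\<dots> = (LINT z|lborel. f (x - z) * bump e z)"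
      by (subst integral_distr[OF _ meas]) auto
    finally have 1: "(LINT z|lborel. f (x - z) * bump e z) = (LINT y|lborel. f y * bump e (x - y))" by simp
    have "set_integrable lborel (cbox a b) (\<lambda>y. f y * bump e (x - y))"
      unfolding set_integrable_def by (rule borel_integrable_compact) (auto intro: c)
    from set_borel_integral_eq_integral(2)[OF this]
    have "integral (cbox a b) (\<lambda>y. f y * bump e (x - y)) = (LINT y:cbox a b|lborel. f y * bump e (x - y))" by simp
    also have "\<dots> = (LINT y|lborel. f y * bump e (x - y))"
      unfolding set_lebesgue_integral_def
      by (rule Bochner_Integration.integral_cong) (use K(2) ab in \<open>auto simp: indicator_def\<close>)
    finally show ?thesis using 1 by simp
  qed
  have "Ck_on UNIV n (\<lambda>x. (1 / (LINT z|lborel. bump e (z::'a))) * integral (cbox a b) (\<lambda>y. f y * bump e (x - y)))" for n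
    by (intro Ck_on_mult Ck_on_convolution Ck_on_const Ck_on_bump open_UNIV continuous_on_subset[OF f]) auto
  then show ?thesis
    by (simp add: Cinf_def mollify_def[abs_def] eq)
qed

end

text \<open>The bounds are local: \<open>F x\<close> only sees \<open>f\<close> on
  \<open>cball x e\<close>, and the gradient at \<open>x\<close> only the Lipschitz constant on a
  slightly larger ball. This locality is what later produces the asymptotic Lipschitz constant in
  the limit \<open>e \<rightarrow> 0\<close>.\<close>

lemma mollification:
  fixes f :: "'a::euclidean_space \<Rightarrow> real"
  assumes f: "continuous_on UNIV f" and K: "compact K" "\<And>x. x \<notin> K \<Longrightarrow> f x = 0" and e: "0 < e"
  obtains F where "F \<in> Cinf_c"
    "\<And>x a. (\<And>y. y \<in> cball x e \<Longrightarrow> f y \<le> a) \<Longrightarrow> F x \<le> a"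
    "\<And>x a. (\<And>y. y \<in> cball x e \<Longrightarrow> a \<le> f y) \<Longrightarrow> a \<le> F x"
    "\<And>x r L. e < r \<Longrightarrow> 0 \<le> L \<Longrightarrow> (\<And>y z. y \<in> ball x r \<Longrightarrow> z \<in> ball x r \<Longrightarrow> \<bar>f y - f z\<bar> \<le> L * dist y z)
       \<Longrightarrow> norm (grad F x) \<le> L"
proof -
  let ?F = "mollify e f"
  have le: "?F x \<le> a" if "\<And>y. y \<in> cball x e \<Longrightarrow> f y \<le> a" for x a
    by (rule mollify_le[OF f e]) (rule that)
  have neg: "mollify e (\<lambda>x. - f x) x = - ?F x" for x
    by (simp add: mollify_def)
  have ge: "a \<le> ?F x" if "\<And>y. y \<in> cball x e \<Longrightarrow> a \<le> f y" for x a
    using mollify_le[of "\<lambda>x. - f x" e x "- a"] f e that neg by (simp add: continuous_on_minus)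
  have smooth: "?F \<in> Cinf UNIV"
    by (rule mollify_Cinf[OF f e K])
  obtain B where B: "\<And>x. x \<in> K \<Longrightarrow> norm x \<le> B"
    using compact_imp_bounded[OF K(1)] by (auto simp: bounded_iff)
  have "?F x = 0" if "x \<notin> cball 0 (B + e)" for x
  proof -
    have "f y = 0" if y: "y \<in> cball x e" for y
    proof (rule K(2), rule notI)
      assume "y \<in> K"
      then have "norm x \<le> B + e"
        using B[of y] y norm_triangle_sub[of x y] by (simp add: dist_norm)
      then show False using \<open>x \<notin> cball 0 (B + e)\<close> by simp
    qed
    then show ?thesis using le[of x 0] ge[of x 0] by force
  qed
  then have Fc: "?F \<in> Cinf_c"
    using smooth unfolding Cinf_c_iff by (intro conjI exI[of _ "cball 0 (B + e)"]) auto
  have gr: "norm (grad ?F x) \<le> L"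
    if r: "e < r" and L: "0 \<le> L"
      and lip: "\<And>y z. y \<in> ball x r \<Longrightarrow> z \<in> ball x r \<Longrightarrow> \<bar>f y - f z\<bar> \<le> L * dist y z" for x r L
  proof (rule norm_grad_le[of _ _ "r - e"])
    fix y assume y: "y \<in> ball x (r - e)"
    have *: "\<bar>f (y - z) - f (x - z)\<bar> \<le> L * dist y x" if "norm z \<le> e" for z
    proof -
      have "norm (x - (y - z)) \<le> norm (x - y) + norm z"
        using norm_triangle_ineq[of "x - y" z] by (simp add: algebra_simps)
      then have "y - z \<in> ball x r" "x - z \<in> ball x r"
        using y r that by (auto simp: dist_norm)
      from lip[OF this] show ?thesis by (simp add: dist_norm)
    qed
    have "?F y - ?F x \<le> L * dist y x" "?F x - ?F y \<le> L * dist y x"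
      by (rule mollify_diff_le[OF f e]; use * in \<open>force simp: abs_le_iff\<close>)+
    then show "\<bar>?F y - ?F x\<bar> \<le> L * dist y x" by linarith
  qed (use smooth r L in \<open>auto intro: Cinf_differentiable\<close>)
  show ?thesis
    by (rule that[of ?F, OF Fc]) (use le ge gr in blast)+
qed

section \<open>Smooth cutoff functions\<close>

lemma smooth_cutoff:
  fixes K U :: "'a::euclidean_space set"
  assumes K: "compact K" and U: "open U" "K \<subseteq> U"
  obtains \<eta> V C where "\<eta> \<in> Cinf_c" "\<And>x. 0 \<le> \<eta> x" "\<And>x. \<eta> x \<le> 1" "open V" "K \<subseteq> V"
    "\<And>x. x \<in> V \<Longrightarrow> \<eta> x = 1" "compact C" "C \<subseteq> U" "\<And>x. x \<notin> C \<Longrightarrow> \<eta> x = 0"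
proof (cases "K = {}")
  case True
  show ?thesis
    by (rule that[of "\<lambda>_. 0" "{}" "{}"]) (use True in \<open>auto simp: Cinf_c_0\<close>)
next
  case False
  obtain \<epsilon> where \<epsilon>: "\<epsilon> > 0" "{x. infdist x K \<le> \<epsilon>} \<subseteq> U"
    using compact_in_open_separated[OF False K U] by auto
  \<comment> \<open>The profile is \<open>1\<close> up to distance \<open>2 * \<delta>\<close> from
    \<open>K\<close> and \<open>0\<close> from \<open>3 * \<delta>\<close> on. Averaging at scale
    \<open>\<delta>\<close> leaves \<open>1\<close> up to distance \<open>\<delta>\<close> and
    \<open>0\<close> beyond \<open>4 * \<delta> = \<epsilon>\<close>.\<close>
  define \<delta> where "\<delta> = \<epsilon> / 4"
  have \<delta>: "\<delta> > 0" using \<epsilon> by (simp add: \<delta>_def)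
  define f where "f = (\<lambda>x. max 0 (min 1 (3 - infdist x K / \<delta>)))"
  have f: "continuous_on UNIV f"
    unfolding f_def using \<delta> by (intro continuous_intros) auto
  have cK: "compact {x. infdist x K \<le> \<epsilon>}"
    using compact_infdist_le False K \<epsilon> by blast
  have f0: "f x = 0" if "infdist x K \<ge> 3 * \<delta>" for x
    using that \<delta> by (auto simp: f_def le_divide_eq)
  have f1: "f x = 1" if "infdist x K \<le> 2 * \<delta>" for x
  proof -
    have "infdist x K / \<delta> \<le> 2" using that \<delta> by (simp add: divide_le_eq)
    then show ?thesis by (simp add: f_def)
  qed
  obtain F where F: "F \<in> Cinf_c"
    "\<And>x a. (\<And>y. y \<in> cball x \<delta> \<Longrightarrow> f y \<le> a) \<Longrightarrow> F x \<le> a"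
    "\<And>x a. (\<And>y. y \<in> cball x \<delta> \<Longrightarrow> a \<le> f y) \<Longrightarrow> a \<le> F x"
  proof (rule mollification[OF f cK _ \<delta>])
    fix x assume "x \<notin> {x. infdist x K \<le> \<epsilon>}"
    then show "f x = 0" using \<delta> by (intro f0) (simp add: \<delta>_def)
  qed blast
  have inf: "\<bar>infdist x K - infdist y K\<bar> \<le> \<delta>" if "y \<in> cball x \<delta>" for x y
    using infdist_triangle_abs[of x K y] that by simp
  show ?thesis
  proof (rule that[of F "{x. infdist x K < \<delta>}" "{x. infdist x K \<le> \<epsilon>}"])
    show "0 \<le> F x" for x by (rule F(3)) (simp add: f_def)
    show "F x \<le> 1" for x by (rule F(2)) (simp add: f_def)
    show "open {x. infdist x K < \<delta>}"
      by (intro open_Collect_less continuous_intros)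
    show "K \<subseteq> {x. infdist x K < \<delta>}" using \<delta> by auto
    show "F x = 1" if "x \<in> {x. infdist x K < \<delta>}" for x
    proof -
      have "f y = 1" if "y \<in> cball x \<delta>" for y
        using inf[OF that] \<open>x \<in> _\<close> by (intro f1) auto
      then show ?thesis using F(2)[of x 1] F(3)[of x 1] by force
    qed
    show "F x = 0" if "x \<notin> {x. infdist x K \<le> \<epsilon>}" for x
    proof -
      have "f y = 0" if "y \<in> cball x \<delta>" for y
        using inf[OF that] \<open>x \<notin> _\<close> unfolding abs_le_iff
        by (intro f0) (simp add: \<delta>_def)
      then show ?thesis using F(2)[of x 0] F(3)[of x 0] by force
    qed
  qed (use F cK \<epsilon> in auto)
qed

text \<open>The profile has slope \<open>1 / R\<close>, equals \<open>1\<close> up to radius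
  \<open>2 * R\<close> and vanishes from \<open>3 * R\<close> on; averaging at scale
  \<open>R\<close> keeps the value \<open>1\<close> up to \<open>R\<close>. Gradients tend to
  \<open>0\<close> as \<open>R\<close> grows, which makes cutting off harmless in
  \<open>cutoff_divergence_limit\<close>.\<close>

lemma smooth_cutoff_small_grad:
  assumes R: "0 < R"
  obtains \<eta> :: "'a::euclidean_space \<Rightarrow> real" where "\<eta> \<in> Cinf_c" "\<And>x. 0 \<le> \<eta> x" "\<And>x. \<eta> x \<le> 1"
    "\<And>x. norm x \<le> R \<Longrightarrow> \<eta> x = 1" "\<And>x. norm (grad \<eta> x) \<le> 1 / R"
proof -
  define f where "f = (\<lambda>x::'a. max 0 (min 1 (3 - norm x / R)))"
  have f: "continuous_on UNIV f"
    unfolding f_def using R by (intro continuous_intros) auto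
  have lip: "\<bar>f y - f z\<bar> \<le> (1 / R) * dist y z" for y z
  proof -
    have "\<bar>f y - f z\<bar> \<le> \<bar>norm y / R - norm z / R\<bar>" by (auto simp: f_def)
    also have "\<dots> = \<bar>norm y - norm z\<bar> / R"
      using R by (simp add: diff_divide_distrib[symmetric])
    also have "\<dots> \<le> dist y z / R"
      using R by (intro divide_right_mono) (auto simp: dist_norm norm_triangle_ineq3)
    finally show ?thesis by simp
  qed
  obtain F where F: "F \<in> Cinf_c"
    "\<And>x a. (\<And>y. y \<in> cball x R \<Longrightarrow> f y \<le> a) \<Longrightarrow> F x \<le> a"
    "\<And>x a. (\<And>y. y \<in> cball x R \<Longrightarrow> a \<le> f y) \<Longrightarrow> a \<le> F x"
    "\<And>x r L. R < r \<Longrightarrow> 0 \<le> L \<Longrightarrow> (\<And>y z. y \<in> ball x r \<Longrightarrow> z \<in> ball x r \<Longrightarrow> \<bar>f y - f z\<bar> \<le> L * dist y z)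
       \<Longrightarrow> norm (grad F x) \<le> L"
  proof (rule mollification[OF f _ _ R, of "cball 0 (3 * R)"])
    show "f x = 0" if "x \<notin> cball 0 (3 * R)" for x
      using that R by (auto simp: f_def le_divide_eq)
  qed auto
  show ?thesis
  proof (rule that[OF F(1)])
    show "0 \<le> F x" for x by (rule F(3)) (simp add: f_def)
    show "F x \<le> 1" for x by (rule F(2)) (simp add: f_def)
    show "norm (grad F x) \<le> 1 / R" for x
      by (rule F(4)[of "R + 1"]) (use R lip in auto)
    show "F x = 1" if "norm x \<le> R" for x
    proof -
      have "f y = 1" if "y \<in> cball x R" for y
      proof -
        have "norm y \<le> 2 * R"
          using that \<open>norm x \<le> R\<close> norm_triangle_sub[of y x] by (simp add: dist_norm norm_minus_commute)
        then have "norm y / R \<le> 2" using R by (simp add: divide_le_eq)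
        then show ?thesis by (simp add: f_def)
      qed
      then show ?thesis using F(2)[of x 1] F(3)[of x 1] by force
    qed
  qed
qed

subsection \<open>Lipschitz functions and the asymptotic Lipschitz constant\<close>

text \<open>\<open>Lip f (ball x r)\<close> is monotone in the radius, so the limit in the
  definition exists and is an infimum.\<close>

lemma lip_a_eq_INF: "lip_a f x = (INF r\<in>{0<..}. Lip f (ball x r))"
proof -
  have mono: "Lip f (ball x s) \<le> Lip f (ball x r)" if "s \<le> r" for r s
    unfolding Lip_def by (rule SUP_subset_mono) (use that in auto)
  have "((\<lambda>r. Lip f (ball x r)) \<longlongrightarrow> (INF r\<in>{0<..}. Lip f (ball x r))) (at_right 0)"
  proof (rule order_tendstoI)
    fix a assume a: "a < (INF r\<in>{0<..}. Lip f (ball x r))"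
    have "\<forall>\<^sub>F r in at_right (0::real). 0 < r" by (rule eventually_at_right_less)
    then show "\<forall>\<^sub>F r in at_right 0. a < Lip f (ball x r)"
      by eventually_elim (use a in \<open>auto intro: less_le_trans INF_lower\<close>)
  next
    fix a assume "(INF r\<in>{0<..}. Lip f (ball x r)) < a"
    then obtain r where r: "0 < r" "Lip f (ball x r) < a" by (auto simp: INF_less_iff)
    have "\<forall>\<^sub>F s in at_right (0::real). s < r"
      using r(1) by (auto simp: eventually_at_right_field)
    then show "\<forall>\<^sub>F r in at_right 0. Lip f (ball x r) < a"
      by eventually_elim (rule le_less_trans[OF mono r(2)], simp)
  qed
  then show ?thesis unfolding lip_a_def by (intro tendsto_Lim) simp_all
qed

lemma Lip_le:
  assumes "0 \<le> L" "\<And>y z. y \<in> E \<Longrightarrow> z \<in> E \<Longrightarrow> \<bar>f y - f z\<bar> \<le> L * dist y z"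
  shows "Lip f E \<le> ennreal L"
  unfolding Lip_def
proof (rule SUP_least, safe)
  fix y z assume "y \<in> E" "z \<in> E" "y \<noteq> z"
  then show "ennreal (\<bar>f y - f z\<bar> / dist y z) \<le> ennreal L"
    using assms by (intro ennreal_leI) (simp add: divide_le_eq)
qed

lemma Lip_bound:
  assumes "Lip f E \<le> ennreal L" "0 \<le> L" "y \<in> E" "z \<in> E"
  shows "\<bar>f y - f z\<bar> \<le> L * dist y z"
proof (cases "y = z")
  case False
  have "ennreal (\<bar>f y - f z\<bar> / dist y z) \<le> Lip f E"
    unfolding Lip_def by (rule SUP_upper2[of "(y, z)"]) (use assms False in auto)
  then have "ennreal (\<bar>f y - f z\<bar> / dist y z) \<le> ennreal L" using assms(1) by (rule order_trans)
  then have "\<bar>f y - f z\<bar> / dist y z \<le> L" using assms(2) by (simp add: ennreal_le_iff)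
  then show ?thesis using False by (simp add: divide_le_eq)
qed simp

lemma lip_a_le:
  assumes "0 < r" "0 \<le> L" "\<And>y z. y \<in> ball x r \<Longrightarrow> z \<in> ball x r \<Longrightarrow> \<bar>f y - f z\<bar> \<le> L * dist y z"
  shows "lip_a f x \<le> ennreal L"
  unfolding lip_a_eq_INF by (rule INF_lower2[of r]) (use assms in \<open>auto intro: Lip_le\<close>)

lemma lip_a_lessD:
  assumes "lip_a f x < ennreal L" "0 \<le> L"
  obtains r where "0 < r" "\<And>y z. y \<in> ball x r \<Longrightarrow> z \<in> ball x r \<Longrightarrow> \<bar>f y - f z\<bar> \<le> L * dist y z"
proof -
  obtain r where r: "0 < r" "Lip f (ball x r) < ennreal L"
    using assms(1) unfolding lip_a_eq_INF by (auto simp: INF_less_iff)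
  show ?thesis by (rule that[OF r(1)]) (rule Lip_bound[OF less_imp_le[OF r(2)] assms(2)])
qed

lemma lip_a_mono_local:
  assumes V: "open V" "x \<in> V" "\<And>y. y \<in> V \<Longrightarrow> f y = g y"
  shows "lip_a f x \<le> lip_a g x"
proof (rule ennreal_le_epsilon)
  fix e :: real assume fin: "lip_a g x < top" and e: "0 < e"
  define L where "L = enn2real (lip_a g x) + e"
  have L: "0 \<le> L" "lip_a g x < ennreal L"
    using e fin by (cases "lip_a g x"; simp add: L_def ennreal_less_iff)+
  obtain r where r: "0 < r" "\<And>y z. y \<in> ball x r \<Longrightarrow> z \<in> ball x r \<Longrightarrow> \<bar>g y - g z\<bar> \<le> L * dist y z"
    using lip_a_lessD[OF L(2,1)] by blast
  obtain s where s: "0 < s" "ball x s \<subseteq> V" using V openE by blast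
  have "lip_a f x \<le> ennreal L"
    by (rule lip_a_le[of "min r s"]) (use r s V L in \<open>auto simp: subset_iff\<close>)
  then show "lip_a f x \<le> lip_a g x + ennreal e"
    using e fin by (cases "lip_a g x") (auto simp: L_def)
qed

lemma lip_a_cong:
  "open V \<Longrightarrow> x \<in> V \<Longrightarrow> (\<And>y. y \<in> V \<Longrightarrow> f y = g y) \<Longrightarrow> lip_a f x = lip_a g x"
  by (intro antisym lip_a_mono_local[of V]) auto

lemma lipschitz_of_grad_bound:
  assumes S: "convex S" and d: "\<And>x. x \<in> S \<Longrightarrow> f differentiable (at x)"
    and B: "\<And>x. x \<in> S \<Longrightarrow> norm (grad f x) \<le> B" and yz: "y \<in> S" "z \<in> S"
  shows "\<bar>f y - f z\<bar> \<le> B * dist y z"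
proof -
  have "norm (f y - f z) \<le> B * norm (y - z)"
  proof (rule differentiable_bound[OF S _ _ yz])
    fix x assume x: "x \<in> S"
    then show "(f has_derivative (\<lambda>v. grad f x \<bullet> v)) (at x within S)"
      using d has_derivative_grad has_derivative_at_withinI by blast
    show "onorm (\<lambda>v. grad f x \<bullet> v) \<le> B"
    proof (rule onorm_le)
      fix v
      have "\<bar>grad f x \<bullet> v\<bar> \<le> norm (grad f x) * norm v" by (rule Cauchy_Schwarz_ineq2)
      also have "\<dots> \<le> B * norm v" by (rule mult_right_mono[OF B[OF x]]) simp
      finally show "norm (grad f x \<bullet> v) \<le> B * norm v" by simp
    qed
  qed
  then show ?thesis by (simp add: dist_norm)
qed

text \<open>By continuity the gradient near \<open>x\<close> has norm at most
  \<open>norm (grad f x) + e\<close>, and the mean value inequality on a ball turns this into a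
  Lipschitz constant.\<close>

lemma lip_a_le_grad:
  assumes f: "f \<in> Cinf \<Omega>" and \<Omega>: "open \<Omega>" "x \<in> \<Omega>"
  shows "lip_a f x \<le> ennreal (norm (grad f x))"
proof (rule ennreal_le_epsilon)
  fix e :: real assume e: "0 < e"
  have "isCont (grad f) x"
    using Cinf_grad_continuous[OF f] \<Omega> by (simp add: continuous_on_eq_continuous_at)
  then obtain d where d: "d > 0" "\<And>y. dist y x < d \<Longrightarrow> dist (grad f y) (grad f x) < e"
    using e unfolding continuous_at_eps_delta by blast
  obtain s where s: "0 < s" "ball x s \<subseteq> \<Omega>" using \<Omega> openE by blast
  have "lip_a f x \<le> ennreal (norm (grad f x) + e)"
  proof (rule lip_a_le[of "min d s"])
    fix y z assume yz: "y \<in> ball x (min d s)" "z \<in> ball x (min d s)"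
    show "\<bar>f y - f z\<bar> \<le> (norm (grad f x) + e) * dist y z"
    proof (rule lipschitz_of_grad_bound[OF convex_ball _ _ yz])
      fix w assume w: "w \<in> ball x (min d s)"
      then show "f differentiable (at w)" using s by (intro Cinf_differentiable[OF f]) auto
      have "dist (grad f w) (grad f x) < e" using w by (intro d(2)) (simp add: dist_commute)
      then show "norm (grad f w) \<le> norm (grad f x) + e"
        using norm_triangle_sub[of "grad f w" "grad f x"] by (simp add: dist_norm)
    qed
  qed (use d s e in auto)
  then show "lip_a f x \<le> ennreal (norm (grad f x)) + ennreal e"
    using e by simp
qed

section \<open>Lipschitz functions of compact support\<close>

lemma LIP_cI:
  assumes "0 \<le> L" "\<And>y z. \<bar>f y - f z\<bar> \<le> L * dist y z" "compact K" "\<And>x. x \<notin> K \<Longrightarrow> f x = 0"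
  shows "f \<in> LIP_c"
  unfolding LIP_c_def mem_Collect_eq compact_support_iff
  using assms by (intro conjI exI[of _ L] exI[of _ K] lipschitz_onI) (auto simp: dist_real_def)

lemma LIP_cE:
  assumes "f \<in> LIP_c"
  obtains L K B where "0 \<le> L" "\<And>y z. \<bar>f y - f z\<bar> \<le> L * dist y z" "compact K" "\<And>x. x \<notin> K \<Longrightarrow> f x = 0"
    "0 \<le> B" "\<And>x. \<bar>f x\<bar> \<le> B"
proof -
  obtain L K where L: "L-lipschitz_on UNIV f" and K: "compact K" "\<And>x. x \<notin> K \<Longrightarrow> f x = 0"
    using assms unfolding LIP_c_def mem_Collect_eq compact_support_iff by blast
  obtain B where B: "0 \<le> B" "\<And>x. norm (f x) \<le> B"
    using compact_support_bounded[of K f, OF K continuous_on_subset[OF lipschitz_on_continuous_on[OF L]]] by auto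
  show ?thesis
    by (rule that[of L K B]) (use L K B in \<open>auto simp: lipschitz_on_def dist_real_def\<close>)
qed

lemma LIP_c_continuous: "f \<in> LIP_c \<Longrightarrow> continuous_on S f"
  unfolding LIP_c_def using continuous_on_subset lipschitz_on_continuous_on by blast

lemma lip_a_finite: "f \<in> LIP_c \<Longrightarrow> lip_a f x < top"
  by (erule LIP_cE) (auto intro: le_less_trans[OF lip_a_le[of 1]])

lemma Cinf_c_LIP_c:
  assumes "f \<in> Cinf_c" shows "f \<in> LIP_c"
proof -
  obtain K B where "compact K" "0 \<le> B" "\<And>x. x \<notin> K \<Longrightarrow> f x = 0" "\<And>x. norm (grad f x) \<le> B"
    by (rule Cinf_c_bounded[OF assms], rule that)
  moreover have "\<bar>f y - f z\<bar> \<le> B * dist y z" for y z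
    by (rule lipschitz_of_grad_bound[of UNIV])
      (use \<open>\<And>x. norm (grad f x) \<le> B\<close> Cinf_c_differentiable[OF assms] in auto)
  ultimately show ?thesis
    by (intro LIP_cI[of B f K])
qed

lemma Cinf_LIP_loc:
  assumes f: "f \<in> Cinf \<Omega>" and \<Omega>: "open \<Omega>"
  shows "f \<in> LIP_loc \<Omega>"
  unfolding LIP_loc_def
proof (intro CollectI ballI)
  fix x assume "x \<in> \<Omega>"
  then obtain r where r: "0 < r" "cball x r \<subseteq> \<Omega>" using \<Omega> open_contains_cball by blast
  have "bounded (grad f ` cball x r)"
    using Cinf_grad_continuous[OF f] r continuous_on_subset
    by (intro compact_imp_bounded compact_continuous_image) auto
  then obtain B where B: "0 < B" "\<And>y. y \<in> cball x r \<Longrightarrow> norm (grad f y) \<le> B"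
    unfolding bounded_pos by auto
  have "B-lipschitz_on (ball x r) f"
  proof (rule lipschitz_onI)
    fix y z assume yz: "y \<in> ball x r" "z \<in> ball x r"
    show "dist (f y) (f z) \<le> B * dist y z"
      unfolding dist_real_def
      by (rule lipschitz_of_grad_bound[OF convex_ball _ _ yz])
        (use r B in \<open>auto intro!: Cinf_differentiable[OF f]\<close>)
  qed (use B in simp)
  then show "\<exists>r>0. \<exists>L. ball x r \<subseteq> \<Omega> \<and> L-lipschitz_on (ball x r) f"
    using r by (intro exI[of _ r] conjI exI[of _ B]) (auto simp: subset_iff)
qed

lemma LIP_c_add:
  assumes "f \<in> LIP_c" "g \<in> LIP_c" shows "(\<lambda>x. f x + g x) \<in> LIP_c"
proof -
  obtain L K where f: "0 \<le> L" "\<And>y z. \<bar>f y - f z\<bar> \<le> L * dist y z" "compact K" "\<And>x. x \<notin> K \<Longrightarrow> f x = 0"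
    by (rule LIP_cE[OF assms(1)], rule that)
  obtain L' K' where g: "0 \<le> L'" "\<And>y z. \<bar>g y - g z\<bar> \<le> L' * dist y z" "compact K'" "\<And>x. x \<notin> K' \<Longrightarrow> g x = 0"
    by (rule LIP_cE[OF assms(2)], rule that)
  show ?thesis
  proof (rule LIP_cI[of "L + L'" _ "K \<union> K'"])
    show "\<bar>f y + g y - (f z + g z)\<bar> \<le> (L + L') * dist y z" for y z
      using f(2)[of y z] g(2)[of y z] by (simp add: distrib_right)
  qed (use f g in \<open>auto intro: compact_Un\<close>)
qed

lemma LIP_c_cmult:
  assumes "f \<in> LIP_c" shows "(\<lambda>x. c * f x) \<in> LIP_c"
proof -
  obtain L K where f: "0 \<le> L" "\<And>y z. \<bar>f y - f z\<bar> \<le> L * dist y z" "compact K" "\<And>x. x \<notin> K \<Longrightarrow> f x = 0"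
    by (rule LIP_cE[OF assms(1)], rule that)
  show ?thesis
  proof (rule LIP_cI[of "\<bar>c\<bar> * L" _ K])
    show "\<bar>c * f y - c * f z\<bar> \<le> (\<bar>c\<bar> * L) * dist y z" for y z
      using mult_left_mono[OF f(2)[of y z], of "\<bar>c\<bar>"]
      by (simp add: right_diff_distrib[symmetric] abs_mult mult.assoc)
  qed (use f in auto)
qed

lemma LIP_c_diff: "f \<in> LIP_c \<Longrightarrow> g \<in> LIP_c \<Longrightarrow> (\<lambda>x. f x - g x) \<in> LIP_c"
  using LIP_c_add[of f "\<lambda>x. -1 * g x"] LIP_c_cmult[of g "-1"] by simp

text \<open>Compactness gives one Lipschitz constant on a large ball. The nearest point projection
  onto the ball is a contraction and does not change the values of \<open>g\<close>, so the constant
  is valid on the whole space.\<close>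

lemma local_lipschitz_compact_support:
  fixes g :: "'a::euclidean_space \<Rightarrow> real"
  assumes loc: "\<And>x. \<exists>r>0. \<exists>L. L-lipschitz_on (ball x r) g"
    and K: "compact K" "\<And>x. x \<notin> K \<Longrightarrow> g x = 0"
  shows "g \<in> LIP_c"
proof -
  obtain R where R: "0 < R" "K \<subseteq> ball 0 R"
    using bounded_subset_ballD[OF compact_imp_bounded[OF K(1)], of 0] by blast
  let ?B = "cball (0::'a) R"
  \<comment> \<open>The notion is made for time-dependent maps; a single time reduces it to the
    plain one.\<close>
  have "local_lipschitz {0::real} ?B (\<lambda>_. g)"
    unfolding local_lipschitz_def
  proof (intro ballI)
    fix x and t :: real assume "x \<in> ?B"
    obtain r L where r: "0 < r" "L-lipschitz_on (ball x r) g" using loc by blast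
    have "L-lipschitz_on (cball x (r / 2) \<inter> ?B) g"
      by (rule lipschitz_on_subset[OF r(2)]) (use r in auto)
    then show "\<exists>u>0. \<exists>L. \<forall>t\<in>cball t u \<inter> {0}. L-lipschitz_on (cball x u \<inter> ?B) g"
      using r(1) by (metis half_gt_zero)
  qed
  then obtain L where L: "L-lipschitz_on ?B g"
    using local_lipschitz_compact_implies_lipschitz[where X = ?B and T = "{0::real}" and f = "\<lambda>_. g"] by auto
  have proj: "g (closest_point ?B x) = g x" for x
  proof (cases "x \<in> ?B")
    case True
    then show ?thesis by (simp add: closest_point_self)
  next
    case False
    \<comment> \<open>The projection of a point outside the closed ball lies on the sphere, whereas
      \<open>K\<close> lies in the open ball; so \<open>g\<close> vanishes at both points.\<close>
    have "closest_point ?B x \<in> rel_interior ?B \<longleftrightarrow> x \<in> rel_interior ?B"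
      by (rule closest_point_in_rel_interior) (use R in \<open>auto simp: affine_hull_nonempty_interior\<close>)
    moreover have "rel_interior ?B = ball 0 R"
      using R by (simp add: rel_interior_nonempty_interior)
    ultimately have "closest_point ?B x \<notin> K" "x \<notin> K"
      using R False by (auto simp: subset_iff)
    then show ?thesis by (simp add: K)
  qed
  show ?thesis
  proof (rule LIP_cI[of L _ K])
    show "0 \<le> L" using L lipschitz_on_nonneg by blast
    show "\<bar>g y - g z\<bar> \<le> L * dist y z" for y z
    proof -
      have "closest_point ?B x \<in> ?B" for x
        by (rule closest_point_in_set) (use R in auto)
      then have "dist (g (closest_point ?B y)) (g (closest_point ?B z)) \<le> L * dist (closest_point ?B y) (closest_point ?B z)"
        using L by (auto simp: lipschitz_on_def)
      also have "\<dots> \<le> L * dist y z"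
        using \<open>0 \<le> L\<close> R by (intro mult_left_mono closest_point_lipschitz) auto
      finally show ?thesis by (simp add: proj dist_real_def)
    qed
  qed (use K in auto)
qed

text \<open>Turns a competitor of the Lipschitz relaxation on \<open>\<Omega>\<close> into a
  function that can be differentiated along a field. The uncontrolled values of \<open>f\<close>
  outside \<open>\<Omega>\<close> are multiplied by \<open>0\<close>.\<close>

lemma LIP_loc_cutoff:
  assumes f: "f \<in> LIP_loc \<Omega>" and u: "u \<in> LIP_c" and C: "compact C" "C \<subseteq> \<Omega>" "\<And>x. x \<notin> C \<Longrightarrow> u x = 0"
  shows "(\<lambda>x. u x * f x) \<in> LIP_c"
proof (rule local_lipschitz_compact_support[OF _ C(1)])
  fix x
  obtain Lu B where u': "0 \<le> Lu" "\<And>y z. \<bar>u y - u z\<bar> \<le> Lu * dist y z" "0 \<le> B" "\<And>x. \<bar>u x\<bar> \<le> B"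
    by (rule LIP_cE[OF u], rule that)
  show "\<exists>r>0. \<exists>L. L-lipschitz_on (ball x r) (\<lambda>x. u x * f x)"
  proof (cases "x \<in> C")
    case True
    then have "x \<in> \<Omega>" using C by auto
    then obtain r L where r: "0 < r" "L-lipschitz_on (ball x r) f"
      using f unfolding LIP_loc_def by blast
    have L: "0 \<le> L" using r lipschitz_on_nonneg by blast
    have fl: "\<bar>f y - f z\<bar> \<le> L * dist y z" if "y \<in> ball x r" "z \<in> ball x r" for y z
      using r that by (auto simp: lipschitz_on_def dist_real_def)
    define A where "A = \<bar>f x\<bar> + L * r"
    have fb: "\<bar>f y\<bar> \<le> A" if "y \<in> ball x r" for y
    proof -
      have "\<bar>f y - f x\<bar> \<le> L * r"
        using fl[OF that, of x] mult_left_mono[of "dist y x" r L] that r L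
        by (auto simp: dist_commute)
      then show ?thesis by (simp add: A_def)
    qed
    have "(B * L + A * Lu)-lipschitz_on (ball x r) (\<lambda>x. u x * f x)"
    proof (rule lipschitz_onI)
      fix y z assume yz: "y \<in> ball x r" "z \<in> ball x r"
      have "u y * f y - u z * f z = u y * (f y - f z) + f z * (u y - u z)"
        by (simp add: algebra_simps)
      also have "\<bar>\<dots>\<bar> \<le> \<bar>u y\<bar> * \<bar>f y - f z\<bar> + \<bar>f z\<bar> * \<bar>u y - u z\<bar>"
        by (metis abs_mult abs_triangle_ineq)
      also have "\<dots> \<le> B * (L * dist y z) + A * (Lu * dist y z)"
        using u' fl[OF yz] fb[OF yz(2)] by (intro add_mono mult_mono) auto
      finally show "dist (u y * f y) (u z * f z) \<le> (B * L + A * Lu) * dist y z"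
        by (simp add: dist_real_def algebra_simps)
    next
      show "0 \<le> B * L + A * Lu"
        using L u' r by (auto simp: A_def)
    qed
    then show ?thesis using r by blast
  next
    case False
    then obtain r where "0 < r" "ball x r \<subseteq> - C"
      using C(1) compact_imp_closed open_contains_ball by (metis ComplI open_Compl)
    then have "0-lipschitz_on (ball x r) (\<lambda>x. u x * f x)"
      by (auto simp: lipschitz_on_def C(3) subset_iff)
    then show ?thesis using \<open>0 < r\<close> by blast
  qed
qed (simp add: C)

lemma LIP_c_LIP_loc:
  assumes "f \<in> LIP_c" shows "f \<in> LIP_loc UNIV"
proof -
  obtain L where "L-lipschitz_on UNIV f" using assms by (auto simp: LIP_c_def)
  then have "L-lipschitz_on (ball x 1) f" for x by (rule lipschitz_on_subset) simp
  then show ?thesis unfolding LIP_loc_def by (intro CollectI ballI exI[of _ "1::real"]) auto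
qed

lemma LIP_c_mult:
  assumes "f \<in> LIP_c" "g \<in> LIP_c"
  shows "(\<lambda>x. f x * g x) \<in> LIP_c"
proof -
  obtain K where "compact K" "\<And>x. x \<notin> K \<Longrightarrow> f x = 0"
    by (rule LIP_cE[OF assms(1)], rule that)
  then show ?thesis
    by (intro LIP_loc_cutoff[OF LIP_c_LIP_loc]) (use assms in auto)
qed

subsection \<open>Test functions and Radon measures\<close>

lemma radon_sets: "radon_measure M \<Longrightarrow> sets M = sets borel"
  by (simp add: radon_measure_def)

lemma radon_space: "radon_measure M \<Longrightarrow> space M = UNIV"
  by (metis radon_sets sets_eq_imp_space_eq space_borel)

lemma radon_measurable: "radon_measure M \<Longrightarrow> borel_measurable M = borel_measurable borel"
  by (intro measurable_cong_sets radon_sets refl)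

lemma integrable_compact_support:
  fixes f :: "'a::euclidean_space \<Rightarrow> 'b::{banach, second_countable_topology}"
  assumes M: "radon_measure M" and f: "f \<in> borel_measurable M" and K: "compact K"
    and z: "\<And>x. x \<notin> K \<Longrightarrow> f x = 0" and B: "AE x in M. norm (f x) \<le> B"
  shows "integrable M f"
  by (rule integrableI_bounded_set[of K M f B])
    (use M f K z B in \<open>auto simp: radon_measure_def compact_imp_closed\<close>)

text \<open>Smooth tests approximate the indicator of every compact \<open>K \<subseteq> U\<close>,
  so the integral of \<open>g\<close> over \<open>K\<close> is nonnegative. Compact subsets of
  \<open>{x \<in> U. g x < 0}\<close> are therefore null, and inner regularity makes the set itself
  null.\<close>

lemma nonneg_of_smooth_tests:
  fixes g :: "'a::euclidean_space \<Rightarrow> real"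
  assumes M: "radon_measure M" and g: "g \<in> borel_measurable M"
    and int: "\<And>R. integrable M (\<lambda>x. indicator (cball 0 R) x * g x)"
    and U: "open U"
    and pos: "\<And>\<phi> K. \<phi> \<in> Cinf_c \<Longrightarrow> (\<And>x. 0 \<le> \<phi> x) \<Longrightarrow> compact K \<Longrightarrow> K \<subseteq> U \<Longrightarrow>
       (\<And>x. x \<notin> K \<Longrightarrow> \<phi> x = 0) \<Longrightarrow> 0 \<le> (LINT x|M. \<phi> x * g x)"
  shows "AE x in M. x \<in> U \<longrightarrow> 0 \<le> g x"
proof -
  note [measurable] = g
  note sets = radon_sets[OF M]
  have [measurable]: "g \<in> borel_measurable borel" by (rule g[unfolded radon_measurable[OF M]])
  have compact_pos: "0 \<le> (LINT x|M. indicator K x * g x)" if K: "compact K" "K \<subseteq> U" for K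
  proof -
    \<comment> \<open>The cutoffs are supported in shrinking neighbourhoods of \<open>K\<close>, so
      they converge pointwise to its indicator.\<close>
    define V where "V = (\<lambda>n::nat. U \<inter> (\<Union>x\<in>K. ball x (1 / Suc n)))"
    have V: "open (V n)" "K \<subseteq> V n" for n
      using K U by (auto simp: V_def)
    have "\<exists>\<phi> D. \<phi> \<in> Cinf_c \<and> (\<forall>x. 0 \<le> \<phi> x \<and> \<phi> x \<le> 1) \<and> (\<forall>x\<in>K. \<phi> x = 1) \<and> compact D \<and> D \<subseteq> V n \<and>
      (\<forall>x. x \<notin> D \<longrightarrow> \<phi> x = 0)" for n
    proof -
      obtain \<phi> W D where "\<phi> \<in> Cinf_c" "\<And>x. 0 \<le> \<phi> x" "\<And>x. \<phi> x \<le> 1" "open W" "K \<subseteq> W"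
        "\<And>x. x \<in> W \<Longrightarrow> \<phi> x = 1" "compact D" "D \<subseteq> V n" "\<And>x. x \<notin> D \<Longrightarrow> \<phi> x = 0"
        using smooth_cutoff[OF K(1) V] by metis
      then show ?thesis by (intro exI[of _ \<phi>] exI[of _ D]) auto
    qed
    then obtain \<phi> D where p: "\<And>n. \<phi> n \<in> Cinf_c" "\<And>n x. 0 \<le> \<phi> n x" "\<And>n x. \<phi> n x \<le> 1"
      "\<And>n x. x \<in> K \<Longrightarrow> \<phi> n x = 1" "\<And>n. compact (D n)" "\<And>n. D n \<subseteq> V n" "\<And>n x. x \<notin> D n \<Longrightarrow> \<phi> n x = 0"
      by metis
    obtain R where R: "\<And>x. x \<in> K \<Longrightarrow> norm x \<le> R"
      using compact_imp_bounded[OF K(1)] by (auto simp: bounded_iff)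
    have D: "D n \<subseteq> cball 0 (R + 1)" for n
    proof
      fix x assume "x \<in> D n"
      then obtain y where y: "y \<in> K" "dist y x < 1 / Suc n" using p(6) by (force simp: V_def)
      have "1 / real (Suc n) \<le> 1" by simp
      then have "dist y x \<le> 1" using y(2) by linarith
      then show "x \<in> cball 0 (R + 1)"
        using R[OF y(1)] norm_triangle_sub[of x y] by (simp add: dist_norm norm_minus_commute)
    qed
    have [measurable]: "\<phi> n \<in> borel_measurable M" for n
      unfolding radon_measurable[OF M] by (rule borel_measurable_continuous_onI[OF Cinf_c_continuous[OF p(1)]])
    have lim: "(\<lambda>n. \<phi> n x) \<longlonglongrightarrow> indicator K x" for x
    proof (cases "x \<in> K")
      case False
      then obtain \<delta> where \<delta>: "0 < \<delta>" "ball x \<delta> \<subseteq> - K"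
        using K(1) compact_imp_closed open_contains_ball by (metis ComplI open_Compl)
      obtain N where N: "1 / real (Suc N) < \<delta>" using \<delta>(1) nat_approx_posE by blast
      have "\<phi> n x = 0" if "n \<ge> N" for n
      proof (rule p(7), rule notI)
        assume "x \<in> D n"
        then obtain y where y: "y \<in> K" "dist y x < 1 / Suc n" using p(6) by (force simp: V_def)
        have "1 / real (Suc n) \<le> 1 / real (Suc N)" using that by (simp add: frac_le)
        then have "y \<in> ball x \<delta>" using y N by (simp add: dist_commute)
        then show False using \<delta> y by auto
      qed
      then have "\<forall>\<^sub>F n in sequentially. \<phi> n x = 0" by (auto simp: eventually_sequentially)
      then show ?thesis using False by (simp add: tendsto_eventually)
    qed (simp add: p)
    have "(\<lambda>n. LINT x|M. \<phi> n x * g x) \<longlonglongrightarrow> (LINT x|M. indicator K x * g x)"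
    proof (rule integral_dominated_convergence)
      show "integrable M (\<lambda>x. \<bar>indicator (cball 0 (R + 1)) x * g x\<bar>)"
        by (rule integrable_abs[OF int])
      show "AE x in M. norm (\<phi> n x * g x) \<le> \<bar>indicator (cball 0 (R + 1)) x * g x\<bar>" for n
      proof (rule AE_I2)
        fix x
        show "norm (\<phi> n x * g x) \<le> \<bar>indicator (cball 0 (R + 1)) x * g x\<bar>"
        proof (cases "x \<in> D n")
          case True
          then show ?thesis using D[of n] p(2,3)[of n x] by (auto simp: abs_mult mult_left_le_one_le)
        qed (simp add: p(7))
      qed
    next
      have "K \<in> sets M" using K by (simp add: sets compact_imp_closed)
      then show "(\<lambda>x. indicator K x * g x) \<in> borel_measurable M" by measurable
    qed (use lim in \<open>auto intro!: tendsto_mult\<close>)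
    moreover have "0 \<le> (LINT x|M. \<phi> n x * g x)" for n
      by (rule pos[of "\<phi> n" "D n"]) (use p in \<open>auto simp: V_def\<close>)
    ultimately show ?thesis by (blast intro: LIMSEQ_le_const)
  qed
  define A where "A = {x \<in> U. g x < 0}"
  have A: "A \<in> sets borel" unfolding A_def using U by measurable
  have null_compact: "emeasure M K = 0" if K: "compact K" "K \<subseteq> A" for K
  proof -
    have KM: "K \<in> sets M" using K by (simp add: sets compact_imp_closed)
    obtain R where R: "K \<subseteq> cball 0 R"
      using bounded_subset_ballD[OF compact_imp_bounded[OF K(1)], of 0] ball_subset_cball by blast
    have int: "integrable M (\<lambda>x. - (indicator K x * g x))"
    proof (rule Bochner_Integration.integrable_bound[OF int[of R]])
      show "AE x in M. norm (- (indicator K x * g x)) \<le> norm (indicator (cball 0 R) x * g x)"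
        using R by (intro AE_I2) (auto simp: indicator_def)
    qed (use KM in measurable)
    have nn: "AE x in M. 0 \<le> - (indicator K x * g x)"
      using K by (intro AE_I2) (auto simp: indicator_def A_def)
    have "(LINT x|M. - (indicator K x * g x)) \<le> 0"
      using compact_pos[OF K(1)] K(2) by (auto simp: A_def)
    moreover have "0 \<le> (LINT x|M. - (indicator K x * g x))"
      by (rule integral_nonneg_AE[OF nn])
    ultimately have "AE x in M. - (indicator K x * g x) = 0"
      using integral_nonneg_eq_0_iff_AE[OF int nn] by auto
    then have "AE x in M. x \<notin> K"
      by eventually_elim (use K in \<open>auto simp: indicator_def A_def\<close>)
    then show ?thesis using KM by (subst (asm) AE_iff_null_sets[symmetric]) auto
  qed
  have "emeasure M (A \<inter> cball 0 (real m)) = 0" for m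
  proof -
    \<comment> \<open>\<open>inner_regular\<close> is about finite measures, so \<open>M\<close> is
      restricted to balls, which exhaust the space.\<close>
    let ?N = "density M (indicator (cball 0 (real m)))"
    have N: "emeasure ?N B = emeasure M (B \<inter> cball 0 (real m))" if "B \<in> sets borel" for B
    proof -
      have "(indicator (cball 0 (real m)) :: 'a \<Rightarrow> ennreal) \<in> borel_measurable M"
        by (rule borel_measurable_indicator) (simp add: sets)
      then have "emeasure ?N B = (\<integral>\<^sup>+x. indicator (cball 0 (real m)) x * indicator B x \<partial>M)"
        using that by (subst emeasure_density) (simp_all add: sets)
      also have "\<dots> = (\<integral>\<^sup>+x. indicator (B \<inter> cball 0 (real m)) x \<partial>M)"
        by (intro nn_integral_cong) (auto simp: indicator_def)
      finally show ?thesis using that by (simp add: sets)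
    qed
    have "emeasure M (cball 0 (real m)) < \<infinity>" using M by (simp add: radon_measure_def)
    then have fin: "emeasure ?N (space ?N) \<noteq> \<infinity>"
      using N[of UNIV] by (simp add: radon_space[OF M])
    have "emeasure ?N A = (SUP K\<in>{K. K \<subseteq> A \<and> compact K}. emeasure ?N K)"
      by (rule inner_regular[OF _ fin A]) (simp add: sets)
    also have "\<dots> \<le> 0"
    proof (rule SUP_least)
      fix K assume "K \<in> {K. K \<subseteq> A \<and> compact K}"
      then have "emeasure M (K \<inter> cball 0 (real m)) = 0"
        by (intro null_compact) auto
      then show "emeasure ?N K \<le> 0"
        using N[of K] \<open>K \<in> _\<close> by (simp add: compact_imp_closed)
    qed
    finally show ?thesis using N[OF A] by simp
  qed
  then have "(\<Union>m. A \<inter> cball 0 (real m)) \<in> null_sets M"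
    using A by (intro null_sets_UN) (auto simp: null_sets_def sets)
  moreover have "(\<Union>m. A \<inter> cball 0 (real m)) = A"
    by (auto simp: real_arch_simple)
  ultimately have "A \<in> null_sets M" by simp
  from AE_not_in[OF this] show ?thesis
    by eventually_elim (auto simp: A_def)
qed

lemma zero_of_smooth_tests:
  fixes g :: "'a::euclidean_space \<Rightarrow> real"
  assumes M: "radon_measure M" and g: "g \<in> borel_measurable M" and C: "AE x in M. \<bar>g x\<bar> \<le> C"
    and U: "open U"
    and zero: "\<And>\<phi> K. \<phi> \<in> Cinf_c \<Longrightarrow> compact K \<Longrightarrow> K \<subseteq> U \<Longrightarrow>
       (\<And>x. x \<notin> K \<Longrightarrow> \<phi> x = 0) \<Longrightarrow> (LINT x|M. \<phi> x * g x) = 0"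
  shows "AE x in M. x \<in> U \<longrightarrow> g x = 0"
proof -
  have int: "integrable M (\<lambda>x. indicator (cball 0 R) x * g x)" for R
  proof (rule integrable_compact_support[OF M, of _ "cball 0 R" C])
    have "(indicator (cball 0 R) :: 'a \<Rightarrow> real) \<in> borel_measurable M"
      by (rule borel_measurable_indicator) (simp add: radon_sets[OF M])
    then show "(\<lambda>x. indicator (cball 0 R) x * g x) \<in> borel_measurable M" using g by measurable
    show "AE x in M. norm (indicator (cball 0 R) x * g x) \<le> C"
      using C by eventually_elim (auto simp: indicator_def)
  qed auto
  have "AE x in M. x \<in> U \<longrightarrow> 0 \<le> g x"
    by (rule nonneg_of_smooth_tests[OF M g int U]) (simp add: zero)
  moreover have "AE x in M. x \<in> U \<longrightarrow> 0 \<le> - g x"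
    by (rule nonneg_of_smooth_tests[OF M _ _ U]) (use g int zero in auto)
  ultimately show ?thesis by eventually_elim auto
qed

subsection \<open>Convergence of convex combinations\<close>

text \<open>A fast subsequence converges a.e. because its increments are summable in the mean;
  Fatou's lemma along it then bounds the squared distance of every \<open>u n\<close> to the limit
  by the rate \<open>a n\<close>.\<close>

lemma L2_Cauchy_converges:
  fixes u :: "nat \<Rightarrow> 'a \<Rightarrow> 'b::euclidean_space"
  assumes N: "finite_measure N" and u [measurable]: "\<And>n. u n \<in> borel_measurable N"
    and cau: "\<And>n m. (\<integral>\<^sup>+x. ennreal ((norm (u n x - u m x))\<^sup>2) \<partial>N) \<le> ennreal (a n + a m)"
    and a: "a \<longlonglongrightarrow> 0" and a0: "\<And>n. 0 \<le> a n"
  obtains r w where "strict_mono r" "w \<in> borel_measurable N" "AE x in N. (\<lambda>k. u (r k) x) \<longlonglongrightarrow> w x"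
    "\<And>n. (\<integral>\<^sup>+x. ennreal ((norm (u n x - w x))\<^sup>2) \<partial>N) \<le> ennreal (a n)"
proof -
  interpret finite_measure N by fact
  have "\<exists>M. \<forall>n\<ge>M. a n \<le> (1/8)^k / 2" for k :: nat
  proof -
    have "\<forall>\<^sub>F n in sequentially. a n < (1/8)^k / 2"
      by (rule order_tendstoD(2)[OF a]) simp
    then show ?thesis unfolding eventually_sequentially by (meson less_imp_le)
  qed
  then obtain P where P: "\<And>k n. n \<ge> P k \<Longrightarrow> a n \<le> (1/8)^k / 2" by metis
  \<comment> \<open>Summing \<open>Suc (P i)\<close> makes \<open>r\<close> strictly increasing and
    at least as large as \<open>P\<close>.\<close>
  define r where "r k = (\<Sum>i\<le>k. Suc (P i))" for k
  have r: "strict_mono r" by (simp add: strict_mono_Suc_iff r_def)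
  have "P k \<le> r k" for k by (cases k) (simp_all add: r_def)
  then have ar: "a (r k) \<le> (1/8)^k / 2" for k using P by blast
  define D where "D k x = u (r (Suc k)) x - u (r k) x" for k x
  have [measurable]: "D k \<in> borel_measurable N" for k unfolding D_def by measurable
  have D2: "(\<integral>\<^sup>+x. ennreal ((norm (D k x))\<^sup>2) \<partial>N) \<le> ennreal ((1/8)^k)" for k
  proof -
    have "(1/8::real)^Suc k \<le> (1/8)^k" by simp
    then have "a (r (Suc k)) + a (r k) \<le> (1/8)^k" using ar[of k] ar[of "Suc k"] by linarith
    then show ?thesis
      unfolding D_def by (rule order_trans[OF cau ennreal_leI])
  qed
  \<comment> \<open>The inequality \<open>y \<le> t + y\<^sup>2 / t\<close> with
    \<open>t = (1/2)^k\<close> passes from squares to first powers. The factor \<open>2^k\<close> is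
    absorbed by the bound \<open>(1/8)^k\<close>, which explains that rate.\<close>
  have pw: "norm (D k x) \<le> (1/2)^k + 2^k * (norm (D k x))\<^sup>2" for k x
  proof (cases "norm (D k x) \<le> (1/2)^k")
    case False
    have eq: "(2::real)^k * (1/2)^k = 1" by (simp add: power_mult_distrib[symmetric])
    have "1 \<le> 2^k * norm (D k x)"
      using mult_left_mono[of "(1/2)^k" "norm (D k x)" "2^k"] False unfolding eq by simp
    then have "norm (D k x) \<le> 2^k * norm (D k x) * norm (D k x)"
      using mult_right_mono[of 1 "2^k * norm (D k x)" "norm (D k x)"] by simp
    moreover have "0 \<le> (1/2::real) ^ k" by simp
    ultimately show ?thesis
      unfolding power2_eq_square mult.assoc by linarith
  qed (simp add: add_increasing2)
  have D1: "(\<integral>\<^sup>+x. ennreal (norm (D k x)) \<partial>N) \<le> ennreal ((1/2)^k * measure N (space N) + (1/4)^k)" for k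
  proof -
    have "(\<integral>\<^sup>+x. ennreal (norm (D k x)) \<partial>N) \<le>
        (\<integral>\<^sup>+x. ennreal ((1/2)^k) + ennreal (2^k) * ennreal ((norm (D k x))\<^sup>2) \<partial>N)"
      by (intro nn_integral_mono) (simp add: pw flip: ennreal_plus ennreal_mult)
    also have "\<dots> = ennreal ((1/2)^k) * emeasure N (space N) + ennreal (2^k) * (\<integral>\<^sup>+x. ennreal ((norm (D k x))\<^sup>2) \<partial>N)"
      by (simp add: nn_integral_add nn_integral_cmult)
    also have "\<dots> \<le> ennreal ((1/2)^k) * emeasure N (space N) + ennreal (2^k) * ennreal ((1/8)^k)"
      by (intro add_mono mult_left_mono D2) simp_all
    also have "\<dots> = ennreal ((1/2)^k * measure N (space N) + (1/4)^k)"
      by (simp add: emeasure_eq_measure power_mult_distrib[symmetric] flip: ennreal_plus ennreal_mult)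
    finally show ?thesis .
  qed
  have "(\<integral>\<^sup>+x. (\<Sum>k. ennreal (norm (D k x))) \<partial>N) = (\<Sum>k. \<integral>\<^sup>+x. ennreal (norm (D k x)) \<partial>N)"
    by (rule nn_integral_suminf) simp
  also have "\<dots> \<le> (\<Sum>k. ennreal ((1/2)^k * measure N (space N) + (1/4)^k))"
    by (intro suminf_le D1) auto
  also have "\<dots> = ennreal (\<Sum>k. (1/2)^k * measure N (space N) + (1/4)^k)"
    by (intro suminf_ennreal2 summable_add summable_mult2 summable_geometric) auto
  finally have "(\<integral>\<^sup>+x. (\<Sum>k. ennreal (norm (D k x))) \<partial>N) \<noteq> \<infinity>"
    by (auto simp: top_unique)
  then have "AE x in N. (\<Sum>k. ennreal (norm (D k x))) \<noteq> \<infinity>"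
    by (intro nn_integral_PInf_AE) auto
  then have conv: "AE x in N. convergent (\<lambda>k. u (r k) x)"
  proof eventually_elim
    case (elim x)
    then have "summable (\<lambda>k. norm (D k x))"
      by (intro summable_suminf_not_top) auto
    then have "summable (\<lambda>k. D k x)" by (rule summable_norm_cancel)
    then have "convergent (\<lambda>n. \<Sum>k<n. D k x)" by (simp add: summable_iff_convergent)
    moreover have "(\<Sum>k<n. D k x) = u (r n) x - u (r 0) x" for n
      unfolding D_def by (rule sum_lessThan_telescope)
    ultimately have "convergent (\<lambda>n. (u (r n) x - u (r 0) x) + u (r 0) x)"
      by (intro convergent_add convergent_const) simp
    then show ?case by simp
  qed
  define w where "w x = lim (\<lambda>k. u (r k) x)" for x
  have w_meas [measurable]: "w \<in> borel_measurable N"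
    unfolding w_def by (rule borel_measurable_lim_metric) simp
  have w: "AE x in N. (\<lambda>k. u (r k) x) \<longlonglongrightarrow> w x"
    using conv by eventually_elim (simp add: convergent_LIMSEQ_iff w_def)
  have "(\<integral>\<^sup>+x. ennreal ((norm (u n x - w x))\<^sup>2) \<partial>N) \<le> ennreal (a n)" for n
  proof -
    have "AE x in N. ennreal ((norm (u n x - w x))\<^sup>2) = liminf (\<lambda>k. ennreal ((norm (u n x - u (r k) x))\<^sup>2))"
      using w
    proof eventually_elim
      case (elim x)
      have "(\<lambda>k. ennreal ((norm (u n x - u (r k) x))\<^sup>2)) \<longlonglongrightarrow> ennreal ((norm (u n x - w x))\<^sup>2)"
        by (intro tendsto_ennrealI tendsto_power tendsto_norm tendsto_diff tendsto_const elim)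
      then show ?case by (rule lim_imp_Liminf[symmetric, rotated]) simp
    qed
    then have "(\<integral>\<^sup>+x. ennreal ((norm (u n x - w x))\<^sup>2) \<partial>N) =
        (\<integral>\<^sup>+x. liminf (\<lambda>k. ennreal ((norm (u n x - u (r k) x))\<^sup>2)) \<partial>N)"
      by (rule nn_integral_cong_AE)
    also have "\<dots> \<le> liminf (\<lambda>k. \<integral>\<^sup>+x. ennreal ((norm (u n x - u (r k) x))\<^sup>2) \<partial>N)"
      by (rule nn_integral_liminf) simp
    also have "\<dots> \<le> liminf (\<lambda>k. ennreal (a n + a (r k)))"
      by (intro Liminf_mono always_eventually allI cau)
    also have "\<dots> = ennreal (a n)"
    proof (rule lim_imp_Liminf)
      have "(\<lambda>k. ennreal (a n + a (r k))) \<longlonglongrightarrow> ennreal (a n + 0)"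
        using LIMSEQ_subseq_LIMSEQ[OF a r] by (intro tendsto_ennrealI tendsto_add tendsto_const) (simp add: o_def)
      then show "(\<lambda>k. ennreal (a n + a (r k))) \<longlonglongrightarrow> ennreal (a n)" by simp
    qed simp
    finally show ?thesis .
  qed
  then show ?thesis by (rule that[OF r w_meas w])
qed

text \<open>The coefficients vanish below \<open>n\<close>, so the \<open>n\<close>-th combination
  only sees terms that are already close to the limit.\<close>

lemma convex_tail_tendsto:
  fixes a :: "nat \<Rightarrow> 'b::real_normed_vector"
  assumes c: "\<And>n k. 0 \<le> c n k" "\<And>n k. k < n \<Longrightarrow> c n k = 0" "\<And>n. (\<Sum>k\<le>m n. c n k) = 1"
    and a: "a \<longlonglongrightarrow> l"
  shows "(\<lambda>n. \<Sum>k\<le>m n. c n k *\<^sub>R a k) \<longlonglongrightarrow> l"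
proof (rule LIMSEQ_I)
  fix e :: real assume "0 < e"
  then obtain N where N: "\<And>k. k \<ge> N \<Longrightarrow> norm (a k - l) < e / 2"
    using LIMSEQ_D[OF a, of "e / 2"] by auto
  have "norm ((\<Sum>k\<le>m n. c n k *\<^sub>R a k) - l) < e" if n: "n \<ge> N" for n
  proof -
    have "(\<Sum>k\<le>m n. c n k *\<^sub>R a k) - l = (\<Sum>k\<le>m n. c n k *\<^sub>R (a k - l))"
      by (simp add: scaleR_diff_right sum_subtractf c(3) flip: scaleR_left.sum)
    also have "norm \<dots> \<le> (\<Sum>k\<le>m n. c n k * (e / 2))"
    proof (rule sum_norm_le)
      fix k
      show "norm (c n k *\<^sub>R (a k - l)) \<le> c n k * (e / 2)"
      proof (cases "k < n")
        case False
        then have "norm (a k - l) \<le> e / 2" using N[of k] n by simp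
        then show ?thesis using mult_left_mono[OF _ c(1)[of n k]] c(1)[of n k] by fastforce
      qed (simp add: c)
    qed
    also have "\<dots> = e / 2" using c(3)[of n] by (simp flip: sum_distrib_right sum_divide_distrib)
    finally show ?thesis using \<open>0 < e\<close> by simp
  qed
  then show "\<exists>N. \<forall>n\<ge>N. norm ((\<Sum>k\<le>m n. c n k *\<^sub>R a k) - l) < e" by blast
qed

lemma convex_tail_norm_le:
  fixes a :: "nat \<Rightarrow> 'b::real_normed_vector"
  assumes c: "\<And>k. 0 \<le> c k" "\<And>k. k < n \<Longrightarrow> c k = 0" "(\<Sum>k\<le>m. c k) = (1::real)"
    and B: "\<And>k. k \<ge> n \<Longrightarrow> norm (a k) \<le> B"
  shows "norm (\<Sum>k\<le>m. c k *\<^sub>R a k) \<le> B"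
proof -
  have "norm (\<Sum>k\<le>m. c k *\<^sub>R a k) \<le> (\<Sum>k\<le>m. c k * B)"
  proof (rule sum_norm_le)
    fix k
    show "norm (c k *\<^sub>R a k) \<le> c k * B"
      by (cases "k < n") (use c(1)[of k] c(2)[of k] B[of k] in \<open>auto intro: mult_left_mono\<close>)
  qed
  also have "\<dots> = B" using c(3) by (simp flip: sum_distrib_right)
  finally show ?thesis .
qed

lemma norm_diff_parallelogram:
  fixes x y :: "'b::real_inner"
  shows "(norm (x - y))\<^sup>2 = 2 * (norm x)\<^sup>2 + 2 * (norm y)\<^sup>2 - 4 * (norm ((1/2) *\<^sub>R (x + y)))\<^sup>2"
  by (simp add: power2_norm_eq_inner inner_add_left inner_add_right inner_diff_left inner_diff_right
      inner_commute algebra_simps power_mult_distrib)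

text \<open>Instead of weak compactness in \<open>L\<^sup>2\<close>, the convex combinations of the tails of almost
  minimal norm converge strongly, by the parallelogram law.\<close>

lemma bounded_convex_combinations_converge:
  fixes u :: "nat \<Rightarrow> 'a \<Rightarrow> 'b::euclidean_space"
  assumes N: "finite_measure N" and u [measurable]: "\<And>n. u n \<in> borel_measurable N"
    and K: "\<And>n. AE x in N. norm (u n x) \<le> K"
  obtains m c h where "\<And>n k. 0 \<le> c n k" "\<And>n k. k < n \<Longrightarrow> c n k = 0" "\<And>n. (\<Sum>k\<le>m n. c n k) = (1::real)"
    "h \<in> borel_measurable N" "AE x in N. (\<lambda>n. \<Sum>k\<le>m n. c n k *\<^sub>R u k x) \<longlonglongrightarrow> h x"
proof -
  interpret finite_measure N by fact
  have K': "AE x in N. \<forall>k. norm (u k x) \<le> K" using K by (simp add: AE_all_countable)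
  \<comment> \<open>Last index and coefficients of a convex combination of the tail from
    \<open>n\<close>. The coefficients also vanish beyond the last index, so that combinations of
    different length can be averaged term by term.\<close>
  define W :: "nat \<Rightarrow> (nat \<times> (nat \<Rightarrow> real)) set" where
    "W n = {(m, c). (\<forall>k. 0 \<le> c k) \<and> (\<forall>k<n. c k = 0) \<and> (\<forall>k>m. c k = 0) \<and> (\<Sum>k\<le>m. c k) = 1}" for n
  define cmb where "cmb p x = (\<Sum>k\<le>fst p. snd p k *\<^sub>R u k x)" for p :: "nat \<times> (nat \<Rightarrow> real)" and x
  define E where "E p = (LINT x|N. (norm (cmb p x))\<^sup>2)" for p
  have [measurable]: "cmb p \<in> borel_measurable N" for p unfolding cmb_def by measurable
  have bound: "AE x in N. norm (cmb p x) \<le> K" if "p \<in> W n" for p n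
    using K'
  proof eventually_elim
    case (elim x)
    then show ?case
      unfolding cmb_def using that by (intro convex_tail_norm_le[of "snd p" n]) (auto simp: W_def)
  qed
  have int: "integrable N (\<lambda>x. (norm (cmb p x))\<^sup>2)" if "p \<in> W n" for p n
    by (rule integrable_const_bound[of _ "K\<^sup>2"])
      (use bound[OF that] in \<open>auto elim!: eventually_mono intro: power_mono\<close>)
  have E0: "0 \<le> E p" for p by (simp add: E_def)
  have EK: "E p \<le> K\<^sup>2 * measure N (space N)" if "p \<in> W n" for p n
  proof -
    have "E p \<le> (LINT x|N. K\<^sup>2)"
      unfolding E_def by (rule integral_mono_AE[OF int[OF that]])
        (use bound[OF that] in \<open>auto elim!: eventually_mono intro: power_mono\<close>)
    then show ?thesis by (simp add: mult.commute)
  qed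
  have ne: "(n, \<lambda>k. if k = n then 1 else 0) \<in> W n" for n
    by (auto simp: W_def)
  have Wmono: "W n' \<subseteq> W n" if "n \<le> n'" for n n'
    using that by (auto simp: W_def)
  define I where "I n = Inf (E ` W n)" for n
  have bb: "bdd_below (E ` W n)" for n by (rule bdd_belowI[of _ 0]) (use E0 in auto)
  have I_le: "I n \<le> E p" if "p \<in> W n" for n p
    unfolding I_def by (rule cINF_lower[OF bb that])
  have I_mono: "I n \<le> I n'" if "n \<le> n'" for n n'
    unfolding I_def by (rule cINF_superset_mono[OF _ bb]) (use Wmono[OF that] ne in auto)
  have I_bd: "I n \<le> K\<^sup>2 * measure N (space N)" for n
    using I_le[OF ne] EK[OF ne] by (rule order_trans)
  obtain L where L: "I \<longlonglongrightarrow> L" "\<And>n. I n \<le> L"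
    using incseq_convergent[of I "K\<^sup>2 * measure N (space N)"] I_mono I_bd by (auto simp: incseq_def)
  have "\<exists>p. p \<in> W n \<and> E p < I n + 1 / Suc n" for n
  proof -
    have "Inf (E ` W n) < I n + 1 / Suc n" by (simp add: I_def)
    then show ?thesis
      using cInf_lessD[of "E ` W n"] ne by blast
  qed
  then obtain p where p: "\<And>n. p n \<in> W n" "\<And>n. E (p n) < I n + 1 / Suc n" by metis
  \<comment> \<open>Twice the distance of \<open>I n\<close> to its limit plus twice the selection
    error; the parallelogram law bounds squared distances of combinations by the sum of two such
    terms.\<close>
  define a where "a n = 2 * (L - I n) + 2 / Suc n" for n
  have key: "(LINT x|N. (norm (cmb (p n) x - cmb (p n') x))\<^sup>2) \<le> a n + a n'" if "n \<le> n'" for n n'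
  proof -
    \<comment> \<open>The average is again a combination of the tail from \<open>n\<close>, so its
      energy is at least \<open>I n\<close>. This is the lower bound that the parallelogram law
      requires.\<close>
    define q where "q = (max (fst (p n)) (fst (p n')), \<lambda>k. (snd (p n) k + snd (p n') k) / 2)"
    have pn: "p n \<in> W n" "p n' \<in> W n" using p Wmono[OF that] by auto
    have ext: "(\<Sum>k\<le>fst r. f k *\<^sub>R g k) = (\<Sum>k\<le>M. f k *\<^sub>R (g k :: 'c::real_vector))"
      if "\<forall>k>fst r. f k = 0" "fst r \<le> M" for r :: "nat \<times> (nat \<Rightarrow> real)" and f M g
      by (rule sum.mono_neutral_left) (use that in auto)
    have avg: "cmb q x = (1/2) *\<^sub>R (cmb (p n) x + cmb (p n') x)" for x
    proof -
      have "cmb (p n) x = (\<Sum>k\<le>fst q. snd (p n) k *\<^sub>R u k x)" "cmb (p n') x = (\<Sum>k\<le>fst q. snd (p n') k *\<^sub>R u k x)"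
        unfolding cmb_def by (rule ext; use pn in \<open>auto simp: W_def q_def\<close>)+
      then show ?thesis
        by (simp add: cmb_def q_def scaleR_sum_right sum.distrib[symmetric] scaleR_add_left[symmetric] add_divide_distrib)
    qed
    have one: "(\<Sum>k\<le>fst q. snd (p n) k) = 1" "(\<Sum>k\<le>fst q. snd (p n') k) = 1"
      using ext[of "p n" "snd (p n)" "fst q" "\<lambda>_. 1::real"] ext[of "p n'" "snd (p n')" "fst q" "\<lambda>_. 1::real"] pn
      by (auto simp: W_def q_def split_beta)
    have q: "q \<in> W n"
      using pn one by (auto simp: W_def q_def split_beta sum.distrib add_divide_distrib simp flip: sum_divide_distrib)
    have "(LINT x|N. (norm (cmb (p n) x - cmb (p n') x))\<^sup>2) = 2 * E (p n) + 2 * E (p n') - 4 * E q"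
      unfolding norm_diff_parallelogram E_def avg[symmetric] using int pn q by simp
    also have "\<dots> \<le> 2 * (I n + 1 / Suc n) + 2 * (I n' + 1 / Suc n') - 4 * I n"
      using p(2)[of n] p(2)[of n'] I_le[OF q] by simp
    also have "\<dots> \<le> a n + a n'"
      using L(2)[of n] L(2)[of n'] by (simp add: a_def)
    finally show ?thesis .
  qed
  have key': "(\<integral>\<^sup>+x. ennreal ((norm (cmb (p n) x - cmb (p n') x))\<^sup>2) \<partial>N) \<le> ennreal (a n + a n')" for n n'
  proof -
    have i: "integrable N (\<lambda>x. (norm (cmb (p n) x - cmb (p n') x))\<^sup>2)"
    proof (rule integrable_const_bound[of _ "(K + K)\<^sup>2"])
      show "AE x in N. norm ((norm (cmb (p n) x - cmb (p n') x))\<^sup>2) \<le> (K + K)\<^sup>2"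
        using bound[OF p(1)[of n]] bound[OF p(1)[of n']]
      proof eventually_elim
        case (elim x)
        then have "norm (cmb (p n) x - cmb (p n') x) \<le> K + K"
          using norm_triangle_ineq4[of "cmb (p n) x" "cmb (p n') x"] by linarith
        then have "(norm (cmb (p n) x - cmb (p n') x))\<^sup>2 \<le> (K + K)\<^sup>2"
          by (rule power_mono) simp
        then show ?case by simp
      qed
    qed simp
    have "(LINT x|N. (norm (cmb (p n) x - cmb (p n') x))\<^sup>2) \<le> a n + a n'"
      using key[of n n'] key[of n' n] by (cases "n \<le> n'") (auto simp: norm_minus_commute add.commute)
    then show ?thesis
      by (simp add: nn_integral_eq_integral[OF i] ennreal_leI)
  qed
  have a: "a \<longlonglongrightarrow> 0"
  proof -
    have "(\<lambda>n. 2 * (L - I n) + 2 * (1 / real (Suc n))) \<longlonglongrightarrow> 2 * (L - L) + 2 * 0"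
      by (intro tendsto_add tendsto_mult tendsto_diff tendsto_const L lim_1_over_n[THEN LIMSEQ_Suc])
    then show ?thesis by (simp add: a_def[abs_def])
  qed
  obtain r h where r: "strict_mono r" and h: "h \<in> borel_measurable N"
    "AE x in N. (\<lambda>k. cmb (p (r k)) x) \<longlonglongrightarrow> h x"
    by (rule L2_Cauchy_converges[OF N _ key' a]) (use L in \<open>auto simp: a_def\<close>)
  show ?thesis
  proof (rule that[of "\<lambda>n. snd (p (r n))" "\<lambda>n. fst (p (r n))" h])
    fix n k :: nat
    show "0 \<le> snd (p (r n)) k" "(\<Sum>k\<le>fst (p (r n)). snd (p (r n)) k) = 1"
      using p(1)[of "r n"] by (auto simp: W_def)
    assume "k < n"
    then have "k < r n" using seq_suble[OF r, of n] by simp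
    then show "snd (p (r n)) k = 0"
      using p(1)[of "r n"] by (auto simp: W_def)
  qed (use h in \<open>auto simp: cmb_def\<close>)
qed

text \<open>The numbers \<open>p n\<close> decrease, and \<open>p n\<close> times the mass of the
  ball of radius \<open>n + 1\<close> is at most \<open>(1/2)^n\<close>. Used on the shells
  \<open>n \<le> norm x < n + 1\<close> they give an integrable function, which by monotonicity
  stays above a positive constant on bounded sets.\<close>

lemma radon_weight:
  fixes M :: "'a::euclidean_space measure"
  assumes M: "radon_measure M"
  obtains s :: "'a::euclidean_space \<Rightarrow> real" where "s \<in> borel_measurable M" "\<And>x. 0 < s x" "integrable M s"
    "\<And>K. compact K \<Longrightarrow> \<exists>\<delta>>0. \<forall>x\<in>K. \<delta> \<le> s x"
proof -
  define p where "p n = 1 / ((1 + measure M (cball 0 (Suc n))) * 2 ^ n)" for n :: nat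
  have fin: "emeasure M (cball (0::'a) r) < \<infinity>" for r using M by (simp add: radon_measure_def)
  have [measurable]: "cball (0::'a) r \<in> sets M" for r
    by (simp add: radon_sets[OF M])
  have p0: "0 < p n" for n
    by (simp add: p_def add_pos_nonneg)
  have pmono: "p n \<le> p m" if "m \<le> n" for m n
  proof -
    have "measure M (cball 0 (real (Suc m))) \<le> measure M (cball (0::'a) (real (Suc n)))"
      using that fin by (intro measure_mono_fmeasurable) (auto simp: fmeasurable_def radon_sets[OF M])
    then show ?thesis
      unfolding p_def using that
      by (intro frac_le mult_mono mult_pos_pos power_increasing) (auto simp: add_pos_nonneg)
  qed
  define s where "s x = p (nat \<lfloor>norm x\<rfloor>)" for x :: 'a
  have [measurable]: "s \<in> borel_measurable M"
    unfolding s_def radon_measurable[OF M] by measurable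
  have "(\<integral>\<^sup>+x. ennreal (s x) \<partial>M) \<le> (\<integral>\<^sup>+x. (\<Sum>n. ennreal (p n) * indicator (cball 0 (Suc n)) x) \<partial>M)"
  proof (rule nn_integral_mono)
    fix x :: 'a
    let ?n = "nat \<lfloor>norm x\<rfloor>"
    have "norm x \<le> Suc ?n" by (simp add: of_nat_nat) linarith
    then have "ennreal (s x) = ennreal (p ?n) * indicator (cball 0 (Suc ?n)) x"
      by (simp add: s_def)
    also have "\<dots> \<le> (\<Sum>n. ennreal (p n) * indicator (cball 0 (Suc n)) x)"
    proof -
      define g where "g = (\<lambda>n. ennreal (p n) * indicator (cball 0 (real (Suc n))) x)"
      have "g ?n = sum g {?n}" by simp
      also have "\<dots> \<le> suminf g" by (rule sum_le_suminf) auto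
      finally show ?thesis by (simp only: g_def)
    qed
    finally show "ennreal (s x) \<le> (\<Sum>n. ennreal (p n) * indicator (cball 0 (Suc n)) x)" .
  qed
  also have "\<dots> = (\<Sum>n. ennreal (p n) * emeasure M (cball 0 (Suc n)))"
    by (subst nn_integral_suminf) (auto simp: radon_sets[OF M] nn_integral_cmult_indicator)
  also have "\<dots> \<le> (\<Sum>n. ennreal ((1/2) ^ n))"
  proof (intro suminf_le)
    fix n
    let ?m = "measure M (cball 0 (Suc n))"
    have "p n * ?m \<le> (1/2) ^ n"
      by (simp add: p_def divide_simps add_pos_nonneg)
    then have "ennreal (p n * ?m) \<le> ennreal ((1/2) ^ n)" by (rule ennreal_leI)
    moreover have "emeasure M (cball 0 (Suc n)) = ennreal ?m"
      by (rule emeasure_eq_ennreal_measure) (use fin[of "Suc n"] in simp)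
    ultimately show "ennreal (p n) * emeasure M (cball 0 (Suc n)) \<le> ennreal ((1/2) ^ n)"
      using p0[of n] by (simp only: ennreal_mult less_imp_le measure_nonneg)
  qed auto
  also have "\<dots> < \<infinity>"
    by (subst suminf_ennreal2) (auto intro: summable_geometric)
  finally have int: "integrable M s"
    using p0 by (intro integrableI_bounded) (auto simp: s_def less_imp_le)
  show ?thesis
  proof (rule that[of s])
    fix K :: "'a set" assume "compact K"
    then have "bounded K" by (rule compact_imp_bounded)
    then obtain R where R: "\<And>x. x \<in> K \<Longrightarrow> norm x \<le> R"
      by (auto simp: bounded_iff)
    have "p (nat \<lfloor>R\<rfloor>) \<le> s x" if "x \<in> K" for x
      unfolding s_def by (intro pmono nat_mono floor_mono R that)
    then show "\<exists>\<delta>>0. \<forall>x\<in>K. \<delta> \<le> s x" using p0 by blast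
  qed (use int in \<open>auto simp: s_def p0\<close>)
qed

text \<open>The measure with the positive integrable density of \<open>radon_weight\<close> is
  finite and has the same null sets as \<open>M\<close>.\<close>

lemma radon_convex_combinations_converge:
  fixes u :: "nat \<Rightarrow> 'a::euclidean_space \<Rightarrow> 'b::euclidean_space"
  assumes M: "radon_measure M" and u: "\<And>n. u n \<in> borel_measurable M"
    and K: "\<And>n. AE x in M. norm (u n x) \<le> K"
  obtains m c h where "\<And>n k. 0 \<le> c n k" "\<And>n k. k < n \<Longrightarrow> c n k = 0" "\<And>n. (\<Sum>k\<le>m n. c n k) = (1::real)"
    "h \<in> borel_measurable M" "AE x in M. (\<lambda>n. \<Sum>k\<le>m n. c n k *\<^sub>R u k x) \<longlonglongrightarrow> h x"
proof -
  obtain s :: "'a \<Rightarrow> real" where [measurable]: "s \<in> borel_measurable M" and s: "\<And>x. 0 < s x" "integrable M s"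
    by (rule radon_weight[OF M], rule that)
  let ?N = "density M (\<lambda>x. ennreal (s x))"
  have AE: "(AE x in ?N. P x) \<longleftrightarrow> (AE x in M. P x)" for P
    using s by (subst AE_density) auto
  have "emeasure ?N (space ?N) = (\<integral>\<^sup>+x. ennreal (s x) \<partial>M)"
    by (subst emeasure_density) (auto intro!: nn_integral_cong)
  also have "\<dots> < \<infinity>"
    using s by (simp add: nn_integral_eq_integral less_imp_le)
  finally have N: "finite_measure ?N" by (intro finite_measureI) auto
  have K': "\<And>n. AE x in ?N. norm (u n x) \<le> K" using K by (simp add: AE)
  have u': "\<And>n. u n \<in> borel_measurable ?N" using u by simp
  show ?thesis
    by (rule bounded_convex_combinations_converge[OF N u' K'], rule that) (simp_all add: AE)
qed

subsection \<open>Vector fields and directional derivatives of Lipschitz functions\<close>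

lemma is_div_Linf: "is_div M v g \<Longrightarrow> g \<in> Linf M"
  by (simp add: is_div_def)

lemma LinfE:
  assumes "v \<in> Linf M"
  obtains C where "0 \<le> C" "AE x in M. norm (v x) \<le> C" "v \<in> borel_measurable M"
proof -
  obtain C where C: "AE x in M. norm (v x) \<le> C" and v: "v \<in> borel_measurable M"
    using assms by (auto simp: Linf_def)
  have "AE x in M. norm (v x) \<le> max 0 C" using C by eventually_elim auto
  then show ?thesis using v by (intro that[of "max 0 C"]) auto
qed

lemma LinfI: "v \<in> borel_measurable M \<Longrightarrow> AE x in M. norm (v x) \<le> C \<Longrightarrow> v \<in> Linf M"
  by (auto simp: Linf_def)

lemma Linf_measurable: "v \<in> Linf M \<Longrightarrow> v \<in> borel_measurable M"
  by (simp add: Linf_def)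

lemma Linf_add:
  assumes "v \<in> Linf M" "w \<in> Linf M" shows "(\<lambda>x. v x + w x) \<in> Linf M"
proof -
  obtain C where C: "AE x in M. norm (v x) \<le> C" "v \<in> borel_measurable M" by (rule LinfE[OF assms(1)])
  obtain D where D: "AE x in M. norm (w x) \<le> D" "w \<in> borel_measurable M" by (rule LinfE[OF assms(2)])
  show ?thesis
  proof (rule LinfI)
    show "AE x in M. norm (v x + w x) \<le> C + D"
      using C(1) D(1) by eventually_elim (rule norm_triangle_mono)
  qed (use C D in measurable)
qed

lemma Linf_bilinear:
  assumes h: "bounded_bilinear h" "(\<lambda>x. h (v x) (w x)) \<in> borel_measurable M"
    and "v \<in> Linf M" "w \<in> Linf M"
  shows "(\<lambda>x. h (v x) (w x)) \<in> Linf M"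
proof -
  obtain C where C: "0 \<le> C" "AE x in M. norm (v x) \<le> C" by (rule LinfE[OF assms(3)])
  obtain D where D: "0 \<le> D" "AE x in M. norm (w x) \<le> D" by (rule LinfE[OF assms(4)])
  obtain K where K: "\<And>a b. norm (h a b) \<le> norm a * norm b * K" "0 \<le> K"
    using bounded_bilinear.nonneg_bounded[OF h(1)] by auto
  show ?thesis
  proof (rule LinfI[OF h(2)])
    show "AE x in M. norm (h (v x) (w x)) \<le> C * D * K"
      using C(2) D(2)
    proof eventually_elim
      case (elim x)
      have "norm (h (v x) (w x)) \<le> norm (v x) * norm (w x) * K" by (rule K)
      also have "\<dots> \<le> C * D * K" using elim C D K by (intro mult_right_mono mult_mono) auto
      finally show ?case .
    qed
  qed
qed

lemma Linf_mult:
  assumes v: "v \<in> Linf M" and w: "w \<in> Linf M"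
  shows "(\<lambda>x. v x * w x :: real) \<in> Linf M"
  by (rule Linf_bilinear[OF bounded_bilinear_mult _ v w])
    (use Linf_measurable[OF v] Linf_measurable[OF w] in measurable)

lemma Linf_scaleR:
  assumes v: "v \<in> Linf M" and w: "w \<in> Linf M"
  shows "(\<lambda>x. v x *\<^sub>R w x) \<in> Linf M"
  by (rule Linf_bilinear[OF bounded_bilinear_scaleR _ v w])
    (use Linf_measurable[OF v] Linf_measurable[OF w] in measurable)

lemma Linf_inner:
  assumes v: "v \<in> Linf M" and w: "w \<in> Linf M"
  shows "(\<lambda>x. v x \<bullet> w x) \<in> Linf M"
  by (rule Linf_bilinear[OF bounded_bilinear_inner _ v w])
    (use Linf_measurable[OF v] Linf_measurable[OF w] in measurable)

lemma Linf_const: "(\<lambda>x. c) \<in> Linf M"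
  by (rule LinfI[of _ _ "norm c"]) auto

lemma Linf_cmult: "v \<in> Linf M \<Longrightarrow> (\<lambda>x. c * v x :: real) \<in> Linf M"
  by (rule Linf_mult[OF Linf_const])

lemma integrable_mult_Linf:
  fixes f :: "'a::euclidean_space \<Rightarrow> real"
  assumes f: "integrable M f" and g: "g \<in> Linf M"
  shows "integrable M (\<lambda>x. f x * g x)"
proof -
  obtain C where C: "0 \<le> C" "AE x in M. norm (g x) \<le> C" "g \<in> borel_measurable M" by (rule LinfE[OF g])
  have fm: "f \<in> borel_measurable M" using f by simp
  show ?thesis
  proof (rule Bochner_Integration.integrable_bound)
    show "integrable M (\<lambda>x. C * f x)" using f by simp
    show "AE x in M. norm (f x * g x) \<le> norm (C * f x)"
      using C(2)
    proof eventually_elim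
      case (elim x)
      have "\<bar>f x\<bar> * \<bar>g x\<bar> \<le> \<bar>f x\<bar> * C" by (rule mult_left_mono) (use elim in auto)
      then show ?case using C(1) by (simp add: abs_mult mult.commute)
    qed
  qed (use C fm in measurable)
qed

text \<open>One compact set and one bound for all \<open>G n\<close> and their gradients make
  dominated convergence applicable to both sides of the divergence identity. Convergence of the
  gradients is asked only along \<open>v\<close>.\<close>

definition wder_seq :: "'a::euclidean_space measure \<Rightarrow> ('a \<Rightarrow> 'a) \<Rightarrow> ('a \<Rightarrow> real) \<Rightarrow> ('a \<Rightarrow> real) \<Rightarrow>
    (nat \<Rightarrow> 'a \<Rightarrow> real) \<Rightarrow> 'a set \<Rightarrow> real \<Rightarrow> bool" where
  "wder_seq M v f h G K C \<longleftrightarrow> h \<in> borel_measurable M \<and> compact K \<and> 0 \<le> C \<and>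
     (\<forall>n. G n \<in> Cinf_c) \<and> (\<forall>n x. x \<notin> K \<longrightarrow> G n x = 0) \<and> (\<forall>n x. \<bar>G n x\<bar> \<le> C) \<and>
     (\<forall>n x. norm (grad (G n) x) \<le> C) \<and> (\<forall>x. (\<lambda>n. G n x) \<longlonglongrightarrow> f x) \<and>
     (AE x in M. (\<lambda>n. grad (G n) x \<bullet> v x) \<longlonglongrightarrow> h x)"

text \<open>The derivative \<open>h\<close> of \<open>f\<close> in the direction \<open>v\<close> as an a.e. limit of derivatives of
  smooth functions; the divergence of \<open>v\<close> makes it unique.\<close>

definition wder :: "'a::euclidean_space measure \<Rightarrow> ('a \<Rightarrow> 'a) \<Rightarrow> ('a \<Rightarrow> real) \<Rightarrow> ('a \<Rightarrow> real) \<Rightarrow> bool" where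
  "wder M v f h \<longleftrightarrow> (\<exists>G K C. wder_seq M v f h G K C)"

lemma wder_seq_grad_0: "wder_seq M v f h G K C \<Longrightarrow> x \<notin> K \<Longrightarrow> grad (G n) x = 0"
  unfolding wder_seq_def by (intro grad_outside_support[of K]) (auto simp: compact_imp_closed)

section \<open>Divergence and directional derivatives over a Radon measure\<close>

locale radon =
  fixes M :: "'a::euclidean_space measure"
  assumes radon: "radon_measure M"
begin

lemmas sets_M = radon_sets[OF radon]
lemmas space_M = radon_space[OF radon]
lemmas meas_M = radon_measurable[OF radon]

lemma continuous_measurable: "continuous_on UNIV f \<Longrightarrow> f \<in> borel_measurable M"
  unfolding meas_M by (rule borel_measurable_continuous_onI)

lemma Cinf_c_measurable [measurable (raw)]: "\<phi> \<in> Cinf_c \<Longrightarrow> \<phi> \<in> borel_measurable M"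
  by (rule continuous_measurable[OF Cinf_c_continuous])

lemma grad_measurable [measurable (raw)]: "\<phi> \<in> Cinf_c \<Longrightarrow> grad \<phi> \<in> borel_measurable M"
  by (rule continuous_measurable[OF Cinf_c_grad_continuous])

lemma LIP_c_measurable [measurable (raw)]: "\<phi> \<in> LIP_c \<Longrightarrow> \<phi> \<in> borel_measurable M"
  by (rule continuous_measurable[OF LIP_c_continuous])

lemma LIP_c_Linf:
  assumes "f \<in> LIP_c" shows "f \<in> Linf M"
proof -
  obtain B where "\<And>x. \<bar>f x\<bar> \<le> B" by (rule LIP_cE[OF assms], rule that)
  then show ?thesis by (intro LinfI[of _ _ B] LIP_c_measurable assms) auto
qed

lemma grad_Linf:
  assumes "f \<in> Cinf_c" shows "grad f \<in> Linf M"
proof -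
  obtain B where "\<And>x. norm (grad f x) \<le> B" by (rule Cinf_c_bounded[OF assms], rule that)
  then show ?thesis by (intro LinfI[of _ _ B] grad_measurable assms) auto
qed

lemma Linf_integrable:
  assumes h: "h \<in> Linf M" and K: "compact K" "\<And>x. x \<notin> K \<Longrightarrow> h x = 0"
  shows "integrable M h"
proof -
  obtain B where B: "AE x in M. norm (h x) \<le> B" "h \<in> borel_measurable M" by (rule LinfE[OF h])
  show ?thesis by (rule integrable_compact_support[OF radon B(2) K B(1)])
qed

lemma LIP_c_integrable:
  assumes "f \<in> LIP_c" shows "integrable M f"
proof -
  obtain K where "compact K" "\<And>x. x \<notin> K \<Longrightarrow> f x = 0" by (rule LIP_cE[OF assms], rule that)
  then show ?thesis by (rule Linf_integrable[OF LIP_c_Linf[OF assms]])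
qed

lemma grad_integrable:
  assumes "f \<in> Cinf_c" shows "integrable M (grad f)"
proof -
  obtain K where "compact K" "\<And>x. x \<notin> K \<Longrightarrow> grad f x = 0" by (rule Cinf_c_bounded[OF assms], rule that)
  then show ?thesis by (rule Linf_integrable[OF grad_Linf[OF assms]])
qed

lemma integrable_LIP_c_mult: "f \<in> LIP_c \<Longrightarrow> g \<in> Linf M \<Longrightarrow> integrable M (\<lambda>x. f x * g x)"
  by (rule integrable_mult_Linf[OF LIP_c_integrable])

lemma integrable_grad_inner:
  assumes "f \<in> Cinf_c" "v \<in> Linf M" shows "integrable M (\<lambda>x. grad f x \<bullet> v x)"
proof -
  obtain K where "compact K" "\<And>x. x \<notin> K \<Longrightarrow> grad f x = 0" by (rule Cinf_c_bounded[OF assms(1)], rule that)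
  then show ?thesis by (intro Linf_integrable[OF Linf_inner[OF grad_Linf[OF assms(1)] assms(2)]]) auto
qed

lemma is_divD:
  "is_div M v g \<Longrightarrow> \<phi> \<in> Cinf_c \<Longrightarrow> (LINT x|M. grad \<phi> x \<bullet> v x) = - (LINT x|M. \<phi> x * g x)"
  by (simp add: is_div_def)

lemma div_field: "v \<in> D_inf M \<Longrightarrow> is_div M v (div_field M v)"
  using someI_ex[of "is_div M v"] by (auto simp: div_field_def D_inf_def)

lemma D_infI: "v \<in> Linf M \<Longrightarrow> is_div M v g \<Longrightarrow> v \<in> D_inf M"
  by (auto simp: D_inf_def)

lemma D_inf_Linf: "v \<in> D_inf M \<Longrightarrow> v \<in> Linf M"
  by (simp add: D_inf_def)

lemma AE_eq_of_smooth_tests: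
  assumes g: "g \<in> Linf M" and h: "h \<in> Linf M"
    and eq: "\<And>\<phi>. \<phi> \<in> Cinf_c \<Longrightarrow> (LINT x|M. \<phi> x * g x) = (LINT x|M. \<phi> x * h x)"
  shows "AE x in M. g x = (h x :: real)"
proof -
  have d: "(\<lambda>x. g x + -1 * h x) \<in> Linf M" by (intro Linf_add Linf_cmult g h)
  obtain C where C: "AE x in M. norm (g x + -1 * h x) \<le> C" by (rule LinfE[OF d])
  have "AE x in M. x \<in> UNIV \<longrightarrow> g x + -1 * h x = 0"
  proof (rule zero_of_smooth_tests[OF radon Linf_measurable[OF d] _ open_UNIV])
    fix \<phi> :: "'a \<Rightarrow> real" assume \<phi>: "\<phi> \<in> Cinf_c"
    note i = integrable_LIP_c_mult[OF Cinf_c_LIP_c[OF \<phi>]]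
    have "(LINT x|M. \<phi> x * (g x + -1 * h x)) = (LINT x|M. \<phi> x * g x - \<phi> x * h x)"
      by (simp add: right_diff_distrib)
    also have "\<dots> = 0" using eq[OF \<phi>] by (simp add: i g h)
    finally show "(LINT x|M. \<phi> x * (g x + -1 * h x)) = 0" .
  qed (use C in simp)
  then show ?thesis by eventually_elim simp
qed

lemma is_div_unique: "is_div M v g \<Longrightarrow> is_div M v h \<Longrightarrow> AE x in M. g x = h x"
  by (rule AE_eq_of_smooth_tests) (auto simp: is_div_def)

lemma is_div_add:
  assumes "v \<in> Linf M" "w \<in> Linf M" and g: "is_div M v g" and h: "is_div M w h"
  shows "is_div M (\<lambda>x. v x + w x) (\<lambda>x. g x + h x)"
  unfolding is_div_def
proof (intro conjI ballI)
  fix \<phi> :: "'a \<Rightarrow> real" assume \<phi>: "\<phi> \<in> Cinf_c"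
  note i = integrable_LIP_c_mult[OF Cinf_c_LIP_c[OF \<phi>]]
  show "(LINT x|M. grad \<phi> x \<bullet> (v x + w x)) = - (LINT x|M. \<phi> x * (g x + h x))"
    using is_divD[OF g \<phi>] is_divD[OF h \<phi>]
    by (simp add: inner_add_right distrib_left integrable_grad_inner[OF \<phi>] assms i is_div_Linf[OF g] is_div_Linf[OF h])
qed (use g h in \<open>auto intro: Linf_add is_div_Linf\<close>)

lemma is_div_scale:
  assumes "is_div M v g"
  shows "is_div M (\<lambda>x. c *\<^sub>R v x) (\<lambda>x. c * g x)"
  using assms unfolding is_div_def
  by (simp add: Linf_cmult mult.left_commute)

text \<open>Product rule for the divergence, obtained by testing \<open>v\<close> with the product
  of \<open>\<phi>\<close> and \<open>\<psi>\<close>.\<close>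

lemma is_div_mult:
  assumes v: "v \<in> Linf M" and g: "is_div M v g" and \<psi>: "\<psi> \<in> Cinf_c"
  shows "is_div M (\<lambda>x. \<psi> x *\<^sub>R v x) (\<lambda>x. \<psi> x * g x + grad \<psi> x \<bullet> v x)"
  unfolding is_div_def
proof (intro conjI ballI)
  note l = LIP_c_Linf[OF Cinf_c_LIP_c[OF \<psi>]]
  note l1 = Linf_mult[OF l is_div_Linf[OF g]] and l2 = Linf_inner[OF grad_Linf[OF \<psi>] v]
  show "(\<lambda>x. \<psi> x * g x + grad \<psi> x \<bullet> v x) \<in> Linf M"
    by (rule Linf_add[OF l1 l2])
  fix \<phi> :: "'a \<Rightarrow> real" assume \<phi>: "\<phi> \<in> Cinf_c"
  note i = integrable_LIP_c_mult[OF Cinf_c_LIP_c[OF \<phi>]]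
  have p: "(\<lambda>x. \<phi> x * \<psi> x) \<in> Cinf_c" by (rule Cinf_c_mult[OF \<phi> Cinf_c_Cinf[OF \<psi>]])
  have gr: "grad (\<lambda>x. \<phi> x * \<psi> x) x = \<phi> x *\<^sub>R grad \<psi> x + \<psi> x *\<^sub>R grad \<phi> x" for x
    by (rule grad_mult) (use \<phi> \<psi> Cinf_c_differentiable in auto)
  have i3: "integrable M (\<lambda>x. grad \<phi> x \<bullet> (\<psi> x *\<^sub>R v x))"
    by (rule integrable_grad_inner[OF \<phi> Linf_scaleR[OF l v]])
  have "(LINT x|M. \<phi> x * (grad \<psi> x \<bullet> v x) + grad \<phi> x \<bullet> (\<psi> x *\<^sub>R v x)) = - (LINT x|M. \<phi> x * (\<psi> x * g x))"
    using is_divD[OF g p] by (simp add: gr inner_add_left mult.assoc)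
  then show "(LINT x|M. grad \<phi> x \<bullet> (\<psi> x *\<^sub>R v x)) = - (LINT x|M. \<phi> x * (\<psi> x * g x + grad \<psi> x \<bullet> v x))"
    unfolding distrib_left
    by (simp only: Bochner_Integration.integral_add[OF i[OF l2] i3] Bochner_Integration.integral_add[OF i[OF l1] i[OF l2]])
qed

text \<open>A test function supported in \<open>U\<close> has its gradient supported there too,
  where \<open>v\<close> vanishes. For fields supported inside \<open>\<Omega>\<close> this allows
  integrals over \<open>\<Omega>\<close> to be exchanged with integrals over the whole
  space.\<close>

lemma is_div_local:
  assumes g: "is_div M v g" and U: "open U" "AE x in M. x \<in> U \<longrightarrow> v x = 0"
  shows "AE x in M. x \<in> U \<longrightarrow> g x = 0"
proof -
  obtain C where C: "AE x in M. norm (g x) \<le> C" "g \<in> borel_measurable M"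
    by (rule LinfE[OF is_div_Linf[OF g]])
  show ?thesis
  proof (rule zero_of_smooth_tests[OF radon C(2) _ U(1)])
    fix \<phi> :: "'a \<Rightarrow> real" and K assume \<phi>: "\<phi> \<in> Cinf_c" and K: "compact K" "K \<subseteq> U" "\<And>x. x \<notin> K \<Longrightarrow> \<phi> x = 0"
    have "AE x in M. grad \<phi> x \<bullet> v x = 0"
      using U(2)
    proof eventually_elim
      case (elim x)
      show ?case
        by (cases "x \<in> K") (use elim K grad_outside_support[of K \<phi> x] in \<open>auto simp: compact_imp_closed\<close>)
    qed
    then have "(LINT x|M. grad \<phi> x \<bullet> v x) = 0" by (rule integral_eq_zero_AE)
    then show "(LINT x|M. \<phi> x * g x) = 0" using is_divD[OF g \<phi>] by simp
  qed (use C in simp)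
qed

lemma ess_supp_closed: "closed (ess_supp M v)"
  unfolding ess_supp_def by (intro closed_Compl open_Union) auto

text \<open>The complement of the support is a possibly uncountable union of open sets; by
  Lindelof's theorem countably many suffice, and their exceptional sets unite to a null set.\<close>

lemma AE_ess_supp: "AE x in M. x \<notin> ess_supp M v \<longrightarrow> v x = 0"
proof -
  let ?F = "{U. open U \<and> (AE x in M. x \<in> U \<longrightarrow> v x = 0)}"
  obtain F' where F': "F' \<subseteq> ?F" "countable F'" "\<Union>F' = \<Union>?F"
    by (rule Lindelof[of ?F]) auto
  have "AE x in M. \<forall>U\<in>F'. x \<in> U \<longrightarrow> v x = 0"
    by (subst AE_ball_countable[OF F'(2)]) (use F'(1) in auto)
  then show ?thesis
    by eventually_elim (use F'(3) in \<open>auto simp: ess_supp_def\<close>)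
qed

lemma ess_supp_subset: "closed C \<Longrightarrow> AE x in M. x \<notin> C \<longrightarrow> v x = 0 \<Longrightarrow> ess_supp M v \<subseteq> C"
  unfolding ess_supp_def by (auto intro!: exI[of _ "- C"] open_Compl)

lemma compactly_inside_ess_supp:
  "ess_supp M v \<Subset> \<Omega> \<longleftrightarrow> compact (ess_supp M v) \<and> ess_supp M v \<subseteq> \<Omega>"
  by (simp add: compactly_inside_def closure_closed[OF ess_supp_closed])

lemma compactly_insideI:
  assumes "compact C" "C \<subseteq> \<Omega>" "AE x in M. x \<notin> C \<longrightarrow> v x = 0"
  shows "ess_supp M v \<Subset> \<Omega>"
proof -
  have "ess_supp M v \<subseteq> C" using assms by (intro ess_supp_subset compact_imp_closed)
  moreover from this have "compact (ess_supp M v)"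
    using assms(1) ess_supp_closed compact_Int_closed by (metis inf.absorb_iff2)
  ultimately show ?thesis using assms(2) by (auto simp: compactly_inside_ess_supp)
qed

text \<open>Mollifications of \<open>f\<close> are differentiated along \<open>v\<close>, and convex
  combinations of the results converge a.e. The pointwise bound survives because the gradient at
  \<open>x\<close> of a fine mollification depends only on \<open>f\<close> near
  \<open>x\<close>.\<close>

lemma wder_exists:
  assumes v: "v \<in> Linf M" and f: "f \<in> LIP_c"
  obtains h where "wder M v f h" "AE x in M. ennreal \<bar>h x\<bar> \<le> ennreal (norm (v x)) * lip_a f x"
proof -
  obtain L K B where f': "0 \<le> L" "\<And>y z. \<bar>f y - f z\<bar> \<le> L * dist y z" "compact K"
    "\<And>x. x \<notin> K \<Longrightarrow> f x = 0" "0 \<le> B" "\<And>x. \<bar>f x\<bar> \<le> B"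
    by (rule LIP_cE[OF f], rule that)
  obtain Cv where Cv: "0 \<le> Cv" "AE x in M. norm (v x) \<le> Cv" and [measurable]: "v \<in> borel_measurable M"
    by (rule LinfE[OF v])
  define e where "e k = 1 / real (Suc k)" for k
  have e: "0 < e k" "e k \<le> 1" for k by (simp_all add: e_def)
  have e0: "e \<longlonglongrightarrow> 0" unfolding e_def by (rule lim_1_over_n[THEN LIMSEQ_Suc])
  have "\<exists>F. F \<in> Cinf_c \<and>
    (\<forall>x a. (\<forall>y. y \<in> cball x (e k) \<longrightarrow> f y \<le> a) \<longrightarrow> F x \<le> a) \<and>
    (\<forall>x a. (\<forall>y. y \<in> cball x (e k) \<longrightarrow> a \<le> f y) \<longrightarrow> a \<le> F x) \<and>
    (\<forall>x r L. e k < r \<longrightarrow> 0 \<le> L \<longrightarrow> (\<forall>y z. y \<in> ball x r \<longrightarrow> z \<in> ball x r \<longrightarrow> \<bar>f y - f z\<bar> \<le> L * dist y z)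
       \<longrightarrow> norm (grad F x) \<le> L)" for k
    by (rule mollification[OF LIP_c_continuous[OF f] f'(3,4) e(1)[of k]]) blast+
  then obtain F where F: "\<And>k. F k \<in> Cinf_c"
    "\<And>k x a. (\<And>y. y \<in> cball x (e k) \<Longrightarrow> f y \<le> a) \<Longrightarrow> F k x \<le> a"
    "\<And>k x a. (\<And>y. y \<in> cball x (e k) \<Longrightarrow> a \<le> f y) \<Longrightarrow> a \<le> F k x"
    "\<And>k x r L. e k < r \<Longrightarrow> 0 \<le> L \<Longrightarrow> (\<And>y z. y \<in> ball x r \<Longrightarrow> z \<in> ball x r \<Longrightarrow> \<bar>f y - f z\<bar> \<le> L * dist y z)
       \<Longrightarrow> norm (grad (F k) x) \<le> L"
    by metis
  have F_grad: "norm (grad (F k) x) \<le> L" for k x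
    by (rule F(4)[of k "e k + 1"]) (use f' in auto)
  have F_bd: "\<bar>F k x\<bar> \<le> B" for k x
  proof -
    have B: "- B \<le> f y" "f y \<le> B" for y using f'(6)[of y] by linarith+
    have "F k x \<le> B" "- B \<le> F k x" by (rule F(2), rule B, rule F(3), rule B)
    then show ?thesis by linarith
  qed
  have F_close: "\<bar>F k x - f x\<bar> \<le> L * e k" for k x
  proof -
    have *: "\<bar>f y - f x\<bar> \<le> L * e k" if "y \<in> cball x (e k)" for y
      using f'(2)[of y x] mult_left_mono[of "dist y x" "e k" L] that f'(1) by (auto simp: dist_commute)
    have "F k x \<le> f x + L * e k" by (rule F(2)) (use * in \<open>force simp: abs_le_iff\<close>)
    moreover have "f x - L * e k \<le> F k x" by (rule F(3)) (use * in \<open>force simp: abs_le_iff\<close>)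
    ultimately show ?thesis by linarith
  qed
  have F_lim: "(\<lambda>k. F k x) \<longlonglongrightarrow> f x" for x
  proof -
    have "(\<lambda>k. L * e k) \<longlonglongrightarrow> L * 0" by (intro tendsto_mult tendsto_const e0)
    then have "(\<lambda>k. F k x - f x) \<longlonglongrightarrow> 0"
      using F_close by (intro Lim_null_comparison[of "\<lambda>k. F k x - f x" "\<lambda>k. L * e k"]) auto
    then show ?thesis by (simp add: LIM_zero_iff)
  qed
  obtain R where R: "\<And>x. x \<in> K \<Longrightarrow> norm x \<le> R"
    using compact_imp_bounded[OF f'(3)] by (auto simp: bounded_iff)
  \<comment> \<open>Since \<open>e k \<le> 1\<close>, all mollifications vanish outside one ball, as
    \<open>wder_seq\<close> demands.\<close>
  have F_0: "F k x = 0" if x: "x \<notin> cball 0 (R + 1)" for k x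
  proof -
    have "f y = 0" if y: "y \<in> cball x (e k)" for y
    proof (rule f'(4), rule notI)
      assume "y \<in> K"
      then show False
        using R[of y] norm_triangle_sub[of x y] x y e[of k] by (auto simp: dist_norm)
    qed
    then show ?thesis using F(2)[of x k 0] F(3)[of x k 0] by force
  qed
  define u where "u k x = grad (F k) x \<bullet> v x" for k x
  have [measurable]: "u k \<in> borel_measurable M" for k
    unfolding u_def using grad_measurable[OF F(1)[of k]] by measurable
  have u_bd: "AE x in M. norm (u k x) \<le> L * Cv" for k
    using Cv(2)
  proof eventually_elim
    case (elim x)
    have "norm (u k x) \<le> norm (grad (F k) x) * norm (v x)"
      unfolding u_def real_norm_def by (rule Cauchy_Schwarz_ineq2)
    also have "\<dots> \<le> L * Cv" using F_grad[of k x] elim f' by (intro mult_mono) auto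
    finally show ?case .
  qed
  obtain m c h where c: "\<And>n k. 0 \<le> c n k" "\<And>n k. k < n \<Longrightarrow> c n k = 0" "\<And>n. (\<Sum>k\<le>m n. c n k) = (1::real)"
    and h: "h \<in> borel_measurable M" "AE x in M. (\<lambda>n. \<Sum>k\<le>m n. c n k *\<^sub>R u k x) \<longlonglongrightarrow> h x"
    by (rule radon_convex_combinations_converge[OF radon, of u "L * Cv"]) (use u_bd in auto)
  define G where "G n x = (\<Sum>k\<le>m n. c n k * F k x)" for n x
  have gradG: "grad (G n) x = (\<Sum>k\<le>m n. c n k *\<^sub>R grad (F k) x)" for n x
    unfolding G_def
    by (subst grad_sum) (auto intro!: Cinf_c_differentiable Cinf_c_cmult F sum.cong grad_cmult)
  have "wder_seq M v f h G (cball 0 (R + 1)) (max B L)"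
    unfolding wder_seq_def
  proof (intro conjI allI impI)
    fix n x
    show "G n \<in> Cinf_c"
      unfolding G_def by (intro Cinf_c_sum Cinf_c_cmult F) auto
    show "x \<notin> cball 0 (R + 1) \<Longrightarrow> G n x = 0" by (simp add: G_def F_0)
    have "norm (\<Sum>k\<le>m n. c n k *\<^sub>R F k x) \<le> B"
      by (rule convex_tail_norm_le[of "c n" n]) (use c F_bd in auto)
    then show "\<bar>G n x\<bar> \<le> max B L" by (simp add: G_def)
    have "norm (\<Sum>k\<le>m n. c n k *\<^sub>R grad (F k) x) \<le> L"
      by (rule convex_tail_norm_le[of "c n" n]) (use c F_grad in auto)
    then show "norm (grad (G n) x) \<le> max B L" by (simp add: gradG)
    show "(\<lambda>n. G n x) \<longlonglongrightarrow> f x"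
      using convex_tail_tendsto[of c m, OF c F_lim] by (simp add: G_def)
    show "AE x in M. (\<lambda>n. grad (G n) x \<bullet> v x) \<longlonglongrightarrow> h x"
      using h(2) by (simp add: gradG u_def inner_sum_left)
  qed (use h f' in auto)
  moreover have "AE x in M. ennreal \<bar>h x\<bar> \<le> ennreal (norm (v x)) * lip_a f x"
    using h(2)
  proof eventually_elim
    case (elim x)
    obtain l where l: "lip_a f x = ennreal l" "0 \<le> l"
      using lip_a_finite[OF f, of x] by (cases "lip_a f x") auto
    \<comment> \<open>For \<open>L'\<close> above \<open>lip_a f x\<close> the function is
      \<open>L'\<close>-Lipschitz on some ball around \<open>x\<close>. Mollifications at smaller
      scale, and hence combinations of a late tail, have gradient at most \<open>L'\<close> at
      \<open>x\<close>.\<close>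
    have *: "\<bar>h x\<bar> \<le> norm (v x) * L'" if L': "l < L'" for L'
    proof -
      obtain r where r: "0 < r" "\<And>y z. y \<in> ball x r \<Longrightarrow> z \<in> ball x r \<Longrightarrow> \<bar>f y - f z\<bar> \<le> L' * dist y z"
        using lip_a_lessD[of f x L'] L' l by (auto simp: ennreal_less_iff)
      have "\<forall>\<^sub>F k in sequentially. e k < r" by (rule order_tendstoD(2)[OF e0 r(1)])
      then obtain N where N: "\<And>k. k \<ge> N \<Longrightarrow> e k < r" by (auto simp: eventually_sequentially)
      have u: "norm (u k x) \<le> norm (v x) * L'" if "k \<ge> N" for k
      proof -
        have "norm (grad (F k) x) \<le> L'" by (rule F(4)[OF N[OF that]]) (use r L' l in auto)
        then have "norm (grad (F k) x) * norm (v x) \<le> L' * norm (v x)" by (rule mult_right_mono) simp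
        then show ?thesis
          using Cauchy_Schwarz_ineq2[of "grad (F k) x" "v x"] by (simp add: u_def mult.commute)
      qed
      have "norm (\<Sum>k\<le>m n. c n k *\<^sub>R u k x) \<le> norm (v x) * L'" if "n \<ge> N" for n
        by (rule convex_tail_norm_le[of "c n" n]) (use c u that in auto)
      then have "\<forall>\<^sub>F n in sequentially. norm (\<Sum>k\<le>m n. c n k *\<^sub>R u k x) \<le> norm (v x) * L'"
        by (auto simp: eventually_sequentially)
      then have "norm (h x) \<le> norm (v x) * L'"
        by (intro tendsto_upperbound[OF tendsto_norm[OF elim]]) auto
      then show ?thesis by simp
    qed
    have "\<bar>h x\<bar> \<le> norm (v x) * l"
    proof (rule field_le_epsilon)
      fix d :: real assume d: "0 < d"
      \<comment> \<open>The slack \<open>d\<close> is divided by \<open>norm (v x) + 1\<close>,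
        since \<open>v x\<close> may be \<open>0\<close>.\<close>
      have pos: "0 < norm (v x) + 1" by (simp add: add_nonneg_pos)
      have "\<bar>h x\<bar> \<le> norm (v x) * (l + d / (norm (v x) + 1))"
        by (rule *) (use d pos in simp)
      also have "\<dots> \<le> norm (v x) * l + d"
        using d pos by (simp add: distrib_left divide_le_eq mult.commute)
      finally show "\<bar>h x\<bar> \<le> norm (v x) * l + d" .
    qed
    then show ?case using l by (simp add: ennreal_leI flip: ennreal_mult)
  qed
  ultimately show ?thesis by (intro that) (auto simp: wder_def)
qed

lemma wder_properties:
  assumes v: "v \<in> Linf M" and w: "wder M v f h"
  obtains K where "compact K" "\<And>x. x \<notin> K \<Longrightarrow> f x = 0" "AE x in M. x \<notin> K \<longrightarrow> h x = 0"
    "f \<in> Linf M" "h \<in> Linf M"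
proof -
  obtain G K C where s: "wder_seq M v f h G K C" using w by (auto simp: wder_def)
  then have G: "\<And>n. G n \<in> Cinf_c" "\<And>n x. x \<notin> K \<Longrightarrow> G n x = 0" "\<And>n x. \<bar>G n x\<bar> \<le> C"
    "\<And>n x. norm (grad (G n) x) \<le> C" "\<And>x. (\<lambda>n. G n x) \<longlonglongrightarrow> f x" and C: "0 \<le> C" "compact K"
    and h: "h \<in> borel_measurable M" "AE x in M. (\<lambda>n. grad (G n) x \<bullet> v x) \<longlonglongrightarrow> h x"
    by (auto simp: wder_seq_def)
  obtain Cv where Cv: "0 \<le> Cv" "AE x in M. norm (v x) \<le> Cv" by (rule LinfE[OF v])
  show ?thesis
  proof (rule that[of K])
    show "compact K" by fact
    show "f x = 0" if "x \<notin> K" for x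
      using G(5)[of x] G(2)[OF that] by (simp add: LIMSEQ_const_iff)
    show "AE x in M. x \<notin> K \<longrightarrow> h x = 0"
      using h(2) by eventually_elim (auto simp: wder_seq_grad_0[OF s] LIMSEQ_const_iff)
    have "f \<in> borel_measurable M"
      by (rule borel_measurable_LIMSEQ_metric[of G]) (use G in \<open>auto intro: Cinf_c_measurable\<close>)
    moreover have "\<bar>f x\<bar> \<le> C" for x
      by (rule tendsto_upperbound[OF tendsto_rabs[OF G(5)]]) (use G in auto)
    ultimately show "f \<in> Linf M" by (intro LinfI[of _ _ C]) auto
    show "h \<in> Linf M"
    proof (rule LinfI[OF h(1)])
      show "AE x in M. norm (h x) \<le> C * Cv"
        using h(2) Cv(2)
      proof eventually_elim
        case (elim x)
        have "norm (grad (G n) x \<bullet> v x) \<le> C * Cv" for n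
          using Cauchy_Schwarz_ineq2[of "grad (G n) x" "v x"] mult_mono[OF G(4)[of n x] elim(2)] C by simp
        then show ?case by (intro tendsto_upperbound[OF tendsto_norm[OF elim(1)]]) auto
      qed
    qed
  qed
qed

text \<open>Each \<open>G n\<close> satisfies the divergence identity, and both sides pass to the
  limit with a multiple of the indicator of \<open>K\<close> as dominating function.\<close>

lemma integral_wder:
  assumes v: "v \<in> Linf M" and g: "is_div M v g" and w: "wder M v f h"
  shows "(LINT x|M. h x) = - (LINT x|M. f x * g x)"
proof -
  obtain G K C where s: "wder_seq M v f h G K C" using w by (auto simp: wder_def)
  then have G: "\<And>n. G n \<in> Cinf_c" "\<And>n x. x \<notin> K \<Longrightarrow> G n x = 0" "\<And>n x. \<bar>G n x\<bar> \<le> C"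
    "\<And>n x. norm (grad (G n) x) \<le> C" "\<And>x. (\<lambda>n. G n x) \<longlonglongrightarrow> f x" and C: "0 \<le> C" "compact K"
    and h: "h \<in> borel_measurable M" "AE x in M. (\<lambda>n. grad (G n) x \<bullet> v x) \<longlonglongrightarrow> h x"
    by (auto simp: wder_seq_def)
  obtain Cv where Cv: "0 \<le> Cv" "AE x in M. norm (v x) \<le> Cv" and [measurable]: "v \<in> borel_measurable M"
    by (rule LinfE[OF v])
  obtain Cg where Cg: "0 \<le> Cg" "AE x in M. norm (g x) \<le> Cg" and [measurable]: "g \<in> borel_measurable M"
    by (rule LinfE[OF is_div_Linf[OF g]])
  have KM: "K \<in> sets M" using C by (simp add: sets_M compact_imp_closed)
  have dom: "integrable M (\<lambda>x. indicator K x * D)" for D :: real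
    by (rule Linf_integrable[OF _ C(2)])
      (use KM in \<open>auto intro!: LinfI[of _ _ "\<bar>D\<bar>"] borel_measurable_times borel_measurable_indicator simp: indicator_def\<close>)
  have fm: "f \<in> borel_measurable M"
    by (rule borel_measurable_LIMSEQ_metric[of G]) (use G in \<open>auto intro: Cinf_c_measurable\<close>)
  have 1: "(\<lambda>n. LINT x|M. grad (G n) x \<bullet> v x) \<longlonglongrightarrow> (LINT x|M. h x)"
  proof (rule integral_dominated_convergence[OF h(1) _ dom h(2)])
    show "(\<lambda>x. grad (G n) x \<bullet> v x) \<in> borel_measurable M" for n
      using grad_measurable[OF G(1)[of n]] by measurable
    show "AE x in M. norm (grad (G n) x \<bullet> v x) \<le> indicator K x * (C * Cv)" for n
      using Cv(2)
    proof eventually_elim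
      case (elim x)
      show ?case
        using Cauchy_Schwarz_ineq2[of "grad (G n) x" "v x"] mult_mono[OF G(4)[of n x] elim] C
        by (cases "x \<in> K") (auto simp: wder_seq_grad_0[OF s])
    qed
  qed
  have 2: "(\<lambda>n. LINT x|M. G n x * g x) \<longlonglongrightarrow> (LINT x|M. f x * g x)"
  proof (rule integral_dominated_convergence[OF _ _ dom])
    show "(\<lambda>x. G n x * g x) \<in> borel_measurable M" for n
      using Cinf_c_measurable[OF G(1)[of n]] by measurable
    show "(\<lambda>x. f x * g x) \<in> borel_measurable M" using fm by measurable
    show "AE x in M. (\<lambda>n. G n x * g x) \<longlonglongrightarrow> f x * g x"
      by (intro AE_I2 tendsto_mult G tendsto_const)
    show "AE x in M. norm (G n x * g x) \<le> indicator K x * (C * Cg)" for n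
      using Cg(2)
    proof eventually_elim
      case (elim x)
      show ?case
        using mult_mono[OF G(3)[of n x] elim] C
        by (cases "x \<in> K") (auto simp: G(2) abs_mult)
    qed
  qed
  have "(\<lambda>n. LINT x|M. grad (G n) x \<bullet> v x) \<longlonglongrightarrow> - (LINT x|M. f x * g x)"
    using tendsto_minus[OF 2] by (simp add: is_divD[OF g G(1)])
  then show ?thesis using 1 LIMSEQ_unique by blast
qed

lemma wder_smooth:
  assumes v: "v \<in> Linf M" and \<phi>: "\<phi> \<in> Cinf_c"
  shows "wder M v \<phi> (\<lambda>x. grad \<phi> x \<bullet> v x)"
proof -
  obtain K B where "compact K" "0 \<le> B" "\<And>x. x \<notin> K \<Longrightarrow> \<phi> x = 0" "\<And>x. \<bar>\<phi> x\<bar> \<le> B" "\<And>x. norm (grad \<phi> x) \<le> B"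
    by (rule Cinf_c_bounded[OF \<phi>], rule that)
  then have "wder_seq M v \<phi> (\<lambda>x. grad \<phi> x \<bullet> v x) (\<lambda>_. \<phi>) K B"
    unfolding wder_seq_def using Linf_measurable[OF Linf_inner[OF grad_Linf[OF \<phi>] v]] \<phi> by auto
  then show ?thesis by (auto simp: wder_def)
qed

lemma wder_add:
  assumes "wder M v f h" "wder M v f' h'"
  shows "wder M v (\<lambda>x. f x + f' x) (\<lambda>x. h x + h' x)"
proof -
  obtain G K C G' K' C' where s: "wder_seq M v f h G K C" "wder_seq M v f' h' G' K' C'"
    using assms by (auto simp: wder_def)
  have gr: "grad (\<lambda>x. G n x + G' n x) x = grad (G n) x + grad (G' n) x" for n x
    using s by (intro grad_add Cinf_c_differentiable) (auto simp: wder_seq_def)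
  have "wder_seq M v (\<lambda>x. f x + f' x) (\<lambda>x. h x + h' x) (\<lambda>n x. G n x + G' n x) (K \<union> K') (C + C')"
    unfolding wder_seq_def gr
  proof (intro conjI allI impI)
    show "AE x in M. (\<lambda>n. (grad (G n) x + grad (G' n) x) \<bullet> v x) \<longlonglongrightarrow> h x + h' x"
    proof -
      have "AE x in M. (\<lambda>n. grad (G n) x \<bullet> v x) \<longlonglongrightarrow> h x" "AE x in M. (\<lambda>n. grad (G' n) x \<bullet> v x) \<longlonglongrightarrow> h' x"
        using s by (auto simp: wder_seq_def)
      then show ?thesis
        unfolding inner_add_left by eventually_elim (rule tendsto_add)
    qed
    show "norm (grad (G n) x + grad (G' n) x) \<le> C + C'" for n x
      using s by (intro norm_triangle_mono) (auto simp: wder_seq_def)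
    show "\<bar>G n x + G' n x\<bar> \<le> C + C'" for n x
      using s norm_triangle_mono[of "G n x" C "G' n x" C'] by (auto simp: wder_seq_def)
  qed (use s in \<open>auto simp: wder_seq_def intro: Cinf_c_add tendsto_add compact_Un\<close>)
  then show ?thesis by (auto simp: wder_def)
qed

lemma wder_mult:
  assumes "wder M v f h" "wder M v f' h'"
  shows "wder M v (\<lambda>x. f x * f' x) (\<lambda>x. f x * h' x + f' x * h x)"
proof -
  obtain G K C G' K' C' where s: "wder_seq M v f h G K C" "wder_seq M v f' h' G' K' C'"
    using assms by (auto simp: wder_def)
  then have C: "0 \<le> C" "0 \<le> C'" by (auto simp: wder_seq_def)
  have fm: "f \<in> borel_measurable M" "f' \<in> borel_measurable M"
    by (rule borel_measurable_LIMSEQ_metric[of G], use s in \<open>auto simp: wder_seq_def intro: Cinf_c_measurable\<close>)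
      (rule borel_measurable_LIMSEQ_metric[of G'], use s in \<open>auto simp: wder_seq_def intro: Cinf_c_measurable\<close>)
  have hm: "h \<in> borel_measurable M" "h' \<in> borel_measurable M"
    using s by (auto simp: wder_seq_def)
  have gr: "grad (\<lambda>x. G n x * G' n x) x = G n x *\<^sub>R grad (G' n) x + G' n x *\<^sub>R grad (G n) x" for n x
    using s by (intro grad_mult Cinf_c_differentiable) (auto simp: wder_seq_def)
  have "wder_seq M v (\<lambda>x. f x * f' x) (\<lambda>x. f x * h' x + f' x * h x) (\<lambda>n x. G n x * G' n x) K (C * C' + C' * C)"
    unfolding wder_seq_def gr
  proof (intro conjI allI impI)
    show "(\<lambda>x. f x * h' x + f' x * h x) \<in> borel_measurable M"
      using fm hm by measurable
    have "AE x in M. (\<lambda>n. grad (G n) x \<bullet> v x) \<longlonglongrightarrow> h x" "AE x in M. (\<lambda>n. grad (G' n) x \<bullet> v x) \<longlonglongrightarrow> h' x"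
      using s by (auto simp: wder_seq_def)
    then show "AE x in M. (\<lambda>n. (G n x *\<^sub>R grad (G' n) x + G' n x *\<^sub>R grad (G n) x) \<bullet> v x) \<longlonglongrightarrow> f x * h' x + f' x * h x"
    proof eventually_elim
      case (elim x)
      then show ?case
        unfolding inner_add_left inner_scaleR_left using s
        by (intro tendsto_add tendsto_mult) (auto simp: wder_seq_def)
    qed
    show "norm (G n x *\<^sub>R grad (G' n) x + G' n x *\<^sub>R grad (G n) x) \<le> C * C' + C' * C" for n x
      by (rule norm_triangle_mono; unfold norm_scaleR; rule mult_mono)
        (use s C in \<open>auto simp: wder_seq_def\<close>)
    show "\<bar>G n x * G' n x\<bar> \<le> C * C' + C' * C" for n x
    proof -
      have "\<bar>G n x\<bar> * \<bar>G' n x\<bar> \<le> C * C'"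
        by (rule mult_mono) (use s C in \<open>auto simp: wder_seq_def\<close>)
      also have "\<dots> \<le> C * C' + C' * C" using C by simp
      finally show ?thesis by (simp only: abs_mult)
    qed
  qed (use s C in \<open>auto simp: wder_seq_def intro: Cinf_c_mult Cinf_c_Cinf tendsto_mult\<close>)
  then show ?thesis by (auto simp: wder_def)
qed

text \<open>The product rule for \<open>\<phi>\<close> and \<open>f\<close>, combined with
  \<open>integral_wder\<close>. The right-hand side does not mention \<open>h\<close>, so tests
  determine \<open>h\<close> a.e.; here the divergence of \<open>v\<close> yields
  uniqueness.\<close>

lemma integral_test_wder:
  assumes v: "v \<in> Linf M" and g: "is_div M v g" and w: "wder M v f h" and \<phi>: "\<phi> \<in> Cinf_c"
  shows "(LINT x|M. \<phi> x * h x) = - (LINT x|M. \<phi> x * f x * g x) - (LINT x|M. f x * (grad \<phi> x \<bullet> v x))"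
proof -
  note w2 = wder_mult[OF wder_smooth[OF v \<phi>] w]
  obtain K where K: "compact K" "\<And>x. x \<notin> K \<Longrightarrow> f x = 0" "f \<in> Linf M" "h \<in> Linf M"
    by (rule wder_properties[OF v w], rule that)
  have i1: "integrable M (\<lambda>x. \<phi> x * h x)"
    by (rule integrable_LIP_c_mult[OF Cinf_c_LIP_c[OF \<phi>] K(4)])
  have i2: "integrable M (\<lambda>x. f x * (grad \<phi> x \<bullet> v x))"
    using K(1,2) by (intro Linf_integrable[OF Linf_mult[OF K(3) Linf_inner[OF grad_Linf[OF \<phi>] v]] K(1)]) auto
  show ?thesis
    using integral_wder[OF v g w2] by (simp add: i1 i2)
qed

lemma wder_unique:
  assumes v: "v \<in> Linf M" and g: "is_div M v g" and w: "wder M v f h" "wder M v f h'"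
  shows "AE x in M. h x = h' x"
proof (rule AE_eq_of_smooth_tests)
  show "h \<in> Linf M" by (rule wder_properties[OF v w(1)])
  show "h' \<in> Linf M" by (rule wder_properties[OF v w(2)])
qed (simp add: integral_test_wder[OF v g w(1)] integral_test_wder[OF v g w(2)])

end

subsection \<open>The variation as a Borel measure\<close>

lemma outer_ext_open:
  assumes mono: "\<And>A B. open A \<Longrightarrow> open B \<Longrightarrow> A \<subseteq> B \<Longrightarrow> \<phi> A \<le> \<phi> B" and A: "open A"
  shows "outer_ext \<phi> A = \<phi> A"
  unfolding outer_ext_def
  by (intro antisym INF_lower INF_greatest) (use assms in auto)

lemma outer_ext_cong: "(\<And>A. open A \<Longrightarrow> \<phi> A = \<psi> A) \<Longrightarrow> outer_ext \<phi> B = outer_ext \<psi> B"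
  unfolding outer_ext_def by (intro INF_cong) auto

lemma outer_ext_mono: "A \<subseteq> B \<Longrightarrow> outer_ext \<phi> A \<le> outer_ext \<phi> B"
  unfolding outer_ext_def by (intro INF_superset_mono) auto

text \<open>The criterion of De Giorgi and Letta. After Caratheodory's construction it remains to
  see that open sets are measurable, which follows from superadditivity and inner
  approximation.\<close>

lemma measure_space_of_open_sets:
  fixes \<phi> :: "'a::euclidean_space set \<Rightarrow> ennreal"
  assumes empty: "\<phi> {} = 0"
    and mono: "\<And>A B. open A \<Longrightarrow> open B \<Longrightarrow> A \<subseteq> B \<Longrightarrow> \<phi> A \<le> \<phi> B"
    and superadd: "\<And>A B. open A \<Longrightarrow> open B \<Longrightarrow> A \<inter> B = {} \<Longrightarrow> \<phi> A + \<phi> B \<le> \<phi> (A \<union> B)"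
    and subadd: "\<And>A :: nat \<Rightarrow> 'a set. (\<And>n. open (A n)) \<Longrightarrow> \<phi> (\<Union>n. A n) \<le> (\<Sum>n. \<phi> (A n))"
    and inner: "\<And>A. open A \<Longrightarrow> \<phi> A \<le> (SUP V\<in>{V. open V \<and> closure V \<subseteq> A}. \<phi> V)"
  shows "measure_space UNIV (sets borel) (outer_ext \<phi>)"
proof -
  let ?f = "outer_ext \<phi>"
  note eq = outer_ext_open[of \<phi>, OF mono]
  have pos: "positive (Pow UNIV) ?f"
    by (simp add: positive_def eq empty)
  have csub: "countably_subadditive (Pow UNIV) ?f"
    unfolding countably_subadditive_def
  proof (intro allI impI)
    fix A :: "nat \<Rightarrow> 'a set"
    show "?f (\<Union>i. A i) \<le> (\<Sum>i. ?f (A i))"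
    proof (rule ennreal_le_epsilon)
      fix e :: real assume e: "0 < e" and fin: "(\<Sum>i. ?f (A i)) < top"
      have "\<exists>U. open U \<and> A i \<subseteq> U \<and> \<phi> U \<le> ?f (A i) + ennreal (e * (1/2)^Suc i)" for i
      proof -
        have "?f (A i) < top"
          using fin by (rule le_less_trans[OF sum_le_suminf[of "\<lambda>i. ?f (A i)" "{i}", simplified], rotated])
        then have "?f (A i) < ?f (A i) + ennreal (e * (1/2)^Suc i)"
          using e by (simp add: ennreal_less_zero_iff)
        then obtain U where "open U" "A i \<subseteq> U" "\<phi> U < ?f (A i) + ennreal (e * (1/2)^Suc i)"
          unfolding outer_ext_def by (subst (asm) INF_less_iff) blast
        then show ?thesis using less_imp_le by blast
      qed
      then obtain U where U: "\<And>i. open (U i)" "\<And>i. A i \<subseteq> U i"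
        "\<And>i. \<phi> (U i) \<le> ?f (A i) + ennreal (e * (1/2)^Suc i)" by metis
      have "?f (\<Union>i. A i) \<le> \<phi> (\<Union>i. U i)"
        unfolding outer_ext_def by (rule INF_lower) (use U in blast)
      also have "\<dots> \<le> (\<Sum>i. \<phi> (U i))" by (rule subadd) (rule U)
      also have "\<dots> \<le> (\<Sum>i. ?f (A i) + ennreal (e * (1/2)^Suc i))"
        by (intro suminf_le U) auto
      also have "\<dots> = (\<Sum>i. ?f (A i)) + (\<Sum>i. ennreal (e * (1/2)^Suc i))"
        by (rule suminf_add[symmetric]) auto
      also have "(\<Sum>i. ennreal (e * (1/2)^Suc i)) = ennreal e"
      proof -
        have "(\<lambda>i. e * (1/2)^Suc i) sums (e * 1)" by (intro sums_mult power_half_series)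
        then show ?thesis using e by (intro suminf_ennreal_eq) auto
      qed
      finally show "?f (\<Union>i. A i) \<le> (\<Sum>i. ?f (A i)) + ennreal e" .
    qed
  qed
  have oms: "outer_measure_space (Pow UNIV) ?f"
    unfolding outer_measure_space_def increasing_def using pos csub by (auto intro: outer_ext_mono)
  define L where "L = lambda_system UNIV (Pow UNIV) ?f"
  have ms: "measure_space UNIV L ?f"
    unfolding L_def by (rule sigma_algebra.caratheodory_lemma[OF sigma_algebra_Pow oms])
  have "U \<in> L" if U: "open U" for U
    unfolding L_def lambda_system_def
  proof (intro CollectI conjI ballI antisym)
    fix X :: "'a set"
    have "subadditive (Pow UNIV) ?f"
      by (rule ring_of_sets.countably_subadditive_subadditive[OF
            algebra.axioms(1)[OF sigma_algebra.axioms(1)[OF sigma_algebra_Pow]] pos csub])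
    then have "?f ((U \<inter> X) \<union> ((UNIV - U) \<inter> X)) \<le> ?f (U \<inter> X) + ?f ((UNIV - U) \<inter> X)"
      unfolding subadditive_def by (elim ballE[of _ _ "U \<inter> X"] ballE[of _ _ "(UNIV - U) \<inter> X"]) auto
    moreover have "(U \<inter> X) \<union> ((UNIV - U) \<inter> X) = X" by auto
    ultimately show "?f X \<le> ?f (U \<inter> X) + ?f ((UNIV - U) \<inter> X)" by simp
    show "?f (U \<inter> X) + ?f ((UNIV - U) \<inter> X) \<le> ?f X"
    proof (subst (3) outer_ext_def, rule INF_greatest, clarify)
      fix O' assume O': "open O'" "X \<subseteq> O'"
      \<comment> \<open>Superadditivity is about disjoint open sets, so \<open>O' \<inter> U\<close>
        is exhausted by sets \<open>V\<close> whose closure lies inside. Then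
        \<open>O' - closure V\<close> is open, disjoint from \<open>V\<close> and covers the part of
        \<open>X\<close> outside \<open>U\<close>.\<close>
      let ?S = "{V. open V \<and> closure V \<subseteq> O' \<inter> U}"
      have "?f (U \<inter> X) + ?f ((UNIV - U) \<inter> X) \<le> (SUP V\<in>?S. \<phi> V) + ?f ((UNIV - U) \<inter> X)"
      proof (rule add_right_mono)
        have "?f (U \<inter> X) \<le> \<phi> (O' \<inter> U)"
          unfolding outer_ext_def by (rule INF_lower) (use O' U in auto)
        also have "\<dots> \<le> (SUP V\<in>?S. \<phi> V)" by (rule inner) (use O' U in auto)
        finally show "?f (U \<inter> X) \<le> (SUP V\<in>?S. \<phi> V)" .
      qed
      also have "\<dots> = (SUP V\<in>?S. \<phi> V + ?f ((UNIV - U) \<inter> X))"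
        by (rule ennreal_SUP_add_left[symmetric]) (auto intro!: exI[of _ "{}"])
      also have "\<dots> \<le> \<phi> O'"
      proof (rule SUP_least, clarify)
        fix V assume V: "open V" "closure V \<subseteq> O' \<inter> U"
        have op: "open (O' - closure V)" using O' by (intro open_Diff) auto
        have "?f ((UNIV - U) \<inter> X) \<le> \<phi> (O' - closure V)"
          unfolding outer_ext_def by (rule INF_lower) (use O' V op in auto)
        then have "\<phi> V + ?f ((UNIV - U) \<inter> X) \<le> \<phi> V + \<phi> (O' - closure V)"
          by (rule add_left_mono)
        also have "\<dots> \<le> \<phi> (V \<union> (O' - closure V))"
          by (rule superadd) (use V op closure_subset[of V] in auto)
        also have "\<dots> \<le> \<phi> O'"
          by (rule mono) (use V op O' closure_subset[of V] in auto)
        finally show "\<phi> V + ?f ((UNIV - U) \<inter> X) \<le> \<phi> O'" .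
      qed
      finally show "?f (U \<inter> X) + ?f ((UNIV - U) \<inter> X) \<le> \<phi> O'" .
    qed
  qed auto
  moreover have "sigma_algebra UNIV L" using ms by (simp add: measure_space_def)
  ultimately have "sigma_sets UNIV {S. open S} \<subseteq> L"
    by (intro sigma_algebra.sigma_sets_subset) auto
  then have sub: "sets borel \<subseteq> L"
    by (simp add: borel_def)
  have "sigma_algebra UNIV (sets (borel :: 'a measure))"
    using sets.sigma_algebra_axioms[of "borel :: 'a measure"] by simp
  moreover have "countably_additive (sets borel) ?f"
    using ms sub unfolding measure_space_def countably_additive_def by blast
  ultimately show ?thesis
    using pos by (simp add: measure_space_def positive_def)
qed

context radon
begin

lemma Linf_set_integrable:
  assumes "set_integrable M \<Omega> f" "g \<in> Linf M"
  shows "set_integrable M \<Omega> (\<lambda>x. f x * g x :: real)"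
proof -
  have "integrable M (\<lambda>x. (indicator \<Omega> x *\<^sub>R f x) * g x)"
    by (rule integrable_mult_Linf) (use assms in \<open>auto simp: set_integrable_def\<close>)
  then show ?thesis by (simp add: set_integrable_def mult.assoc)
qed

lemma integrable_set_integrable:
  fixes f :: "'a \<Rightarrow> real"
  shows "open \<Omega> \<Longrightarrow> integrable M f \<Longrightarrow> set_integrable M \<Omega> f"
  unfolding set_integrable_def by (intro integrable_mult_indicator) (auto simp: sets_M)

lemma L1_converges_tendsto:
  assumes F: "L1_converges M \<Omega> F f" and f: "set_integrable M \<Omega> f" and g: "g \<in> Linf M"
  shows "(\<lambda>n. LINT x:\<Omega>|M. F n x * g x) \<longlonglongrightarrow> (LINT x:\<Omega>|M. f x * g x :: real)"
proof -
  have Fi: "set_integrable M \<Omega> (F n)" for n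
    using F by (auto simp: L1_converges_def)
  have lim: "(\<lambda>n. LINT x:\<Omega>|M. \<bar>F n x - f x\<bar>) \<longlonglongrightarrow> 0"
    using F by (auto simp: L1_converges_def)
  obtain C where C: "0 \<le> C" "AE x in M. norm (g x) \<le> C" "g \<in> borel_measurable M" by (rule LinfE[OF g])
  have "\<bar>(LINT x:\<Omega>|M. F n x * g x) - (LINT x:\<Omega>|M. f x * g x)\<bar> \<le> (LINT x:\<Omega>|M. \<bar>F n x - f x\<bar>) * C" for n
  proof -
    have d: "set_integrable M \<Omega> (\<lambda>x. F n x - f x)" by (rule set_integral_diff(1)[OF Fi f])
    have "(LINT x:\<Omega>|M. F n x * g x) - (LINT x:\<Omega>|M. f x * g x) = (LINT x:\<Omega>|M. (F n x - f x) * g x)"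
      by (simp add: left_diff_distrib set_integral_diff(2)[OF Linf_set_integrable[OF Fi g] Linf_set_integrable[OF f g]])
    also have "\<bar>\<dots>\<bar> \<le> (LINT x:\<Omega>|M. \<bar>(F n x - f x) * g x\<bar>)"
      using set_integral_norm_bound[OF Linf_set_integrable[OF d g]] by simp
    also have "\<dots> \<le> (LINT x:\<Omega>|M. \<bar>F n x - f x\<bar> * C)"
    proof (rule set_integral_mono_AE)
      show "set_integrable M \<Omega> (\<lambda>x. \<bar>(F n x - f x) * g x\<bar>)"
        by (rule set_integrable_abs[OF Linf_set_integrable[OF d g]])
      show "set_integrable M \<Omega> (\<lambda>x. \<bar>F n x - f x\<bar> * C)"
        by (rule set_integrable_mult_left) (rule set_integrable_abs[OF d])
      show "AE x\<in>\<Omega> in M. \<bar>(F n x - f x) * g x\<bar> \<le> \<bar>F n x - f x\<bar> * C"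
        using C(2) by eventually_elim (auto simp: abs_mult intro: mult_left_mono)
    qed
    also have "\<dots> = (LINT x:\<Omega>|M. \<bar>F n x - f x\<bar>) * C"
      by (rule set_integral_mult_left)
    finally show ?thesis .
  qed
  moreover have "(\<lambda>n. (LINT x:\<Omega>|M. \<bar>F n x - f x\<bar>) * C) \<longlonglongrightarrow> 0 * C"
    by (intro tendsto_mult lim tendsto_const)
  ultimately have "(\<lambda>n. (LINT x:\<Omega>|M. F n x * g x) - (LINT x:\<Omega>|M. f x * g x)) \<longlonglongrightarrow> 0"
    by (intro Lim_null_comparison[of "\<lambda>n. (LINT x:\<Omega>|M. F n x * g x) - (LINT x:\<Omega>|M. f x * g x)"
          "\<lambda>n. (LINT x:\<Omega>|M. \<bar>F n x - f x\<bar>) * C"]) auto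
  then show ?thesis by (simp add: LIM_zero_iff)
qed

end

section \<open>The variation on open sets, by duality with vector fields\<close>

locale radon_L1 = radon M for M :: "'a::euclidean_space measure" +
  fixes f :: "'a \<Rightarrow> real"
  assumes f: "integrable M f"
begin

lemma f_measurable: "f \<in> borel_measurable M"
  using f by simp

lemma integrable_f_mult: "g \<in> Linf M \<Longrightarrow> integrable M (\<lambda>x. f x * g x)"
  by (rule integrable_mult_Linf[OF f])

lemma integral_f_cong:
  assumes g: "is_div M v g" and h: "is_div M v h"
  shows "(LINT x|M. f x * g x) = (LINT x|M. f x * h x)"
proof (rule integral_cong_AE)
  show "AE x in M. f x * g x = f x * h x"
    using is_div_unique[OF g h] by eventually_elim simp
qed (use integrable_f_mult[OF is_div_Linf[OF g]] integrable_f_mult[OF is_div_Linf[OF h]] in auto)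

lemma integral_f_restrict:
  assumes \<Omega>: "open \<Omega>" and g: "is_div M v g"
    and C: "compact C" "C \<subseteq> \<Omega>" "AE x in M. x \<notin> C \<longrightarrow> v x = 0"
  shows "(LINT x:\<Omega>|M. f x * g x) = (LINT x|M. f x * g x)"
  unfolding set_lebesgue_integral_def
proof (rule integral_cong_AE)
  have "AE x in M. x \<in> - C \<longrightarrow> g x = 0"
    by (rule is_div_local[OF g]) (use C in \<open>auto simp: compact_imp_closed\<close>)
  then show "AE x in M. indicator \<Omega> x *\<^sub>R (f x * g x) = f x * g x"
    by eventually_elim (use C in \<open>auto simp: indicator_def\<close>)
  show 1: "(\<lambda>x. f x * g x) \<in> borel_measurable M"
    using integrable_f_mult[OF is_div_Linf[OF g]] by auto
  show "(\<lambda>x. indicator \<Omega> x *\<^sub>R (f x * g x)) \<in> borel_measurable M"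
    by (intro borel_measurable_scaleR 1 borel_measurable_indicator) (simp add: sets_M \<Omega>)
qed

lemma var_open_ge:
  assumes \<Omega>: "open \<Omega>" and v: "v \<in> Linf M" and g: "is_div M v g"
    and C: "compact C" "C \<subseteq> \<Omega>" "AE x in M. x \<notin> C \<longrightarrow> v x = 0" and 1: "AE x in M. norm (v x) \<le> 1"
  shows "ennreal (LINT x|M. f x * g x) \<le> var_open M f \<Omega>"
  unfolding var_open_def
proof (rule SUP_upper2[of v])
  have D: "v \<in> D_inf M" by (rule D_infI[OF v g])
  show "v \<in> {v \<in> D_inf M. ess_supp M v \<Subset> \<Omega> \<and> (AE x in M. norm (v x) \<le> 1)}"
    using D compactly_insideI[OF C] 1 by simp
  have d: "is_div M v (div_field M v)" by (rule div_field[OF D])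
  show "ennreal (LINT x|M. f x * g x) \<le> ennreal (LINT x:\<Omega>|M. f x * div_field M v x)"
    by (simp add: integral_f_restrict[OF \<Omega> d C] integral_f_cong[OF g d])
qed

text \<open>Replaces the chosen \<open>div_field\<close> by an arbitrary divergence and the exact
  support by any compact set outside of which the field vanishes a.e.; constructions of fields
  provide data of this kind.\<close>

lemma var_open_eq:
  assumes \<Omega>: "open \<Omega>"
  shows "var_open M f \<Omega> = (SUP (v, g)\<in>{(v, g). v \<in> Linf M \<and> is_div M v g \<and> (AE x in M. norm (v x) \<le> 1) \<and>
      (\<exists>C. compact C \<and> C \<subseteq> \<Omega> \<and> (AE x in M. x \<notin> C \<longrightarrow> v x = 0))}. ennreal (LINT x|M. f x * g x))"
    (is "_ = ?r")
proof (rule antisym)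
  show "?r \<le> var_open M f \<Omega>"
    by (rule SUP_least) (auto intro: var_open_ge[OF \<Omega>])
  show "var_open M f \<Omega> \<le> ?r"
    unfolding var_open_def
  proof (rule SUP_least, clarify)
    fix v assume v: "v \<in> D_inf M" "ess_supp M v \<Subset> \<Omega>" "AE x in M. norm (v x) \<le> 1"
    have C: "compact (ess_supp M v)" "ess_supp M v \<subseteq> \<Omega>"
      using v(2) by (auto simp: compactly_inside_ess_supp)
    show "ennreal (LINT x:\<Omega>|M. f x * div_field M v x) \<le> ?r"
      unfolding integral_f_restrict[OF \<Omega> div_field[OF v(1)] C AE_ess_supp]
    proof (rule SUP_upper2[of "(v, div_field M v)"])
      show "(v, div_field M v) \<in> {(v, g). v \<in> Linf M \<and> is_div M v g \<and> (AE x in M. norm (v x) \<le> 1) \<and>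
          (\<exists>C. compact C \<and> C \<subseteq> \<Omega> \<and> (AE x in M. x \<notin> C \<longrightarrow> v x = 0))}"
        using v(3) C D_inf_Linf[OF v(1)] div_field[OF v(1)] AE_ess_supp[of v] by blast
    qed simp
  qed
qed

lemma var_open_least:
  assumes \<Omega>: "open \<Omega>"
    and "\<And>v g C. v \<in> Linf M \<Longrightarrow> is_div M v g \<Longrightarrow> compact C \<Longrightarrow> C \<subseteq> \<Omega> \<Longrightarrow> AE x in M. x \<notin> C \<longrightarrow> v x = 0 \<Longrightarrow>
      AE x in M. norm (v x) \<le> 1 \<Longrightarrow> ennreal (LINT x|M. f x * g x) \<le> B"
  shows "var_open M f \<Omega> \<le> B"
  unfolding var_open_eq[OF \<Omega>] by (rule SUP_least) (use assms(2) in auto)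

lemma var_open_mono:
  assumes "open A" "open B" "A \<subseteq> B" shows "var_open M f A \<le> var_open M f B"
  by (rule var_open_least[OF assms(1)], rule var_open_ge[OF assms(2)]) (use assms in auto)

lemma var_open_empty: "var_open M f {} = 0"
proof -
  have "var_open M f {} \<le> 0"
  proof (rule var_open_least)
    fix v g and C :: "'a set"
    assume g: "is_div M v g" and C: "compact C" "C \<subseteq> {}" "AE x in M. x \<notin> C \<longrightarrow> v x = 0"
    have "AE x in M. x \<in> UNIV \<longrightarrow> g x = 0"
      by (rule is_div_local[OF g]) (use C in auto)
    then have "AE x in M. f x * g x = 0" by eventually_elim simp
    then have "(LINT x|M. f x * g x) = 0" by (rule integral_eq_zero_AE)
    then show "ennreal (LINT x|M. f x * g x) \<le> 0" by simp
  qed simp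
  then show ?thesis by simp
qed

lemma is_div_0: "is_div M (\<lambda>x. 0) (\<lambda>x. 0)"
  by (simp add: is_div_def Linf_const)

text \<open>Fields with disjoint supports can be added without exceeding norm
  \<open>1\<close>.\<close>

lemma var_open_superadditive:
  assumes A: "open A" and B: "open B" and AB: "A \<inter> B = {}"
  shows "var_open M f A + var_open M f B \<le> var_open M f (A \<union> B)"
proof -
  let ?S = "\<lambda>\<Omega>. {(v, g). v \<in> Linf M \<and> is_div M v g \<and> (AE x in M. norm (v x) \<le> 1) \<and>
      (\<exists>C. compact C \<and> C \<subseteq> \<Omega> \<and> (AE x in M. x \<notin> C \<longrightarrow> v x = 0))}"
  let ?F = "\<lambda>(v :: 'a \<Rightarrow> 'a, g). ennreal (LINT x|M. f x * g x)"
  have zero: "((\<lambda>x. 0), (\<lambda>x. 0)) \<in> ?S \<Omega>" for \<Omega>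
    using is_div_0 Linf_const by (auto intro!: exI[of _ "{}"])
  have ne: "?S \<Omega> \<noteq> {}" for \<Omega> using zero by blast
  have AB': "open (A \<union> B)" using A B by auto
  have pair: "?F p + ?F q \<le> var_open M f (A \<union> B)" if p: "p \<in> ?S A" and q: "q \<in> ?S B" for p q
  proof -
    obtain v g C where v: "p = (v, g)" "v \<in> Linf M" "is_div M v g" "AE x in M. norm (v x) \<le> 1"
      "compact C" "C \<subseteq> A" "AE x in M. x \<notin> C \<longrightarrow> v x = 0" using p by auto
    obtain w h D where w: "q = (w, h)" "w \<in> Linf M" "is_div M w h" "AE x in M. norm (w x) \<le> 1"
      "compact D" "D \<subseteq> B" "AE x in M. x \<notin> D \<longrightarrow> w x = 0" using q by auto
    let ?a = "LINT x|M. f x * g x" and ?b = "LINT x|M. f x * h x"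
    have a: "ennreal ?a \<le> var_open M f (A \<union> B)"
      by (rule var_open_ge[OF AB' v(2,3,5) _ v(7,4)]) (use v in auto)
    have b: "ennreal ?b \<le> var_open M f (A \<union> B)"
      by (rule var_open_ge[OF AB' w(2,3,5) _ w(7,4)]) (use w in auto)
    have "ennreal (LINT x|M. f x * (g x + h x)) \<le> var_open M f (A \<union> B)"
    proof (rule var_open_ge[OF AB' Linf_add[OF v(2) w(2)] is_div_add[OF v(2) w(2) v(3) w(3)], of "C \<union> D"])
      show "AE x in M. x \<notin> C \<union> D \<longrightarrow> v x + w x = 0"
        using v(7) w(7) by eventually_elim auto
      show "AE x in M. norm (v x + w x) \<le> 1"
        using v(4,7) w(4,7)
      proof eventually_elim
        case (elim x)
        then show ?case using v(6) w(6) AB by (cases "x \<in> C") auto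
      qed
    qed (use v w in auto)
    then have ab: "ennreal (?a + ?b) \<le> var_open M f (A \<union> B)"
      using integrable_f_mult[OF is_div_Linf[OF v(3)]] integrable_f_mult[OF is_div_Linf[OF w(3)]]
      by (simp add: distrib_left)
    show ?thesis
    \<comment> \<open>The suprema are taken in \<open>ennreal\<close>, where negative integrals
      count as \<open>0\<close>; if one integral is negative, the other field alone
      suffices.\<close>
    proof (cases "0 \<le> ?a \<and> 0 \<le> ?b")
      case True
      then show ?thesis using ab by (simp add: v w)
    next
      case False
      then show ?thesis using a b by (auto simp: v w ennreal_neg not_le)
    qed
  qed
  have "var_open M f A + var_open M f B = (SUP p\<in>?S A. ?F p + (SUP q\<in>?S B. ?F q))"
    unfolding var_open_eq[OF A] var_open_eq[OF B] using ne by (subst ennreal_SUP_add_left) auto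
  also have "\<dots> = (SUP p\<in>?S A. SUP q\<in>?S B. ?F p + ?F q)"
    by (rule SUP_cong[OF refl], rule ennreal_SUP_add_right, rule ne)
  also have "\<dots> \<le> var_open M f (A \<union> B)"
    by (intro SUP_least pair)
  finally show ?thesis .
qed

lemma is_div_diff_mult:
  assumes v: "v \<in> Linf M" and g: "is_div M v g" and u: "u \<in> Cinf_c"
  shows "(\<lambda>x. v x + -1 *\<^sub>R (u x *\<^sub>R v x)) \<in> Linf M"
    "is_div M (\<lambda>x. v x + -1 *\<^sub>R (u x *\<^sub>R v x)) (\<lambda>x. g x + -1 * (u x * g x + grad u x \<bullet> v x))"
proof -
  have uv: "(\<lambda>x. u x *\<^sub>R v x) \<in> Linf M" by (rule Linf_scaleR[OF LIP_c_Linf[OF Cinf_c_LIP_c[OF u]] v])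
  have uv': "(\<lambda>x. -1 *\<^sub>R (u x *\<^sub>R v x)) \<in> Linf M" by (rule Linf_scaleR[OF Linf_const uv])
  show "(\<lambda>x. v x + -1 *\<^sub>R (u x *\<^sub>R v x)) \<in> Linf M" by (rule Linf_add[OF v uv'])
  show "is_div M (\<lambda>x. v x + -1 *\<^sub>R (u x *\<^sub>R v x)) (\<lambda>x. g x + -1 * (u x * g x + grad u x \<bullet> v x))"
    by (rule is_div_add[OF v uv' g is_div_scale[OF is_div_mult[OF v g u]]])
qed

lemma ennreal_add_le: "ennreal (x + y) \<le> ennreal x + ennreal y"
proof -
  have "ennreal (x + y) \<le> ennreal (max 0 x + max 0 y)" by (intro ennreal_leI) auto
  also have "\<dots> = ennreal x + ennreal y" by (subst ennreal_plus) (auto simp: max_def ennreal_neg)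
  finally show ?thesis .
qed

text \<open>The cutoff \<open>u\<close> equals \<open>1\<close> near the part of the support outside
  \<open>B\<close>. It splits the field into a multiple by \<open>u\<close>, supported in
  \<open>A\<close>, and a multiple by \<open>1 - u\<close>, supported in \<open>B\<close>.\<close>

lemma var_open_subadditive:
  assumes A: "open A" and B: "open B"
  shows "var_open M f (A \<union> B) \<le> var_open M f A + var_open M f B"
proof (rule var_open_least)
  fix v g C assume v: "v \<in> Linf M" and g: "is_div M v g" and C: "compact C" "C \<subseteq> A \<union> B"
    "AE x in M. x \<notin> C \<longrightarrow> v x = 0" and 1: "AE x in M. norm (v x) \<le> 1"
  have "compact (C - B)" by (rule compact_diff[OF C(1) B])
  then obtain u V D where u: "u \<in> Cinf_c" "\<And>x. 0 \<le> u x" "\<And>x. u x \<le> 1" "open V" "C - B \<subseteq> V"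
    "\<And>x. x \<in> V \<Longrightarrow> u x = 1" "compact D" "D \<subseteq> A" "\<And>x. x \<notin> D \<Longrightarrow> u x = 0"
    by (rule smooth_cutoff[OF _ A]) (use C in auto)
  let ?g1 = "\<lambda>x. u x * g x + grad u x \<bullet> v x"
  have uv: "(\<lambda>x. u x *\<^sub>R v x) \<in> Linf M" by (rule Linf_scaleR[OF LIP_c_Linf[OF Cinf_c_LIP_c[OF u(1)]] v])
  have g1: "is_div M (\<lambda>x. u x *\<^sub>R v x) ?g1" by (rule is_div_mult[OF v g u(1)])
  note g2 = is_div_diff_mult[OF v g u(1)]
  have a: "ennreal (LINT x|M. f x * ?g1 x) \<le> var_open M f A"
  proof (rule var_open_ge[OF A uv g1 u(7,8)])
    show "AE x in M. norm (u x *\<^sub>R v x) \<le> 1"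
      using 1 by eventually_elim (use u in \<open>auto intro: mult_le_one\<close>)
  qed (use u in auto)
  have b: "ennreal (LINT x|M. f x * (g x + -1 * ?g1 x)) \<le> var_open M f B"
  proof (rule var_open_ge[OF B g2])
    show "compact (C - V)" by (rule compact_diff[OF C(1) u(4)])
    show "C - V \<subseteq> B" using u(5) by auto
    show "AE x in M. x \<notin> C - V \<longrightarrow> v x + - 1 *\<^sub>R (u x *\<^sub>R v x) = 0"
      using C(3) by eventually_elim (use u(6) in auto)
    show "AE x in M. norm (v x + - 1 *\<^sub>R (u x *\<^sub>R v x)) \<le> 1"
      using 1
    proof eventually_elim
      case (elim x)
      have "v x + - 1 *\<^sub>R (u x *\<^sub>R v x) = (1 - u x) *\<^sub>R v x" by (simp add: scaleR_diff_left)
      then show ?case using elim u(2,3)[of x] by (simp add: mult_le_one)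
    qed
  qed
  have "(LINT x|M. f x * g x) = (LINT x|M. f x * ?g1 x + f x * (g x + -1 * ?g1 x))"
    by (simp add: algebra_simps)
  also have "\<dots> = (LINT x|M. f x * ?g1 x) + (LINT x|M. f x * (g x + -1 * ?g1 x))"
    by (rule Bochner_Integration.integral_add[OF integrable_f_mult[OF is_div_Linf[OF g1]]
          integrable_f_mult[OF is_div_Linf[OF g2(2)]]])
  finally have "ennreal (LINT x|M. f x * g x) \<le> ennreal (LINT x|M. f x * ?g1 x) + ennreal (LINT x|M. f x * (g x + -1 * ?g1 x))"
    by (simp only: ennreal_add_le)
  also have "\<dots> \<le> var_open M f A + var_open M f B" by (rule add_mono[OF a b])
  finally show "ennreal (LINT x|M. f x * g x) \<le> var_open M f A + var_open M f B" .
qed (use A B in auto)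

text \<open>An admissible field has compact support: finitely many sets of a countable open cover
  contain it, and so does an open set whose closure stays inside \<open>A\<close>. This gives
  countable subadditivity and inner approximation.\<close>

lemma measure_space_var: "measure_space UNIV (sets borel) (var M f)"
  unfolding var_def
proof (rule measure_space_of_open_sets)
  fix A :: "nat \<Rightarrow> 'a set" assume A: "\<And>n. open (A n)"
  have fin: "var_open M f (\<Union>i<n. A i) \<le> (\<Sum>i<n. var_open M f (A i))" for n
  proof (induction n)
    case (Suc n)
    have "var_open M f (\<Union>i<Suc n. A i) = var_open M f ((\<Union>i<n. A i) \<union> A n)"
      by (simp add: lessThan_Suc Un_commute)
    also have "\<dots> \<le> var_open M f (\<Union>i<n. A i) + var_open M f (A n)"
      using A by (intro var_open_subadditive) auto
    also have "\<dots> \<le> (\<Sum>i<n. var_open M f (A i)) + var_open M f (A n)"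
      by (rule add_right_mono[OF Suc])
    finally show ?case by simp
  qed (simp add: var_open_empty)
  show "var_open M f (\<Union>n. A n) \<le> (\<Sum>n. var_open M f (A n))"
  proof (rule var_open_least)
    fix v g C assume v: "v \<in> Linf M" and g: "is_div M v g" and C: "compact C" "C \<subseteq> (\<Union>n. A n)"
      "AE x in M. x \<notin> C \<longrightarrow> v x = 0" and 1: "AE x in M. norm (v x) \<le> 1"
    obtain I where I: "finite I" "C \<subseteq> (\<Union>n\<in>I. A n)"
      using compactE_image[OF C(1), of UNIV A] A C(2) by auto
    obtain n where "I \<subseteq> {..<n}" using finite_nat_bounded[OF I(1)] by auto
    then have "C \<subseteq> (\<Union>i<n. A i)" using I by blast
    then have "ennreal (LINT x|M. f x * g x) \<le> var_open M f (\<Union>i<n. A i)"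
      by (intro var_open_ge[OF _ v g C(1) _ C(3) 1]) (use A in auto)
    also note fin
    also have "(\<Sum>i<n. var_open M f (A i)) \<le> (\<Sum>n. var_open M f (A n))"
      by (rule sum_le_suminf) auto
    finally show "ennreal (LINT x|M. f x * g x) \<le> (\<Sum>n. var_open M f (A n))" .
  qed (use A in auto)
next
  fix A :: "'a set" assume A: "open A"
  show "var_open M f A \<le> (SUP V\<in>{V. open V \<and> closure V \<subseteq> A}. var_open M f V)"
  proof (rule var_open_least[OF A])
    fix v g C assume v: "v \<in> Linf M" and g: "is_div M v g" and C: "compact C" "C \<subseteq> A"
      "AE x in M. x \<notin> C \<longrightarrow> v x = 0" and 1: "AE x in M. norm (v x) \<le> 1"
    obtain u V D where u: "open V" "C \<subseteq> V" "\<And>x. x \<in> V \<Longrightarrow> u x = (1::real)" "compact D" "D \<subseteq> A"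
      "\<And>x. x \<notin> D \<Longrightarrow> u x = 0"
      by (rule smooth_cutoff[OF C(1) A C(2)], rule that)
    have "V \<subseteq> D" using u by force
    then have "closure V \<subseteq> A" using u closure_minimal compact_imp_closed by blast
    moreover have "ennreal (LINT x|M. f x * g x) \<le> var_open M f V"
      by (rule var_open_ge[OF u(1) v g C(1) u(2) C(3) 1])
    ultimately show "ennreal (LINT x|M. f x * g x) \<le> (SUP V\<in>{V. open V \<and> closure V \<subseteq> A}. var_open M f V)"
      using u(1) by (intro SUP_upper2[of V]) auto
  qed
qed (simp_all add: var_open_empty var_open_mono var_open_superadditive)

lemma var_eq_var_open: "open A \<Longrightarrow> var M f A = var_open M f A"
  unfolding var_def by (rule outer_ext_open) (rule var_open_mono)

lemma BV_seminorm_ge: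
  assumes v: "v \<in> Linf M" and g: "is_div M v g" and 1: "AE x in M. norm (v x) \<le> 1"
  shows "ennreal (LINT x|M. f x * g x) \<le> BV_seminorm M f"
  unfolding BV_seminorm_def
proof (rule SUP_upper2[of v])
  have D: "v \<in> D_inf M" by (rule D_infI[OF v g])
  then show "v \<in> {v \<in> D_inf M. AE x in M. norm (v x) \<le> 1}" using 1 by simp
  show "ennreal (LINT x|M. f x * g x) \<le> ennreal (LINT x|M. f x * div_field M v x)"
    using integral_f_cong[OF g div_field[OF D]] by simp
qed

text \<open>Cutoffs with gradients of order \<open>1 / n\<close> change the divergence by a term
  that tends to \<open>0\<close>, and all integrands are dominated by a multiple of
  \<open>\<bar>f\<bar>\<close>.\<close>

lemma cutoff_divergence_limit:
  assumes v: "v \<in> Linf M" and g: "is_div M v g"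
  obtains u where "\<And>n. u n \<in> Cinf_c" "\<And>n x. 0 \<le> u n x" "\<And>n x. u n x \<le> 1" "\<And>x. (\<lambda>n. u n x) \<longlonglongrightarrow> 1"
    "(\<lambda>n. LINT x|M. f x * (u n x * g x + grad (u n) x \<bullet> v x)) \<longlonglongrightarrow> (LINT x|M. f x * g x)"
proof -
  obtain Cg where Cg: "0 \<le> Cg" "AE x in M. norm (g x) \<le> Cg" by (rule LinfE[OF is_div_Linf[OF g]])
  obtain Cv where Cv: "0 \<le> Cv" "AE x in M. norm (v x) \<le> Cv" by (rule LinfE[OF v])
  have "\<exists>u. u \<in> Cinf_c \<and> (\<forall>x::'a. 0 \<le> u x \<and> u x \<le> 1 \<and> (norm x \<le> Suc n \<longrightarrow> u x = 1) \<and> norm (grad u x) \<le> 1 / Suc n)" for n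
    by (rule smooth_cutoff_small_grad[of "real (Suc n)"]) auto
  then obtain u where u: "\<And>n. u n \<in> Cinf_c" "\<And>n x. 0 \<le> u n x" "\<And>n x. u n x \<le> 1"
    "\<And>n x. norm (x::'a) \<le> Suc n \<Longrightarrow> u n x = 1" "\<And>n x. norm (grad (u n) x) \<le> 1 / Suc n" by metis
  let ?gn = "\<lambda>n x. u n x * g x + grad (u n) x \<bullet> v x"
  have gn: "is_div M (\<lambda>x. u n x *\<^sub>R v x) (?gn n)" for n by (rule is_div_mult[OF v g u(1)])
  have u1: "(\<lambda>n. u n x) \<longlonglongrightarrow> 1" for x
  proof (rule tendsto_eventually)
    obtain N :: nat where "norm x \<le> real N" using real_arch_simple by blast
    then show "\<forall>\<^sub>F n in sequentially. u n x = 1"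
      unfolding eventually_sequentially by (intro exI[of _ N]) (use u(4) in auto)
  qed
  have "(\<lambda>n. LINT x|M. f x * ?gn n x) \<longlonglongrightarrow> (LINT x|M. f x * g x)"
  proof (rule integral_dominated_convergence[of _ _ _ "\<lambda>x. (Cg + Cv) * \<bar>f x\<bar>"])
    show "(\<lambda>x. f x * g x) \<in> borel_measurable M" "(\<lambda>x. f x * ?gn n x) \<in> borel_measurable M" for n
      using integrable_f_mult[OF is_div_Linf[OF g]] integrable_f_mult[OF is_div_Linf[OF gn[of n]]] by auto
    show "integrable M (\<lambda>x. (Cg + Cv) * \<bar>f x\<bar>)" using f by simp
    have lim: "(\<lambda>n. ?gn n x) \<longlonglongrightarrow> g x" for x
    proof -
      have "(\<lambda>n. grad (u n) x) \<longlonglongrightarrow> 0"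
        by (rule Lim_null_comparison[OF _ lim_1_over_n[THEN LIMSEQ_Suc]]) (use u(5) in auto)
      then have "(\<lambda>n. ?gn n x) \<longlonglongrightarrow> 1 * g x + 0 \<bullet> v x"
        by (intro tendsto_add tendsto_mult tendsto_inner tendsto_const u1)
      then show ?thesis by simp
    qed
    show "AE x in M. (\<lambda>n. f x * ?gn n x) \<longlonglongrightarrow> f x * g x"
      by (intro AE_I2 tendsto_mult tendsto_const lim)
    show "AE x in M. norm (f x * ?gn n x) \<le> (Cg + Cv) * \<bar>f x\<bar>" for n
      using Cg(2) Cv(2)
    proof eventually_elim
      case (elim x)
      have "\<bar>u n x * g x\<bar> \<le> 1 * Cg"
        unfolding abs_mult by (rule mult_mono) (use u(2,3)[of n x] elim in auto)
      moreover have "\<bar>grad (u n) x \<bullet> v x\<bar> \<le> 1 * Cv"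
      proof (rule order_trans[OF Cauchy_Schwarz_ineq2 mult_mono])
        have "1 / real (Suc n) \<le> 1" by simp
        then show "norm (grad (u n) x) \<le> 1" using u(5)[of n x] by linarith
      qed (use elim in auto)
      ultimately have "\<bar>?gn n x\<bar> \<le> Cg + Cv" by linarith
      then show ?case
        using mult_right_mono[OF _ abs_ge_zero[of "f x"]] by (simp only: abs_mult mult.commute[of "\<bar>f x\<bar>"] real_norm_def)
    qed
  qed
  then show ?thesis by (rule that[OF u(1-3) u1])
qed

text \<open>The seminorm admits fields of arbitrary support, the variation of the whole space only
  compactly supported ones; cutoffs bridge the difference.\<close>

lemma BV_seminorm_eq: "BV_seminorm M f = var_open M f UNIV"
proof (rule antisym)
  show "var_open M f UNIV \<le> BV_seminorm M f"
    by (rule var_open_least) (auto intro: BV_seminorm_ge)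
  show "BV_seminorm M f \<le> var_open M f UNIV"
    unfolding BV_seminorm_def
  proof (rule SUP_least, clarify)
    fix v assume D: "v \<in> D_inf M" and 1: "AE x in M. norm (v x) \<le> 1"
    let ?g = "div_field M v"
    have v: "v \<in> Linf M" and g: "is_div M v ?g" by (auto intro: D_inf_Linf D div_field)
    obtain u where u: "\<And>n. u n \<in> Cinf_c" "\<And>n x. 0 \<le> u n x" "\<And>n x. u n x \<le> 1"
      and lim: "(\<lambda>n. LINT x|M. f x * (u n x * ?g x + grad (u n) x \<bullet> v x)) \<longlonglongrightarrow> (LINT x|M. f x * ?g x)"
      by (rule cutoff_divergence_limit[OF v g], rule that)
    have le: "ennreal (LINT x|M. f x * (u n x * ?g x + grad (u n) x \<bullet> v x)) \<le> var_open M f UNIV" for n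
    proof -
      obtain K where K: "compact K" "\<And>x. x \<notin> K \<Longrightarrow> u n x = 0" by (rule Cinf_c_bounded[OF u(1)[of n]], rule that)
      show ?thesis
      proof (rule var_open_ge[OF open_UNIV _ is_div_mult[OF v g u(1)] K(1)])
        show "(\<lambda>x. u n x *\<^sub>R v x) \<in> Linf M" by (rule Linf_scaleR[OF LIP_c_Linf[OF Cinf_c_LIP_c[OF u(1)]] v])
        show "AE x in M. norm (u n x *\<^sub>R v x) \<le> 1"
          using 1 by eventually_elim (use u in \<open>auto intro: mult_le_one\<close>)
      qed (use K in auto)
    qed
    show "ennreal (LINT x|M. f x * ?g x) \<le> var_open M f UNIV"
      by (rule tendsto_upperbound[OF tendsto_ennrealI[OF lim]]) (use le in auto)
  qed
qed

text \<open>Integration by parts against each member of a competing sequence: as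
  \<open>norm (v x) \<le> 1\<close> a.e., the integral of \<open>F n\<close> times the divergence is
  at most the integral of \<open>lip_a (F n)\<close>, and the left side converges.\<close>

lemma var_open_le_var_Lip_open:
  assumes \<Omega>: "open \<Omega>"
  shows "var_open M f \<Omega> \<le> var_Lip_open M f \<Omega>"
  unfolding var_Lip_open_def
proof (rule INF_greatest, clarify)
  fix F assume F: "\<forall>n. F n \<in> LIP_loc \<Omega>" and conv: "L1_converges M \<Omega> F f"
  show "var_open M f \<Omega> \<le> liminf (\<lambda>n. \<integral>\<^sup>+x\<in>\<Omega>. lip_a (F n) x \<partial>M)"
  proof (rule var_open_least[OF \<Omega>])
    fix v g C assume v: "v \<in> Linf M" and g: "is_div M v g" and C: "compact C" "C \<subseteq> \<Omega>"
      "AE x in M. x \<notin> C \<longrightarrow> v x = 0" and 1: "AE x in M. norm (v x) \<le> 1"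
    obtain u V D where u: "u \<in> Cinf_c" "open V" "C \<subseteq> V" "\<And>x. x \<in> V \<Longrightarrow> u x = (1::real)" "compact D" "D \<subseteq> \<Omega>"
      "\<And>x. x \<notin> D \<Longrightarrow> u x = 0"
      by (rule smooth_cutoff[OF C(1) \<Omega> C(2)], rule that)
    have V: "V \<subseteq> \<Omega>" using u by force
    have g0: "AE x in M. x \<in> - C \<longrightarrow> g x = 0"
      by (rule is_div_local[OF g]) (use C in \<open>auto simp: compact_imp_closed\<close>)
    have le: "ennreal (LINT x:\<Omega>|M. F n x * g x) \<le> (\<integral>\<^sup>+x\<in>\<Omega>. lip_a (F n) x \<partial>M)" for n
    proof -
      \<comment> \<open>\<open>F n\<close> is Lipschitz only locally in \<open>\<Omega>\<close>; the
        cutoff makes it globally Lipschitz with compact support and leaves it unchanged near the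
        support of \<open>v\<close>.\<close>
      let ?w = "\<lambda>x. u x * F n x"
      have w: "?w \<in> LIP_c"
        by (rule LIP_loc_cutoff[OF F[rule_format] Cinf_c_LIP_c[OF u(1)] u(5,6,7)])
      obtain h where h: "wder M v ?w h" "AE x in M. ennreal \<bar>h x\<bar> \<le> ennreal (norm (v x)) * lip_a ?w x"
        by (rule wder_exists[OF v w])
      have wl: "?w \<in> Linf M" by (rule wder_properties[OF v h(1)])
      obtain K where K: "compact K" "AE x in M. x \<notin> K \<longrightarrow> h x = 0" by (rule wder_properties[OF v h(1)], rule that)
      have "(LINT x:\<Omega>|M. F n x * g x) = (LINT x|M. ?w x * g x)"
        unfolding set_lebesgue_integral_def
      proof (rule integral_cong_AE)
        have "set_integrable M \<Omega> (\<lambda>x. F n x * g x)"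
          using conv by (intro Linf_set_integrable is_div_Linf[OF g]) (auto simp: L1_converges_def)
        then show "(\<lambda>x. indicator \<Omega> x *\<^sub>R (F n x * g x)) \<in> borel_measurable M"
          by (auto simp: set_integrable_def)
        show "(\<lambda>x. ?w x * g x) \<in> borel_measurable M"
          by (rule Linf_measurable[OF Linf_mult[OF wl is_div_Linf[OF g]]])
        show "AE x in M. indicator \<Omega> x *\<^sub>R (F n x * g x) = ?w x * g x"
          using g0 by eventually_elim (use u(3,4) C(2) in \<open>auto simp: indicator_def subset_iff\<close>)
      qed
      also have "\<dots> = - (LINT x|M. h x)" using integral_wder[OF v g h(1)] by simp
      also have "ennreal (- (LINT x|M. h x)) \<le> ennreal \<bar>LINT x|M. h x\<bar>" by (intro ennreal_leI) auto
      also have "\<dots> \<le> (\<integral>\<^sup>+x. ennreal \<bar>h x\<bar> \<partial>M)"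
      \<comment> \<open>Without integrability the Bochner integral is \<open>0\<close> by
        convention.\<close>
      proof (cases "integrable M h")
        case True
        then show ?thesis using integral_norm_bound_ennreal[of M h] by simp
      qed (simp add: not_integrable_integral_eq)
      also have "\<dots> \<le> (\<integral>\<^sup>+x\<in>\<Omega>. lip_a (F n) x \<partial>M)"
      proof (rule nn_integral_mono_AE)
        show "AE x in M. ennreal \<bar>h x\<bar> \<le> lip_a (F n) x * indicator \<Omega> x"
          using h(2) C(3) 1
        proof eventually_elim
          case (elim x)
          show ?case
          proof (cases "x \<in> V")
            case True
            have "lip_a ?w x = lip_a (F n) x" by (rule lip_a_cong[OF u(2) True]) (simp add: u)
            moreover have "ennreal (norm (v x)) * lip_a (F n) x \<le> 1 * lip_a (F n) x"
              using elim by (intro mult_right_mono) auto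
            ultimately show ?thesis using elim True V by (auto simp: indicator_def)
          next
            case False
            then have "v x = 0" using elim u(3) by auto
            then show ?thesis using elim by simp
          qed
        qed
      qed
      finally show ?thesis .
    qed
    have "(\<lambda>n. LINT x:\<Omega>|M. F n x * g x) \<longlonglongrightarrow> (LINT x:\<Omega>|M. f x * g x)"
      by (rule L1_converges_tendsto[OF conv integrable_set_integrable[OF \<Omega> f] is_div_Linf[OF g]])
    then have lim: "(\<lambda>n. ennreal (LINT x:\<Omega>|M. F n x * g x)) \<longlonglongrightarrow> ennreal (LINT x|M. f x * g x)"
      unfolding integral_f_restrict[OF \<Omega> g C] by (rule tendsto_ennrealI)
    have "ennreal (LINT x|M. f x * g x) = liminf (\<lambda>n. ennreal (LINT x:\<Omega>|M. F n x * g x))"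
      by (rule lim_imp_Liminf[symmetric, OF _ lim]) simp
    also have "\<dots> \<le> liminf (\<lambda>n. \<integral>\<^sup>+x\<in>\<Omega>. lip_a (F n) x \<partial>M)"
      by (intro Liminf_mono always_eventually allI le)
    finally show "ennreal (LINT x|M. f x * g x) \<le> liminf (\<lambda>n. \<integral>\<^sup>+x\<in>\<Omega>. lip_a (F n) x \<partial>M)" .
  qed
qed

end

lemma nn_integral_lip_a_le_grad:
  assumes "f \<in> Cinf \<Omega>" "open \<Omega>"
  shows "(\<integral>\<^sup>+x\<in>\<Omega>. lip_a f x \<partial>M) \<le> (\<integral>\<^sup>+x\<in>\<Omega>. ennreal (norm (grad f x)) \<partial>M)"
  by (intro nn_integral_mono) (use lip_a_le_grad[OF assms] in \<open>auto simp: indicator_def\<close>)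

lemma var_Lip_open_le_var_Cinf_open:
  assumes \<Omega>: "open \<Omega>"
  shows "var_Lip_open M f \<Omega> \<le> var_Cinf_open M f \<Omega>"
  unfolding var_Cinf_open_def
proof (rule INF_greatest, clarify)
  fix F assume F: "\<forall>n. F n \<in> Cinf \<Omega>" "L1_converges M \<Omega> F f"
  have "var_Lip_open M f \<Omega> \<le> liminf (\<lambda>n. \<integral>\<^sup>+x\<in>\<Omega>. lip_a (F n) x \<partial>M)"
    unfolding var_Lip_open_def by (rule INF_lower) (use F Cinf_LIP_loc[OF _ \<Omega>] in auto)
  also have "\<dots> \<le> liminf (\<lambda>n. \<integral>\<^sup>+x\<in>\<Omega>. ennreal (norm (grad (F n) x)) \<partial>M)"
    by (intro Liminf_mono always_eventually allI nn_integral_lip_a_le_grad \<Omega>) (use F in auto)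
  finally show "var_Lip_open M f \<Omega> \<le> liminf (\<lambda>n. \<integral>\<^sup>+x\<in>\<Omega>. ennreal (norm (grad (F n) x)) \<partial>M)" .
qed

subsection \<open>Approximation in energy by smooth functions\<close>

context radon
begin

text \<open>The limit of convex combinations serves as a weak limit: convergent pairings, upper
  bounds of pairings and norm bounds of linear images all pass to convex combinations and then to
  the limit. The maps \<open>T\<close> allow the components of a pair to be bounded
  separately.\<close>

lemma weak_limit_exists:
  fixes u :: "nat \<Rightarrow> 'a \<Rightarrow> 'b::euclidean_space"
  assumes u: "\<And>n. u n \<in> borel_measurable M" and K: "\<And>n. AE x in M. norm (u n x) \<le> K"
  shows "\<exists>h. h \<in> borel_measurable M \<and>
    (\<forall>w l. integrable M w \<longrightarrow> (\<lambda>n. LINT x|M. u n x \<bullet> w x) \<longlonglongrightarrow> l \<longrightarrow> (LINT x|M. h x \<bullet> w x) = l) \<and>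
    (\<forall>w a. integrable M w \<longrightarrow> (\<forall>n. (LINT x|M. u n x \<bullet> w x) \<le> a) \<longrightarrow> (LINT x|M. h x \<bullet> w x) \<le> a) \<and>
    (\<forall>(T :: 'b \<Rightarrow> 'c::real_normed_vector) B. bounded_linear T \<longrightarrow> (\<forall>n. AE x in M. norm (T (u n x)) \<le> B) \<longrightarrow>
       (AE x in M. norm (T (h x)) \<le> B))"
proof -
  obtain m c h where c: "\<And>n k. 0 \<le> c n k" "\<And>n k. k < n \<Longrightarrow> c n k = 0" "\<And>n. (\<Sum>k\<le>m n. c n k) = (1::real)"
    and h: "h \<in> borel_measurable M" "AE x in M. (\<lambda>n. \<Sum>k\<le>m n. c n k *\<^sub>R u k x) \<longlonglongrightarrow> h x"
    by (rule radon_convex_combinations_converge[OF radon u K], rule that)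
  define H where "H n x = (\<Sum>k\<le>m n. c n k *\<^sub>R u k x)" for n x
  have Hm: "H n \<in> borel_measurable M" for n
    unfolding H_def using u by measurable
  have KK: "AE x in M. \<forall>k. norm (u k x) \<le> K" using K by (simp add: AE_all_countable)
  have HK: "AE x in M. norm (H n x) \<le> K" for n
    using KK by eventually_elim (auto simp: H_def intro!: convex_tail_norm_le[of "c n" n] c)
  have int: "integrable M (\<lambda>x. u k x \<bullet> w x)" if w: "integrable M w" for k w
  proof (rule Bochner_Integration.integrable_bound)
    have [measurable]: "w \<in> borel_measurable M" using w by simp
    show "integrable M (\<lambda>x. K *\<^sub>R w x)" using w by simp
    show "(\<lambda>x. u k x \<bullet> w x) \<in> borel_measurable M" using u[of k] by measurable
    show "AE x in M. norm (u k x \<bullet> w x) \<le> norm (K *\<^sub>R w x)"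
      using K[of k]
    proof eventually_elim
      case (elim x)
      have "\<bar>u k x \<bullet> w x\<bar> \<le> norm (u k x) * norm (w x)" by (rule Cauchy_Schwarz_ineq2)
      also have "\<dots> \<le> \<bar>K\<bar> * norm (w x)" using elim by (intro mult_right_mono) auto
      finally show ?case by simp
    qed
  qed
  have eq: "(LINT x|M. H n x \<bullet> w x) = (\<Sum>k\<le>m n. c n k *\<^sub>R (LINT x|M. u k x \<bullet> w x))" if w: "integrable M w" for n w
    unfolding H_def inner_sum_left by (subst Bochner_Integration.integral_sum) (simp_all add: int[OF w])
  have lim: "(\<lambda>n. LINT x|M. H n x \<bullet> w x) \<longlonglongrightarrow> (LINT x|M. h x \<bullet> w x)" if w: "integrable M w" for w
  proof (rule integral_dominated_convergence[of _ _ _ "\<lambda>x. K * norm (w x)"])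
    have [measurable]: "w \<in> borel_measurable M" using w by simp
    show "(\<lambda>x. h x \<bullet> w x) \<in> borel_measurable M" "(\<lambda>x. H n x \<bullet> w x) \<in> borel_measurable M" for n
      using h(1) Hm[of n] by measurable
    show "integrable M (\<lambda>x. K * norm (w x))" using w by simp
    show "AE x in M. (\<lambda>n. H n x \<bullet> w x) \<longlonglongrightarrow> h x \<bullet> w x"
      using h(2) unfolding H_def by eventually_elim (intro tendsto_inner tendsto_const)
    show "AE x in M. norm (H n x \<bullet> w x) \<le> K * norm (w x)" for n
      using HK[of n]
    proof eventually_elim
      case (elim x)
      have "\<bar>H n x \<bullet> w x\<bar> \<le> norm (H n x) * norm (w x)" by (rule Cauchy_Schwarz_ineq2)
      also have "\<dots> \<le> K * norm (w x)" using elim by (intro mult_right_mono) auto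
      finally show ?case by simp
    qed
  qed
  show ?thesis
  proof (intro exI[of _ h] conjI allI impI)
    show "h \<in> borel_measurable M" by (rule h(1))
    show "(LINT x|M. h x \<bullet> w x) = l" if w: "integrable M w" and l: "(\<lambda>n. LINT x|M. u n x \<bullet> w x) \<longlonglongrightarrow> l" for w l
    proof -
      have "(\<lambda>n. LINT x|M. H n x \<bullet> w x) \<longlonglongrightarrow> l"
        unfolding eq[OF w] by (rule convex_tail_tendsto[OF c l])
      then show ?thesis using lim[OF w] LIMSEQ_unique by blast
    qed
    show "(LINT x|M. h x \<bullet> w x) \<le> a" if w: "integrable M w" and a: "\<forall>n. (LINT x|M. u n x \<bullet> w x) \<le> a" for w a
    proof -
      have "(LINT x|M. H n x \<bullet> w x) \<le> a" for n
      proof -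
        have "(\<Sum>k\<le>m n. c n k *\<^sub>R (LINT x|M. u k x \<bullet> w x)) \<le> (\<Sum>k\<le>m n. c n k * a)"
          by (rule sum_mono) (use a c in \<open>simp add: mult_left_mono\<close>)
        also have "\<dots> = a" using c(3)[of n] by (simp flip: sum_distrib_right)
        finally show ?thesis by (simp only: eq[OF w])
      qed
      then show ?thesis by (intro tendsto_upperbound[OF lim[OF w]]) auto
    qed
    show "AE x in M. norm (T (h x)) \<le> B"
      if T: "bounded_linear T" and B: "\<forall>n. AE x in M. norm (T (u n x)) \<le> B" for T :: "'b \<Rightarrow> 'c" and B
    proof -
      have "AE x in M. \<forall>k. norm (T (u k x)) \<le> B" using B by (simp add: AE_all_countable)
      then show ?thesis
        using h(2)
      proof eventually_elim
        case (elim x)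
        have "T (\<Sum>k\<le>m n. c n k *\<^sub>R u k x) = (\<Sum>k\<le>m n. c n k *\<^sub>R T (u k x))" for n
          using T by (simp add: linear_sum linear_scale bounded_linear.linear)
        then have "norm (T (\<Sum>k\<le>m n. c n k *\<^sub>R u k x)) \<le> B" for n
          using elim(1) by (auto intro!: convex_tail_norm_le[of "c n" n] c)
        then show ?case
          by (intro tendsto_upperbound[OF tendsto_norm[OF bounded_linear.tendsto[OF T elim(2)]]]) auto
      qed
    qed
  qed
qed

end

text \<open>For \<open>s > 0\<close> this is
  \<open>sqrt (s\<^sup>2 + \<bar>p\<bar>\<^sup>2) - s\<close>, a smooth convex function that
  vanishes at \<open>0\<close> and stays within \<open>s\<close> of \<open>\<bar>p\<bar>\<close>.
  The norm of the product space makes triangle inequalities available.\<close>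

definition soft_norm :: "real \<Rightarrow> 'b::euclidean_space \<Rightarrow> real" where
  "soft_norm s p = norm (s, p) - s"

definition soft_grad :: "real \<Rightarrow> 'b::euclidean_space \<Rightarrow> 'b" where
  "soft_grad s p = p /\<^sub>R norm (s, p)"

lemma norm_Pair_pos: "0 < s \<Longrightarrow> 0 < norm (s::real, p)"
  by (rule less_le_trans[OF _ norm_fst_le]) simp

lemma soft_norm_nonneg: "0 \<le> soft_norm s p"
  using norm_fst_le[of s p] by (simp add: soft_norm_def)

lemma soft_norm_le: "0 < s \<Longrightarrow> soft_norm s p \<le> norm p"
  using norm_Pair_le[of s p] by (simp add: soft_norm_def)

lemma norm_le_soft_norm: "norm p \<le> soft_norm s p + s"
  using norm_snd_le[of p s] by (simp add: soft_norm_def)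

lemma soft_norm_lipschitz: "\<bar>soft_norm s p - soft_norm s q\<bar> \<le> norm (p - q)"
proof -
  have "\<bar>soft_norm s p - soft_norm s q\<bar> \<le> norm ((s, p) - (s, q))"
    unfolding soft_norm_def using norm_triangle_ineq3[of "(s, p)" "(s, q)"] by simp
  then show ?thesis by (simp add: norm_Pair)
qed

lemma norm_soft_grad:
  assumes "0 < s" shows "norm (soft_grad s p) \<le> 1"
proof -
  have "norm (soft_grad s p) = norm p / norm (s, p)"
    by (simp add: soft_grad_def divide_inverse mult.commute)
  then show ?thesis
    using norm_snd_le[of p s] norm_Pair_pos[OF assms, of p] by (simp add: divide_le_eq)
qed

lemma norm_Pair_sq: "(norm (s::real, p))\<^sup>2 = s\<^sup>2 + p \<bullet> p"
  by (simp add: norm_Pair power2_norm_eq_inner)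

text \<open>A convex function vanishing at \<open>0\<close> is at most its derivative at
  \<open>p\<close> in the direction \<open>p\<close>.\<close>

lemma soft_grad_inner_self:
  assumes "0 < s" shows "soft_norm s p \<le> soft_grad s p \<bullet> p"
proof -
  let ?N = "norm (s, p)"
  have N: "0 < ?N" "s \<le> ?N" using norm_Pair_pos[OF assms] norm_fst_le[of s p] by auto
  have "s * s \<le> s * ?N" using N assms by (intro mult_left_mono) auto
  then have "(?N - s) * ?N \<le> p \<bullet> p"
    using norm_Pair_sq[of s p] by (simp add: power2_eq_square left_diff_distrib)
  then have "?N - s \<le> (p \<bullet> p) / ?N" using N by (simp add: le_divide_eq)
  then show ?thesis by (simp add: soft_norm_def soft_grad_def divide_inverse mult.commute)
qed

text \<open>Comes from \<open>2 * a * b \<le> a\<^sup>2 + b\<^sup>2\<close> for the two product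
  norms. The constant \<open>1 / (2 * s)\<close> is the curvature that the smoothing
  introduces.\<close>

lemma soft_norm_taylor:
  assumes s: "0 < s"
  shows "soft_norm s (p + q) \<le> soft_norm s p + soft_grad s p \<bullet> q + (norm q)\<^sup>2 / (2 * s)"
proof -
  let ?N = "norm (s, p)" and ?N' = "norm (s, p + q)"
  have N: "0 < ?N" "s \<le> ?N" using norm_Pair_pos[OF s] norm_fst_le[of s p] by auto
  have "2 * ?N' * ?N \<le> ?N'\<^sup>2 + ?N\<^sup>2" using sum_squares_bound[of ?N' ?N] .
  also have "\<dots> = 2 * ?N\<^sup>2 + 2 * (p \<bullet> q) + (norm q)\<^sup>2"
    by (simp add: norm_Pair_sq inner_add_left inner_add_right inner_commute power2_norm_eq_inner)
  finally have "?N' \<le> (2 * ?N\<^sup>2 + 2 * (p \<bullet> q) + (norm q)\<^sup>2) / (2 * ?N)"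
    using N by (simp add: le_divide_eq mult.commute mult.left_commute)
  also have "\<dots> = ?N + (p \<bullet> q) / ?N + (norm q)\<^sup>2 / (2 * ?N)"
    using N by (simp add: add_divide_distrib power2_eq_square)
  also have "(norm q)\<^sup>2 / (2 * ?N) \<le> (norm q)\<^sup>2 / (2 * s)"
    using N s by (intro divide_left_mono) auto
  finally have "?N' \<le> ?N + (p \<bullet> q) / ?N + (norm q)\<^sup>2 / (2 * s)" by simp
  moreover have "soft_grad s p \<bullet> q = (p \<bullet> q) / ?N"
    by (simp add: soft_grad_def divide_inverse mult.commute)
  ultimately show ?thesis
    unfolding soft_norm_def by linarith
qed

lemma soft_norm_measurable [measurable (raw)]:
  "s \<in> borel_measurable N \<Longrightarrow> p \<in> borel_measurable N \<Longrightarrow> (\<lambda>x. soft_norm (s x) (p x)) \<in> borel_measurable N"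
  unfolding soft_norm_def by measurable

lemma soft_grad_measurable [measurable (raw)]:
  "s \<in> borel_measurable N \<Longrightarrow> p \<in> borel_measurable N \<Longrightarrow> (\<lambda>x. soft_grad (s x) (p x)) \<in> borel_measurable N"
  unfolding soft_grad_def by measurable

text \<open>The quadratic remainder of a test function involves \<open>1 / s\<close>, hence the
  lower bound on compact sets. Integrability of the smoothing parameter enters later, in
  \<open>smooth_approximation\<close>.\<close>

locale smoothed_energy = radon_L1 M f for M :: "'a::euclidean_space measure" and f +
  fixes s :: "'a \<Rightarrow> real" and k :: real
  assumes s_meas [measurable]: "s \<in> borel_measurable M" and s_pos: "\<And>x. 0 < s x"
    and s_lower: "\<And>K. compact K \<Longrightarrow> \<exists>\<delta>>0. \<forall>x\<in>K. \<delta> \<le> s x"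
    and k: "0 < k"
begin

lemma soft_norm_integrable:
  fixes p :: "'a \<Rightarrow> 'b::euclidean_space"
  assumes p: "integrable M p" shows "integrable M (\<lambda>x. soft_norm (s x) (p x))"
proof (rule Bochner_Integration.integrable_bound[OF p])
  have "p \<in> borel_measurable M" using p by simp
  then show "(\<lambda>x. soft_norm (s x) (p x)) \<in> borel_measurable M" by measurable
qed (simp add: soft_norm_nonneg soft_norm_le s_pos)

lemma soft_grad_inner_integrable:
  fixes p q :: "'a \<Rightarrow> 'b::euclidean_space"
  assumes p: "p \<in> borel_measurable M" and q: "integrable M q"
  shows "integrable M (\<lambda>x. soft_grad (s x) (p x) \<bullet> q x)"
proof (rule Bochner_Integration.integrable_bound[OF q])
  have "q \<in> borel_measurable M" using q by simp
  then show "(\<lambda>x. soft_grad (s x) (p x) \<bullet> q x) \<in> borel_measurable M" using p by measurable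
  have "\<bar>soft_grad (s x) (p x) \<bullet> q x\<bar> \<le> 1 * norm (q x)" for x
    by (rule order_trans[OF Cauchy_Schwarz_ineq2]) (intro mult_right_mono norm_soft_grad s_pos, simp)
  then show "AE x in M. norm (soft_grad (s x) (p x) \<bullet> q x) \<le> norm (q x)" by simp
qed

text \<open>A penalized total variation: the \<open>L\<^sup>1\<close> distance to \<open>f\<close>
  has weight \<open>k\<close>, and both norms are smoothed.\<close>

definition J where
  "J \<phi> = (LINT x|M. soft_norm (s x) (grad \<phi> x)) + k * (LINT x|M. soft_norm (s x) (\<phi> x - f x))"

definition dJ where
  "dJ \<phi> \<eta> = (LINT x|M. soft_grad (s x) (grad \<phi> x) \<bullet> grad \<eta> x) + k * (LINT x|M. soft_grad (s x) (\<phi> x - f x) \<bullet> \<eta> x)"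

text \<open>Bound for the quadratic remainder of \<open>J\<close>. It is independent of the base
  point, so one estimate serves a whole minimizing sequence.\<close>

definition ddJ where
  "ddJ \<eta> = (LINT x|M. (norm (grad \<eta> x))\<^sup>2 / (2 * s x)) + k * (LINT x|M. (norm (\<eta> x))\<^sup>2 / (2 * s x))"

lemma J_nonneg: "0 \<le> J \<phi>"
  unfolding J_def using k by (intro add_nonneg_nonneg mult_nonneg_nonneg Bochner_Integration.integral_nonneg) (auto simp: soft_norm_nonneg)

lemma Cinf_c_integrable: "\<phi> \<in> Cinf_c \<Longrightarrow> integrable M \<phi>"
  by (rule LIP_c_integrable[OF Cinf_c_LIP_c])

lemma diff_integrable: "\<phi> \<in> Cinf_c \<Longrightarrow> integrable M (\<lambda>x. \<phi> x - f x)"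
  by (intro Bochner_Integration.integrable_diff Cinf_c_integrable f)

lemma weighted_square_integrable:
  fixes q :: "'a \<Rightarrow> 'b::euclidean_space"
  assumes q: "q \<in> borel_measurable M" and K: "compact K" "\<And>x. x \<notin> K \<Longrightarrow> q x = 0" and B: "\<And>x. norm (q x) \<le> B"
  shows "integrable M (\<lambda>x. (norm (q x))\<^sup>2 / (2 * s x))"
proof -
  obtain \<delta> where \<delta>: "\<delta> > 0" "\<And>x. x \<in> K \<Longrightarrow> \<delta> \<le> s x" using s_lower[OF K(1)] by blast
  show ?thesis
  proof (rule integrable_compact_support[OF radon _ K(1)])
    show "(\<lambda>x. (norm (q x))\<^sup>2 / (2 * s x)) \<in> borel_measurable M" using q by measurable
    have "(norm (q x))\<^sup>2 / (2 * s x) \<le> B\<^sup>2 / (2 * \<delta>)" if "x \<in> K" for x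
      using \<delta>(1) \<delta>(2)[OF that] B[of x] by (intro frac_le power_mono) auto
    then have "norm ((norm (q x))\<^sup>2 / (2 * s x)) \<le> B\<^sup>2 / (2 * \<delta>)" for x
      using s_pos[of x] K(2)[of x] \<delta>(1) by (cases "x \<in> K") (auto simp: abs_of_nonneg)
    then show "AE x in M. norm ((norm (q x))\<^sup>2 / (2 * s x)) \<le> B\<^sup>2 / (2 * \<delta>)" by simp
  qed (use K in auto)
qed

lemma weighted_square_integrable_Cinf_c:
  assumes "\<eta> \<in> Cinf_c"
  shows "integrable M (\<lambda>x. (norm (grad \<eta> x))\<^sup>2 / (2 * s x))" "integrable M (\<lambda>x. (norm (\<eta> x))\<^sup>2 / (2 * s x))"
proof -
  obtain K B where K: "compact K" "\<And>x. x \<notin> K \<Longrightarrow> \<eta> x = 0" "\<And>x. x \<notin> K \<Longrightarrow> grad \<eta> x = 0"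
    "\<And>x. \<bar>\<eta> x\<bar> \<le> B" "\<And>x. norm (grad \<eta> x) \<le> B"
    by (rule Cinf_c_bounded[OF assms], rule that)
  show "integrable M (\<lambda>x. (norm (grad \<eta> x))\<^sup>2 / (2 * s x))"
    by (rule weighted_square_integrable[OF grad_measurable[OF assms] K(1,3,5)])
  show "integrable M (\<lambda>x. (norm (\<eta> x))\<^sup>2 / (2 * s x))"
    by (rule weighted_square_integrable[OF Cinf_c_measurable[OF assms] K(1,2), of B]) (use K in auto)
qed

lemma J_taylor:
  assumes \<phi>: "\<phi> \<in> Cinf_c" and \<eta>: "\<eta> \<in> Cinf_c"
  shows "J (\<lambda>x. \<phi> x + t * \<eta> x) \<le> J \<phi> + t * dJ \<phi> \<eta> + t\<^sup>2 * ddJ \<eta>"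
proof -
  have e: "(\<lambda>x. t * \<eta> x) \<in> Cinf_c" by (rule Cinf_c_cmult[OF \<eta>])
  have pe: "(\<lambda>x. \<phi> x + t * \<eta> x) \<in> Cinf_c" by (rule Cinf_c_add[OF \<phi> e])
  have gr: "grad (\<lambda>x. \<phi> x + t * \<eta> x) x = grad \<phi> x + t *\<^sub>R grad \<eta> x" for x
    using Cinf_c_differentiable[OF \<phi>] Cinf_c_differentiable[OF \<eta>] Cinf_c_differentiable[OF e]
    by (simp add: grad_add grad_cmult)
  note i1 = soft_norm_integrable[OF grad_integrable[OF \<phi>]]
    and i2 = soft_grad_inner_integrable[OF grad_measurable[OF \<phi>] grad_integrable[OF \<eta>]]
    and i3 = weighted_square_integrable_Cinf_c[OF \<eta>]
    and i4 = soft_norm_integrable[OF diff_integrable[OF \<phi>]]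
  have dm: "(\<lambda>x. \<phi> x - f x) \<in> borel_measurable M" using diff_integrable[OF \<phi>] by simp
  note i5 = soft_grad_inner_integrable[OF dm Cinf_c_integrable[OF \<eta>]]
  have pt: "soft_norm (s x) (p + t *\<^sub>R q) \<le> soft_norm (s x) p + t * (soft_grad (s x) p \<bullet> q) + t\<^sup>2 * ((norm q)\<^sup>2 / (2 * s x))"
    for x and p q :: "'b::euclidean_space"
    using soft_norm_taylor[OF s_pos, of x p "t *\<^sub>R q"] by (simp add: power_mult_distrib)
  have "(LINT x|M. soft_norm (s x) (grad (\<lambda>x. \<phi> x + t * \<eta> x) x)) \<le>
      (LINT x|M. soft_norm (s x) (grad \<phi> x) + t * (soft_grad (s x) (grad \<phi> x) \<bullet> grad \<eta> x) + t\<^sup>2 * ((norm (grad \<eta> x))\<^sup>2 / (2 * s x)))"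
    by (rule Bochner_Integration.integral_mono[OF soft_norm_integrable[OF grad_integrable[OF pe]]])
      (intro Bochner_Integration.integrable_add integrable_mult_right i1 i2 i3(1), simp only: gr pt)
  also have "\<dots> = (LINT x|M. soft_norm (s x) (grad \<phi> x)) + t * (LINT x|M. soft_grad (s x) (grad \<phi> x) \<bullet> grad \<eta> x) +
      t\<^sup>2 * (LINT x|M. (norm (grad \<eta> x))\<^sup>2 / (2 * s x))"
    using i1 i2 i3 by (simp del: times_divide_eq_right)
  finally have A: "(LINT x|M. soft_norm (s x) (grad (\<lambda>x. \<phi> x + t * \<eta> x) x)) \<le> \<dots>" .
  have "(LINT x|M. soft_norm (s x) (\<phi> x + t * \<eta> x - f x)) \<le>
      (LINT x|M. soft_norm (s x) (\<phi> x - f x) + t * (soft_grad (s x) (\<phi> x - f x) \<bullet> \<eta> x) + t\<^sup>2 * ((norm (\<eta> x))\<^sup>2 / (2 * s x)))"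
  proof (rule Bochner_Integration.integral_mono[OF soft_norm_integrable[OF diff_integrable[OF pe]]])
    show "soft_norm (s x) (\<phi> x + t * \<eta> x - f x) \<le>
      soft_norm (s x) (\<phi> x - f x) + t * (soft_grad (s x) (\<phi> x - f x) \<bullet> \<eta> x) + t\<^sup>2 * ((norm (\<eta> x))\<^sup>2 / (2 * s x))" for x
      using pt[of x "\<phi> x - f x" "\<eta> x"] by (simp add: algebra_simps)
  qed (use i3 i4 i5 in \<open>auto simp del: times_divide_eq_right\<close>)
  also have "\<dots> = (LINT x|M. soft_norm (s x) (\<phi> x - f x)) + t * (LINT x|M. soft_grad (s x) (\<phi> x - f x) \<bullet> \<eta> x) +
      t\<^sup>2 * (LINT x|M. (norm (\<eta> x))\<^sup>2 / (2 * s x))"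
    using i3 i4 i5 by (simp del: times_divide_eq_right)
  finally have B: "k * (LINT x|M. soft_norm (s x) (\<phi> x + t * \<eta> x - f x)) \<le> k * \<dots>"
    using k by (intro mult_left_mono) auto
  show ?thesis
    using add_mono[OF A B] by (simp add: J_def dJ_def ddJ_def algebra_simps)
qed

lemma dJ_scale: "dJ \<phi> (\<lambda>x. t * \<eta> x) = t * dJ \<phi> \<eta>" if "\<eta> \<in> Cinf_c"
proof -
  have "grad (\<lambda>x. t * \<eta> x) x = t *\<^sub>R grad \<eta> x" for x
    by (rule grad_cmult[OF Cinf_c_differentiable[OF that]])
  then show ?thesis
    unfolding dJ_def by (simp add: distrib_left mult.left_commute)
qed

text \<open>Provides the continuity along a ray that makes a minimum on a segment exist.\<close>

lemma J_ray_lipschitz: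
  assumes \<phi>: "\<phi> \<in> Cinf_c"
  shows "\<bar>J (\<lambda>x. a * \<phi> x) - J (\<lambda>x. b * \<phi> x)\<bar> \<le>
    ((LINT x|M. norm (grad \<phi> x)) + k * (LINT x|M. \<bar>\<phi> x\<bar>)) * \<bar>a - b\<bar>"
proof -
  have c: "(\<lambda>x. a * \<phi> x) \<in> Cinf_c" for a by (rule Cinf_c_cmult[OF \<phi>])
  have gr: "grad (\<lambda>x. a * \<phi> x) x = a *\<^sub>R grad \<phi> x" for x a
    by (rule grad_cmult[OF Cinf_c_differentiable[OF \<phi>]])
  have gen: "\<bar>(LINT x|M. soft_norm (s x) (P x)) - (LINT x|M. soft_norm (s x) (Q x))\<bar> \<le> (LINT x|M. norm (R x)) * \<bar>a - b\<bar>"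
    if P: "integrable M P" and Q: "integrable M Q" and R: "integrable M R" and PQ: "\<And>x. P x - Q x = (a - b) *\<^sub>R R x"
    for P Q R :: "'a \<Rightarrow> 'b::euclidean_space"
  proof -
    note i = soft_norm_integrable[OF P] soft_norm_integrable[OF Q]
    have "\<bar>(LINT x|M. soft_norm (s x) (P x)) - (LINT x|M. soft_norm (s x) (Q x))\<bar> =
        \<bar>LINT x|M. soft_norm (s x) (P x) - soft_norm (s x) (Q x)\<bar>" using i by simp
    also have "\<dots> \<le> (LINT x|M. \<bar>soft_norm (s x) (P x) - soft_norm (s x) (Q x)\<bar>)"
      by (rule integral_abs_bound)
    also have "\<dots> \<le> (LINT x|M. norm (R x) * \<bar>a - b\<bar>)"
    proof (rule Bochner_Integration.integral_mono)
      show "\<bar>soft_norm (s x) (P x) - soft_norm (s x) (Q x)\<bar> \<le> norm (R x) * \<bar>a - b\<bar>" for x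
        using soft_norm_lipschitz[of "s x" "P x" "Q x"] by (simp add: PQ mult.commute)
    qed (use i R in auto)
    finally show ?thesis by simp
  qed
  have 1: "\<bar>(LINT x|M. soft_norm (s x) (grad (\<lambda>x. a * \<phi> x) x)) - (LINT x|M. soft_norm (s x) (grad (\<lambda>x. b * \<phi> x) x))\<bar> \<le>
      (LINT x|M. norm (grad \<phi> x)) * \<bar>a - b\<bar>"
    by (rule gen[OF grad_integrable[OF c] grad_integrable[OF c] grad_integrable[OF \<phi>]]) (simp add: gr scaleR_diff_left)
  have 2: "\<bar>(LINT x|M. soft_norm (s x) (a * \<phi> x - f x)) - (LINT x|M. soft_norm (s x) (b * \<phi> x - f x))\<bar> \<le>
      (LINT x|M. norm (\<phi> x)) * \<bar>a - b\<bar>"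
    by (rule gen[OF diff_integrable[OF c] diff_integrable[OF c] Cinf_c_integrable[OF \<phi>]]) (simp add: left_diff_distrib)
  have "\<bar>k * (LINT x|M. soft_norm (s x) (a * \<phi> x - f x)) - k * (LINT x|M. soft_norm (s x) (b * \<phi> x - f x))\<bar> \<le>
      k * ((LINT x|M. norm (\<phi> x)) * \<bar>a - b\<bar>)"
    using mult_left_mono[OF 2, of k] k by (simp add: abs_mult flip: right_diff_distrib)
  then show ?thesis
    using 1 unfolding J_def by (simp add: algebra_simps)
qed

text \<open>Minimality along the segment from \<open>0\<close> to \<open>\<phi>\<close> already gives the sign condition of the
  duality estimate \<open>J_le_dual\<close>, so no minimizer over all test functions is needed.\<close>

lemma J_ray_minimum:
  assumes \<phi>: "\<phi> \<in> Cinf_c"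
  obtains \<psi> where "\<psi> \<in> Cinf_c" "J \<psi> \<le> J \<phi>" "dJ \<psi> \<psi> \<le> 0"
proof -
  let ?j = "\<lambda>t. J (\<lambda>x. t * \<phi> x)"
  define L where "L = (LINT x|M. norm (grad \<phi> x)) + k * (LINT x|M. \<bar>\<phi> x\<bar>)"
  have "L-lipschitz_on {0..1} ?j"
    by (rule lipschitz_onI)
      (use k J_ray_lipschitz[OF \<phi>] in \<open>auto simp: L_def dist_real_def intro!: add_nonneg_nonneg mult_nonneg_nonneg Bochner_Integration.integral_nonneg\<close>)
  then have "continuous_on {0..1} ?j" by (rule lipschitz_on_continuous_on)
  then obtain t where t: "t \<in> {0..1}" "\<And>u. u \<in> {0..1} \<Longrightarrow> ?j t \<le> ?j u"
    using continuous_attains_inf[of "{0..1::real}" ?j] by auto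
  have c: "(\<lambda>x. t * \<phi> x) \<in> Cinf_c" by (rule Cinf_c_cmult[OF \<phi>])
  have "t * dJ (\<lambda>x. t * \<phi> x) \<phi> \<le> 0"
  proof (cases "t = 0")
    case False
    let ?D = "dJ (\<lambda>x. t * \<phi> x) \<phi>"
    \<comment> \<open>Moving back from \<open>t\<close> towards \<open>0\<close> stays in the
      segment even for \<open>t = 1\<close> and gives the one-sided condition. For
      \<open>t = 0\<close> the factor \<open>t\<close> makes the claim trivial.\<close>
    have "?D \<le> \<tau> * ddJ \<phi>" if \<tau>: "0 < \<tau>" "\<tau> < t" for \<tau>
    proof -
      have eq: "(\<lambda>x. t * \<phi> x + (- \<tau>) * \<phi> x) = (\<lambda>x. (t - \<tau>) * \<phi> x)" by (simp add: left_diff_distrib)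
      have "?j t \<le> ?j (t - \<tau>)" by (rule t(2)) (use t(1) \<tau> in auto)
      also have "\<dots> \<le> ?j t + (- \<tau>) * ?D + (- \<tau>)\<^sup>2 * ddJ \<phi>"
        using J_taylor[OF c \<phi>, of "- \<tau>"] unfolding eq .
      finally have "\<tau> * ?D \<le> \<tau> * (\<tau> * ddJ \<phi>)" by (simp add: power2_eq_square mult.assoc)
      then show ?thesis using \<tau> by simp
    qed
    then have ev: "\<forall>\<^sub>F \<tau> in at_right 0. ?D \<le> \<tau> * ddJ \<phi>"
      using t(1) False by (auto simp: eventually_at_right_field intro!: exI[of _ t])
    have "((\<lambda>\<tau>. \<tau> * ddJ \<phi>) \<longlongrightarrow> 0 * ddJ \<phi>) (at_right 0)"
      by (intro tendsto_mult tendsto_ident_at tendsto_const)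
    then have "?D \<le> 0" using tendsto_lowerbound[OF _ ev] by simp
    then show ?thesis using t(1) by (simp add: mult_nonneg_nonpos)
  qed simp
  then have "dJ (\<lambda>x. t * \<phi> x) (\<lambda>x. t * \<phi> x) \<le> 0" by (simp add: dJ_scale[OF \<phi>])
  moreover have "?j t \<le> ?j 1" by (rule t(2)) simp
  ultimately show ?thesis using that c by simp
qed

text \<open>Both smoothed norms are bounded by their radial derivatives. These would add up to
  \<open>dJ \<phi> \<phi>\<close>, but the second direction is \<open>\<phi> - f\<close> in place of
  \<open>\<phi>\<close>, which leaves the term with \<open>f\<close>.\<close>

lemma J_le_dual:
  assumes \<phi>: "\<phi> \<in> Cinf_c" and d: "dJ \<phi> \<phi> \<le> 0"
  shows "J \<phi> \<le> - (LINT x|M. (k * soft_grad (s x) (\<phi> x - f x)) * f x)"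
proof -
  have dm: "(\<lambda>x. \<phi> x - f x) \<in> borel_measurable M" using diff_integrable[OF \<phi>] by simp
  note i1 = soft_grad_inner_integrable[OF grad_measurable[OF \<phi>] grad_integrable[OF \<phi>]]
  note i2 = soft_grad_inner_integrable[OF dm diff_integrable[OF \<phi>]]
  note i3 = soft_grad_inner_integrable[OF dm f]
  have A: "(LINT x|M. soft_norm (s x) (grad \<phi> x)) \<le> (LINT x|M. soft_grad (s x) (grad \<phi> x) \<bullet> grad \<phi> x)"
    by (rule Bochner_Integration.integral_mono[OF soft_norm_integrable[OF grad_integrable[OF \<phi>]] i1])
      (rule soft_grad_inner_self[OF s_pos])
  have B: "(LINT x|M. soft_norm (s x) (\<phi> x - f x)) \<le> (LINT x|M. soft_grad (s x) (\<phi> x - f x) \<bullet> (\<phi> x - f x))"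
    by (rule Bochner_Integration.integral_mono[OF soft_norm_integrable[OF diff_integrable[OF \<phi>]] i2])
      (rule soft_grad_inner_self[OF s_pos])
  have C: "(LINT x|M. soft_grad (s x) (\<phi> x - f x) \<bullet> \<phi> x) =
      (LINT x|M. soft_grad (s x) (\<phi> x - f x) \<bullet> (\<phi> x - f x)) + (LINT x|M. soft_grad (s x) (\<phi> x - f x) \<bullet> f x)"
    using i2 i3 by (subst Bochner_Integration.integral_add[symmetric]) (auto simp: algebra_simps)
  have "J \<phi> \<le> dJ \<phi> \<phi> - k * (LINT x|M. soft_grad (s x) (\<phi> x - f x) \<bullet> f x)"
    unfolding J_def dJ_def C distrib_left using A mult_left_mono[OF B less_imp_le[OF k]] by linarith
  then show ?thesis using d by (simp add: mult.assoc)
qed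

text \<open>The Euler-Lagrange equation is reached only in the limit of a minimizing sequence. The
  two soft gradients are kept as one pair, which forces the same convex combinations on the field
  and on its divergence.\<close>

lemma exists_near_minimizer:
  assumes B: "BV_seminorm M f = ennreal B" "0 \<le> B" and e: "0 < e"
  obtains \<phi> where "\<phi> \<in> Cinf_c" "J \<phi> \<le> B + e"
proof -
  define I where "I = Inf (J ` Cinf_c)"
  have bb: "bdd_below (J ` Cinf_c)" by (rule bdd_belowI[of _ 0]) (use J_nonneg in auto)
  have I_le: "I \<le> J \<phi>" if "\<phi> \<in> Cinf_c" for \<phi>
    unfolding I_def by (rule cINF_lower[OF bb that])
  have I0: "0 \<le> I" unfolding I_def by (rule cINF_greatest) (use Cinf_c_0 J_nonneg in auto)
  have near: "\<exists>\<phi>. \<phi> \<in> Cinf_c \<and> J \<phi> < I + d" if "0 < d" for d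
    using cInf_lessD[of "J ` Cinf_c" "I + d"] Cinf_c_0 that by (auto simp: I_def)
  have "\<exists>\<psi>. \<psi> \<in> Cinf_c \<and> J \<psi> \<le> I + 1 / Suc n \<and> dJ \<psi> \<psi> \<le> 0" for n
  proof -
    obtain \<phi> where \<phi>: "\<phi> \<in> Cinf_c" "J \<phi> < I + 1 / Suc n" using near[of "1 / Suc n"] by auto
    obtain \<psi> where "\<psi> \<in> Cinf_c" "J \<psi> \<le> J \<phi>" "dJ \<psi> \<psi> \<le> 0" by (rule J_ray_minimum[OF \<phi>(1)])
    then show ?thesis using \<phi>(2) by (intro exI[of _ \<psi>]) auto
  qed
  then obtain \<psi> where \<psi>: "\<And>n. \<psi> n \<in> Cinf_c" "\<And>n. J (\<psi> n) \<le> I + 1 / Suc n" "\<And>n. dJ (\<psi> n) (\<psi> n) \<le> 0"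
    by metis
  have dm: "(\<lambda>x. \<psi> n x - f x) \<in> borel_measurable M" for n using diff_integrable[OF \<psi>(1)] by simp
  define u where "u n x = (soft_grad (s x) (grad (\<psi> n) x), k * soft_grad (s x) (\<psi> n x - f x))" for n x
  have um: "u n \<in> borel_measurable M" for n
    unfolding u_def using dm[of n] grad_measurable[OF \<psi>(1)[of n]] by measurable
  have u1: "norm (fst (u n x)) \<le> 1" and u2: "norm (snd (u n x)) \<le> k" for n x
    using norm_soft_grad[OF s_pos] k mult_left_mono[OF norm_soft_grad[OF s_pos], of k x "\<psi> n x - f x"]
    by (auto simp: u_def abs_mult)
  have uK: "norm (u n x) \<le> 1 + k" for n x
    using norm_Pair_le[of "fst (u n x)" "snd (u n x)"] u1[of n x] u2[of n x] by simp
  have EL: "(\<lambda>n. dJ (\<psi> n) \<eta>) \<longlonglongrightarrow> 0" if \<eta>: "\<eta> \<in> Cinf_c" for \<eta>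
  proof -
    \<comment> \<open>Near-minimality with gap \<open>t\<^sup>2 = 1 / Suc n\<close>, tested with the
      steps \<open>t\<close> and \<open>- t\<close>, bounds the first variation by a multiple of
      \<open>t\<close>.\<close>
    have "\<bar>dJ (\<psi> n) \<eta>\<bar> \<le> (1 + ddJ \<eta>) * sqrt (1 / Suc n)" for n
    proof -
      define t where "t = sqrt (1 / Suc n)"
      have t: "0 < t" "t\<^sup>2 = 1 / Suc n" by (simp_all add: t_def)
      have "I \<le> J (\<psi> n) + r * dJ (\<psi> n) \<eta> + r\<^sup>2 * ddJ \<eta>" for r
        using I_le[OF Cinf_c_add[OF \<psi>(1) Cinf_c_cmult[OF \<eta>]], of n r] J_taylor[OF \<psi>(1) \<eta>, of n r] by linarith
      then have *: "0 \<le> t\<^sup>2 + r * dJ (\<psi> n) \<eta> + r\<^sup>2 * ddJ \<eta>" for r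
        using \<psi>(2)[of n] t(2) by (smt (verit))
      have "t * (- dJ (\<psi> n) \<eta>) \<le> t * ((1 + ddJ \<eta>) * t)"
        using *[of t] by (simp add: algebra_simps power2_eq_square)
      moreover have "t * dJ (\<psi> n) \<eta> \<le> t * ((1 + ddJ \<eta>) * t)"
        using *[of "- t"] by (simp add: algebra_simps power2_eq_square)
      ultimately have "\<bar>dJ (\<psi> n) \<eta>\<bar> \<le> (1 + ddJ \<eta>) * t"
        unfolding abs_le_iff using t(1) by (simp only: mult_le_cancel_left_pos)
      then show ?thesis by (simp only: t_def)
    qed
    moreover have "(\<lambda>n. (1 + ddJ \<eta>) * sqrt (1 / Suc n)) \<longlonglongrightarrow> (1 + ddJ \<eta>) * sqrt 0"
      by (intro tendsto_mult tendsto_const tendsto_real_sqrt lim_1_over_n[THEN LIMSEQ_Suc])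
    ultimately show ?thesis
      by (intro Lim_null_comparison[of "\<lambda>n. dJ (\<psi> n) \<eta>" "\<lambda>n. (1 + ddJ \<eta>) * sqrt (1 / Suc n)"]) auto
  qed
  obtain h where h: "h \<in> borel_measurable M"
    "\<And>w l. integrable M w \<Longrightarrow> (\<lambda>n. LINT x|M. u n x \<bullet> w x) \<longlonglongrightarrow> l \<Longrightarrow> (LINT x|M. h x \<bullet> w x) = l"
    "\<And>w a. integrable M w \<Longrightarrow> (\<And>n. (LINT x|M. u n x \<bullet> w x) \<le> a) \<Longrightarrow> (LINT x|M. h x \<bullet> w x) \<le> a"
    "\<And>T :: 'a \<times> real \<Rightarrow> 'a \<times> real. \<And>B. bounded_linear T \<Longrightarrow> (\<And>n. AE x in M. norm (T (u n x)) \<le> B) \<Longrightarrow>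
       AE x in M. norm (T (h x)) \<le> B"
    using weak_limit_exists[where u = u and K = "1 + k" and 'c = "'a \<times> real", OF um] uK by auto
  define v g where "v x = fst (h x)" and "g x = snd (h x)" for x
  \<comment> \<open>The two components obey separate bounds. The projections are embedded into the
    product because \<open>T\<close> has been fixed to take values there.\<close>
  have "AE x in M. norm ((\<lambda>p. (fst p, 0::real)) (h x)) \<le> 1"
    by (rule h(4)) (use u1 in \<open>auto intro!: bounded_linear_Pair bounded_linear_fst\<close>)
  then have v1: "AE x in M. norm (v x) \<le> 1" by (simp add: v_def)
  have "AE x in M. norm ((\<lambda>p. (0::'a, snd p)) (h x)) \<le> k"
    by (rule h(4)) (use u2 in \<open>auto intro!: bounded_linear_Pair bounded_linear_snd\<close>)
  then have g1: "AE x in M. norm (g x) \<le> k" by (simp add: g_def norm_Pair)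
  have vm: "v \<in> borel_measurable M" and gm: "g \<in> borel_measurable M"
    unfolding v_def g_def
    by (rule measurable_compose[OF h(1)], rule borel_measurable_continuous_onI, intro continuous_intros)+
  have vL: "v \<in> Linf M" and gL: "g \<in> Linf M" by (rule LinfI[OF vm v1], rule LinfI[OF gm g1])
  have div: "is_div M v g"
    unfolding is_div_def
  proof (intro conjI ballI gL)
    fix \<eta> :: "'a \<Rightarrow> real" assume \<eta>: "\<eta> \<in> Cinf_c"
    have w: "integrable M (\<lambda>x. (grad \<eta> x, \<eta> x))"
    proof (rule Bochner_Integration.integrable_bound)
      show "integrable M (\<lambda>x. norm (grad \<eta> x) + \<bar>\<eta> x\<bar>)"
        using grad_integrable[OF \<eta>] Cinf_c_integrable[OF \<eta>] by simp
      show "(\<lambda>x. (grad \<eta> x, \<eta> x)) \<in> borel_measurable M"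
        using grad_measurable[OF \<eta>] Cinf_c_measurable[OF \<eta>] by measurable
      show "AE x in M. norm (grad \<eta> x, \<eta> x) \<le> norm (norm (grad \<eta> x) + \<bar>\<eta> x\<bar>)"
        using norm_Pair_le[of "grad \<eta> _" "\<eta> _"] by (intro AE_I2) (simp add: abs_of_nonneg)
    qed
    have "(LINT x|M. u n x \<bullet> (grad \<eta> x, \<eta> x)) = dJ (\<psi> n) \<eta>" for n
      using soft_grad_inner_integrable[OF grad_measurable[OF \<psi>(1)[of n]] grad_integrable[OF \<eta>]]
        soft_grad_inner_integrable[OF dm[of n] Cinf_c_integrable[OF \<eta>]]
      by (simp add: u_def dJ_def mult.assoc)
    then have "(LINT x|M. h x \<bullet> (grad \<eta> x, \<eta> x)) = 0"
      using h(2)[OF w, of 0] EL[OF \<eta>] by simp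
    then have "(LINT x|M. grad \<eta> x \<bullet> v x + \<eta> x * g x) = 0"
      by (simp add: inner_prod_def v_def g_def inner_commute mult.commute)
    then show "(LINT x|M. grad \<eta> x \<bullet> v x) = - (LINT x|M. \<eta> x * g x)"
      using integrable_grad_inner[OF \<eta> vL] integrable_LIP_c_mult[OF Cinf_c_LIP_c[OF \<eta>] gL] by simp
  qed
  have "(LINT x|M. h x \<bullet> (0, f x)) \<le> - I"
  proof (rule h(3))
    show "integrable M (\<lambda>x. (0::'a, f x))"
    proof (rule Bochner_Integration.integrable_bound[OF f])
      show "(\<lambda>x. (0::'a, f x)) \<in> borel_measurable M" using f_measurable by measurable
    qed (simp add: norm_Pair)
    show "(LINT x|M. u n x \<bullet> (0, f x)) \<le> - I" for n
      using J_le_dual[OF \<psi>(1)[of n] \<psi>(3)[of n]] I_le[OF \<psi>(1)[of n]] by (simp add: u_def)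
  qed
  then have "I \<le> (LINT x|M. f x * (-1 * g x))"
    by (simp add: g_def mult.commute inner_prod_def)
  \<comment> \<open>The competitor in the seminorm is \<open>- v\<close>, whose divergence is
    \<open>- g\<close>.\<close>
  moreover have "ennreal (LINT x|M. f x * (-1 * g x)) \<le> ennreal B"
    unfolding B(1)[symmetric]
    by (rule BV_seminorm_ge[OF _ is_div_scale[OF div, of "-1"]])
      (rule Linf_scaleR[OF Linf_const vL], use v1 in simp)
  ultimately have "I \<le> B" using B(2) by (simp add: ennreal_le_iff)
  then show ?thesis using near[OF e] that by force
qed

end

section \<open>Test functions of almost optimal energy\<close>

context radon_L1
begin

text \<open>With penalty \<open>k = n + 1\<close> a near-minimizer has energy only slightly above
  the seminorm and distance of order \<open>1 / k\<close> to \<open>f\<close>. Lower semicontinuity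
  supplies the reverse inequality for the limit of the energies.\<close>

lemma smooth_approximation:
  assumes fin: "BV_seminorm M f < \<infinity>"
  obtains F where "\<And>n. F n \<in> Cinf_c" "(\<lambda>n. LINT x|M. \<bar>F n x - f x\<bar>) \<longlonglongrightarrow> 0"
    "(\<lambda>n. \<integral>\<^sup>+x. ennreal (norm (grad (F n) x)) \<partial>M) \<longlonglongrightarrow> BV_seminorm M f"
proof -
  obtain B where B: "BV_seminorm M f = ennreal B" "0 \<le> B"
    using fin by (cases "BV_seminorm M f") auto
  obtain w :: "'a \<Rightarrow> real" where w: "w \<in> borel_measurable M" "\<And>x. 0 < w x" "integrable M w"
    "\<And>K. compact K \<Longrightarrow> \<exists>\<delta>>0. \<forall>x\<in>K. \<delta> \<le> w x"
    by (rule radon_weight[OF radon], rule that)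
  define W where "W = (LINT x|M. w x) + 1"
  have "0 \<le> (LINT x|M. w x)" using w(2) by (intro Bochner_Integration.integral_nonneg) (auto simp: less_imp_le)
  then have W: "0 < W" "(LINT x|M. w x) \<le> W" by (simp_all add: W_def)
  have "\<exists>\<phi>. \<phi> \<in> Cinf_c \<and> (LINT x|M. norm (grad \<phi> x)) \<le> B + 2 / Suc n \<and>
      (LINT x|M. \<bar>\<phi> x - f x\<bar>) \<le> (B + 2) / Suc n" for n
  proof -
    define k where "k = real (Suc n)"
    have k1: "1 \<le> k" by (simp add: k_def)
    \<comment> \<open>Scaled so that \<open>k * k\<close> times the integral of \<open>s\<close> is
      at most \<open>1\<close>: the smoothing error stays below \<open>1 / k\<close> even after
      multiplication by the penalty.\<close>
    define s where "s x = w x / (k * k * W)" for x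
    have kW: "0 < k * k * W" using k1 W by simp
    interpret smoothed_energy M f s k
    proof
      show "s \<in> borel_measurable M" unfolding s_def using w(1) by measurable
      show "0 < s x" for x using w(2) kW by (simp add: s_def)
      show "\<exists>\<delta>>0. \<forall>x\<in>K. \<delta> \<le> s x" if "compact K" for K
      proof -
        obtain \<delta> where "\<delta> > 0" "\<forall>x\<in>K. \<delta> \<le> w x" using w(4)[OF \<open>compact K\<close>] by blast
        then show ?thesis using kW
          by (intro exI[of _ "\<delta> / (k * k * W)"]) (auto simp: s_def intro: divide_right_mono)
      qed
    qed (use k1 in simp)
    have si: "integrable M s" unfolding s_def using w(3) by simp
    have s_int: "k * (k * (LINT x|M. s x)) \<le> 1"
      using W k1 by (simp add: s_def divide_le_eq)
    have s0: "0 \<le> (LINT x|M. s x)" using s_pos by (intro Bochner_Integration.integral_nonneg) (auto simp: less_imp_le)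
    have s_k: "k * (LINT x|M. s x) \<le> 1 / k" using s_int k1 by (simp add: le_divide_eq mult.commute)
    obtain \<phi> where \<phi>: "\<phi> \<in> Cinf_c" "J \<phi> \<le> B + 1 / k"
      by (rule exists_near_minimizer[OF B, of "1 / k"]) (use k1 in auto)
    have soft: "(LINT x|M. norm (p x)) \<le> (LINT x|M. soft_norm (s x) (p x)) + (LINT x|M. s x)"
      if p: "integrable M p" for p :: "'a \<Rightarrow> 'b::euclidean_space"
    proof -
      have "(LINT x|M. norm (p x)) \<le> (LINT x|M. soft_norm (s x) (p x) + s x)"
        by (rule Bochner_Integration.integral_mono)
          (use p soft_norm_integrable[OF p] si norm_le_soft_norm in auto)
      then show ?thesis using soft_norm_integrable[OF p] si by simp
    qed
    let ?A = "LINT x|M. soft_norm (s x) (grad \<phi> x)" and ?B = "LINT x|M. soft_norm (s x) (\<phi> x - f x)"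
    have AB: "0 \<le> ?A" "0 \<le> ?B" by (auto intro!: Bochner_Integration.integral_nonneg simp: soft_norm_nonneg)
    have J: "?A + k * ?B \<le> B + 1 / k" using \<phi>(2) by (simp add: J_def)
    have "(LINT x|M. s x) \<le> k * (LINT x|M. s x)" using mult_right_mono[OF k1 s0] by simp
    moreover have "(LINT x|M. norm (grad \<phi> x)) \<le> B + 2 / k"
    proof -
      have "0 \<le> k * ?B" using AB k1 by simp
      moreover have "2 / k = 1 / k + 1 / k" by simp
      ultimately show ?thesis
        using soft[OF grad_integrable[OF \<phi>(1)]] J AB s_k \<open>(LINT x|M. s x) \<le> _\<close> by linarith
    qed
    moreover have "(LINT x|M. \<bar>\<phi> x - f x\<bar>) \<le> (B + 2) / k"
    proof -
      have "k * (LINT x|M. \<bar>\<phi> x - f x\<bar>) \<le> k * (?B + (LINT x|M. s x))"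
        using soft[OF diff_integrable[OF \<phi>(1)]] k1 by (intro mult_left_mono) auto
      also have "\<dots> \<le> B + 1 / k + 1 / k" using J AB s_k by (simp add: distrib_left)
      also have "\<dots> \<le> B + 2" using k1 by (simp add: divide_le_eq)
      finally show ?thesis using k1 by (simp add: le_divide_eq mult.commute)
    qed
    ultimately show ?thesis using \<phi>(1) by (auto simp: k_def)
  qed
  then obtain F where F: "\<And>n. F n \<in> Cinf_c" "\<And>n. (LINT x|M. norm (grad (F n) x)) \<le> B + 2 / Suc n"
    "\<And>n. (LINT x|M. \<bar>F n x - f x\<bar>) \<le> (B + 2) / Suc n" by metis
  have conv: "(\<lambda>n. LINT x|M. \<bar>F n x - f x\<bar>) \<longlonglongrightarrow> 0"
  proof (rule tendsto_sandwich[OF _ _ tendsto_const])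
    have "(\<lambda>n. (B + 2) * (1 / real (Suc n))) \<longlonglongrightarrow> (B + 2) * 0"
      by (intro tendsto_mult tendsto_const lim_1_over_n[THEN LIMSEQ_Suc])
    then show "(\<lambda>n. (B + 2) / real (Suc n)) \<longlonglongrightarrow> 0" by simp
  qed (use F(3) in auto)
  have L1: "L1_converges M UNIV F f"
    unfolding L1_converges_def using conv LIP_c_integrable[OF Cinf_c_LIP_c[OF F(1)]]
    by (simp add: set_integrable_def set_lebesgue_integral_def)
  let ?G = "\<lambda>n. \<integral>\<^sup>+x. ennreal (norm (grad (F n) x)) \<partial>M"
  have G_le: "?G n \<le> ennreal (B + 2 / Suc n)" for n
    using grad_integrable[OF F(1)[of n]] F(2)[of n] by (subst nn_integral_eq_integral) (auto intro: ennreal_leI)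
  have "BV_seminorm M f \<le> var_Cinf_open M f UNIV"
    unfolding BV_seminorm_eq
    using var_open_le_var_Lip_open[OF open_UNIV] var_Lip_open_le_var_Cinf_open[OF open_UNIV] by (rule order_trans)
  also have "\<dots> \<le> liminf ?G"
    unfolding var_Cinf_open_def by (rule INF_lower2[of F]) (use L1 F(1) Cinf_c_Cinf in auto)
  finally have lower: "ennreal B \<le> liminf ?G" by (simp add: B)
  have lim: "(\<lambda>n. ennreal (B + 2 / Suc n)) \<longlonglongrightarrow> ennreal B"
  proof -
    have "(\<lambda>n. B + 2 * (1 / real (Suc n))) \<longlonglongrightarrow> B + 2 * 0"
      by (intro tendsto_add tendsto_mult tendsto_const lim_1_over_n[THEN LIMSEQ_Suc])
    then show ?thesis by (intro tendsto_ennrealI) simp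
  qed
  have "limsup ?G \<le> limsup (\<lambda>n. ennreal (B + 2 / Suc n))"
    by (intro Limsup_mono always_eventually allI G_le)
  also have "\<dots> = ennreal B" by (rule lim_imp_Limsup[OF _ lim]) simp
  finally have upper: "limsup ?G \<le> ennreal B" .
  have "?G \<longlonglongrightarrow> ennreal B"
  proof (rule Liminf_eq_Limsup)
    have "liminf ?G \<le> limsup ?G" by (rule Liminf_le_Limsup) simp
    then show "liminf ?G = ennreal B" "limsup ?G = ennreal B"
      using lower upper by (auto intro: antisym order_trans)
  qed simp
  then show ?thesis by (intro that[of F] F(1) conv) (simp add: B)
qed

end

subsection \<open>Localization to open sets\<close>

text \<open>Fubini's theorem for the region below the graph. Negative values of \<open>g\<close>
  contribute to neither side.\<close>

lemma layer_cake:
  fixes g :: "'a::euclidean_space \<Rightarrow> real"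
  assumes N: "sigma_finite_measure N" "sets N = sets borel" and g: "g \<in> borel_measurable borel"
  shows "(\<lambda>t. emeasure N {x. t < g x}) \<in> borel_measurable borel"
    "(\<integral>\<^sup>+x. ennreal (g x) \<partial>N) = (\<integral>\<^sup>+t. emeasure N {x. t < g x} * indicator {0..} t \<partial>lborel)"
proof -
  interpret N: sigma_finite_measure N by fact
  interpret pair_sigma_finite N lborel by standard
  have sp: "space N = UNIV" using sets_eq_imp_space_eq[OF N(2)] by simp
  have [measurable]: "g \<in> borel_measurable N" using g by (simp add: measurable_cong_sets[OF N(2) refl])
  have *: "(\<lambda>(x, t). indicator {t. 0 \<le> t \<and> t < g x} t :: ennreal) \<in> borel_measurable (N \<Otimes>\<^sub>M lborel)"
    by (simp add: indicator_def[abs_def] split_beta') measurable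
  have set: "{x. t < g x} \<in> sets N" for t
    using measurable_sets_borel[of g borel "{t<..}"] g by (simp add: N(2) vimage_def)
  have in1: "(\<integral>\<^sup>+t. indicator {t. 0 \<le> t \<and> t < g x} t \<partial>lborel) = ennreal (g x)" for x
  proof -
    have "(\<integral>\<^sup>+t. indicator {t. 0 \<le> t \<and> t < g x} t \<partial>lborel) = (\<integral>\<^sup>+t. indicator {0..<g x} t \<partial>lborel)"
      by (intro nn_integral_cong) (auto simp: indicator_def)
    also have "\<dots> = ennreal (g x)"
      by (cases "0 \<le> g x") (auto simp: ennreal_neg)
    finally show ?thesis .
  qed
  have in2: "(\<integral>\<^sup>+x. indicator {t. 0 \<le> t \<and> t < g x} t \<partial>N) = emeasure N {x. t < g x} * indicator {0..} t" for t
  proof -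
    have "(\<integral>\<^sup>+x. indicator {t. 0 \<le> t \<and> t < g x} t \<partial>N) = (\<integral>\<^sup>+x. indicator {0..} t * indicator {x. t < g x} x \<partial>N)"
      by (intro nn_integral_cong) (auto simp: indicator_def)
    also have "\<dots> = indicator {0..} t * emeasure N {x. t < g x}"
      using set by (simp add: nn_integral_cmult)
    finally show ?thesis by (simp add: mult.commute)
  qed
  show "(\<integral>\<^sup>+x. ennreal (g x) \<partial>N) = (\<integral>\<^sup>+t. emeasure N {x. t < g x} * indicator {0..} t \<partial>lborel)"
    using Fubini'[OF *] by (simp add: in1 in2)
  have **: "(\<lambda>(x, t). indicator {t. t < g x} t :: ennreal) \<in> borel_measurable (N \<Otimes>\<^sub>M lborel)"
    by (simp add: indicator_def[abs_def] split_beta') measurable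
  have "(\<lambda>t. \<integral>\<^sup>+x. indicator {t. t < g x} t \<partial>N) \<in> borel_measurable lborel"
    using N.borel_measurable_nn_integral[of "\<lambda>t x. indicator {t. t < g x} t" lborel] **
    by (subst (asm) measurable_pair_swap_iff) (simp add: split_beta')
  moreover have "(\<integral>\<^sup>+x. indicator {t. t < g x} t \<partial>N) = emeasure N {x. t < g x}" for t
  proof -
    have "(\<integral>\<^sup>+x. indicator {t. t < g x} t \<partial>N) = (\<integral>\<^sup>+x. indicator {x. t < g x} x \<partial>N)"
      by (intro nn_integral_cong) (auto simp: indicator_def)
    then show ?thesis using set by simp
  qed
  ultimately show "(\<lambda>t. emeasure N {x. t < g x}) \<in> borel_measurable borel" by simp
qed

text \<open>Superlevel sets of a continuous function are open, so the assumption holds at each level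
  \<open>t\<close>, and Fatou's lemma integrates it over \<open>t\<close>.\<close>

lemma nn_integral_le_liminf:
  fixes g :: "'a::euclidean_space \<Rightarrow> real"
  assumes N: "finite_measure N" "sets N = sets borel"
    and P: "\<And>n. finite_measure (P n)" "\<And>n. sets (P n) = sets borel"
    and lower: "\<And>U. open U \<Longrightarrow> emeasure N U \<le> liminf (\<lambda>n. emeasure (P n) U)"
    and g: "continuous_on UNIV g"
  shows "(\<integral>\<^sup>+x. ennreal (g x) \<partial>N) \<le> liminf (\<lambda>n. \<integral>\<^sup>+x. ennreal (g x) \<partial>P n)"
proof -
  have gm: "g \<in> borel_measurable borel" by (rule borel_measurable_continuous_onI[OF g])
  have sN: "sigma_finite_measure N" using N(1) by (simp add: finite_measure_def)
  have sP: "sigma_finite_measure (P n)" for n using P(1)[of n] by (simp add: finite_measure_def)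
  have op: "open {x. t < g x}" for t
    using g by (intro open_Collect_less continuous_intros) auto
  note [measurable] = layer_cake(1)[OF sP P(2) gm]
  have "(\<integral>\<^sup>+x. ennreal (g x) \<partial>N) = (\<integral>\<^sup>+t. emeasure N {x. t < g x} * indicator {0..} t \<partial>lborel)"
    by (rule layer_cake(2)[OF sN N(2) gm])
  also have "\<dots> \<le> (\<integral>\<^sup>+t. liminf (\<lambda>n. emeasure (P n) {x. t < g x} * indicator {0..} t) \<partial>lborel)"
    by (intro nn_integral_mono) (use lower[OF op] in \<open>auto simp: indicator_def\<close>)
  also have "\<dots> \<le> liminf (\<lambda>n. \<integral>\<^sup>+t. emeasure (P n) {x. t < g x} * indicator {0..} t \<partial>lborel)"
    by (rule nn_integral_liminf) measurable
  also have "\<dots> = liminf (\<lambda>n. \<integral>\<^sup>+x. ennreal (g x) \<partial>P n)"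
    by (simp add: layer_cake(2)[OF sP P(2) gm])
  finally show ?thesis .
qed

text \<open>Lower semicontinuity is applied to \<open>c - \<zeta>\<close>; since the total masses
  converge, it becomes an upper bound for the integrals of \<open>\<zeta>\<close>.\<close>

lemma eventually_integral_less:
  fixes \<zeta> :: "'a::euclidean_space \<Rightarrow> real"
  assumes N: "finite_measure N" "sets N = sets borel"
    and P: "\<And>n. finite_measure (P n)" "\<And>n. sets (P n) = sets borel"
    and lower: "\<And>U. open U \<Longrightarrow> emeasure N U \<le> liminf (\<lambda>n. emeasure (P n) U)"
    and mass: "(\<lambda>n. emeasure (P n) UNIV) \<longlonglongrightarrow> emeasure N UNIV"
    and \<zeta>: "continuous_on UNIV \<zeta>" "\<And>x. 0 \<le> \<zeta> x" "\<And>x. \<zeta> x \<le> c" and e: "0 < e"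
  shows "\<forall>\<^sub>F n in sequentially. (LINT x|P n. \<zeta> x) < (LINT x|N. \<zeta> x) + e"
proof -
  have c: "0 \<le> c" using \<zeta>(2,3) order_trans by blast
  let ?g = "\<lambda>x. c - \<zeta> x"
  have \<zeta>m: "\<zeta> \<in> borel_measurable borel" by (rule borel_measurable_continuous_onI[OF \<zeta>(1)])
  have int: "integrable Q \<zeta>" if "finite_measure Q" "sets Q = sets borel" for Q
  proof -
    interpret finite_measure Q by fact
    show ?thesis
      by (rule integrable_const_bound[of _ c])
        (use \<zeta> \<zeta>m in \<open>auto simp: measurable_cong_sets[OF that(2) refl]\<close>)
  qed
  have eq: "(LINT x|Q. ?g x) = c * measure Q UNIV - (LINT x|Q. \<zeta> x)" "integrable Q ?g"
    if Q: "finite_measure Q" "sets Q = sets borel" for Q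
  proof -
    interpret finite_measure Q by fact
    have "space Q = UNIV" using sets_eq_imp_space_eq[OF Q(2)] by simp
    then show "(LINT x|Q. ?g x) = c * measure Q UNIV - (LINT x|Q. \<zeta> x)" "integrable Q ?g"
      using int[OF Q] by (auto simp: mult.commute)
  qed
  have nn: "(\<integral>\<^sup>+x. ennreal (?g x) \<partial>Q) = ennreal (LINT x|Q. ?g x)" if Q: "finite_measure Q" "sets Q = sets borel" for Q
    by (rule nn_integral_eq_integral[OF eq(2)[OF Q]]) (use \<zeta>(3) in auto)
  have "ennreal (LINT x|N. ?g x) \<le> liminf (\<lambda>n. ennreal (LINT x|P n. ?g x))"
    using nn_integral_le_liminf[OF N P lower, of ?g] \<zeta>(1)
    by (simp add: nn[OF N] nn[OF P] continuous_on_diff)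
  have "\<forall>\<^sub>F n in sequentially. (LINT x|N. ?g x) - e / 2 < (LINT x|P n. ?g x)"
  \<comment> \<open>A negative lower bound is invisible in \<open>ennreal\<close>, so this case is
    settled in the reals.\<close>
  proof (cases "(LINT x|N. ?g x) - e / 2 < 0")
    case True
    have "0 \<le> (LINT x|P n. ?g x)" for n by (rule Bochner_Integration.integral_nonneg) (use \<zeta>(3) in auto)
    then show ?thesis by (intro always_eventually allI) (rule less_le_trans[OF True])
  next
    case False
    have "ennreal ((LINT x|N. ?g x) - e / 2) < ennreal (LINT x|N. ?g x)"
      using e False by (intro ennreal_lessI) auto
    also have "\<dots> \<le> liminf (\<lambda>n. ennreal (LINT x|P n. ?g x))" by fact
    finally have "\<forall>\<^sub>F n in sequentially. ennreal ((LINT x|N. ?g x) - e / 2) < ennreal (LINT x|P n. ?g x)"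
      by (rule less_LiminfD)
    then show ?thesis
      by eventually_elim (use False in \<open>simp add: ennreal_less_iff\<close>)
  qed
  moreover have "\<forall>\<^sub>F n in sequentially. c * measure (P n) UNIV < c * measure N UNIV + e / 2"
  proof -
    have "emeasure Q UNIV = ennreal (measure Q UNIV)" if "finite_measure Q" for Q :: "'a measure"
      using that by (rule finite_measure.emeasure_eq_measure)
    then have "(\<lambda>n. ennreal (measure (P n) UNIV)) \<longlonglongrightarrow> ennreal (measure N UNIV)"
      using mass N(1) P(1) by simp
    then have "(\<lambda>n. measure (P n) UNIV) \<longlonglongrightarrow> measure N UNIV"
      by (simp add: tendsto_ennreal_iff)
    then have "(\<lambda>n. c * measure (P n) UNIV) \<longlonglongrightarrow> c * measure N UNIV"
      by (intro tendsto_mult tendsto_const)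
    then show ?thesis by (rule order_tendstoD) (use e in simp)
  qed
  ultimately show ?thesis
    by eventually_elim (simp add: eq(1)[OF N] eq(1)[OF P])
qed

section \<open>Energy measures and gluing for functions of bounded variation\<close>

locale BV_function = radon_L1 M f for M :: "'a::euclidean_space measure" and f +
  assumes BV_finite: "BV_seminorm M f < \<infinity>"
begin

text \<open>The variation as a value of the type of measures, so that functions can be integrated
  against it.\<close>

definition N :: "'a measure" where
  "N = measure_of UNIV (sets borel) (var M f)"

lemma sets_N: "sets N = sets borel"
  using sets.sigma_sets_eq[of "borel :: 'a measure"] by (simp add: N_def)

lemma space_N: "space N = UNIV"
  unfolding N_def by simp

lemma emeasure_N: "A \<in> sets borel \<Longrightarrow> emeasure N A = var M f A"
  unfolding N_def using measure_space_var
  by (intro emeasure_measure_of_sigma) (auto simp: measure_space_def)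

lemma emeasure_N_open: "open U \<Longrightarrow> emeasure N U = var_open M f U"
  by (simp add: emeasure_N var_eq_var_open)

lemma emeasure_N_UNIV: "emeasure N UNIV = BV_seminorm M f"
  by (simp add: emeasure_N_open BV_seminorm_eq)

lemma finite_N: "finite_measure N"
  by (rule finite_measureI) (use BV_finite in \<open>simp add: space_N emeasure_N_UNIV\<close>)

lemma radon_N: "radon_measure N"
proof -
  interpret finite_measure N by (rule finite_N)
  show ?thesis by (auto simp: radon_measure_def sets_N less_top[symmetric])
qed

lemma finite_borel_measure_var: "finite_borel_measure (var M f)"
  unfolding finite_borel_measure_def
  using measure_space_var BV_finite by (simp add: var_eq_var_open BV_seminorm_eq)

text \<open>The measures \<open>\<bar>grad (F n)\<bar> M\<close> of an optimal approximating sequence converge weakly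
  to \<open>N\<close>, because their masses converge and \<open>N\<close> is lower semicontinuous on open sets.\<close>

lemma smooth_approximation_weak:
  obtains F where "\<And>n. F n \<in> Cinf_c" "(\<lambda>n. LINT x|M. \<bar>F n x - f x\<bar>) \<longlonglongrightarrow> 0"
    "\<And>\<zeta> c e. continuous_on UNIV \<zeta> \<Longrightarrow> (\<And>x. 0 \<le> \<zeta> x) \<Longrightarrow> (\<And>x. \<zeta> x \<le> c) \<Longrightarrow> 0 < e \<Longrightarrow>
      \<forall>\<^sub>F n in sequentially. (LINT x|M. \<zeta> x * norm (grad (F n) x)) < (LINT x|N. \<zeta> x) + e"
proof -
  obtain F where F: "\<And>n. F n \<in> Cinf_c" "(\<lambda>n. LINT x|M. \<bar>F n x - f x\<bar>) \<longlonglongrightarrow> 0"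
    "(\<lambda>n. \<integral>\<^sup>+x. ennreal (norm (grad (F n) x)) \<partial>M) \<longlonglongrightarrow> BV_seminorm M f"
    by (rule smooth_approximation[OF BV_finite], rule that)
  note gm = grad_measurable[OF F(1)]
  define P where "P n = density M (\<lambda>x. ennreal (norm (grad (F n) x)))" for n
  have wm: "(\<lambda>x. ennreal (norm (grad (F n) x))) \<in> borel_measurable M" for n
    using gm[of n] by measurable
  have sP: "sets (P n) = sets borel" for n by (simp add: P_def sets_M)
  have eP: "emeasure (P n) A = (\<integral>\<^sup>+x\<in>A. ennreal (norm (grad (F n) x)) \<partial>M)" if "A \<in> sets borel" for n A
    unfolding P_def using that by (subst emeasure_density[OF wm]) (auto simp: sets_M)
  have fP: "finite_measure (P n)" for n
  proof (rule finite_measureI)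
    have "(\<integral>\<^sup>+x. ennreal (norm (grad (F n) x)) \<partial>M) < \<infinity>"
      using grad_integrable[OF F(1)[of n]] by (simp add: integrable_iff_bounded)
    then show "emeasure (P n) (space (P n)) \<noteq> \<infinity>"
      using eP[of UNIV n] by (simp add: P_def space_M)
  qed
  have L1: "L1_converges M U F f" if "open U" for U
    unfolding L1_converges_def
  proof (intro conjI allI)
    show Fi: "set_integrable M U (F n)" for n
      by (rule integrable_set_integrable[OF that LIP_c_integrable[OF Cinf_c_LIP_c[OF F(1)]]])
    have "0 \<le> (LINT x:U|M. \<bar>F n x - f x\<bar>) \<and> (LINT x:U|M. \<bar>F n x - f x\<bar>) \<le> (LINT x|M. \<bar>F n x - f x\<bar>)" for n
    proof -
      have i: "integrable M (\<lambda>x. \<bar>F n x - f x\<bar>)"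
        using LIP_c_integrable[OF Cinf_c_LIP_c[OF F(1)[of n]]] f by simp
      show ?thesis
        unfolding set_lebesgue_integral_def
        using integrable_mult_indicator[OF _ i, of U] that i
        by (auto intro!: Bochner_Integration.integral_nonneg Bochner_Integration.integral_mono simp: sets_M indicator_def)
    qed
    then show "(\<lambda>n. LINT x:U|M. \<bar>F n x - f x\<bar>) \<longlonglongrightarrow> 0"
      by (intro tendsto_sandwich[OF _ _ tendsto_const F(2)]) auto
  qed
  \<comment> \<open>On every open set the \<open>F n\<close> compete in the smooth relaxation, which
    dominates the variation.\<close>
  have lower: "emeasure N U \<le> liminf (\<lambda>n. emeasure (P n) U)" if U: "open U" for U
  proof -
    have "emeasure N U \<le> var_Lip_open M f U"
      unfolding emeasure_N_open[OF U] by (rule var_open_le_var_Lip_open[OF U])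
    also have "\<dots> \<le> var_Cinf_open M f U" by (rule var_Lip_open_le_var_Cinf_open[OF U])
    also have "\<dots> \<le> liminf (\<lambda>n. \<integral>\<^sup>+x\<in>U. ennreal (norm (grad (F n) x)) \<partial>M)"
      unfolding var_Cinf_open_def
      by (rule INF_lower) (use L1[OF U] Cinf_c_Cinf[OF F(1)] in auto)
    also have "\<dots> = liminf (\<lambda>n. emeasure (P n) U)" using eP U by simp
    finally show ?thesis .
  qed
  have mass: "(\<lambda>n. emeasure (P n) UNIV) \<longlonglongrightarrow> emeasure N UNIV"
    using F(3) by (simp add: eP emeasure_N_UNIV)
  show ?thesis
  proof (rule that[OF F(1,2)])
    fix \<zeta> :: "'a \<Rightarrow> real" and c e :: real
    assume \<zeta>: "continuous_on UNIV \<zeta>" "\<And>x. 0 \<le> \<zeta> x" "\<And>x. \<zeta> x \<le> c" and e: "0 < e"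
    have "(LINT x|P n. \<zeta> x) = (LINT x|M. \<zeta> x * norm (grad (F n) x))" for n
      unfolding P_def using continuous_measurable[OF \<zeta>(1)] gm[of n]
      by (subst integral_real_density) (auto simp: mult.commute)
    then show "\<forall>\<^sub>F n in sequentially. (LINT x|M. \<zeta> x * norm (grad (F n) x)) < (LINT x|N. \<zeta> x) + e"
      using eventually_integral_less[OF finite_N sets_N fP sP lower mass \<zeta> e] by simp
  qed
qed

text \<open>A Meyers--Serrin construction: the gradients of the cutoffs \<open>\<zeta> j\<close> sum to zero, so they only
  meet the differences \<open>G j - f\<close>, which are small in \<open>L\<^sup>1\<close>.\<close>

lemma smooth_gluing:
  assumes \<Omega>: "open \<Omega>" and e: "0 < e"
  obtains H where "H \<in> Cinf \<Omega>" "(\<integral>\<^sup>+x\<in>\<Omega>. ennreal \<bar>H x - f x\<bar> \<partial>M) \<le> ennreal e"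
    "(\<integral>\<^sup>+x\<in>\<Omega>. ennreal (norm (grad H x)) \<partial>M) \<le> emeasure N \<Omega> + ennreal (2 * e)"
proof -
  obtain F where F: "\<And>n. F n \<in> Cinf_c" "(\<lambda>n. LINT x|M. \<bar>F n x - f x\<bar>) \<longlonglongrightarrow> 0"
    and Fw: "\<And>\<zeta> c e. continuous_on UNIV \<zeta> \<Longrightarrow> (\<And>x. 0 \<le> \<zeta> x) \<Longrightarrow> (\<And>x. \<zeta> x \<le> c) \<Longrightarrow> 0 < e \<Longrightarrow>
      \<forall>\<^sub>F n in sequentially. (LINT x|M. \<zeta> x * norm (grad (F n) x)) < (LINT x|N. \<zeta> x) + e"
    by (rule smooth_approximation_weak) blast
  obtain C where C: "\<And>n. compact (C n)" "\<And>n. C n \<subseteq> \<Omega>" "\<And>n. C n \<subseteq> interior (C (Suc n))" "\<Union>(range C) = \<Omega>"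
    by (rule open_Union_compact_subsets[OF \<Omega>]) blast
  have Cmono: "C m \<subseteq> C n" if "m \<le> n" for m n
    using that by (rule lift_Suc_mono_le[of C, rotated]) (use C(3) interior_subset in blast)
  have "\<exists>u. u \<in> Cinf_c \<and> (\<forall>x. 0 \<le> u x \<and> u x \<le> 1 \<and> (x \<in> C n \<longrightarrow> u x = 1) \<and> (x \<notin> C (Suc n) \<longrightarrow> u x = 0))" for n
  proof -
    obtain u V D where u: "u \<in> Cinf_c" "\<And>x. 0 \<le> u x" "\<And>x. u x \<le> 1" "open V" "C n \<subseteq> V"
      "\<And>x. x \<in> V \<Longrightarrow> u x = 1" "compact D" "D \<subseteq> interior (C (Suc n))" "\<And>x. x \<notin> D \<Longrightarrow> u x = 0"
      by (rule smooth_cutoff[OF C(1) open_interior C(3)], rule that)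
    have "D \<subseteq> C (Suc n)" using u(8) interior_subset by blast
    then show ?thesis using u by (intro exI[of _ u]) blast
  qed
  then obtain u where u: "\<And>n. u n \<in> Cinf_c" "\<And>n x. 0 \<le> u n x" "\<And>n x. u n x \<le> 1"
    "\<And>n x. x \<in> C n \<Longrightarrow> u n x = 1" "\<And>n x. x \<notin> C (Suc n) \<Longrightarrow> u n x = 0"
    by metis
  \<comment> \<open>Differences of successive cutoffs: the partial sums telescope to
    \<open>u J\<close>, so the \<open>\<zeta> j\<close> form a locally finite partition of unity on
    \<open>\<Omega>\<close>.\<close>
  define \<zeta> where "\<zeta> j = (\<lambda>x. if j = 0 then u 0 x else u j x - u (j - 1) x)" for j
  have \<zeta>c: "\<zeta> j \<in> Cinf_c" for j
    using u(1) Cinf_c_diff[OF u(1) u(1)] by (cases j) (auto simp: \<zeta>_def)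
  have \<zeta>_sum: "(\<Sum>j\<le>J. \<zeta> j x) = u J x" for J x
    by (induction J) (auto simp: \<zeta>_def)
  \<comment> \<open>Points with \<open>u i x \<noteq> 0\<close> lie in \<open>C (Suc i)\<close>,
    where \<open>u (Suc i)\<close> is already \<open>1\<close>.\<close>
  have \<zeta>0: "0 \<le> \<zeta> j x" for j x
  proof (cases j)
    case (Suc i)
    show ?thesis
    proof (cases "x \<in> C (Suc i)")
      case True
      then show ?thesis using Suc u(3)[of i x] u(4)[of x "Suc i"] by (simp add: \<zeta>_def)
    next
      case False
      then show ?thesis using Suc u(5)[of x i] u(2)[of "Suc i" x] by (simp add: \<zeta>_def)
    qed
  qed (simp add: \<zeta>_def u)
  have \<zeta>1: "\<zeta> j x \<le> 1" for j x
    using u(2,3) by (cases j) (auto simp: \<zeta>_def algebra_simps intro: order_trans[of _ 1] add_increasing2)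
  have \<zeta>_off: "\<zeta> j x = 0" if "x \<notin> \<Omega>" for j x
  proof -
    have "u n x = 0" for n using that C(2) u(5) by blast
    then show ?thesis by (simp add: \<zeta>_def)
  qed
  have \<zeta>_late: "\<zeta> j x = 0" if "x \<in> C J" "J < j" for j J x
  proof -
    obtain i where i: "j = Suc i" "J \<le> i" using \<open>J < j\<close> by (cases j) auto
    have "x \<in> C i" "x \<in> C j" using Cmono[of J i] Cmono[of J j] that i by auto
    then show ?thesis using i u(4) by (simp add: \<zeta>_def)
  qed
  have "\<exists>B. 0 \<le> B \<and> (\<forall>x. norm (grad (\<zeta> j) x) \<le> B)" for j
    by (rule Cinf_c_bounded[OF \<zeta>c[of j]]) blast
  then obtain B where B: "\<And>j. 0 \<le> B j" "\<And>j x. norm (grad (\<zeta> j) x) \<le> B j" by metis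
  define d where "d j = e * (1/2) ^ Suc j" for j
  have d0: "0 < d j" for j using e by (simp add: d_def)
  have d_sums: "d sums e"
    using sums_mult[OF power_half_series, of e] by (simp add: d_def[abs_def])
  \<comment> \<open>Each piece receives its own approximation. Dividing the \<open>L\<^sup>1\<close>
    error by \<open>1 + B j\<close> absorbs the gradient of \<open>\<zeta> j\<close>, and the
    localized energy exceeds the integral of \<open>\<zeta> j\<close> against \<open>N\<close> by
    less than \<open>d j\<close>; together the errors are at most \<open>2 * d j\<close>.\<close>
  have "\<exists>n. (LINT x|M. \<bar>F n x - f x\<bar>) < d j / (1 + B j) \<and>
      (LINT x|M. \<zeta> j x * norm (grad (F n) x)) < (LINT x|N. \<zeta> j x) + d j" for j
  proof -
    have "\<forall>\<^sub>F n in sequentially. (LINT x|M. \<bar>F n x - f x\<bar>) < d j / (1 + B j)"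
      by (rule order_tendstoD(2)[OF F(2)]) (use d0[of j] B(1)[of j] in simp)
    moreover have "\<forall>\<^sub>F n in sequentially. (LINT x|M. \<zeta> j x * norm (grad (F n) x)) < (LINT x|N. \<zeta> j x) + d j"
      by (rule Fw[OF Cinf_c_continuous[OF \<zeta>c] \<zeta>0 \<zeta>1 d0])
    ultimately have "\<forall>\<^sub>F n in sequentially. (LINT x|M. \<bar>F n x - f x\<bar>) < d j / (1 + B j) \<and>
      (LINT x|M. \<zeta> j x * norm (grad (F n) x)) < (LINT x|N. \<zeta> j x) + d j"
      by eventually_elim simp
    then show ?thesis by (auto simp: eventually_sequentially)
  qed
  then obtain i where i: "\<And>j. (LINT x|M. \<bar>F (i j) x - f x\<bar>) < d j / (1 + B j)"
    "\<And>j. (LINT x|M. \<zeta> j x * norm (grad (F (i j)) x)) < (LINT x|N. \<zeta> j x) + d j" by metis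
  define G where "G j = F (i j)" for j
  have G: "G j \<in> Cinf_c" for j by (simp add: G_def F)
  have Gf: "integrable M (\<lambda>x. \<bar>G j x - f x\<bar>)" for j
    using LIP_c_integrable[OF Cinf_c_LIP_c[OF G[of j]]] f by simp
  have G1: "(1 + B j) * (LINT x|M. \<bar>G j x - f x\<bar>) \<le> d j" for j
    using i(1)[of j] B(1)[of j] by (simp add: G_def pos_less_divide_eq mult.commute)
  have Gnn: "0 \<le> (LINT x|M. \<bar>G j x - f x\<bar>)" for j by (rule Bochner_Integration.integral_nonneg) simp
  define H where "H x = (\<Sum>j. \<zeta> j x * G j x)" for x
  have Hloc: "H x = (\<Sum>j\<le>J. \<zeta> j x * G j x)" if "x \<in> C J" for x J
    unfolding H_def by (rule suminf_finite) (use \<zeta>_late[OF that] in auto)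
  have ex_J: "\<exists>J. x \<in> interior (C J)" if "x \<in> \<Omega>" for x
    using that C(3,4) by blast
  have HC: "H \<in> Cinf \<Omega>"
    unfolding Cinf_def
  proof (intro CollectI allI Ck_on_local)
    fix n x assume "x \<in> \<Omega>"
    then obtain J where J: "x \<in> interior (C J)" using ex_J by blast
    have "(\<lambda>x. \<Sum>j\<le>J. \<zeta> j x * G j x) \<in> Cinf (interior (C J))"
      by (intro Cinf_sum Cinf_mult Cinf_c_Cinf \<zeta>c G) auto
    then show "\<exists>V g. open V \<and> x \<in> V \<and> Ck_on V n g \<and> (\<forall>y\<in>V. H y = g y)"
      using J
      by (intro exI[of _ "interior (C J)"] exI[of _ "\<lambda>x. \<Sum>j\<le>J. \<zeta> j x * G j x"])
        (auto dest: Cinf_D intro!: Hloc subsetD[OF interior_subset])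
  qed
  have Hf: "\<bar>H x - f x\<bar> \<le> (\<Sum>j\<le>J. \<bar>G j x - f x\<bar>)" if x: "x \<in> C J" for x J
  proof -
    have "f x = (\<Sum>j\<le>J. \<zeta> j x * f x)"
      using \<zeta>_sum[of x J] u(4)[OF x] by (simp flip: sum_distrib_right)
    then have "H x - f x = (\<Sum>j\<le>J. \<zeta> j x * (G j x - f x))"
      using Hloc[OF x] by (simp add: sum_subtractf right_diff_distrib)
    also have "\<bar>\<dots>\<bar> \<le> (\<Sum>j\<le>J. \<bar>\<zeta> j x * (G j x - f x)\<bar>)" by (rule sum_abs)
    also have "\<dots> \<le> (\<Sum>j\<le>J. \<bar>G j x - f x\<bar>)"
      using \<zeta>0 \<zeta>1 by (intro sum_mono) (simp add: abs_mult mult_left_le_one_le)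
    finally show ?thesis .
  qed
  have gradH: "norm (grad H x) \<le> (\<Sum>j\<le>J. \<zeta> j x * norm (grad (G j) x) + B j * \<bar>G j x - f x\<bar>)"
    if x: "x \<in> interior (C J)" for x J
  proof -
    have xC: "x \<in> C J" using x interior_subset by blast
    note dif = Cinf_c_differentiable
    have zG: "(\<lambda>x. \<zeta> j x * G j x) \<in> Cinf_c" for j
      by (rule Cinf_c_mult[OF \<zeta>c Cinf_c_Cinf[OF G]])
    have "grad H x = grad (\<lambda>x. \<Sum>j\<le>J. \<zeta> j x * G j x) x"
    proof (rule grad_cong[of "interior (C J)"])
      show "H y = (\<Sum>j\<le>J. \<zeta> j y * G j y)" if "y \<in> interior (C J)" for y
        by (rule Hloc, rule subsetD[OF interior_subset], rule that)
      show "(\<lambda>x. \<Sum>j\<le>J. \<zeta> j x * G j x) differentiable at x"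
        by (rule dif[OF Cinf_c_sum]) (simp_all add: zG)
    qed (use x in auto)
    also have "\<dots> = (\<Sum>j\<le>J. \<zeta> j x *\<^sub>R grad (G j) x + G j x *\<^sub>R grad (\<zeta> j) x)"
      by (subst grad_sum) (auto intro!: dif zG \<zeta>c G sum.cong grad_mult)
    also have "\<dots> = (\<Sum>j\<le>J. \<zeta> j x *\<^sub>R grad (G j) x + (G j x - f x) *\<^sub>R grad (\<zeta> j) x)"
    proof -
      have "(\<Sum>j\<le>J. grad (\<zeta> j) x) = grad (\<lambda>x. \<Sum>j\<le>J. \<zeta> j x) x"
        by (rule grad_sum[symmetric]) (auto intro!: dif \<zeta>c)
      also have "\<dots> = 0"
        by (rule grad_eq_0[of "interior (C J)" _ _ 1]) (use x u(4) interior_subset in \<open>auto simp: \<zeta>_sum\<close>)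
      finally have "(\<Sum>j\<le>J. f x *\<^sub>R grad (\<zeta> j) x) = 0" by (simp flip: scaleR_sum_right)
      then show ?thesis by (simp add: sum.distrib scaleR_diff_left sum_subtractf)
    qed
    finally have "norm (grad H x) \<le> (\<Sum>j\<le>J. norm (\<zeta> j x *\<^sub>R grad (G j) x + (G j x - f x) *\<^sub>R grad (\<zeta> j) x))"
      by (simp add: norm_sum)
    also have "\<dots> \<le> (\<Sum>j\<le>J. \<zeta> j x * norm (grad (G j) x) + B j * \<bar>G j x - f x\<bar>)"
    proof (intro sum_mono norm_triangle_mono)
      fix j
      show "norm (\<zeta> j x *\<^sub>R grad (G j) x) \<le> \<zeta> j x * norm (grad (G j) x)" using \<zeta>0 by simp
      show "norm ((G j x - f x) *\<^sub>R grad (\<zeta> j) x) \<le> B j * \<bar>G j x - f x\<bar>"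
        using mult_left_mono[OF B(2)[of j x], of "\<bar>G j x - f x\<bar>"] by (simp add: mult.commute)
    qed
    finally show ?thesis .
  qed
  have finite_le_suminf: "ennreal (\<Sum>j\<le>J. a j) \<le> (\<Sum>j. ennreal (a j))" if "\<And>j. 0 \<le> a j" for a :: "nat \<Rightarrow> real" and J
  proof -
    have "ennreal (\<Sum>j\<le>J. a j) = (\<Sum>j\<le>J. ennreal (a j))" using that by (simp add: sum_ennreal)
    also have "\<dots> \<le> (\<Sum>j. ennreal (a j))" by (rule sum_le_suminf) auto
    finally show ?thesis .
  qed
  have [measurable]: "(\<lambda>x. \<bar>G j x - f x\<bar>) \<in> borel_measurable M" for j
    using Gf[of j] by simp
  have 1: "(\<integral>\<^sup>+x\<in>\<Omega>. ennreal \<bar>H x - f x\<bar> \<partial>M) \<le> ennreal e"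
  proof -
    have "(\<integral>\<^sup>+x\<in>\<Omega>. ennreal \<bar>H x - f x\<bar> \<partial>M) \<le> (\<integral>\<^sup>+x. (\<Sum>j. ennreal \<bar>G j x - f x\<bar>) \<partial>M)"
    proof (rule nn_integral_mono)
      fix x
      show "ennreal \<bar>H x - f x\<bar> * indicator \<Omega> x \<le> (\<Sum>j. ennreal \<bar>G j x - f x\<bar>)"
      proof (cases "x \<in> \<Omega>")
        case True
        then obtain J where "x \<in> C J" using C(4) by blast
        then have "ennreal \<bar>H x - f x\<bar> \<le> ennreal (\<Sum>j\<le>J. \<bar>G j x - f x\<bar>)" by (intro ennreal_leI Hf)
        also have "\<dots> \<le> (\<Sum>j. ennreal \<bar>G j x - f x\<bar>)" by (rule finite_le_suminf) simp
        finally show ?thesis using True by simp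
      qed simp
    qed
    also have "\<dots> = (\<Sum>j. \<integral>\<^sup>+x. ennreal \<bar>G j x - f x\<bar> \<partial>M)" by (rule nn_integral_suminf) measurable
    also have "\<dots> \<le> (\<Sum>j. ennreal (d j))"
    proof (rule suminf_le)
      fix j
      have "(LINT x|M. \<bar>G j x - f x\<bar>) \<le> (1 + B j) * (LINT x|M. \<bar>G j x - f x\<bar>)"
        using mult_right_mono[of 1 "1 + B j", OF _ Gnn[of j]] B(1)[of j] by simp
      also note G1
      finally show "(\<integral>\<^sup>+x. ennreal \<bar>G j x - f x\<bar> \<partial>M) \<le> ennreal (d j)"
        using Gf[of j] by (simp add: nn_integral_eq_integral ennreal_leI)
    qed auto
    also have "\<dots> = ennreal e" using d_sums d0 e by (intro suminf_ennreal_eq) (auto intro: less_imp_le)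
    finally show ?thesis .
  qed
  have gi: "integrable M (\<lambda>x. \<zeta> j x * norm (grad (G j) x))" for j
    by (rule integrable_LIP_c_mult[OF Cinf_c_LIP_c[OF \<zeta>c]])
      (use grad_Linf[OF G[of j]] in \<open>auto simp: Linf_def\<close>)
  let ?T = "\<lambda>j x. \<zeta> j x * norm (grad (G j) x) + B j * \<bar>G j x - f x\<bar>"
  have T0: "0 \<le> ?T j x" for j x using \<zeta>0 B(1) by simp
  have Ti: "integrable M (?T j)" for j using gi[of j] Gf[of j] by simp
  interpret FN: finite_measure N by (rule finite_N)
  have \<zeta>N: "integrable N (\<zeta> j)" for j
    by (rule FN.integrable_const_bound[of _ 1])
      (use \<zeta>0 \<zeta>1 borel_measurable_continuous_onI[OF Cinf_c_continuous[OF \<zeta>c[of j]]] in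
        \<open>auto simp: measurable_cong_sets[OF sets_N refl]\<close>)
  have \<zeta>N0: "0 \<le> (LINT x|N. \<zeta> j x)" for j by (rule Bochner_Integration.integral_nonneg) (simp add: \<zeta>0)
  have 2: "(\<integral>\<^sup>+x\<in>\<Omega>. ennreal (norm (grad H x)) \<partial>M) \<le> emeasure N \<Omega> + ennreal (2 * e)"
  proof -
    have "(\<integral>\<^sup>+x\<in>\<Omega>. ennreal (norm (grad H x)) \<partial>M) \<le> (\<integral>\<^sup>+x. (\<Sum>j. ennreal (?T j x)) \<partial>M)"
    proof (rule nn_integral_mono)
      fix x
      show "ennreal (norm (grad H x)) * indicator \<Omega> x \<le> (\<Sum>j. ennreal (?T j x))"
      proof (cases "x \<in> \<Omega>")
        case True
        then obtain J where "x \<in> interior (C J)" using ex_J by blast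
        then have "ennreal (norm (grad H x)) \<le> ennreal (\<Sum>j\<le>J. ?T j x)" by (intro ennreal_leI gradH)
        also have "\<dots> \<le> (\<Sum>j. ennreal (?T j x))" by (rule finite_le_suminf[OF T0])
        finally show ?thesis using True by simp
      qed simp
    qed
    also have "\<dots> = (\<Sum>j. \<integral>\<^sup>+x. ennreal (?T j x) \<partial>M)"
    proof (rule nn_integral_suminf)
      show "(\<lambda>x. ennreal (?T j x)) \<in> borel_measurable M" for j
        by (rule measurable_compose[OF borel_measurable_integrable[OF Ti] measurable_ennreal])
    qed
    also have "\<dots> \<le> (\<Sum>j. ennreal (LINT x|N. \<zeta> j x) + ennreal (2 * d j))"
    proof (rule suminf_le)
      fix j
      have "(LINT x|M. ?T j x) = (LINT x|M. \<zeta> j x * norm (grad (G j) x)) + B j * (LINT x|M. \<bar>G j x - f x\<bar>)"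
        using gi[of j] Gf[of j] by simp
      also have "\<dots> \<le> ((LINT x|N. \<zeta> j x) + d j) + d j"
      proof (rule add_mono)
        show "(LINT x|M. \<zeta> j x * norm (grad (G j) x)) \<le> (LINT x|N. \<zeta> j x) + d j"
          using i(2)[of j] by (simp add: G_def)
        show "B j * (LINT x|M. \<bar>G j x - f x\<bar>) \<le> d j"
          using G1[of j] Gnn[of j] unfolding distrib_right by linarith
      qed
      finally have "(LINT x|M. ?T j x) \<le> (LINT x|N. \<zeta> j x) + 2 * d j" by simp
      then have "(\<integral>\<^sup>+x. ennreal (?T j x) \<partial>M) \<le> ennreal ((LINT x|N. \<zeta> j x) + 2 * d j)"
        using Ti[of j] T0 by (simp add: nn_integral_eq_integral ennreal_leI)
      then show "(\<integral>\<^sup>+x. ennreal (?T j x) \<partial>M) \<le> ennreal (LINT x|N. \<zeta> j x) + ennreal (2 * d j)"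
        using \<zeta>N0[of j] d0[of j] by simp
    qed auto
    also have "\<dots> = (\<Sum>j. ennreal (LINT x|N. \<zeta> j x)) + (\<Sum>j. ennreal (2 * d j))"
      by (rule suminf_add[symmetric]) auto
    also have "\<dots> \<le> emeasure N \<Omega> + ennreal (2 * e)"
    proof (rule add_mono)
      \<comment> \<open>The first \<open>J + 1\<close> integrals add up to the integral of
        \<open>u J\<close>, which is at most the indicator of \<open>\<Omega>\<close>.\<close>
      show "(\<Sum>j. ennreal (LINT x|N. \<zeta> j x)) \<le> emeasure N \<Omega>"
      proof (rule suminf_le_const)
        fix n
        show "(\<Sum>j<n. ennreal (LINT x|N. \<zeta> j x)) \<le> emeasure N \<Omega>"
        proof (cases n)
          case (Suc J)
          have "(\<Sum>j<n. ennreal (LINT x|N. \<zeta> j x)) = ennreal (LINT x|N. (\<Sum>j\<le>J. \<zeta> j x))"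
            using \<zeta>N \<zeta>N0 by (simp add: Suc lessThan_Suc_atMost sum_ennreal)
          also have "\<dots> = (\<integral>\<^sup>+x. ennreal (u J x) \<partial>N)"
          proof (subst nn_integral_eq_integral)
            show "integrable N (u J)"
              using Bochner_Integration.integrable_sum[of "{..J}" N \<zeta>] \<zeta>N by (simp add: \<zeta>_sum)
          qed (use u(2) in \<open>auto simp: \<zeta>_sum\<close>)
          also have "\<dots> \<le> (\<integral>\<^sup>+x. indicator \<Omega> x \<partial>N)"
          proof (rule nn_integral_mono)
            fix x
            show "ennreal (u J x) \<le> indicator \<Omega> x"
            proof (cases "x \<in> \<Omega>")
              case False
              then have "x \<notin> C (Suc J)" using C(2) by blast
              then show ?thesis using u(5) by simp
            qed (use u(3)[of J x] in simp)
          qed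
          also have "\<dots> = emeasure N \<Omega>" using \<Omega> by (simp add: sets_N)
          finally show ?thesis .
        qed simp
      qed auto
      have "(\<lambda>j. 2 * d j) sums (2 * e)" by (rule sums_mult[OF d_sums])
      then show "(\<Sum>j. ennreal (2 * d j)) \<le> ennreal (2 * e)"
        using d0 e by (subst suminf_ennreal_eq) (auto intro: less_imp_le)
    qed
    finally show ?thesis .
  qed
  show ?thesis by (rule that[OF HC 1 2])
qed

lemma var_Cinf_open_le:
  assumes \<Omega>: "open \<Omega>"
  shows "var_Cinf_open M f \<Omega> \<le> var_open M f \<Omega>"
proof -
  have "\<exists>H. H \<in> Cinf \<Omega> \<and> (\<integral>\<^sup>+x\<in>\<Omega>. ennreal \<bar>H x - f x\<bar> \<partial>M) \<le> ennreal (1 / Suc n) \<and>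
    (\<integral>\<^sup>+x\<in>\<Omega>. ennreal (norm (grad H x)) \<partial>M) \<le> emeasure N \<Omega> + ennreal (2 * (1 / Suc n))" for n
  proof -
    have pos: "0 < 1 / real (Suc n)" by simp
    obtain K where K: "K \<in> Cinf \<Omega>" "(\<integral>\<^sup>+x\<in>\<Omega>. ennreal \<bar>K x - f x\<bar> \<partial>M) \<le> ennreal (1 / Suc n)"
      "(\<integral>\<^sup>+x\<in>\<Omega>. ennreal (norm (grad K x)) \<partial>M) \<le> emeasure N \<Omega> + ennreal (2 * (1 / Suc n))"
      by (rule smooth_gluing[OF \<Omega> pos], rule that)
    show ?thesis by (rule exI[of _ K]) (intro conjI K)
  qed
  then have "\<forall>n. \<exists>H. H \<in> Cinf \<Omega> \<and> (\<integral>\<^sup>+x\<in>\<Omega>. ennreal \<bar>H x - f x\<bar> \<partial>M) \<le> ennreal (1 / Suc n) \<and>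
    (\<integral>\<^sup>+x\<in>\<Omega>. ennreal (norm (grad H x)) \<partial>M) \<le> emeasure N \<Omega> + ennreal (2 * (1 / Suc n))" ..
  from choice[OF this] obtain H where H': "\<forall>n. H n \<in> Cinf \<Omega> \<and>
    (\<integral>\<^sup>+x\<in>\<Omega>. ennreal \<bar>H n x - f x\<bar> \<partial>M) \<le> ennreal (1 / Suc n) \<and>
    (\<integral>\<^sup>+x\<in>\<Omega>. ennreal (norm (grad (H n) x)) \<partial>M) \<le> emeasure N \<Omega> + ennreal (2 * (1 / Suc n))" ..
  have H: "H n \<in> Cinf \<Omega>" "(\<integral>\<^sup>+x\<in>\<Omega>. ennreal \<bar>H n x - f x\<bar> \<partial>M) \<le> ennreal (1 / Suc n)"
    "(\<integral>\<^sup>+x\<in>\<Omega>. ennreal (norm (grad (H n) x)) \<partial>M) \<le> emeasure N \<Omega> + ennreal (2 * (1 / Suc n))" for n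
    using spec[OF H', of n] by simp_all
  \<comment> \<open>\<open>H n\<close> is controlled on \<open>\<Omega>\<close> only, so
    measurability is available after multiplication by the indicator.\<close>
  have Hm: "(\<lambda>x. indicator \<Omega> x *\<^sub>R H n x) \<in> borel_measurable M" for n
    unfolding meas_M using \<Omega> Cinf_continuous[OF H(1)] by (intro borel_measurable_continuous_on_indicator) auto
  have di: "integrable M (\<lambda>x. indicator \<Omega> x *\<^sub>R \<bar>H n x - f x\<bar>)"
    and dle: "(LINT x:\<Omega>|M. \<bar>H n x - f x\<bar>) \<le> 1 / Suc n" for n
  proof -
    have eq: "(\<lambda>x. indicator \<Omega> x *\<^sub>R \<bar>H n x - f x\<bar>) = (\<lambda>x. \<bar>indicator \<Omega> x *\<^sub>R H n x - indicator \<Omega> x *\<^sub>R f x\<bar>)"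
      by (auto simp: indicator_def)
    have m: "(\<lambda>x. indicator \<Omega> x *\<^sub>R \<bar>H n x - f x\<bar>) \<in> borel_measurable M"
      unfolding eq using Hm[of n] integrable_mult_indicator[OF _ f, of \<Omega>] \<Omega>
      by (intro borel_measurable_abs borel_measurable_diff) (auto simp: sets_M)
    have nn: "(\<integral>\<^sup>+x. ennreal (indicator \<Omega> x *\<^sub>R \<bar>H n x - f x\<bar>) \<partial>M) \<le> ennreal (1 / Suc n)"
    proof -
      have "(\<integral>\<^sup>+x. ennreal (indicator \<Omega> x *\<^sub>R \<bar>H n x - f x\<bar>) \<partial>M) = (\<integral>\<^sup>+x\<in>\<Omega>. ennreal \<bar>H n x - f x\<bar> \<partial>M)"
        by (intro nn_integral_cong) (auto simp: indicator_def)
      then show ?thesis using H(2)[of n] by simp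
    qed
    show i: "integrable M (\<lambda>x. indicator \<Omega> x *\<^sub>R \<bar>H n x - f x\<bar>)"
      by (rule integrableI_nonneg[OF m]) (use nn in \<open>auto intro: le_less_trans\<close>)
    have "ennreal (LINT x:\<Omega>|M. \<bar>H n x - f x\<bar>) \<le> ennreal (1 / Suc n)"
      unfolding set_lebesgue_integral_def
      by (subst nn_integral_eq_integral[OF i, symmetric]) (use nn in auto)
    then show "(LINT x:\<Omega>|M. \<bar>H n x - f x\<bar>) \<le> 1 / Suc n" by (simp add: ennreal_le_iff)
  qed
  have L1: "L1_converges M \<Omega> H f"
    unfolding L1_converges_def
  proof (intro conjI allI)
    fix n
    show "set_integrable M \<Omega> (H n)"
      unfolding set_integrable_def
    proof (rule Bochner_Integration.integrable_bound[OF Bochner_Integration.integrable_add[OF di[of n] integrable_abs[OF f]] Hm])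
      show "AE x in M. norm (indicator \<Omega> x *\<^sub>R H n x) \<le> norm (indicator \<Omega> x *\<^sub>R \<bar>H n x - f x\<bar> + \<bar>f x\<bar>)"
        by (intro AE_I2) (auto simp: indicator_def)
    qed
  next
    show "(\<lambda>n. LINT x:\<Omega>|M. \<bar>H n x - f x\<bar>) \<longlonglongrightarrow> 0"
    proof (rule tendsto_sandwich[OF _ _ tendsto_const lim_1_over_n[THEN LIMSEQ_Suc]])
      have "0 \<le> (LINT x:\<Omega>|M. \<bar>H n x - f x\<bar>)" for n
        unfolding set_lebesgue_integral_def by (rule Bochner_Integration.integral_nonneg) simp
      then show "\<forall>\<^sub>F n in sequentially. 0 \<le> (LINT x:\<Omega>|M. \<bar>H n x - f x\<bar>)" by simp
    qed (use dle in simp)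
  qed
  have "var_Cinf_open M f \<Omega> \<le> liminf (\<lambda>n. \<integral>\<^sup>+x\<in>\<Omega>. ennreal (norm (grad (H n) x)) \<partial>M)"
    unfolding var_Cinf_open_def by (rule INF_lower) (use H(1) L1 in auto)
  also have "\<dots> \<le> liminf (\<lambda>n. emeasure N \<Omega> + ennreal (2 * (1 / Suc n)))"
    by (intro Liminf_mono always_eventually allI H(3))
  also have "\<dots> = emeasure N \<Omega> + ennreal (2 * 0)"
    by (intro lim_imp_Liminf tendsto_add tendsto_ennrealI tendsto_mult tendsto_const lim_1_over_n[THEN LIMSEQ_Suc]) simp
  finally show ?thesis by (simp add: emeasure_N_open[OF \<Omega>])
qed

text \<open>The three inequalities between these quantities close up to a circle.\<close>

lemma relaxations_eq_var_open:
  assumes "open \<Omega>"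
  shows "var_Lip_open M f \<Omega> = var_open M f \<Omega>" "var_Cinf_open M f \<Omega> = var_open M f \<Omega>"
  using var_open_le_var_Lip_open[OF assms] var_Lip_open_le_var_Cinf_open[OF assms, of M f] var_Cinf_open_le[OF assms]
  by auto

end

subsection \<open>Functionals with bounded densities\<close>

text \<open>Evaluation at \<open>r = t\<close> and \<open>r = - t\<close>. If \<open>t * t\<close>
  is the gap to an infimum, it turns near-minimality into a small first variation.\<close>

lemma quadratic_nonneg_bound:
  fixes A G t :: real
  assumes t: "0 < t" and q: "\<And>r. 0 \<le> t * t + r * A + r\<^sup>2 * G"
  shows "\<bar>A\<bar> \<le> (1 + G) * t"
proof -
  have "t * (- A) \<le> t * ((1 + G) * t)" "t * A \<le> t * ((1 + G) * t)"
    using q[of t] q[of "- t"] by (simp_all add: algebra_simps power2_eq_square)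
  then show ?thesis unfolding abs_le_iff using t by (simp only: mult_le_cancel_left_pos)
qed

locale finite_radon = radon M + finite_measure M for M :: "'a::euclidean_space measure"
begin

lemma LIP_c_square_integrable: "f \<in> LIP_c \<Longrightarrow> g \<in> LIP_c \<Longrightarrow> integrable M (\<lambda>x. f x * g x)"
  by (intro integrable_LIP_c_mult LIP_c_Linf)

text \<open>The density is the minimizer of the quadratic functional \<open>\<integral> \<phi>\<^sup>2 / 2 - L \<phi>\<close>; minimizing
  sequences of test functions are Cauchy in \<open>L\<^sup>2\<close> by the parallelogram law.\<close>

lemma functional_has_density:
  fixes L :: "('a \<Rightarrow> real) \<Rightarrow> real"
  assumes add: "\<And>f g. f \<in> LIP_c \<Longrightarrow> g \<in> LIP_c \<Longrightarrow> L (\<lambda>x. f x + g x) = L f + L g"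
    and scale: "\<And>f c. f \<in> LIP_c \<Longrightarrow> L (\<lambda>x. c * f x) = c * L f"
    and C: "0 \<le> C" "\<And>f. f \<in> LIP_c \<Longrightarrow> \<bar>L f\<bar> \<le> C * (LINT x|M. \<bar>f x\<bar>)"
  obtains w where "w \<in> borel_measurable M" "\<And>x. \<bar>w x\<bar> \<le> C" "\<And>f. f \<in> LIP_c \<Longrightarrow> (LINT x|M. f x * w x) = L f"
proof -
  define Q where "Q f = (LINT x|M. f x * f x) / 2 - L f" for f
  note sq = LIP_c_square_integrable
  have expand: "Q (\<lambda>x. f x + t * g x) = Q f + t * ((LINT x|M. f x * g x) - L g) + t\<^sup>2 / 2 * (LINT x|M. g x * g x)"
    if f: "f \<in> LIP_c" and g: "g \<in> LIP_c" for f g t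
  proof -
    have "(LINT x|M. (f x + t * g x) * (f x + t * g x)) =
        (LINT x|M. f x * f x + 2 * t * (f x * g x) + t\<^sup>2 * (g x * g x))"
      by (intro Bochner_Integration.integral_cong) (auto simp: algebra_simps power2_eq_square)
    also have "\<dots> = (LINT x|M. f x * f x) + 2 * t * (LINT x|M. f x * g x) + t\<^sup>2 * (LINT x|M. g x * g x)"
      using sq[OF f f] sq[OF f g] sq[OF g g] by simp
    finally show ?thesis
      using add[OF f LIP_c_cmult[OF g]] scale[OF g] by (simp add: Q_def field_simps)
  qed
  \<comment> \<open>Young's inequality; the finite mass of \<open>M\<close> makes the constant
    \<open>C\<^sup>2 / 2\<close> integrable.\<close>
  have Q_lower: "- (C\<^sup>2 / 2 * measure M (space M)) \<le> Q f" if f: "f \<in> LIP_c" for f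
  proof -
    have "C * (LINT x|M. \<bar>f x\<bar>) = (LINT x|M. C * \<bar>f x\<bar>)" by simp
    also have "\<dots> \<le> (LINT x|M. f x * f x / 2 + C\<^sup>2 / 2)"
    proof (rule Bochner_Integration.integral_mono)
      show "C * \<bar>f x\<bar> \<le> f x * f x / 2 + C\<^sup>2 / 2" for x
        using sum_squares_bound[of C "\<bar>f x\<bar>"] by (simp add: power2_eq_square)
    qed (use LIP_c_integrable[OF f] sq[OF f f] in auto)
    also have "\<dots> = (LINT x|M. f x * f x) / 2 + C\<^sup>2 / 2 * measure M (space M)"
      using sq[OF f f] by (simp add: mult.commute)
    finally show ?thesis using C(2)[OF f] by (simp add: Q_def)
  qed
  define I where "I = Inf (Q ` LIP_c)"
  have zero: "(\<lambda>x. 0) \<in> LIP_c" by (rule Cinf_c_LIP_c[OF Cinf_c_0])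
  have bb: "bdd_below (Q ` LIP_c)" by (rule bdd_belowI2[OF Q_lower])
  have I_le: "I \<le> Q f" if "f \<in> LIP_c" for f unfolding I_def by (rule cINF_lower[OF bb that])
  define \<delta> where "\<delta> n = 1 / real (Suc n)" for n
  have \<delta>: "0 < \<delta> n" for n by (simp add: \<delta>_def)
  have \<delta>_lim: "\<delta> \<longlonglongrightarrow> 0" unfolding \<delta>_def by (rule lim_1_over_n[THEN LIMSEQ_Suc])
  have "\<exists>f. f \<in> LIP_c \<and> Q f < I + \<delta> n" for n
    using cInf_lessD[of "Q ` LIP_c" "I + \<delta> n"] zero \<delta>[of n] by (auto simp: I_def)
  then obtain \<phi> where \<phi>: "\<And>n. \<phi> n \<in> LIP_c" "\<And>n. Q (\<phi> n) < I + \<delta> n" by metis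
  have dL: "(\<lambda>x. \<phi> n x - \<phi> m x) \<in> LIP_c" for n m by (rule LIP_c_diff[OF \<phi>(1) \<phi>(1)])
  have cau: "(LINT x|M. (\<phi> n x - \<phi> m x) * (\<phi> n x - \<phi> m x)) \<le> 4 * \<delta> n + 4 * \<delta> m" for n m
  proof -
    let ?d = "\<lambda>x. \<phi> n x - \<phi> m x"
    have 1: "Q (\<phi> n) = Q (\<phi> m) + ((LINT x|M. \<phi> m x * ?d x) - L ?d) + 1 / 2 * (LINT x|M. ?d x * ?d x)"
      using expand[OF \<phi>(1)[of m] dL[of n m], of 1] by simp
    \<comment> \<open>The mean of the two end values exceeds the midpoint value by one eighth of the
      squared distance, hence the factor \<open>4\<close> in the bound.\<close>
    have 2: "Q (\<lambda>x. \<phi> m x + (1/2) * ?d x) = Q (\<phi> m) + (1/2) * ((LINT x|M. \<phi> m x * ?d x) - L ?d) + (1/8) * (LINT x|M. ?d x * ?d x)"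
      using expand[OF \<phi>(1)[of m] dL[of n m], of "1/2"] by (simp add: power2_eq_square)
    have "I \<le> Q (\<lambda>x. \<phi> m x + (1/2) * ?d x)" by (rule I_le[OF LIP_c_add[OF \<phi>(1) LIP_c_cmult[OF dL]]])
    moreover define X A where "X = (LINT x|M. ?d x * ?d x)" and "A = (LINT x|M. \<phi> m x * ?d x) - L ?d"
    ultimately have "X \<le> 4 * \<delta> n + 4 * \<delta> m"
      using 1 2 \<phi>(2)[of n] \<phi>(2)[of m] unfolding X_def[symmetric] A_def[symmetric] by simp
    then show ?thesis by (simp only: X_def)
  qed
  have \<phi>m [measurable]: "\<phi> n \<in> borel_measurable M" for n by (rule LIP_c_measurable[OF \<phi>(1)])
  have cau': "(\<integral>\<^sup>+x. ennreal ((norm (\<phi> n x - \<phi> m x))\<^sup>2) \<partial>M) \<le> ennreal (4 * \<delta> n + 4 * \<delta> m)" for n m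
  proof -
    have "(\<integral>\<^sup>+x. ennreal ((norm (\<phi> n x - \<phi> m x))\<^sup>2) \<partial>M) = (\<integral>\<^sup>+x. ennreal ((\<phi> n x - \<phi> m x) * (\<phi> n x - \<phi> m x)) \<partial>M)"
      by (simp add: power2_eq_square)
    also have "\<dots> = ennreal (LINT x|M. (\<phi> n x - \<phi> m x) * (\<phi> n x - \<phi> m x))"
      by (rule nn_integral_eq_integral[OF sq[OF dL dL]]) simp
    finally show ?thesis using cau by (simp add: ennreal_leI)
  qed
  have lim4: "(\<lambda>n. 4 * \<delta> n) \<longlonglongrightarrow> 0" using tendsto_mult[OF tendsto_const[of "4::real"] \<delta>_lim] by simp
  obtain r w where w: "w \<in> borel_measurable M" "\<And>n. (\<integral>\<^sup>+x. ennreal ((norm (\<phi> n x - w x))\<^sup>2) \<partial>M) \<le> ennreal (4 * \<delta> n)"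
    by (rule L2_Cauchy_converges[OF finite_measure_axioms \<phi>m cau' lim4]) (use \<delta> in \<open>auto intro: less_imp_le\<close>)
  note [measurable] = w(1)
  have Di: "integrable M (\<lambda>x. (\<phi> n x - w x)\<^sup>2)" "(LINT x|M. (\<phi> n x - w x)\<^sup>2) \<le> 4 * \<delta> n" for n
  proof -
    show i: "integrable M (\<lambda>x. (\<phi> n x - w x)\<^sup>2)"
      by (rule integrableI_nonneg) (use w(2)[of n] in \<open>auto intro: le_less_trans\<close>)
    have "ennreal (LINT x|M. (\<phi> n x - w x)\<^sup>2) \<le> ennreal (4 * \<delta> n)"
      using w(2)[of n] by (subst nn_integral_eq_integral[OF i, symmetric]) auto
    then show "(LINT x|M. (\<phi> n x - w x)\<^sup>2) \<le> 4 * \<delta> n" using \<delta>[of n] by (simp add: ennreal_le_iff)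
  qed
  define K where "K = measure M (space M)"
  \<comment> \<open>With \<open>t = sqrt (\<delta> n)\<close> this passes from squared distances of
    order \<open>\<delta> n\<close> to first powers of order
    \<open>sqrt (\<delta> n)\<close>.\<close>
  have amgm: "\<bar>y\<bar> \<le> t / 2 + y\<^sup>2 / (2 * t)" if t: "0 < t" for t y :: real
  proof -
    have "2 * t * \<bar>y\<bar> \<le> t\<^sup>2 + y\<^sup>2" using sum_squares_bound[of t "\<bar>y\<bar>"] by simp
    then have "\<bar>y\<bar> \<le> (t\<^sup>2 + y\<^sup>2) / (2 * t)" using t by (simp add: le_divide_eq mult.commute mult.left_commute)
    then show ?thesis using t by (simp add: add_divide_distrib power2_eq_square)
  qed
  have D1: "integrable M (\<lambda>x. \<phi> n x - w x)" "(LINT x|M. \<bar>\<phi> n x - w x\<bar>) \<le> (K + 4) / 2 * sqrt (\<delta> n)" for n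
  proof -
    let ?t = "sqrt (\<delta> n)"
    have t: "0 < ?t" "?t * ?t = \<delta> n" using \<delta>[of n] by auto
    have pt: "\<bar>y\<bar> \<le> ?t / 2 + y\<^sup>2 / (2 * ?t)" for y :: real
      by (rule amgm[OF t(1)])
    have bi: "integrable M (\<lambda>x. ?t / 2 + (\<phi> n x - w x)\<^sup>2 / (2 * ?t))" using Di(1)[of n] by simp
    show i: "integrable M (\<lambda>x. \<phi> n x - w x)"
      by (rule Bochner_Integration.integrable_bound[OF bi]) (use pt t in \<open>auto intro: order_trans\<close>)
    have "(LINT x|M. \<bar>\<phi> n x - w x\<bar>) \<le> (LINT x|M. ?t / 2 + (\<phi> n x - w x)\<^sup>2 / (2 * ?t))"
      by (rule Bochner_Integration.integral_mono[OF integrable_abs[OF i] bi pt])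
    also have "\<dots> = K * (?t / 2) + (LINT x|M. (\<phi> n x - w x)\<^sup>2) / (2 * ?t)"
      using Di(1)[of n] by (simp add: K_def)
    also have "\<dots> \<le> K * (?t / 2) + (4 * \<delta> n) / (2 * ?t)"
      using Di(2)[of n] t by (intro add_left_mono divide_right_mono) auto
    also have "(4 * \<delta> n) / (2 * ?t) = 2 * ?t" using t by (simp add: divide_eq_eq)
    finally show "(LINT x|M. \<bar>\<phi> n x - w x\<bar>) \<le> (K + 4) / 2 * sqrt (\<delta> n)" by (simp add: field_simps)
  qed
  have wi: "integrable M w"
    using Bochner_Integration.integrable_diff[OF LIP_c_integrable[OF \<phi>(1)[of 0]] D1(1)[of 0]] by simp
  have sqrt_lim: "(\<lambda>n. c * sqrt (\<delta> n)) \<longlonglongrightarrow> 0" for c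
    using tendsto_mult[OF tendsto_const[of c] tendsto_real_sqrt[OF \<delta>_lim]] by simp
  have main: "(LINT x|M. g x * w x) = L g" if g: "g \<in> LIP_c" for g
  proof -
    obtain B where B: "0 \<le> B" "\<And>x. \<bar>g x\<bar> \<le> B" by (rule LIP_cE[OF g], rule that)
    have gw: "integrable M (\<lambda>x. g x * w x)"
      using integrable_mult_Linf[OF wi LIP_c_Linf[OF g]] by (simp add: mult.commute)
    have "\<bar>(LINT x|M. g x * w x) - (LINT x|M. \<phi> n x * g x)\<bar> \<le> B * ((K + 4) / 2) * sqrt (\<delta> n)" for n
    proof -
      have i: "integrable M (\<lambda>x. (\<phi> n x - w x) * g x)" by (rule integrable_mult_Linf[OF D1(1) LIP_c_Linf[OF g]])
      have "(LINT x|M. \<phi> n x * g x) - (LINT x|M. g x * w x) = (LINT x|M. (\<phi> n x - w x) * g x)"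
        using sq[OF \<phi>(1)[of n] g] gw by (simp add: left_diff_distrib mult.commute[of "w _"])
      also have "\<bar>\<dots>\<bar> \<le> (LINT x|M. \<bar>(\<phi> n x - w x) * g x\<bar>)" by (rule integral_abs_bound)
      also have "\<dots> \<le> (LINT x|M. B * \<bar>\<phi> n x - w x\<bar>)"
      proof (rule Bochner_Integration.integral_mono)
        show "\<bar>(\<phi> n x - w x) * g x\<bar> \<le> B * \<bar>\<phi> n x - w x\<bar>" for x
          using mult_right_mono[OF B(2)[of x], of "\<bar>\<phi> n x - w x\<bar>"] by (simp add: abs_mult mult.commute)
      qed (use i D1(1)[of n] in auto)
      also have "\<dots> \<le> B * ((K + 4) / 2 * sqrt (\<delta> n))"
        using mult_left_mono[OF D1(2)[of n] B(1)] D1(1)[of n] by simp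
      finally show ?thesis by (simp add: abs_minus_commute mult.assoc)
    qed
    then have l1: "(\<lambda>n. (LINT x|M. g x * w x) - (LINT x|M. \<phi> n x * g x)) \<longlonglongrightarrow> 0"
      by (intro Lim_null_comparison[OF _ sqrt_lim[of "B * ((K + 4) / 2)"]]) auto
    let ?G = "LINT x|M. g x * g x"
    have "\<bar>(LINT x|M. \<phi> n x * g x) - L g\<bar> \<le> (1 + ?G / 2) * sqrt (\<delta> n)" for n
    proof -
      let ?t = "sqrt (\<delta> n)" and ?A = "(LINT x|M. \<phi> n x * g x) - L g"
      have t: "0 < ?t" "?t * ?t = \<delta> n" using \<delta>[of n] by auto
      have "I \<le> Q (\<phi> n) + s * ?A + s\<^sup>2 / 2 * ?G" for s
        using I_le[OF LIP_c_add[OF \<phi>(1)[of n] LIP_c_cmult[OF g]], of s] expand[OF \<phi>(1)[of n] g, of s] by simp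
      then have *: "0 \<le> ?t * ?t + s * ?A + s\<^sup>2 / 2 * ?G" for s
        using \<phi>(2)[of n] unfolding t(2) by (smt (verit))
      show ?thesis
        by (rule quadratic_nonneg_bound[OF t(1)]) (use * in simp)
    qed
    then have l2: "(\<lambda>n. (LINT x|M. \<phi> n x * g x) - L g) \<longlonglongrightarrow> 0"
      by (intro Lim_null_comparison[OF _ sqrt_lim[of "1 + ?G / 2"]]) auto
    have "(\<lambda>n. (LINT x|M. g x * w x) - L g) \<longlonglongrightarrow> 0"
      using tendsto_add[OF l1 l2] by simp
    then show ?thesis by (simp add: LIMSEQ_const_iff)
  qed
  \<comment> \<open>For both signs \<open>s\<close> the bound on \<open>L\<close> says that
    \<open>C + s * w\<close> has nonnegative integral against nonnegative tests.\<close>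
  have side: "AE x in M. x \<in> UNIV \<longrightarrow> 0 \<le> C + s * w x" if s: "s = 1 \<or> s = -1" for s :: real
  proof (rule nonneg_of_smooth_tests[OF radon _ _ open_UNIV])
    have ci: "integrable M (\<lambda>x. C + s * w x)" using wi by simp
    then show "(\<lambda>x. C + s * w x) \<in> borel_measurable M" by simp
    show "integrable M (\<lambda>x. indicator (cball 0 R) x * (C + s * w x))" for R
      using integrable_mult_indicator[OF _ ci, of "cball 0 R"] by (simp add: sets_M)
    fix p :: "'a \<Rightarrow> real" assume p: "p \<in> Cinf_c" "\<And>x. 0 \<le> p x"
    note pL = Cinf_c_LIP_c[OF p(1)]
    have "s * L p \<ge> - (C * (LINT x|M. p x))"
      using C(2)[OF pL] p(2) s by auto
    moreover have "(LINT x|M. p x * (C + s * w x)) = C * (LINT x|M. p x) + s * L p"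
    proof -
      have "(LINT x|M. p x * (C + s * w x)) = (LINT x|M. C * p x + s * (p x * w x))"
        by (intro Bochner_Integration.integral_cong) (auto simp: algebra_simps)
      also have "\<dots> = C * (LINT x|M. p x) + s * (LINT x|M. p x * w x)"
        using LIP_c_integrable[OF pL] integrable_mult_Linf[OF wi LIP_c_Linf[OF pL]] by (simp add: mult.commute)
      finally show ?thesis by (simp add: main[OF pL])
    qed
    ultimately show "0 \<le> (LINT x|M. p x * (C + s * w x))" by simp
  qed
  have "AE x in M. 0 \<le> C + w x" "AE x in M. w x \<le> C"
    using side[of 1] side[of "-1"] by simp_all
  then have wC: "AE x in M. \<bar>w x\<bar> \<le> C"
    by eventually_elim auto
  \<comment> \<open>Truncation makes the bound hold at every point instead of a.e.\<close>
  define w' where "w' x = max (- C) (min C (w x))" for x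
  have w'_eq: "AE x in M. w' x = w x" using wC by eventually_elim (auto simp: w'_def)
  have w'm [measurable]: "w' \<in> borel_measurable M" unfolding w'_def by measurable
  show ?thesis
  proof (rule that[OF w'm])
    show "\<bar>w' x\<bar> \<le> C" for x using C(1) by (auto simp: w'_def)
    fix g :: "'a \<Rightarrow> real" assume g: "g \<in> LIP_c"
    note [measurable] = LIP_c_measurable[OF g]
    have "(LINT x|M. g x * w' x) = (LINT x|M. g x * w x)"
      by (rule integral_cong_AE) (use w'_eq in auto)
    then show "(LINT x|M. g x * w' x) = L g" using main[OF g] by simp
  qed
qed

end

subsection \<open>Derivations and vector fields\<close>

text \<open>Inequalities that hold a.e. for countably many directions at once extend to all
  directions in this way, without further exceptional sets.\<close>

lemma closed_contains_dense:
  assumes D: "\<And>X. open X \<Longrightarrow> X \<noteq> {} \<Longrightarrow> \<exists>d\<in>D. d \<in> X" and S: "closed S" "D \<subseteq> S"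
  shows "x \<in> S"
proof (rule ccontr)
  assume "x \<notin> S"
  then obtain d where "d \<in> D" "d \<in> - S" using D[of "- S"] S(1) by auto
  then show False using S(2) by auto
qed

context radon
begin

lemma wder_measurable: "wder M v f h \<Longrightarrow> h \<in> borel_measurable M"
  by (auto simp: wder_def wder_seq_def)

lemma wder_cong_AE:
  assumes "wder M v f h" "AE x in M. h x = h' x" "h' \<in> borel_measurable M"
  shows "wder M v f h'"
proof -
  obtain G K C where s: "wder_seq M v f h G K C" using assms(1) by (auto simp: wder_def)
  then have "AE x in M. (\<lambda>n. grad (G n) x \<bullet> v x) \<longlonglongrightarrow> h x" by (simp add: wder_seq_def)
  then have "AE x in M. (\<lambda>n. grad (G n) x \<bullet> v x) \<longlonglongrightarrow> h' x"
    using assms(2) by eventually_elim simp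
  then have "wder_seq M v f h' G K C" using s assms(3) by (simp add: wder_seq_def)
  then show ?thesis by (auto simp: wder_def)
qed

lemma wder_cmult:
  assumes "wder M v f h" shows "wder M v (\<lambda>x. c * f x) (\<lambda>x. c * h x)"
proof -
  obtain G K C where s: "wder_seq M v f h G K C" using assms(1) by (auto simp: wder_def)
  then have Gc: "G n \<in> Cinf_c" for n by (simp add: wder_seq_def)
  have gr: "grad (\<lambda>x. c * G n x) x = c *\<^sub>R grad (G n) x" for n x
    by (rule grad_cmult[OF Cinf_c_differentiable[OF Gc]])
  have "AE x in M. (\<lambda>n. grad (G n) x \<bullet> v x) \<longlonglongrightarrow> h x" using s by (simp add: wder_seq_def)
  then have ae: "AE x in M. (\<lambda>n. c * (grad (G n) x \<bullet> v x)) \<longlonglongrightarrow> c * h x"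
    by eventually_elim (intro tendsto_mult tendsto_const)
  have "wder_seq M v (\<lambda>x. c * f x) (\<lambda>x. c * h x) (\<lambda>n x. c * G n x) K (\<bar>c\<bar> * C)"
    unfolding wder_seq_def gr
    using s ae by (auto simp: wder_seq_def abs_mult intro: Cinf_c_cmult tendsto_mult mult_left_mono)
  then show ?thesis by (auto simp: wder_def)
qed

lemma wder_scale_field:
  assumes "wder M v f h" shows "wder M (\<lambda>x. c *\<^sub>R v x) f (\<lambda>x. c * h x)"
proof -
  obtain G K C where s: "wder_seq M v f h G K C" using assms(1) by (auto simp: wder_def)
  have "AE x in M. (\<lambda>n. grad (G n) x \<bullet> v x) \<longlonglongrightarrow> h x" using s by (simp add: wder_seq_def)
  then have ae: "AE x in M. (\<lambda>n. grad (G n) x \<bullet> (c *\<^sub>R v x)) \<longlonglongrightarrow> c * h x"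
    unfolding inner_scaleR_right by eventually_elim (intro tendsto_mult tendsto_const)
  have "wder_seq M (\<lambda>x. c *\<^sub>R v x) f (\<lambda>x. c * h x) G K C"
    unfolding wder_seq_def using s ae by (auto simp: wder_seq_def)
  then show ?thesis by (auto simp: wder_def)
qed

text \<open>The derivative along \<open>v\<close> is determined only a.e., and \<open>wder\<close>
  accepts every measurable representative of it. So this is a property of the derivation, not of the
  functions chosen for its values.\<close>

definition represents :: "(('a \<Rightarrow> real) \<Rightarrow> 'a \<Rightarrow> real) \<Rightarrow> ('a \<Rightarrow> 'a) \<Rightarrow> bool" where
  "represents b v \<longleftrightarrow> v \<in> D_inf M \<and> (\<forall>f\<in>LIP_c. wder M v f (b f))"

definition field_derivation :: "('a \<Rightarrow> 'a) \<Rightarrow> ('a \<Rightarrow> real) \<Rightarrow> 'a \<Rightarrow> real" where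
  "field_derivation v f = (SOME h. wder M v f h)"

lemma represents_field_derivation:
  assumes v: "v \<in> D_inf M" shows "represents (field_derivation v) v"
  unfolding represents_def
proof (intro conjI ballI v)
  fix f :: "'a \<Rightarrow> real" assume f: "f \<in> LIP_c"
  obtain h where "wder M v f h" by (rule wder_exists[OF D_inf_Linf[OF v] f])
  then show "wder M v f (field_derivation v f)" unfolding field_derivation_def by (rule someI[where P = "wder M v f"])
qed

lemma represents_smooth:
  assumes b: "represents b v" and \<phi>: "\<phi> \<in> Cinf_c"
  shows "AE x in M. b \<phi> x = grad \<phi> x \<bullet> v x"
proof -
  have v: "v \<in> D_inf M" and w: "wder M v \<phi> (b \<phi>)"
    using b Cinf_c_LIP_c[OF \<phi>] by (auto simp: represents_def)
  show ?thesis
    by (rule wder_unique[OF D_inf_Linf[OF v] div_field[OF v] w wder_smooth[OF D_inf_Linf[OF v] \<phi>]])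
qed

lemma represents_bound:
  assumes b: "represents b v" and f: "f \<in> LIP_c"
  shows "AE x in M. ennreal \<bar>b f x\<bar> \<le> ennreal (norm (v x)) * lip_a f x"
proof -
  have v: "v \<in> D_inf M" and w: "wder M v f (b f)" using b f by (auto simp: represents_def)
  obtain h where h: "wder M v f h" "AE x in M. ennreal \<bar>h x\<bar> \<le> ennreal (norm (v x)) * lip_a f x"
    by (rule wder_exists[OF D_inf_Linf[OF v] f])
  have "AE x in M. b f x = h x"
    by (rule wder_unique[OF D_inf_Linf[OF v] div_field[OF v] w h(1)])
  then show ?thesis using h(2) by eventually_elim simp
qed

lemma represents_derivation:
  assumes b: "represents b v" shows "derivation M b"
proof -
  have v: "v \<in> D_inf M" and w: "\<And>f. f \<in> LIP_c \<Longrightarrow> wder M v f (b f)" using b by (auto simp: represents_def)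
  note unique = wder_unique[OF D_inf_Linf[OF v] div_field[OF v]]
  have vm: "v \<in> borel_measurable M" by (rule Linf_measurable[OF D_inf_Linf[OF v]])
  have "der_bound M b (\<lambda>x. norm (v x))"
    unfolding der_bound_def using vm represents_bound[OF b] by auto
  moreover have "AE x in M. b (\<lambda>y. f y * g y) x = b f x * g x + f x * b g x" if "f \<in> LIP_c" "g \<in> LIP_c" for f g
    using unique[OF w[OF LIP_c_mult[OF that]] wder_mult[OF w[OF that(1)] w[OF that(2)]]]
    by eventually_elim (simp add: mult.commute)
  ultimately show ?thesis
    unfolding derivation_def
    using wder_measurable[OF w] unique[OF w[OF LIP_c_add] wder_add[OF w w]] unique[OF w[OF LIP_c_cmult] wder_cmult[OF w]]
    by blast
qed

text \<open>The linear function of direction \<open>l\<close>, cut off at large radius. It is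
  exactly linear on the open ball of radius \<open>m + 1\<close>, so its gradient is
  \<open>l\<close> on the closed ball of radius \<open>m\<close>. All directions are chosen together
  to make it linear in \<open>l\<close> as a function.\<close>

definition smooth_coordinate :: "nat \<Rightarrow> 'a \<Rightarrow> 'a \<Rightarrow> real" where
  "smooth_coordinate m = (SOME p. \<forall>l. p l \<in> Cinf_c \<and> (\<forall>x. norm x < real m + 1 \<longrightarrow> p l x = l \<bullet> x) \<and>
     p l = (\<lambda>x. \<Sum>i\<in>Basis. (l \<bullet> i) * p i x))"

lemma smooth_coordinate:
  "smooth_coordinate m l \<in> Cinf_c"
  "norm x < real m + 1 \<Longrightarrow> smooth_coordinate m l x = l \<bullet> x"
  "smooth_coordinate m l = (\<lambda>x. \<Sum>i\<in>Basis. (l \<bullet> i) * smooth_coordinate m i x)"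
proof -
  obtain u where u: "u \<in> Cinf_c" "\<And>x::'a. norm x \<le> real m + 1 \<Longrightarrow> u x = 1"
    by (rule smooth_cutoff_small_grad[of "real m + 1"]) auto
  have "\<exists>p. \<forall>l. p l \<in> Cinf_c \<and> (\<forall>x. norm x < real m + 1 \<longrightarrow> p l x = l \<bullet> x) \<and>
     p l = (\<lambda>x. \<Sum>i\<in>Basis. (l \<bullet> i) * p i (x::'a))"
  proof (intro exI[of _ "\<lambda>l x. u x * (l \<bullet> x)"] allI conjI impI)
    fix l :: 'a
    have "(\<lambda>x. l \<bullet> x) \<in> Cinf UNIV"
      by (simp add: Cinf_def Ck_on_linear bounded_linear_inner_right)
    then show "(\<lambda>x. u x * (l \<bullet> x)) \<in> Cinf_c" by (rule Cinf_c_mult[OF u(1)])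
    have "u x * (l \<bullet> x) = (\<Sum>i\<in>Basis. (l \<bullet> i) * (u x * (i \<bullet> x)))" for x
      by (subst euclidean_inner) (simp add: sum_distrib_left inner_commute mult.left_commute)
    then show "(\<lambda>x. u x * (l \<bullet> x)) = (\<lambda>x. \<Sum>i\<in>Basis. (l \<bullet> i) * (u x * (i \<bullet> x)))" by blast
  qed (use u(2) in auto)
  from someI_ex[OF this] show "smooth_coordinate m l \<in> Cinf_c"
    "norm x < real m + 1 \<Longrightarrow> smooth_coordinate m l x = l \<bullet> x"
    "smooth_coordinate m l = (\<lambda>x. \<Sum>i\<in>Basis. (l \<bullet> i) * smooth_coordinate m i x)"
    unfolding smooth_coordinate_def[symmetric] by blast+
qed

lemma grad_smooth_coordinate:
  assumes "norm x \<le> real m" shows "grad (smooth_coordinate m l) x = l"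
proof (rule grad_unique, rule has_derivative_transform_within_open[of "\<lambda>x. l \<bullet> x"])
  show "((\<lambda>x. l \<bullet> x) has_derivative (\<lambda>v. l \<bullet> v)) (at x)"
    by (rule bounded_linear_imp_has_derivative[OF bounded_linear_inner_right])
qed (use assms smooth_coordinate(2) in \<open>auto intro: open_ball[of 0 "real m + 1"]\<close>)

lemma der_bound_smooth:
  assumes G: "der_bound M b G" and f: "f \<in> Cinf_c"
  shows "AE x in M. \<bar>b f x\<bar> \<le> G x * norm (grad f x)"
proof -
  have "AE x in M. ennreal \<bar>b f x\<bar> \<le> ennreal (G x) * lip_a f x" "AE x in M. 0 \<le> G x"
    using G Cinf_c_LIP_c[OF f] by (auto simp: der_bound_def)
  then show ?thesis
  proof eventually_elim
    case (elim x)
    have "ennreal (G x) * lip_a f x \<le> ennreal (G x) * ennreal (norm (grad f x))"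
      by (intro mult_left_mono lip_a_le_grad[OF Cinf_c_Cinf[OF f] open_UNIV]) auto
    then have "ennreal \<bar>b f x\<bar> \<le> ennreal (G x * norm (grad f x))"
      using elim by (simp add: ennreal_mult)
    then show ?case using elim(2) by (simp add: ennreal_le_iff)
  qed
qed

text \<open>Testing a bound with smooth coordinates gives
  \<open>\<bar>l \<bullet> v x\<bar> \<le> G x * norm l\<close> for a countable dense set of
  directions, hence also for \<open>l = v x\<close>.\<close>

lemma represents_least:
  assumes b: "represents b v" and G: "der_bound M b G"
  shows "AE x in M. norm (v x) \<le> G x"
proof -
  obtain D :: "'a set" where D: "countable D" "\<And>X. open X \<Longrightarrow> X \<noteq> {} \<Longrightarrow> \<exists>d\<in>D. d \<in> X"
    by (rule countable_dense_setE) blast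
  have "AE x in M. \<bar>grad (smooth_coordinate m l) x \<bullet> v x\<bar> \<le> G x * norm (grad (smooth_coordinate m l) x)" for m l
    using der_bound_smooth[OF G smooth_coordinate(1)[of m l]] represents_smooth[OF b smooth_coordinate(1)[of m l]]
    by eventually_elim simp
  then have "AE x in M. \<forall>l\<in>D. \<forall>m. \<bar>grad (smooth_coordinate m l) x \<bullet> v x\<bar> \<le> G x * norm (grad (smooth_coordinate m l) x)"
    by (simp add: AE_ball_countable[OF D(1)] AE_all_countable)
  moreover have "AE x in M. 0 \<le> G x" using G by (simp add: der_bound_def)
  ultimately show ?thesis
  proof eventually_elim
    case (elim x)
    obtain m where m: "norm x \<le> real m" using real_arch_simple by blast
    have "\<bar>l \<bullet> v x\<bar> \<le> G x * norm l" if "l \<in> D" for l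
      using elim(1) that by (metis grad_smooth_coordinate[OF m])
    then have "D \<subseteq> {l. \<bar>l \<bullet> v x\<bar> \<le> G x * norm l}" by auto
    moreover have "closed {l. \<bar>l \<bullet> v x\<bar> \<le> G x * norm l}"
      by (intro closed_Collect_le continuous_intros)
    ultimately have "v x \<in> {l. \<bar>l \<bullet> v x\<bar> \<le> G x * norm l}" using closed_contains_dense[OF D(2)] by blast
    then have "norm (v x) * norm (v x) \<le> G x * norm (v x)"
      by (simp add: power2_norm_eq_inner[symmetric] power2_eq_square)
    then show ?case
      using elim(2) by (cases "v x = 0") auto
  qed
qed

lemma represents_norm_bound:
  assumes b: "represents b v" shows "der_bound M b (\<lambda>x. norm (v x))"
proof -
  have "v \<in> borel_measurable M" using b by (auto simp: represents_def D_inf_def Linf_def)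
  then show ?thesis unfolding der_bound_def using represents_bound[OF b] by auto
qed

lemma der_abs_represents:
  assumes b: "represents b v"
  shows "AE x in M. der_abs M b x = norm (v x)" "der_abs M b \<in> borel_measurable M"
proof -
  let ?P = "\<lambda>G. der_bound M b G \<and> (\<forall>G'. der_bound M b G' \<longrightarrow> (AE x in M. G x \<le> G' x))"
  have "?P (\<lambda>x. norm (v x))"
    using represents_norm_bound[OF b] represents_least[OF b] by blast
  then have P: "?P (der_abs M b)" unfolding der_abs_def by (rule someI[where P = ?P])
  then show "der_abs M b \<in> borel_measurable M" by (simp add: der_bound_def)
  have "AE x in M. norm (v x) \<le> der_abs M b x" using P represents_least[OF b] by blast
  moreover have "AE x in M. der_abs M b x \<le> norm (v x)" using P represents_norm_bound[OF b] by blast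
  ultimately show "AE x in M. der_abs M b x = norm (v x)" by eventually_elim simp
qed

lemma is_der_div_represents:
  assumes b: "represents b v"
  shows "is_der_div M b g \<longleftrightarrow> is_div M v g"
proof
  have v: "v \<in> Linf M" and w: "\<And>f. f \<in> LIP_c \<Longrightarrow> wder M v f (b f)"
    using b by (auto simp: represents_def D_inf_def)
  show "is_der_div M b g" if g: "is_div M v g"
    unfolding is_der_div_def using is_div_Linf[OF g] integral_wder[OF v g w] by blast
  assume g: "is_der_div M b g"
  show "is_div M v g"
    unfolding is_div_def
  proof (intro conjI ballI)
    show "g \<in> Linf M" using g by (simp add: is_der_div_def)
    fix \<phi> :: "'a \<Rightarrow> real" assume \<phi>: "\<phi> \<in> Cinf_c"
    have "(LINT x|M. grad \<phi> x \<bullet> v x) = (LINT x|M. b \<phi> x)"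
    proof (rule integral_cong_AE)
      show "(\<lambda>x. grad \<phi> x \<bullet> v x) \<in> borel_measurable M" using integrable_grad_inner[OF \<phi> v] by simp
      show "b \<phi> \<in> borel_measurable M" by (rule wder_measurable[OF w[OF Cinf_c_LIP_c[OF \<phi>]]])
      show "AE x in M. grad \<phi> x \<bullet> v x = b \<phi> x" using represents_smooth[OF b \<phi>] by eventually_elim simp
    qed
    then show "(LINT x|M. grad \<phi> x \<bullet> v x) = - (LINT x|M. \<phi> x * g x)"
      using g Cinf_c_LIP_c[OF \<phi>] by (simp add: is_der_div_def)
  qed
qed

lemma represents_Der_b:
  assumes b: "represents b v" shows "b \<in> Der_b M"
  unfolding Der_b_def
proof (intro CollectI conjI)
  have v: "v \<in> D_inf M" using b by (simp add: represents_def)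
  show "derivation M b" by (rule represents_derivation[OF b])
  obtain C where C: "AE x in M. norm (v x) \<le> C" by (rule LinfE[OF D_inf_Linf[OF v]])
  have "AE x in M. norm (der_abs M b x) \<le> C"
    using C der_abs_represents(1)[OF b] by eventually_elim simp
  then show "der_abs M b \<in> Linf M" by (rule LinfI[OF der_abs_represents(2)[OF b]])
  show "\<exists>g. is_der_div M b g" using div_field[OF v] is_der_div_represents[OF b] by blast
qed

lemma der_div_represents:
  assumes b: "represents b v" shows "is_div M v (der_div M b)"
proof -
  have "is_div M v (div_field M v)" using b div_field by (simp add: represents_def)
  then have "is_der_div M b (div_field M v)" by (simp add: is_der_div_represents[OF b])
  then have "is_der_div M b (der_div M b)" unfolding der_div_def by (rule someI[where P = "is_der_div M b"])
  then show ?thesis by (simp add: is_der_div_represents[OF b])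
qed

text \<open>The least bound of a derivation minimizes \<open>G \<mapsto> \<integral> s arctan G\<close> for an integrable weight \<open>s\<close>.\<close>

lemma least_der_bound:
  assumes b: "derivation M b"
  shows "der_bound M b (der_abs M b)"
proof -
  obtain s :: "'a \<Rightarrow> real" where s: "s \<in> borel_measurable M" "\<And>x. 0 < s x" "integrable M s"
    by (rule radon_weight[OF radon], rule that)
  \<comment> \<open>\<open>arctan\<close> keeps the integral finite for every bound and is strictly
    increasing, so equal integrals of ordered bounds force equality a.e.\<close>
  define t where "t G = (LINT x|M. s x * arctan (G x))" for G :: "'a \<Rightarrow> real"
  have ti: "integrable M (\<lambda>x. s x * arctan (G x))" if [measurable]: "G \<in> borel_measurable M" for G :: "'a \<Rightarrow> real"
  proof (rule Bochner_Integration.integrable_bound)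
    show "integrable M (\<lambda>x. 2 * s x)" using s by simp
    have am: "arctan \<in> borel_measurable borel"
      by (rule borel_measurable_continuous_onI) (auto intro: continuous_intros)
    show "(\<lambda>x. s x * arctan (G x)) \<in> borel_measurable M"
      by (rule borel_measurable_times[OF s(1) measurable_compose[OF that am]])
    have "\<bar>arctan y\<bar> \<le> 2" for y
      using arctan_bounded[of y] pi_less_4 by linarith
    then have "\<bar>s x * arctan (G x)\<bar> \<le> \<bar>2 * s x\<bar>" for x
      using mult_left_mono[of "\<bar>arctan (G x)\<bar>" 2 "\<bar>s x\<bar>"] by (simp add: abs_mult mult.commute)
    then show "AE x in M. norm (s x * arctan (G x)) \<le> norm (2 * s x)" by simp
  qed
  let ?B = "{G. der_bound M b G}"
  have ne: "?B \<noteq> {}" using b by (auto simp: derivation_def)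
  have tm: "t G \<le> t H" if "G \<in> borel_measurable M" "H \<in> borel_measurable M" "AE x in M. G x \<le> H x" for G H
    unfolding t_def
    by (rule integral_mono_AE[OF ti[OF that(1)] ti[OF that(2)]])
      (use that(3) less_imp_le[OF s(2)] in \<open>auto elim!: eventually_mono intro!: mult_left_mono arctan_monotone'\<close>)
  have bm: "G \<in> borel_measurable M" if "der_bound M b G" for G using that by (simp add: der_bound_def)
  have bb: "bdd_below (t ` ?B)"
  proof (rule bdd_belowI2)
    fix G assume "G \<in> ?B"
    then show "t (\<lambda>x. 0) \<le> t G" by (intro tm) (auto simp: der_bound_def)
  qed
  define I where "I = Inf (t ` ?B)"
  have I_le: "I \<le> t G" if "der_bound M b G" for G
    unfolding I_def by (rule cINF_lower[OF bb]) (use that in simp)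
  have "\<exists>G. der_bound M b G \<and> t G < I + 1 / Suc n" for n
    using cInf_lessD[of "t ` ?B" "I + 1 / Suc n"] ne by (auto simp: I_def)
  then obtain G where G: "\<And>n. der_bound M b (G n)" "\<And>n. t (G n) < I + 1 / Suc n" by metis
  have Gm: "G n \<in> borel_measurable M" for n by (rule bm[OF G(1)])
  \<comment> \<open>Each \<open>G n\<close> is nonnegative only a.e.; \<open>max 0\<close> keeps the
    infimum bounded below at every point.\<close>
  define H where "H x = (INF n. max 0 (G n x))" for x
  have bd: "bdd_below (range (\<lambda>n. max 0 (G n x)))" for x by (rule bdd_belowI[of _ 0]) auto
  have Hm: "H \<in> borel_measurable M"
    unfolding H_def by (rule borel_measurable_cINF) (use Gm bd in auto)
  have H0: "0 \<le> H x" for x unfolding H_def by (rule cINF_greatest) auto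
  have HG: "H x \<le> max 0 (G n x)" for x n unfolding H_def by (rule cINF_lower[OF bd]) simp
  have HGae: "AE x in M. H x \<le> G n x" for n
  proof -
    have "AE x in M. 0 \<le> G n x" using G(1)[of n] by (simp add: der_bound_def)
    then show ?thesis by eventually_elim (use HG in \<open>metis max.absorb2\<close>)
  qed
  have HB: "der_bound M b H"
    unfolding der_bound_def
  proof (intro conjI ballI Hm)
    show "AE x in M. 0 \<le> H x" using H0 by simp
    fix f :: "'a \<Rightarrow> real" assume f: "f \<in> LIP_c"
    have "AE x in M. \<forall>n. 0 \<le> G n x \<and> ennreal \<bar>b f x\<bar> \<le> ennreal (G n x) * lip_a f x"
      using G(1) f by (auto simp: AE_all_countable der_bound_def)
    then show "AE x in M. ennreal \<bar>b f x\<bar> \<le> ennreal (H x) * lip_a f x"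
    proof eventually_elim
      case (elim x)
      obtain l where l: "lip_a f x = ennreal l" "0 \<le> l"
        using lip_a_finite[OF f, of x] by (cases "lip_a f x") auto
      have n: "\<bar>b f x\<bar> \<le> max 0 (G n x) * l" for n
      proof -
        have G0: "0 \<le> G n x" and "ennreal \<bar>b f x\<bar> \<le> ennreal (G n x) * ennreal l" using elim l by auto
        then have "ennreal \<bar>b f x\<bar> \<le> ennreal (G n x * l)" using l(2) by (simp add: ennreal_mult)
        then have "\<bar>b f x\<bar> \<le> G n x * l" using G0 l(2) by (subst (asm) ennreal_le_iff) auto
        then show ?thesis using G0 by (simp add: max_def)
      qed
      have "\<bar>b f x\<bar> \<le> H x * l"
      proof (cases "l = 0")
        case False
        then have "\<bar>b f x\<bar> / l \<le> H x"
          unfolding H_def using n l by (intro cINF_greatest) (auto simp: divide_le_eq)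
        then show ?thesis using False l by (simp add: divide_le_eq)
      qed (use n in simp)
      then show ?case using l H0[of x] by (simp add: ennreal_leI flip: ennreal_mult)
    qed
  qed
  have tH: "t H \<le> I"
  proof (rule field_le_epsilon)
    fix e :: real assume "0 < e"
    then obtain n where "1 / real (Suc n) < e" using nat_approx_posE by blast
    then show "t H \<le> I + e" using tm[OF Hm Gm HGae, of n] G(2)[of n] by linarith
  qed
  have min: "AE x in M. H x \<le> G' x" if G': "der_bound M b G'" for G'
  proof -
    \<comment> \<open>The minimum of two bounds is a bound. Since \<open>H\<close> already attains
      the least value of \<open>t\<close>, it agrees with this minimum a.e.\<close>
    define K where "K x = min (H x) (G' x)" for x
    have Km: "K \<in> borel_measurable M" unfolding K_def using Hm bm[OF G'] by measurable
    have KB: "der_bound M b K"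
      unfolding der_bound_def
    proof (intro conjI ballI Km)
      show "AE x in M. 0 \<le> K x"
        using G' H0 by (auto simp: K_def der_bound_def)
      fix f :: "'a \<Rightarrow> real" assume f: "f \<in> LIP_c"
      have "AE x in M. ennreal \<bar>b f x\<bar> \<le> ennreal (H x) * lip_a f x" "AE x in M. ennreal \<bar>b f x\<bar> \<le> ennreal (G' x) * lip_a f x"
        using HB G' f by (auto simp: der_bound_def)
      then show "AE x in M. ennreal \<bar>b f x\<bar> \<le> ennreal (K x) * lip_a f x"
        by eventually_elim (auto simp: K_def min_def)
    qed
    have i: "integrable M (\<lambda>x. s x * arctan (H x) - s x * arctan (K x))"
      by (intro Bochner_Integration.integrable_diff ti Hm Km)
    have pos: "AE x in M. 0 \<le> s x * arctan (H x) - s x * arctan (K x)"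
      using less_imp_le[OF s(2)] by (intro AE_I2) (auto simp: K_def intro!: mult_left_mono arctan_monotone')
    have "t K \<le> t H" by (rule tm[OF Km Hm]) (auto simp: K_def)
    then have "t K = t H" using I_le[OF KB] tH by linarith
    then have "(LINT x|M. s x * arctan (H x) - s x * arctan (K x)) = 0"
      using ti[OF Hm] ti[OF Km] by (simp add: t_def)
    then have "AE x in M. s x * arctan (H x) - s x * arctan (K x) = 0"
      using integral_nonneg_eq_0_iff_AE[OF i pos] by simp
    then show ?thesis
    proof eventually_elim
      case (elim x)
      then have "arctan (H x) = arctan (K x)" using s(2)[of x] by simp
      then have "H x = K x" by (simp add: arctan_eq_iff)
      then show ?case by (simp add: K_def min_def split: if_splits)
    qed
  qed
  let ?P = "\<lambda>G. der_bound M b G \<and> (\<forall>G'. der_bound M b G' \<longrightarrow> (AE x in M. G x \<le> G' x))"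
  have "?P (der_abs M b)" unfolding der_abs_def by (rule someI[where P = ?P and x = H]) (use HB min in blast)
  then show ?thesis by simp
qed

lemma LIP_c_sum:
  assumes "finite I" "\<And>i. i \<in> I \<Longrightarrow> f i \<in> LIP_c"
  shows "(\<lambda>y. \<Sum>i\<in>I. c i * f i y :: real) \<in> LIP_c"
  using assms
proof (induction I rule: finite_induct)
  case empty
  show ?case using Cinf_c_LIP_c[OF Cinf_c_0] by simp
next
  case (insert k K)
  then have "(\<lambda>y. c k * f k y + (\<Sum>i\<in>K. c i * f i y)) \<in> LIP_c"
    by (intro LIP_c_add LIP_c_cmult insert.IH) auto
  then show ?case using insert.hyps by simp
qed

lemma derivation_sum:
  assumes b: "derivation M b" and I: "finite I" and f: "\<And>i. i \<in> I \<Longrightarrow> f i \<in> LIP_c"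
  shows "AE x in M. b (\<lambda>y. \<Sum>i\<in>I. c i * f i y) x = (\<Sum>i\<in>I. c i * b (f i) x)"
  using I f
proof (induction I rule: finite_induct)
  case empty
  have z: "(\<lambda>x. 0) \<in> LIP_c" by (rule Cinf_c_LIP_c[OF Cinf_c_0])
  have "AE x in M. b (\<lambda>y. 0 * (\<lambda>x. 0) y) x = 0 * b (\<lambda>x. 0) x"
    using b z by (auto simp only: derivation_def)
  then show ?case by simp
next
  case (insert j J)
  have S: "(\<lambda>y. \<Sum>i\<in>J. c i * f i y) \<in> LIP_c"
    by (rule LIP_c_sum) (use insert in auto)
  have j: "f j \<in> LIP_c" using insert.prems by simp
  have "AE x in M. b (\<lambda>y. c j * f j y + (\<Sum>i\<in>J. c i * f i y)) x = b (\<lambda>y. c j * f j y) x + b (\<lambda>y. \<Sum>i\<in>J. c i * f i y) x"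
    using b LIP_c_cmult[OF j] S by (auto simp only: derivation_def)
  moreover have "AE x in M. b (\<lambda>y. c j * f j y) x = c j * b (f j) x"
    using b j by (auto simp only: derivation_def)
  moreover have "AE x in M. b (\<lambda>y. \<Sum>i\<in>J. c i * f i y) x = (\<Sum>i\<in>J. c i * b (f i) x)"
    by (rule insert.IH) (use insert.prems in auto)
  ultimately show ?case
    by eventually_elim (use insert.hyps in simp)
qed

lemma derivation_diff:
  assumes b: "derivation M b" and f: "f \<in> LIP_c" and g: "g \<in> LIP_c"
  shows "AE x in M. b (\<lambda>y. f y - g y) x = b f x - b g x"
  using derivation_sum[OF b, of "{True, False}" "\<lambda>i. if i then f else g" "\<lambda>i. if i then 1 else -1"] f g by simp

text \<open>On smooth \<open>f\<close> only the gradient matters: \<open>f\<close> minus a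
  coordinate in direction \<open>l\<close> has gradient \<open>grad f x - l\<close>, so
  \<open>b f x\<close> differs from \<open>l \<bullet> v x\<close> by at most the norm of this
  gradient times that of \<open>b\<close>. Letting \<open>l\<close> run through a countable dense
  set towards \<open>grad f x\<close> gives the chain rule.\<close>

lemma Der_b_represents:
  assumes b: "b \<in> Der_b M"
  obtains v where "represents b v"
proof -
  have der: "derivation M b" and AL: "der_abs M b \<in> Linf M" using b by (auto simp: Der_b_def)
  obtain g where g: "is_der_div M b g" using b by (auto simp: Der_b_def)
  have gL: "g \<in> Linf M" using g by (simp add: is_der_div_def)
  let ?A = "der_abs M b"
  have A: "der_bound M b ?A" by (rule least_der_bound[OF der])
  obtain C where C: "0 \<le> C" "AE x in M. norm (?A x) \<le> C" by (rule LinfE[OF AL])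
  have bm: "b f \<in> borel_measurable M" if "f \<in> LIP_c" for f using der that by (simp add: derivation_def)
  let ?p = smooth_coordinate
  have pL: "?p m l \<in> LIP_c" for m l by (rule Cinf_c_LIP_c[OF smooth_coordinate(1)])
  have bp: "AE x in M. norm x \<le> real m \<longrightarrow> \<bar>b f x - b (?p m l) x\<bar> \<le> ?A x * norm (grad f x - l)"
    if f: "f \<in> Cinf_c" for f m l
  proof -
    have "AE x in M. \<bar>b (\<lambda>y. f y - ?p m l y) x\<bar> \<le> ?A x * norm (grad (\<lambda>y. f y - ?p m l y) x)"
      by (rule der_bound_smooth[OF A Cinf_c_diff[OF f smooth_coordinate(1)]])
    then show ?thesis
      using derivation_diff[OF der Cinf_c_LIP_c[OF f] pL[of m l]]
      by eventually_elim
        (auto simp: grad_diff[OF Cinf_c_differentiable[OF f] Cinf_c_differentiable[OF smooth_coordinate(1)]] grad_smooth_coordinate)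
  qed
  have agree: "AE x in M. norm x \<le> real m \<longrightarrow> norm x \<le> real k \<longrightarrow> b (?p k l) x = b (?p m l) x" for m k l
    using bp[OF smooth_coordinate(1)[of k l], of m l] by eventually_elim (auto simp: grad_smooth_coordinate)
  \<comment> \<open>The components are the values of \<open>b\<close> on coordinates that are linear
    near \<open>x\<close>; by \<open>agree\<close> the radius is irrelevant a.e.\<close>
  define v where "v x = (\<Sum>i\<in>Basis. b (?p (nat \<lceil>norm x\<rceil>) i) x *\<^sub>R i)" for x
  have nx: "norm x \<le> real (nat \<lceil>norm x\<rceil>)" for x :: 'a by linarith
  have vm: "v \<in> borel_measurable M"
    unfolding v_def
  proof (intro borel_measurable_sum borel_measurable_scaleR borel_measurable_const)
    fix i :: 'a
    show "(\<lambda>x. b (?p (nat \<lceil>norm x\<rceil>) i) x) \<in> borel_measurable M"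
    proof (rule measurable_compose_countable[of "\<lambda>m x. b (?p m i) x"])
      show "(\<lambda>x. nat \<lceil>norm x\<rceil>) \<in> measurable M (count_space UNIV)"
        unfolding measurable_cong_sets[OF sets_M refl] by measurable
    qed (rule bm[OF pL])
  qed
  have comp: "AE x in M. \<forall>i\<in>Basis. \<forall>m. norm x \<le> real m \<longrightarrow> b (?p m i) x = v x \<bullet> i"
  proof -
    have "AE x in M. \<forall>i\<in>Basis. \<forall>m k. norm x \<le> real m \<longrightarrow> norm x \<le> real k \<longrightarrow> b (?p k i) x = b (?p m i) x"
      unfolding AE_ball_countable[OF countable_finite[OF finite_Basis]] AE_all_countable using agree by blast
    then show ?thesis
    proof eventually_elim
      case (elim x)
      show ?case
      proof (intro ballI allI impI)
        fix i :: 'a and m assume i: "i \<in> Basis" and m: "norm x \<le> real m"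
        have "v x \<bullet> i = b (?p (nat \<lceil>norm x\<rceil>) i) x"
          using i by (simp add: v_def inner_sum_left inner_Basis if_distrib cong: if_cong)
        then show "b (?p m i) x = v x \<bullet> i" using elim[rule_format, OF i nx m] by simp
      qed
    qed
  qed
  have lin: "AE x in M. norm x \<le> real m \<longrightarrow> b (?p m l) x = l \<bullet> v x" for m l
  proof -
    have "AE x in M. b (?p m l) x = (\<Sum>i\<in>Basis. (l \<bullet> i) * b (?p m i) x)"
      using derivation_sum[OF der finite_Basis, of "?p m" "\<lambda>i. l \<bullet> i", OF pL]
      unfolding smooth_coordinate(3)[of m l, symmetric] .
    then show ?thesis
      using comp
    proof eventually_elim
      case (elim x)
      then show ?case by (auto simp: euclidean_inner[of l "v x"])
    qed
  qed
  obtain D :: "'a set" where D: "countable D" "\<And>X. open X \<Longrightarrow> X \<noteq> {} \<Longrightarrow> \<exists>d\<in>D. d \<in> X"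
    by (rule countable_dense_setE) blast
  have chain: "AE x in M. b f x = grad f x \<bullet> v x" if f: "f \<in> Cinf_c" for f
  proof -
    have "AE x in M. \<forall>l\<in>D. \<forall>m. (norm x \<le> real m \<longrightarrow> \<bar>b f x - b (?p m l) x\<bar> \<le> ?A x * norm (grad f x - l)) \<and>
        (norm x \<le> real m \<longrightarrow> b (?p m l) x = l \<bullet> v x)"
      using bp[OF f] lin by (simp add: AE_ball_countable[OF D(1)] AE_all_countable)
    then show ?thesis
    proof eventually_elim
      case (elim x)
      obtain m where m: "norm x \<le> real m" using real_arch_simple by blast
      have "\<bar>b f x - l \<bullet> v x\<bar> \<le> ?A x * norm (grad f x - l)" if l: "l \<in> D" for l
      proof -
        have "\<bar>b f x - b (?p m l) x\<bar> \<le> ?A x * norm (grad f x - l)" "b (?p m l) x = l \<bullet> v x"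
          using elim l m by blast+
        then show ?thesis by simp
      qed
      then have "D \<subseteq> {l. \<bar>b f x - l \<bullet> v x\<bar> \<le> ?A x * norm (grad f x - l)}" by auto
      moreover have "closed {l. \<bar>b f x - l \<bullet> v x\<bar> \<le> ?A x * norm (grad f x - l)}"
        by (intro closed_Collect_le continuous_intros)
      ultimately have "grad f x \<in> {l. \<bar>b f x - l \<bullet> v x\<bar> \<le> ?A x * norm (grad f x - l)}"
        using closed_contains_dense[OF D(2)] by blast
      then show ?case by simp
    qed
  qed
  have vL: "v \<in> Linf M"
  proof (rule LinfI[OF vm])
    have "AE x in M. \<forall>i\<in>Basis. \<forall>m. \<bar>b (?p m i) x\<bar> \<le> ?A x * norm (grad (?p m i) x)"
      using der_bound_smooth[OF A smooth_coordinate(1)]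
      by (simp add: AE_ball_countable[OF countable_finite[OF finite_Basis]] AE_all_countable)
    then show "AE x in M. norm (v x) \<le> (\<Sum>i\<in>(Basis :: 'a set). C)"
      using comp C(2)
    proof eventually_elim
      case (elim x)
      have "norm (v x) \<le> (\<Sum>i\<in>Basis. \<bar>v x \<bullet> i\<bar>)" by (rule norm_le_l1)
      also have "\<dots> \<le> (\<Sum>i\<in>(Basis :: 'a set). C)"
      proof (rule sum_mono)
        fix i :: 'a assume i: "i \<in> Basis"
        let ?m = "nat \<lceil>norm x\<rceil>"
        have "\<bar>v x \<bullet> i\<bar> = \<bar>b (?p ?m i) x\<bar>" using elim(2) i nx[of x] by simp
        also have "\<dots> \<le> ?A x * norm (grad (?p ?m i) x)" using elim(1) i by blast
        also have "\<dots> \<le> C" using elim(3) i by (simp add: grad_smooth_coordinate[OF nx])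
        finally show "\<bar>v x \<bullet> i\<bar> \<le> C" .
      qed
      finally show ?case .
    qed
  qed
  have div: "is_div M v g"
    unfolding is_div_def
  proof (intro conjI ballI gL)
    fix \<phi> :: "'a \<Rightarrow> real" assume \<phi>: "\<phi> \<in> Cinf_c"
    have "(LINT x|M. grad \<phi> x \<bullet> v x) = (LINT x|M. b \<phi> x)"
    proof (rule integral_cong_AE)
      show "(\<lambda>x. grad \<phi> x \<bullet> v x) \<in> borel_measurable M" using integrable_grad_inner[OF \<phi> vL] by simp
      show "b \<phi> \<in> borel_measurable M" by (rule bm[OF Cinf_c_LIP_c[OF \<phi>]])
      show "AE x in M. grad \<phi> x \<bullet> v x = b \<phi> x" using chain[OF \<phi>] by eventually_elim simp
    qed
    then show "(LINT x|M. grad \<phi> x \<bullet> v x) = - (LINT x|M. \<phi> x * g x)"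
      using g Cinf_c_LIP_c[OF \<phi>] by (simp add: is_der_div_def)
  qed
  have "wder M v f (b f)" if f: "f \<in> LIP_c" for f
  proof -
    obtain h where h: "wder M v f h" by (rule wder_exists[OF vL f])
    have hL: "h \<in> Linf M" by (rule wder_properties[OF vL h])
    obtain L K where L: "0 \<le> L" "\<And>y z. \<bar>f y - f z\<bar> \<le> L * dist y z" "compact K" "\<And>x. x \<notin> K \<Longrightarrow> f x = 0"
      by (rule LIP_cE[OF f], rule that)
    have lip: "lip_a f x \<le> ennreal L" for x by (rule lip_a_le[of 1]) (use L in auto)
    have fL: "b f \<in> Linf M"
    proof (rule LinfI[OF bm[OF f]])
      have "AE x in M. ennreal \<bar>b f x\<bar> \<le> ennreal (?A x) * lip_a f x" "AE x in M. 0 \<le> ?A x"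
        using A f by (auto simp: der_bound_def)
      then show "AE x in M. norm (b f x) \<le> C * L"
        using C(2)
      proof eventually_elim
        case (elim x)
        have "ennreal \<bar>b f x\<bar> \<le> ennreal C * ennreal L"
          using elim lip[of x] C(1) by (intro order_trans[OF elim(1)] mult_mono ennreal_leI) auto
        then show ?case using C(1) L(1) by (simp add: ennreal_le_iff flip: ennreal_mult)
      qed
    qed
    \<comment> \<open>Both functions satisfy the same tested identity: \<open>h\<close> by
      \<open>integral_test_wder\<close>, \<open>b f\<close> by the Leibniz rule and the divergence
      of \<open>b\<close>.\<close>
    have "AE x in M. h x = b f x"
    proof (rule AE_eq_of_smooth_tests[OF hL fL])
      fix \<phi> :: "'a \<Rightarrow> real" assume \<phi>: "\<phi> \<in> Cinf_c"
      note \<phi>L = Cinf_c_LIP_c[OF \<phi>]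
      have i1: "integrable M (\<lambda>x. \<phi> x * b f x)" by (rule integrable_LIP_c_mult[OF \<phi>L fL])
      have i2: "integrable M (\<lambda>x. f x * (grad \<phi> x \<bullet> v x))"
        by (rule integrable_LIP_c_mult[OF f Linf_inner[OF grad_Linf[OF \<phi>] vL]])
      have "AE x in M. b (\<lambda>y. \<phi> y * f y) x = b \<phi> x * f x + \<phi> x * b f x"
        using der \<phi>L f by (auto simp only: derivation_def)
      then have ae: "AE x in M. b (\<lambda>y. \<phi> y * f y) x = \<phi> x * b f x + f x * (grad \<phi> x \<bullet> v x)"
        using chain[OF \<phi>] by eventually_elim simp
      have "- (LINT x|M. \<phi> x * f x * g x) = (LINT x|M. b (\<lambda>y. \<phi> y * f y) x)"
        using g LIP_c_mult[OF \<phi>L f] by (simp add: is_der_div_def)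
      also have "\<dots> = (LINT x|M. \<phi> x * b f x + f x * (grad \<phi> x \<bullet> v x))"
        by (rule integral_cong_AE[OF bm[OF LIP_c_mult[OF \<phi>L f]] _ ae]) (use i1 i2 in auto)
      also have "\<dots> = (LINT x|M. \<phi> x * b f x) + (LINT x|M. f x * (grad \<phi> x \<bullet> v x))"
        by (rule Bochner_Integration.integral_add[OF i1 i2])
      finally show "(LINT x|M. \<phi> x * h x) = (LINT x|M. \<phi> x * b f x)"
        unfolding integral_test_wder[OF vL div h \<phi>] by simp
    qed
    then show ?thesis by (rule wder_cong_AE[OF h _ bm[OF f]])
  qed
  then have "represents b v" by (simp add: represents_def D_infI[OF vL div])
  then show ?thesis by (rule that)
qed

text \<open>The tested identity characterizes the derivative along \<open>v\<close> without an
  approximating sequence, so it can be checked for derivations built from others.\<close>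

lemma representsI:
  assumes v: "v \<in> Linf M" and g: "is_div M v g"
    and b: "\<And>f. f \<in> LIP_c \<Longrightarrow> b f \<in> Linf M"
    and eq: "\<And>f \<phi>. f \<in> LIP_c \<Longrightarrow> \<phi> \<in> Cinf_c \<Longrightarrow>
      (LINT x|M. \<phi> x * b f x) = - (LINT x|M. \<phi> x * f x * g x) - (LINT x|M. f x * (grad \<phi> x \<bullet> v x))"
  shows "represents b v"
  unfolding represents_def
proof (intro conjI ballI)
  show "v \<in> D_inf M" by (rule D_infI[OF v g])
  fix f :: "'a \<Rightarrow> real" assume f: "f \<in> LIP_c"
  obtain h where h: "wder M v f h" by (rule wder_exists[OF v f])
  have hL: "h \<in> Linf M" by (rule wder_properties[OF v h])
  have "AE x in M. h x = b f x"
    by (rule AE_eq_of_smooth_tests[OF hL b[OF f]]) (simp add: eq[OF f] integral_test_wder[OF v g h])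
  then show "wder M v f (b f)" by (rule wder_cong_AE[OF h _ Linf_measurable[OF b[OF f]]])
qed

lemma represents_Linf: "represents b v \<Longrightarrow> f \<in> LIP_c \<Longrightarrow> b f \<in> Linf M"
  by (rule wder_properties[of v f "b f"]) (auto simp: represents_def D_inf_def)

lemma represents_test:
  assumes b: "represents b v" and g: "is_div M v g" and f: "f \<in> LIP_c" and \<phi>: "\<phi> \<in> Cinf_c"
  shows "(LINT x|M. \<phi> x * b f x) = - (LINT x|M. \<phi> x * f x * g x) - (LINT x|M. f x * (grad \<phi> x \<bullet> v x))"
  by (rule integral_test_wder[OF _ g _ \<phi>]) (use b f in \<open>auto simp: represents_def D_inf_def\<close>)

lemma represents_field_Linf: "represents b v \<Longrightarrow> v \<in> Linf M"
  by (simp add: represents_def D_inf_def)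

text \<open>The sequences approximating \<open>f\<close> along \<open>v\<close> and along
  \<open>u\<close> may differ, so the sum is handled through the tested identity.\<close>

lemma represents_add:
  assumes b: "represents b v" and c: "represents c u" and g: "is_div M v g" and h: "is_div M u h"
  shows "represents (\<lambda>f x. b f x + c f x) (\<lambda>x. v x + u x)"
proof -
  note v = represents_field_Linf[OF b] and u = represents_field_Linf[OF c]
  show ?thesis
  proof (rule representsI[OF Linf_add[OF v u] is_div_add[OF v u g h]])
    fix f :: "'a \<Rightarrow> real" assume f: "f \<in> LIP_c"
    note bL = represents_Linf[OF b f] and cL = represents_Linf[OF c f]
    show "(\<lambda>x. b f x + c f x) \<in> Linf M" by (rule Linf_add[OF bL cL])
    fix \<phi> :: "'a \<Rightarrow> real" assume \<phi>: "\<phi> \<in> Cinf_c"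
    note \<phi>L = Cinf_c_LIP_c[OF \<phi>]
    note i = integrable_LIP_c_mult[OF \<phi>L bL] integrable_LIP_c_mult[OF \<phi>L cL]
      integrable_LIP_c_mult[OF LIP_c_mult[OF \<phi>L f] is_div_Linf[OF g]]
      integrable_LIP_c_mult[OF LIP_c_mult[OF \<phi>L f] is_div_Linf[OF h]]
      integrable_LIP_c_mult[OF f Linf_inner[OF grad_Linf[OF \<phi>] v]]
      integrable_LIP_c_mult[OF f Linf_inner[OF grad_Linf[OF \<phi>] u]]
    show "(LINT x|M. \<phi> x * (b f x + c f x)) = - (LINT x|M. \<phi> x * f x * (g x + h x)) -
        (LINT x|M. f x * (grad \<phi> x \<bullet> (v x + u x)))"
      using represents_test[OF b g f \<phi>] represents_test[OF c h f \<phi>] i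
      by (simp add: distrib_left inner_add_right)
  qed
qed

lemma represents_scale:
  assumes b: "represents b v" shows "represents (\<lambda>f x. t * b f x) (\<lambda>x. t *\<^sub>R v x)"
proof -
  note v = represents_field_Linf[OF b]
  have g: "is_div M v (div_field M v)" using b by (simp add: represents_def div_field)
  show ?thesis
    unfolding represents_def
    using D_infI[OF Linf_scaleR[OF Linf_const v] is_div_scale[OF g]] b wder_scale_field
    by (auto simp: represents_def)
qed

text \<open>A sequence for \<open>f\<close> along \<open>v\<close> also serves along the multiple,
  as \<open>k x\<close> is a constant factor at each point. In the divergence the term
  \<open>b k\<close> replaces the pairing of \<open>v\<close> with a gradient, which a Lipschitz
  \<open>k\<close> may not have.\<close>

lemma represents_mult:
  assumes b: "represents b v" and g: "is_div M v g" and k: "k \<in> LIP_c"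
  shows "represents (\<lambda>f x. k x * b f x) (\<lambda>x. k x *\<^sub>R v x)"
    and "is_div M (\<lambda>x. k x *\<^sub>R v x) (\<lambda>x. k x * g x + b k x)"
proof -
  note v = represents_field_Linf[OF b]
  have kv: "(\<lambda>x. k x *\<^sub>R v x) \<in> Linf M" by (rule Linf_scaleR[OF LIP_c_Linf[OF k] v])
  show dv: "is_div M (\<lambda>x. k x *\<^sub>R v x) (\<lambda>x. k x * g x + b k x)"
    unfolding is_div_def
  proof (intro conjI ballI)
    note kg = Linf_mult[OF LIP_c_Linf[OF k] is_div_Linf[OF g]] and bk = represents_Linf[OF b k]
    show "(\<lambda>x. k x * g x + b k x) \<in> Linf M" by (rule Linf_add[OF kg bk])
    fix \<phi> :: "'a \<Rightarrow> real" assume \<phi>: "\<phi> \<in> Cinf_c"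
    note \<phi>L = Cinf_c_LIP_c[OF \<phi>]
    have "(LINT x|M. \<phi> x * (k x * g x + b k x)) = (LINT x|M. \<phi> x * k x * g x) + (LINT x|M. \<phi> x * b k x)"
      using integrable_LIP_c_mult[OF \<phi>L kg] integrable_LIP_c_mult[OF \<phi>L bk]
      by (simp add: distrib_left mult.assoc)
    also have "\<dots> = - (LINT x|M. k x * (grad \<phi> x \<bullet> v x))"
      using represents_test[OF b g k \<phi>] by simp
    finally show "(LINT x|M. grad \<phi> x \<bullet> (k x *\<^sub>R v x)) = - (LINT x|M. \<phi> x * (k x * g x + b k x))" by simp
  qed
  have "wder M (\<lambda>x. k x *\<^sub>R v x) f (\<lambda>x. k x * b f x)" if f: "f \<in> LIP_c" for f
  proof -
    obtain G K C where s: "wder_seq M v f (b f) G K C" using b f by (auto simp: represents_def wder_def)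
    then have "AE x in M. (\<lambda>n. grad (G n) x \<bullet> v x) \<longlonglongrightarrow> b f x" by (simp add: wder_seq_def)
    then have ae: "AE x in M. (\<lambda>n. grad (G n) x \<bullet> (k x *\<^sub>R v x)) \<longlonglongrightarrow> k x * b f x"
      unfolding inner_scaleR_right by eventually_elim (intro tendsto_mult tendsto_const)
    have "(\<lambda>x. k x * b f x) \<in> borel_measurable M"
      by (rule Linf_measurable[OF Linf_mult[OF LIP_c_Linf[OF k] represents_Linf[OF b f]]])
    then have "wder_seq M (\<lambda>x. k x *\<^sub>R v x) f (\<lambda>x. k x * b f x) G K C"
      unfolding wder_seq_def using s ae by (auto simp: wder_seq_def)
    then show ?thesis by (auto simp: wder_def)
  qed
  then show "represents (\<lambda>f x. k x * b f x) (\<lambda>x. k x *\<^sub>R v x)"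
    using D_infI[OF kv dv] by (simp add: represents_def)
qed

lemma represents_cong:
  assumes b: "represents b v" and c: "c \<in> Der_b M" and eq: "\<And>f. f \<in> LIP_c \<Longrightarrow> AE x in M. b f x = c f x"
  shows "represents c v"
  unfolding represents_def
proof (intro conjI ballI)
  show "v \<in> D_inf M" using b by (simp add: represents_def)
  fix f :: "'a \<Rightarrow> real" assume f: "f \<in> LIP_c"
  have "c f \<in> borel_measurable M" using c f by (simp add: Der_b_def derivation_def)
  moreover have "wder M v f (b f)" using b f by (simp add: represents_def)
  ultimately show "wder M v f (c f)" using wder_cong_AE eq[OF f] by blast
qed

text \<open>The infimum is attained: the exceptional sets for the bounds with slack
  \<open>1 / Suc n\<close> unite to a null set.\<close>

lemma Linf_norm_bound:
  assumes v: "v \<in> Linf M" shows "0 \<le> Linf_norm M v" "AE x in M. norm (v x) \<le> Linf_norm M v"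
proof -
  let ?S = "{C. 0 \<le> C \<and> (AE x in M. norm (v x) \<le> C)}"
  obtain C where "C \<in> ?S" by (rule LinfE[OF v]) auto
  then have ne: "?S \<noteq> {}" by blast
  show "0 \<le> Linf_norm M v" unfolding Linf_norm_def by (rule cInf_greatest[OF ne]) auto
  have "AE x in M. norm (v x) \<le> Linf_norm M v + 1 / Suc n" for n
  proof -
    have "\<exists>C\<in>?S. C < Linf_norm M v + 1 / Suc n"
      by (rule cInf_lessD[OF ne]) (simp add: Linf_norm_def)
    then obtain C where "AE x in M. norm (v x) \<le> C" "C < Linf_norm M v + 1 / Suc n" by blast
    from this(1) show ?thesis by eventually_elim (use \<open>C < _\<close> in simp)
  qed
  then have "AE x in M. \<forall>n. norm (v x) \<le> Linf_norm M v + 1 / Suc n" by (simp add: AE_all_countable)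
  then show "AE x in M. norm (v x) \<le> Linf_norm M v"
  proof eventually_elim
    case (elim x)
    show ?case
    proof (rule field_le_epsilon)
      fix e :: real assume "0 < e"
      then obtain n where "1 / real (Suc n) < e" using nat_approx_posE by blast
      then show "norm (v x) \<le> Linf_norm M v + e" using elim[rule_format, of n] by linarith
    qed
  qed
qed

lemma Linf_norm_le: "0 \<le> C \<Longrightarrow> AE x in M. norm (v x) \<le> C \<Longrightarrow> Linf_norm M v \<le> C"
  unfolding Linf_norm_def by (rule cInf_lower) (auto intro: bdd_belowI[of _ 0])

end

context radon_L1
begin

text \<open>Fields and derivations correspond with the same norm a.e., the same support and the same
  divergences, so both suprema run over the same numbers.\<close>

lemma SUP_Der_b_eq_var_open:
  assumes \<Omega>: "open \<Omega>"
  shows "(SUP b\<in>{b \<in> Der_b M. der_supp M b \<Subset> \<Omega> \<and> (AE x in M. der_abs M b x \<le> 1)}.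
      ennreal (LINT x:\<Omega>|M. f x * der_div M b x)) = var_open M f \<Omega>" (is "?S = _")
proof (rule antisym)
  show "?S \<le> var_open M f \<Omega>"
  proof (rule SUP_least, clarify)
    fix b assume b: "b \<in> Der_b M" "der_supp M b \<Subset> \<Omega>" "AE x in M. der_abs M b x \<le> 1"
    obtain v where v: "represents b v" by (rule Der_b_represents[OF b(1)])
    let ?C = "ess_supp M (der_abs M b)"
    have C: "compact ?C" "?C \<subseteq> \<Omega>" using b(2) by (auto simp: der_supp_def compactly_inside_ess_supp)
    have v0: "AE x in M. x \<notin> ?C \<longrightarrow> v x = 0"
      using AE_ess_supp[of "der_abs M b"] der_abs_represents(1)[OF v] by eventually_elim auto
    have v1: "AE x in M. norm (v x) \<le> 1"
      using b(3) der_abs_represents(1)[OF v] by eventually_elim auto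
    note g = der_div_represents[OF v]
    show "ennreal (LINT x:\<Omega>|M. f x * der_div M b x) \<le> var_open M f \<Omega>"
      unfolding integral_f_restrict[OF \<Omega> g C v0]
      by (rule var_open_ge[OF \<Omega> represents_field_Linf[OF v] g C v0 v1])
  qed
  show "var_open M f \<Omega> \<le> ?S"
  proof (rule var_open_least[OF \<Omega>])
    fix v g C assume v: "v \<in> Linf M" and g: "is_div M v g" and C: "compact C" "C \<subseteq> \<Omega>"
      "AE x in M. x \<notin> C \<longrightarrow> v x = 0" and 1: "AE x in M. norm (v x) \<le> 1"
    let ?b = "field_derivation v"
    have b: "represents ?b v" by (rule represents_field_derivation[OF D_infI[OF v g]])
    note ab = der_abs_represents(1)[OF b]
    have "AE x in M. x \<notin> C \<longrightarrow> der_abs M ?b x = 0" using C(3) ab by eventually_elim auto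
    then have s: "der_supp M ?b \<Subset> \<Omega>" unfolding der_supp_def by (rule compactly_insideI[OF C(1,2)])
    have a1: "AE x in M. der_abs M ?b x \<le> 1" using 1 ab by eventually_elim simp
    note g' = der_div_represents[OF b]
    have "(LINT x|M. f x * g x) = (LINT x:\<Omega>|M. f x * der_div M ?b x)"
      unfolding integral_f_restrict[OF \<Omega> g' C] by (rule integral_f_cong[OF g g'])
    then show "ennreal (LINT x|M. f x * g x) \<le> ?S"
      using s a1 represents_Der_b[OF b] by (intro SUP_upper2[of ?b]) auto
  qed
qed

text \<open>Continuity at the zero derivation and homogeneity bound the total mass of
  \<open>Df b\<close> on the unit ball of derivations; up to sign these masses are the integrals in
  the seminorm.\<close>

lemma BV_finite_of_differential:
  assumes D: "is_Der_differential M f Df"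
  shows "BV_seminorm M f < \<infinity>"
proof -
  let ?z = "\<lambda>(g :: 'a \<Rightarrow> real) (x :: 'a). 0 :: real"
  have z: "represents ?z (\<lambda>x. 0)"
    using represents_scale[OF represents_field_derivation[OF D_infI[OF Linf_const is_div_0]], of 0] by simp
  have zD: "?z \<in> Der_b M" by (rule represents_Der_b[OF z])
  have "\<forall>b\<in>Der_b M. \<forall>\<epsilon>>0. \<exists>\<delta>>0. \<forall>c\<in>Der_b M. der_norm M (\<lambda>g x. c g x - b g x) < \<delta> \<longrightarrow>
        tv_norm (\<lambda>A. Df c A - Df b A) < ennreal \<epsilon>"
    using D unfolding is_Der_differential_def by (elim conjE)
  from bspec[OF this zD] have P: "\<forall>\<epsilon>>0. \<exists>\<delta>>0. \<forall>c\<in>Der_b M. der_norm M (\<lambda>g x. c g x - 0) < \<delta> \<longrightarrow>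
        tv_norm (\<lambda>A. Df c A - Df ?z A) < ennreal \<epsilon>" .
  from mp[OF spec[OF P, of 1] zero_less_one] obtain \<delta> where \<delta>': "0 < \<delta> \<and>
    (\<forall>c\<in>Der_b M. der_norm M (\<lambda>g x. c g x - 0) < \<delta> \<longrightarrow> tv_norm (\<lambda>A. Df c A - Df ?z A) < ennreal 1)" ..
  have \<delta>: "0 < \<delta>"
    "\<And>c. c \<in> Der_b M \<Longrightarrow> der_norm M (\<lambda>g x. c g x - 0) < \<delta> \<Longrightarrow> tv_norm (\<lambda>A. Df c A - Df ?z A) < ennreal 1"
    by (rule conjunct1[OF \<delta>'], rule mp[OF bspec[OF conjunct2[OF \<delta>']]])
  have scale: "Df (\<lambda>g x. t * b g x) UNIV = t * Df b UNIV" if "b \<in> Der_b M" for t b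
  proof -
    have "\<forall>b\<in>Der_b M. \<forall>t::real. \<forall>A\<in>sets borel. Df (\<lambda>g x. t * b g x) A = t * Df b A"
      using D unfolding is_Der_differential_def by (elim conjE)
    from bspec[OF spec[OF bspec[OF this that]]] show ?thesis by simp
  qed
  have z0: "Df ?z UNIV = 0" using scale[OF zD, of 0] by simp
  have total: "Df b UNIV = - (LINT x|M. f x * der_div M b x)" if "b \<in> Der_b M" for b
    by (rule bspec[OF _ that]) (use D in \<open>unfold is_Der_differential_def, elim conjE\<close>)
  \<comment> \<open>Half of \<open>\<delta>\<close>, because the norm has to be strictly below
    \<open>\<delta>\<close>.\<close>
  define t where "t = \<delta> / 2"
  have t: "0 < t" "t < \<delta>" using \<delta>(1) by (auto simp: t_def)
  have "BV_seminorm M f \<le> ennreal (1 / t)"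
    unfolding BV_seminorm_def
  proof (rule SUP_least, clarify)
    fix v assume v: "v \<in> D_inf M" and 1: "AE x in M. norm (v x) \<le> 1"
    let ?b = "field_derivation v"
    have b: "represents ?b v" by (rule represents_field_derivation[OF v])
    have c: "represents (\<lambda>g x. t * ?b g x) (\<lambda>x. t *\<^sub>R v x)" by (rule represents_scale[OF b])
    have "AE x in M. norm (der_abs M (\<lambda>g x. t * ?b g x) x) \<le> t"
      using der_abs_represents(1)[OF c] 1
      by eventually_elim (use t in \<open>simp add: mult_left_le\<close>)
    then have "der_norm M (\<lambda>g x. t * ?b g x) \<le> t"
      unfolding der_norm_def using t by (intro Linf_norm_le) auto
    then have "tv_norm (\<lambda>A. Df (\<lambda>g x. t * ?b g x) A - Df ?z A) < ennreal 1"
      using \<delta>(2)[OF represents_Der_b[OF c]] t by simp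
    \<comment> \<open>The family that consists of the whole space alone competes in the
      supremum.\<close>
    moreover have "ennreal \<bar>Df (\<lambda>g x. t * ?b g x) UNIV - Df ?z UNIV\<bar> \<le> tv_norm (\<lambda>A. Df (\<lambda>g x. t * ?b g x) A - Df ?z A)"
      unfolding tv_norm_def by (rule SUP_upper2[of "{UNIV}"]) (auto simp: disjoint_def)
    ultimately have "ennreal \<bar>Df (\<lambda>g x. t * ?b g x) UNIV - Df ?z UNIV\<bar> < ennreal 1"
      by (rule le_less_trans[rotated])
    then have "t * \<bar>Df ?b UNIV\<bar> < 1"
      using t(1) unfolding scale[OF represents_Der_b[OF b], of t] z0
      by (subst (asm) ennreal_less_iff) (simp_all add: abs_mult)
    then have "\<bar>LINT x|M. f x * der_div M ?b x\<bar> < 1 / t"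
      using t(1) total[OF represents_Der_b[OF b]] by (simp add: less_divide_eq mult.commute)
    moreover have "(LINT x|M. f x * div_field M v x) = (LINT x|M. f x * der_div M ?b x)"
      by (rule integral_f_cong[OF div_field[OF v] der_div_represents[OF b]])
    ultimately show "ennreal (LINT x|M. f x * div_field M v x) \<le> ennreal (1 / t)"
      by (intro ennreal_leI) simp
  qed
  then show ?thesis by (simp add: le_less_trans)
qed

end

subsection \<open>The differential along derivations\<close>

lemma tv_norm_density_le:
  assumes N: "finite_measure N" "sets N = sets borel" and w: "w \<in> borel_measurable N"
    and C: "0 \<le> C" "AE x in N. \<bar>w x\<bar> \<le> C" and \<nu>: "\<And>A. A \<in> sets borel \<Longrightarrow> \<nu> A = (LINT x:A|N. w x)"
  shows "tv_norm \<nu> \<le> ennreal (C * measure N (space N))"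
  unfolding tv_norm_def
proof (rule SUP_least, clarify)
  interpret finite_measure N by fact
  fix P :: "'a set set" assume P: "finite P" "P \<subseteq> sets borel" "disjoint P"
  have le: "\<bar>\<nu> A\<bar> \<le> C * measure N A" if A: "A \<in> P" for A
  proof -
    have AN: "A \<in> sets N" using P(2) A N(2) by auto
    have iw: "integrable N (\<lambda>x. indicator A x *\<^sub>R w x)"
      by (rule integrable_const_bound[of _ C])
        (use C w AN in \<open>auto simp: indicator_def elim!: eventually_mono intro!: borel_measurable_scaleR\<close>)
    have "\<bar>\<nu> A\<bar> = \<bar>LINT x|N. indicator A x *\<^sub>R w x\<bar>"
      using \<nu> A P(2) by (auto simp: set_lebesgue_integral_def)
    also have "\<dots> \<le> (LINT x|N. \<bar>indicator A x *\<^sub>R w x\<bar>)" by (rule integral_abs_bound)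
    also have "\<dots> \<le> (LINT x|N. C * indicator A x)"
    proof (rule integral_mono_AE)
      show "integrable N (\<lambda>x. C * indicator A x)"
        by (intro integrable_mult_right integrable_real_indicator AN) (simp add: less_top[symmetric])
      show "AE x in N. \<bar>indicator A x *\<^sub>R w x\<bar> \<le> C * indicator A x"
        using C(2) by eventually_elim (simp add: indicator_def)
    qed (use iw in simp)
    also have "\<dots> = C * measure N A" using AN by simp
    finally show ?thesis .
  qed
  have "(\<Sum>A\<in>P. ennreal \<bar>\<nu> A\<bar>) \<le> (\<Sum>A\<in>P. ennreal C * emeasure N A)"
    by (rule sum_mono) (use le C(1) in \<open>auto simp: emeasure_eq_measure ennreal_leI simp flip: ennreal_mult\<close>)
  also have "\<dots> = ennreal C * (\<Sum>A\<in>P. emeasure N A)" by (simp add: sum_distrib_left)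
  also have "(\<Sum>A\<in>P. emeasure N A) = emeasure N (\<Union>A\<in>P. A)"
    by (rule sum_emeasure) (use P N(2) in \<open>auto simp: disjoint_family_on_def disjoint_def\<close>)
  also have "ennreal C * \<dots> \<le> ennreal C * emeasure N (space N)"
    by (intro mult_left_mono emeasure_space) auto
  also have "\<dots> = ennreal (C * measure N (space N))"
    using C(1) by (simp add: emeasure_eq_measure ennreal_mult)
  finally show "(\<Sum>A\<in>P. ennreal \<bar>\<nu> A\<bar>) \<le> ennreal (C * measure N (space N))" .
qed

context
  fixes N :: "'a::euclidean_space measure" and w :: "'a \<Rightarrow> real"
  assumes N: "finite_measure N" "sets N = sets borel" and w: "integrable N w"
begin

lemma density_set_integrable: "A \<in> sets borel \<Longrightarrow> integrable N (\<lambda>x. indicator A x * w x)"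
  using integrable_mult_indicator[OF _ w, of A] N(2) by simp

lemma signed_measure_density: "signed_measure (\<lambda>A. LINT x:A|N. w x)"
  unfolding signed_measure_def
proof (intro conjI allI impI)
  show "(LINT x:{}|N. w x) = 0" by (simp add: set_lebesgue_integral_def)
  fix A :: "nat \<Rightarrow> 'a set" assume A: "range A \<subseteq> sets borel" and dis: "disjoint_family A"
  have Ai: "A i \<in> sets borel" for i using A by auto
  have eq: "(\<Sum>i<n. LINT x:A i|N. w x) = (LINT x|N. indicator (\<Union>i<n. A i) x * w x)" for n
  proof -
    have "(\<Sum>i<n. LINT x:A i|N. w x) = (LINT x|N. (\<Sum>i<n. indicator (A i) x * w x))"
      unfolding set_lebesgue_integral_def real_scaleR_def
      by (rule Bochner_Integration.integral_sum[symmetric], rule density_set_integrable[OF Ai])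
    also have "\<dots> = (LINT x|N. indicator (\<Union>i<n. A i) x * w x)"
    proof (rule Bochner_Integration.integral_cong[OF refl])
      fix x
      have "(\<Sum>i<n. indicator (A i) x) = (indicator (\<Union>i<n. A i) x :: real)"
        by (rule indicator_UN_disjoint[symmetric])
          (use dis in \<open>auto simp: disjoint_family_on_def\<close>)
      then show "(\<Sum>i<n. indicator (A i) x * w x) = indicator (\<Union>i<n. A i) x * w x"
        by (simp flip: sum_distrib_right)
    qed
    finally show ?thesis .
  qed
  have "(\<lambda>n. LINT x|N. indicator (\<Union>i<n. A i) x * w x) \<longlonglongrightarrow> (LINT x|N. indicator (\<Union>i. A i) x * w x)"
  proof (rule integral_dominated_convergence[of _ _ _ "\<lambda>x. \<bar>w x\<bar>"])
    have "(\<Union>i. A i) \<in> sets borel" "(\<Union>i<n. A i) \<in> sets borel" for n using Ai by auto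
    then show "(\<lambda>x. indicator (\<Union>i. A i) x * w x) \<in> borel_measurable N"
      "(\<lambda>x. indicator (\<Union>i<n. A i) x * w x) \<in> borel_measurable N" for n
      using density_set_integrable by blast+
    show "AE x in N. (\<lambda>n. indicator (\<Union>i<n. A i) x * w x) \<longlonglongrightarrow> indicator (\<Union>i. A i) x * w x"
    proof (rule AE_I2, rule tendsto_mult[OF _ tendsto_const])
      fix x
      show "(\<lambda>n. indicator (\<Union>i<n. A i) x :: real) \<longlonglongrightarrow> indicator (\<Union>i. A i) x"
        by (rule LIMSEQ_indicator_UN)
    qed
  qed (use w in \<open>auto simp: indicator_def\<close>)
  then show "(\<lambda>n. LINT x:A n|N. w x) sums (LINT x:\<Union>n. A n|N. w x)"
    by (simp add: sums_def eq) (simp add: set_lebesgue_integral_def)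
qed

text \<open>The supremum over Borel subsets of \<open>A\<close> is attained on the part of
  \<open>A\<close> where \<open>w\<close> is positive, an explicit Hahn decomposition. As a value of
  \<open>ennreal\<close>, \<open>w x\<close> is already its positive part.\<close>

lemma pos_variation_density:
  assumes \<nu>: "\<And>A. A \<in> sets borel \<Longrightarrow> \<nu> A = (LINT x:A|N. w x)"
  shows "pos_variation \<nu> = density N (\<lambda>x. ennreal (w x))"
proof -
  have wm [measurable]: "w \<in> borel_measurable N" using w by simp
  have sp: "space N = UNIV" using sets_eq_imp_space_eq[OF N(2)] by simp
  have eq: "(SUP B\<in>{B \<in> sets borel. B \<subseteq> A}. ennreal (\<nu> B)) = (\<integral>\<^sup>+x. ennreal (w x) * indicator A x \<partial>N)"
    if A: "A \<in> sets borel" for A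
  proof (rule antisym)
    show "(SUP B\<in>{B \<in> sets borel. B \<subseteq> A}. ennreal (\<nu> B)) \<le> (\<integral>\<^sup>+x. ennreal (w x) * indicator A x \<partial>N)"
    proof (rule SUP_least, clarify)
      fix B assume B: "B \<in> sets borel" "B \<subseteq> A"
      have "ennreal (\<nu> B) \<le> ennreal (LINT x|N. max 0 (indicator B x * w x))"
        unfolding \<nu>[OF B(1)] set_lebesgue_integral_def
        using density_set_integrable[OF B(1)] by (intro ennreal_leI Bochner_Integration.integral_mono) auto
      also have "\<dots> = (\<integral>\<^sup>+x. ennreal (max 0 (indicator B x * w x)) \<partial>N)"
        using density_set_integrable[OF B(1)] by (intro nn_integral_eq_integral[symmetric]) auto
      also have "\<dots> \<le> (\<integral>\<^sup>+x. ennreal (w x) * indicator A x \<partial>N)"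
        by (rule nn_integral_mono) (use B(2) in \<open>auto simp: indicator_def max_def ennreal_neg\<close>)
      finally show "ennreal (\<nu> B) \<le> (\<integral>\<^sup>+x. ennreal (w x) * indicator A x \<partial>N)" .
    qed
    let ?B = "A \<inter> {x. 0 < w x}"
    have "{x \<in> space N. 0 < w x} \<in> sets N" by measurable
    then have B: "?B \<in> sets borel" using A by (simp add: sp N(2))
    have "(\<integral>\<^sup>+x. ennreal (w x) * indicator A x \<partial>N) = (\<integral>\<^sup>+x. ennreal (indicator ?B x * w x) \<partial>N)"
      by (rule nn_integral_cong) (auto simp: indicator_def ennreal_neg not_less)
    also have "\<dots> = ennreal (LINT x|N. indicator ?B x * w x)"
      by (rule nn_integral_eq_integral[OF density_set_integrable[OF B]]) (auto simp: indicator_def)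
    also have "\<dots> = ennreal (\<nu> ?B)" by (simp add: \<nu>[OF B] set_lebesgue_integral_def)
    also have "\<dots> \<le> (SUP B\<in>{B \<in> sets borel. B \<subseteq> A}. ennreal (\<nu> B))"
      by (rule SUP_upper) (use B in auto)
    finally show "(\<integral>\<^sup>+x. ennreal (w x) * indicator A x \<partial>N) \<le> (SUP B\<in>{B \<in> sets borel. B \<subseteq> A}. ennreal (\<nu> B))" .
  qed
  show ?thesis
    unfolding pos_variation_def density_def sp N(2)
    by (rule measure_of_eq) (use eq sets.sigma_sets_eq[of "borel :: 'a measure"] in auto)
qed

end

text \<open>The two variations have the densities \<open>max 0 (w x)\<close> and
  \<open>max 0 (- w x)\<close>, whose difference is \<open>w x\<close>.\<close>

lemma signed_density_density:
  assumes N: "finite_measure N" "sets N = sets borel" and w: "integrable N w"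
    and h: "h \<in> borel_measurable N" and hw: "integrable N (\<lambda>x. h x * w x)"
    and \<nu>: "\<And>A. A \<in> sets borel \<Longrightarrow> \<nu> A = (LINT x:A|N. w x)" and A: "A \<in> sets borel"
  shows "signed_density h \<nu> A = (LINT x:A|N. h x * w x)"
proof -
  have wm [measurable]: "w \<in> borel_measurable N" using w by simp
  note [measurable] = h
  have Am: "A \<in> sets N" using A N(2) by simp
  have pos: "(LINT x:A|density N (\<lambda>x. ennreal (u x)). h x) = (LINT x|N. indicator A x * (h x * max 0 (u x)))"
    if u: "u \<in> borel_measurable N" for u
  proof -
    have "density N (\<lambda>x. ennreal (u x)) = density N (\<lambda>x. ennreal (max 0 (u x)))"
      by (intro density_cong) (use u in \<open>auto simp: max_def ennreal_neg\<close>)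
    then have "(LINT x:A|density N (\<lambda>x. ennreal (u x)). h x) =
        (LINT x|density N (\<lambda>x. ennreal (max 0 (u x))). indicator A x * h x)"
      by (simp add: set_lebesgue_integral_def)
    also have "\<dots> = (LINT x|N. max 0 (u x) * (indicator A x * h x))"
      by (rule integral_real_density) (use u Am in auto)
    finally show ?thesis by (simp add: mult.commute mult.left_commute)
  qed
  have "integrable N (\<lambda>x. w x * h x)" using hw by (simp add: mult.commute)
  have i: "integrable N (\<lambda>x. indicator A x * (h x * max 0 (c * w x)))" if "\<bar>c\<bar> = 1" for c :: real
  proof (rule Bochner_Integration.integrable_bound[OF hw])
    show "(\<lambda>x. indicator A x * (h x * max 0 (c * w x))) \<in> borel_measurable N" using Am by measurable
    show "AE x in N. norm (indicator A x * (h x * max 0 (c * w x))) \<le> norm (h x * w x)"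
    proof (rule AE_I2)
      fix x
      have "\<bar>c * w x\<bar> = \<bar>w x\<bar>" using that by (simp add: abs_mult)
      then have "\<bar>max 0 (c * w x)\<bar> \<le> \<bar>w x\<bar>" by linarith
      then show "norm (indicator A x * (h x * max 0 (c * w x))) \<le> norm (h x * w x)"
        by (auto simp: indicator_def abs_mult intro: mult_left_mono)
    qed
  qed
  have nu': "- \<nu> B = (LINT x:B|N. - w x)" if "B \<in> sets borel" for B
    using \<nu>[OF that] by (simp add: set_lebesgue_integral_def)
  have "signed_density h \<nu> A = (LINT x|N. indicator A x * (h x * max 0 (w x))) - (LINT x|N. indicator A x * (h x * max 0 (- w x)))"
    unfolding signed_density_def neg_variation_def
    by (simp add: pos_variation_density[OF N w \<nu>]
        pos_variation_density[of N "\<lambda>x. - w x" "\<lambda>A. - \<nu> A", OF N integrable_minus[OF w] nu'] pos)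
  also have "\<dots> = (LINT x|N. indicator A x * (h x * max 0 (w x)) - indicator A x * (h x * max 0 (- w x)))"
    using i[of 1] i[of "-1"] by simp
  also have "\<dots> = (LINT x:A|N. h x * w x)"
    unfolding set_lebesgue_integral_def
    by (rule Bochner_Integration.integral_cong) (auto simp: max_def)
  finally show ?thesis .
qed

section \<open>Pairing a derivation with Lipschitz functions\<close>

context radon_L1
begin

text \<open>Minus the integral of \<open>f\<close> times the divergence of \<open>\<phi> b\<close>,
  expanded by the product rule. The total mass formula and the \<open>LIP_c\<close>-linearity force
  the integral of \<open>\<phi>\<close> against \<open>Df(b)\<close> to have this value.\<close>

definition pairing :: "(('a \<Rightarrow> real) \<Rightarrow> 'a \<Rightarrow> real) \<Rightarrow> ('a \<Rightarrow> real) \<Rightarrow> real" where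
  "pairing b \<phi> = - (LINT x|M. f x * (\<phi> x * der_div M b x + b \<phi> x))"

lemma pairing_eq:
  assumes b: "represents b v" and \<phi>: "\<phi> \<in> LIP_c" and k: "is_div M (\<lambda>x. \<phi> x *\<^sub>R v x) k"
  shows "pairing b \<phi> = - (LINT x|M. f x * k x)"
  unfolding pairing_def
  using integral_f_cong[OF represents_mult(2)[OF b der_div_represents[OF b] \<phi>] k] by simp

lemma pairing_div:
  assumes b: "represents b v" and \<phi>: "\<phi> \<in> LIP_c"
  obtains k where "is_div M (\<lambda>x. \<phi> x *\<^sub>R v x) k" "pairing b \<phi> = - (LINT x|M. f x * k x)"
    "integrable M (\<lambda>x. f x * k x)" "(\<lambda>x. \<phi> x *\<^sub>R v x) \<in> Linf M"
proof -
  note k = represents_mult(2)[OF b der_div_represents[OF b] \<phi>]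
  show ?thesis
    by (rule that[OF k pairing_eq[OF b \<phi> k] integrable_f_mult[OF is_div_Linf[OF k]]
          Linf_scaleR[OF LIP_c_Linf[OF \<phi>] represents_field_Linf[OF b]]])
qed

lemma pairing_add:
  assumes b: "represents b v" and \<phi>: "\<phi> \<in> LIP_c" and \<psi>: "\<psi> \<in> LIP_c"
  shows "pairing b (\<lambda>x. \<phi> x + \<psi> x) = pairing b \<phi> + pairing b \<psi>"
proof -
  obtain k where k: "is_div M (\<lambda>x. \<phi> x *\<^sub>R v x) k" "pairing b \<phi> = - (LINT x|M. f x * k x)"
    "integrable M (\<lambda>x. f x * k x)" "(\<lambda>x. \<phi> x *\<^sub>R v x) \<in> Linf M" by (rule pairing_div[OF b \<phi>])
  obtain l where l: "is_div M (\<lambda>x. \<psi> x *\<^sub>R v x) l" "pairing b \<psi> = - (LINT x|M. f x * l x)"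
    "integrable M (\<lambda>x. f x * l x)" "(\<lambda>x. \<psi> x *\<^sub>R v x) \<in> Linf M" by (rule pairing_div[OF b \<psi>])
  have "is_div M (\<lambda>x. (\<phi> x + \<psi> x) *\<^sub>R v x) (\<lambda>x. k x + l x)"
    unfolding scaleR_left_distrib by (rule is_div_add[OF k(4) l(4) k(1) l(1)])
  from pairing_eq[OF b LIP_c_add[OF \<phi> \<psi>] this] show ?thesis
    using k(2,3) l(2,3) by (simp add: distrib_left)
qed

lemma pairing_cmult:
  assumes b: "represents b v" and \<phi>: "\<phi> \<in> LIP_c"
  shows "pairing b (\<lambda>x. c * \<phi> x) = c * pairing b \<phi>"
proof -
  obtain k where k: "is_div M (\<lambda>x. \<phi> x *\<^sub>R v x) k" "pairing b \<phi> = - (LINT x|M. f x * k x)"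
    by (rule pairing_div[OF b \<phi>])
  have "is_div M (\<lambda>x. (c * \<phi> x) *\<^sub>R v x) (\<lambda>x. c * k x)"
    unfolding scaleR_scaleR[symmetric] by (rule is_div_scale[OF k(1)])
  from pairing_eq[OF b LIP_c_cmult[OF \<phi>] this] show ?thesis
    using k(2) by (simp add: mult.left_commute)
qed

lemma pairing_cong:
  assumes "represents b v" "represents c v" "\<phi> \<in> LIP_c"
  shows "pairing b \<phi> = pairing c \<phi>"
  by (rule pairing_div[OF assms(2,3)]) (simp add: pairing_eq[OF assms(1,3)])

lemma pairing_add_derivation:
  assumes b: "represents b v" and c: "represents c u" and \<phi>: "\<phi> \<in> LIP_c"
  shows "pairing (\<lambda>g x. b g x + c g x) \<phi> = pairing b \<phi> + pairing c \<phi>"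
proof -
  obtain k where k: "is_div M (\<lambda>x. \<phi> x *\<^sub>R v x) k" "pairing b \<phi> = - (LINT x|M. f x * k x)"
    "integrable M (\<lambda>x. f x * k x)" "(\<lambda>x. \<phi> x *\<^sub>R v x) \<in> Linf M" by (rule pairing_div[OF b \<phi>])
  obtain l where l: "is_div M (\<lambda>x. \<phi> x *\<^sub>R u x) l" "pairing c \<phi> = - (LINT x|M. f x * l x)"
    "integrable M (\<lambda>x. f x * l x)" "(\<lambda>x. \<phi> x *\<^sub>R u x) \<in> Linf M" by (rule pairing_div[OF c \<phi>])
  have "is_div M (\<lambda>x. \<phi> x *\<^sub>R (v x + u x)) (\<lambda>x. k x + l x)"
    unfolding scaleR_right_distrib by (rule is_div_add[OF k(4) l(4) k(1) l(1)])
  from pairing_eq[OF represents_add[OF b c der_div_represents[OF b] der_div_represents[OF c]] \<phi> this] show ?thesis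
    using k(2,3) l(2,3) by (simp add: distrib_left)
qed

lemma pairing_scale_derivation:
  assumes b: "represents b v" and \<phi>: "\<phi> \<in> LIP_c"
  shows "pairing (\<lambda>g x. t * b g x) \<phi> = t * pairing b \<phi>"
proof -
  obtain k where k: "is_div M (\<lambda>x. \<phi> x *\<^sub>R v x) k" "pairing b \<phi> = - (LINT x|M. f x * k x)"
    by (rule pairing_div[OF b \<phi>])
  have "is_div M (\<lambda>x. \<phi> x *\<^sub>R (t *\<^sub>R v x)) (\<lambda>x. t * k x)"
    unfolding scaleR_left_commute[of _ t] by (rule is_div_scale[OF k(1)])
  from pairing_eq[OF represents_scale[OF b] \<phi> this] show ?thesis
    using k(2) by (simp add: mult.left_commute)
qed

lemma pairing_mult_derivation:
  assumes b: "represents b v" and h: "h \<in> LIP_c" and \<phi>: "\<phi> \<in> LIP_c"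
  shows "pairing (\<lambda>g x. h x * b g x) \<phi> = pairing b (\<lambda>x. \<phi> x * h x)"
proof -
  obtain k where k: "is_div M (\<lambda>x. (\<phi> x * h x) *\<^sub>R v x) k" "pairing b (\<lambda>x. \<phi> x * h x) = - (LINT x|M. f x * k x)"
    by (rule pairing_div[OF b LIP_c_mult[OF \<phi> h]])
  from k(1) have "is_div M (\<lambda>x. \<phi> x *\<^sub>R (h x *\<^sub>R v x)) k" by (simp only: scaleR_scaleR)
  from pairing_eq[OF represents_mult(1)[OF b der_div_represents[OF b] h] \<phi> this] show ?thesis
    using k(2) by simp
qed

end

section \<open>The density of the differential with respect to the variation\<close>

context BV_function
begin

interpretation NN: finite_radon N
  by (intro finite_radon.intro radon.intro radon_N finite_N)

text \<open>With a smooth \<open>F n\<close> in place of \<open>f\<close>, integration by parts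
  moves the divergence onto \<open>grad (F n)\<close> and leaves an integral of
  \<open>\<bar>\<phi>\<bar>\<close> against the energy measure. The upper bound of
  \<open>smooth_approximation_weak\<close> turns it into an integral against
  \<open>N\<close>.\<close>

lemma pairing_bound:
  assumes b: "represents b v" and C: "0 \<le> C" "AE x in M. norm (v x) \<le> C" and \<phi>: "\<phi> \<in> LIP_c"
  shows "\<bar>pairing b \<phi>\<bar> \<le> C * (LINT x|N. \<bar>\<phi> x\<bar>)"
proof -
  obtain k where k: "is_div M (\<lambda>x. \<phi> x *\<^sub>R v x) k" "pairing b \<phi> = - (LINT x|M. f x * k x)"
    by (rule pairing_div[OF b \<phi>])
  obtain F where F: "\<And>n. F n \<in> Cinf_c" "(\<lambda>n. LINT x|M. \<bar>F n x - f x\<bar>) \<longlonglongrightarrow> 0"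
    "\<And>\<zeta> c e. continuous_on UNIV \<zeta> \<Longrightarrow> (\<And>x. 0 \<le> \<zeta> x) \<Longrightarrow> (\<And>x. \<zeta> x \<le> c) \<Longrightarrow> 0 < e \<Longrightarrow>
      \<forall>\<^sub>F n in sequentially. (LINT x|M. \<zeta> x * norm (grad (F n) x)) < (LINT x|N. \<zeta> x) + e"
    by (rule smooth_approximation_weak) blast
  have "L1_converges M UNIV F f"
    using F(2) LIP_c_integrable[OF Cinf_c_LIP_c[OF F(1)]]
    by (simp add: L1_converges_def set_integrable_def set_lebesgue_integral_def)
  from L1_converges_tendsto[OF this _ is_div_Linf[OF k(1)]]
  have lim: "(\<lambda>n. LINT x|M. F n x * k x) \<longlonglongrightarrow> (LINT x|M. f x * k x)"
    using f by (simp add: set_integrable_def set_lebesgue_integral_def)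
  have bound: "\<bar>LINT x|M. F n x * k x\<bar> \<le> C * (LINT x|M. \<bar>\<phi> x\<bar> * norm (grad (F n) x))" for n
  proof -
    have kn: "(LINT x|M. F n x * k x) = - (LINT x|M. grad (F n) x \<bullet> (\<phi> x *\<^sub>R v x))"
      using k(1) F(1) by (simp add: is_div_def)
    have i: "integrable M (\<lambda>x. grad (F n) x \<bullet> (\<phi> x *\<^sub>R v x))"
      by (rule integrable_grad_inner[OF F(1) Linf_scaleR[OF LIP_c_Linf[OF \<phi>] represents_field_Linf[OF b]]])
    have "integrable M (\<lambda>x. norm (grad (F n) x) * \<phi> x)"
      by (rule integrable_mult_Linf[OF integrable_norm[OF grad_integrable[OF F(1)]] LIP_c_Linf[OF \<phi>]])
    from Bochner_Integration.integrable_abs[OF this]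
    have j: "integrable M (\<lambda>x. \<bar>\<phi> x\<bar> * norm (grad (F n) x))" by (simp add: abs_mult mult.commute)
    have "\<bar>LINT x|M. F n x * k x\<bar> \<le> (LINT x|M. \<bar>grad (F n) x \<bullet> (\<phi> x *\<^sub>R v x)\<bar>)"
      unfolding kn abs_minus_cancel by (rule integral_abs_bound)
    also have "\<dots> \<le> (LINT x|M. C * (\<bar>\<phi> x\<bar> * norm (grad (F n) x)))"
    proof (rule integral_mono_AE)
      show "AE x in M. \<bar>grad (F n) x \<bullet> (\<phi> x *\<^sub>R v x)\<bar> \<le> C * (\<bar>\<phi> x\<bar> * norm (grad (F n) x))"
        using C(2)
      proof eventually_elim
        case (elim x)
        have "\<bar>grad (F n) x \<bullet> (\<phi> x *\<^sub>R v x)\<bar> \<le> norm (grad (F n) x) * (\<bar>\<phi> x\<bar> * norm (v x))"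
          using Cauchy_Schwarz_ineq2[of "grad (F n) x" "\<phi> x *\<^sub>R v x"] by simp
        also have "\<dots> \<le> norm (grad (F n) x) * (\<bar>\<phi> x\<bar> * C)"
          by (intro mult_left_mono elim) auto
        finally show ?case by (simp only: mult_ac)
      qed
    qed (use i j in auto)
    also have "\<dots> = C * (LINT x|M. \<bar>\<phi> x\<bar> * norm (grad (F n) x))" by simp
    finally show ?thesis .
  qed
  obtain B where B: "\<And>x. \<bar>\<phi> x\<bar> \<le> B" by (rule LIP_cE[OF \<phi>], rule that)
  obtain l where "l-lipschitz_on UNIV \<phi>" using \<phi> by (auto simp: LIP_c_def)
  then have cont: "continuous_on UNIV (\<lambda>x. \<bar>\<phi> x\<bar>)"
    by (intro continuous_on_rabs lipschitz_on_continuous_on)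
  have "\<bar>LINT x|M. f x * k x\<bar> \<le> C * (LINT x|N. \<bar>\<phi> x\<bar>)"
  proof (rule field_le_epsilon)
    fix e :: real assume e: "0 < e"
    \<comment> \<open>The divisor is \<open>C + 1\<close>, since \<open>C\<close> may be
      \<open>0\<close>.\<close>
    then have e': "0 < e / (C + 1)" using C(1) by simp
    have "\<forall>\<^sub>F n in sequentially. \<bar>LINT x|M. F n x * k x\<bar> \<le> C * ((LINT x|N. \<bar>\<phi> x\<bar>) + e / (C + 1))"
      using F(3)[OF cont abs_ge_zero B e']
      by eventually_elim (rule order_trans[OF bound], intro mult_left_mono C(1), simp)
    then have "\<bar>LINT x|M. f x * k x\<bar> \<le> C * ((LINT x|N. \<bar>\<phi> x\<bar>) + e / (C + 1))"
      by (intro tendsto_upperbound[OF tendsto_rabs[OF lim]]) auto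
    moreover have "C * (e / (C + 1)) \<le> e" using C(1) e by (simp add: field_simps)
    ultimately show "\<bar>LINT x|M. f x * k x\<bar> \<le> C * (LINT x|N. \<bar>\<phi> x\<bar>) + e"
      unfolding distrib_left by linarith
  qed
  then show ?thesis by (simp add: k(2))
qed

text \<open>\<open>w\<close> is the density of \<open>Df(b)\<close> with respect to
  \<open>N\<close>; boundedness makes it integrable and, through tests, unique a.e.\<close>

definition has_density :: "(('a \<Rightarrow> real) \<Rightarrow> 'a \<Rightarrow> real) \<Rightarrow> ('a \<Rightarrow> real) \<Rightarrow> bool" where
  "has_density b w \<longleftrightarrow> w \<in> Linf N \<and> (\<forall>\<phi>\<in>LIP_c. (LINT x|N. \<phi> x * w x) = pairing b \<phi>)"

lemma has_density_exists:
  assumes b: "represents b v" and C: "0 \<le> C" "AE x in M. norm (v x) \<le> C"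
  obtains w where "has_density b w" "\<And>x. \<bar>w x\<bar> \<le> C"
proof -
  obtain w where w: "w \<in> borel_measurable N" "\<And>x. \<bar>w x\<bar> \<le> C" "\<And>\<phi>. \<phi> \<in> LIP_c \<Longrightarrow> (LINT x|N. \<phi> x * w x) = pairing b \<phi>"
    using NN.functional_has_density[OF pairing_add[OF b] pairing_cmult[OF b] C(1) pairing_bound[OF b C]] by blast
  then have "w \<in> Linf N" by (intro LinfI[of w N C]) auto
  then show ?thesis by (intro that[of w]) (use w in \<open>auto simp: has_density_def\<close>)
qed

lemma has_density_unique: "has_density b w \<Longrightarrow> has_density b w' \<Longrightarrow> AE x in N. w x = w' x"
  by (rule NN.AE_eq_of_smooth_tests) (auto simp: has_density_def Cinf_c_LIP_c)

lemma Linf_N_integrable: "w \<in> Linf N \<Longrightarrow> integrable N (w :: 'a \<Rightarrow> real)"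
  by (erule LinfE) (rule NN.integrable_const_bound)

lemma has_density_cong:
  assumes "represents b v" "represents c v" "has_density b w" shows "has_density c w"
  using assms(3) pairing_cong[OF assms(1,2)] by (simp add: has_density_def)

lemma has_density_add:
  assumes "represents b v" "represents c u" and w: "has_density b w" and z: "has_density c z"
  shows "has_density (\<lambda>g x. b g x + c g x) (\<lambda>x. w x + z x)"
  unfolding has_density_def
proof (intro conjI ballI)
  have wL: "w \<in> Linf N" and zL: "z \<in> Linf N" using w z by (auto simp: has_density_def)
  show "(\<lambda>x. w x + z x) \<in> Linf N" by (rule Linf_add[OF wL zL])
  fix \<phi> :: "'a \<Rightarrow> real" assume \<phi>: "\<phi> \<in> LIP_c"
  show "(LINT x|N. \<phi> x * (w x + z x)) = pairing (\<lambda>g x. b g x + c g x) \<phi>"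
    using w z \<phi> NN.integrable_LIP_c_mult[OF \<phi> wL] NN.integrable_LIP_c_mult[OF \<phi> zL]
      pairing_add_derivation[OF assms(1,2) \<phi>]
    by (simp add: distrib_left has_density_def)
qed

lemma has_density_scale:
  assumes "represents b v" and w: "has_density b w"
  shows "has_density (\<lambda>g x. t * b g x) (\<lambda>x. t * w x)"
  unfolding has_density_def
proof (intro conjI ballI)
  have "w \<in> Linf N" using w by (simp add: has_density_def)
  then show "(\<lambda>x. t * w x) \<in> Linf N" by (rule Linf_cmult)
  fix \<phi> :: "'a \<Rightarrow> real" assume \<phi>: "\<phi> \<in> LIP_c"
  show "(LINT x|N. \<phi> x * (t * w x)) = pairing (\<lambda>g x. t * b g x) \<phi>"
    using w \<phi> pairing_scale_derivation[OF assms(1) \<phi>] by (simp add: has_density_def mult.left_commute)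
qed

lemma has_density_mult:
  assumes b: "represents b v" and w: "has_density b w" and h: "h \<in> LIP_c"
  shows "has_density (\<lambda>g x. h x * b g x) (\<lambda>x. h x * w x)"
  unfolding has_density_def
proof (intro conjI ballI)
  have "w \<in> Linf N" using w by (simp add: has_density_def)
  then show "(\<lambda>x. h x * w x) \<in> Linf N" by (rule Linf_mult[OF NN.LIP_c_Linf[OF h]])
  fix \<phi> :: "'a \<Rightarrow> real" assume \<phi>: "\<phi> \<in> LIP_c"
  show "(LINT x|N. \<phi> x * (h x * w x)) = pairing (\<lambda>g x. h x * b g x) \<phi>"
    using w LIP_c_mult[OF \<phi> h] pairing_mult_derivation[OF b h \<phi>] by (simp add: has_density_def flip: mult.assoc)
qed

definition differential :: "(('a \<Rightarrow> real) \<Rightarrow> 'a \<Rightarrow> real) \<Rightarrow> 'a set \<Rightarrow> real" where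
  "differential b A = (LINT x:A|N. (SOME w. has_density b w) x)"

lemma has_density_integrable: "has_density b w \<Longrightarrow> integrable N w"
  by (simp add: has_density_def Linf_N_integrable)

lemma has_density_set_integrable: "has_density b w \<Longrightarrow> A \<in> sets borel \<Longrightarrow> integrable N (\<lambda>x. indicator A x * w x)"
  by (rule density_set_integrable[OF finite_N sets_N has_density_integrable])

lemma differential_eq:
  assumes w: "has_density b w" and A: "A \<in> sets borel"
  shows "differential b A = (LINT x:A|N. w x)"
  unfolding differential_def set_lebesgue_integral_def
proof (rule integral_cong_AE)
  have s: "has_density b (SOME w. has_density b w)" by (rule someI[where P = "has_density b", OF w])
  show "AE x in N. indicator A x *\<^sub>R (SOME w. has_density b w) x = indicator A x *\<^sub>R w x"
    using has_density_unique[OF s w] by eventually_elim simp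
  show "(\<lambda>x. indicator A x *\<^sub>R (SOME w. has_density b w) x) \<in> borel_measurable N"
    "(\<lambda>x. indicator A x *\<^sub>R w x) \<in> borel_measurable N"
    using has_density_set_integrable[OF s A] has_density_set_integrable[OF w A] by auto
qed

lemma Der_b_density:
  assumes b: "b \<in> Der_b M"
  obtains v w where "represents b v" "has_density b w"
proof -
  obtain v where v: "represents b v" by (rule Der_b_represents[OF b])
  obtain C where C: "0 \<le> C" "AE x in M. norm (v x) \<le> C" by (rule LinfE[OF represents_field_Linf[OF v]])
  show ?thesis by (rule has_density_exists[OF v C]) (rule that[OF v])
qed

lemma differential_add:
  assumes b: "b \<in> Der_b M" and c: "c \<in> Der_b M" and A: "A \<in> sets borel"
  shows "differential (\<lambda>g x. b g x + c g x) A = differential b A + differential c A"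
proof -
  obtain v w where v: "represents b v" "has_density b w" by (rule Der_b_density[OF b])
  obtain u z where u: "represents c u" "has_density c z" by (rule Der_b_density[OF c])
  show ?thesis
    using has_density_set_integrable[OF v(2) A] has_density_set_integrable[OF u(2) A]
    by (simp add: differential_eq[OF _ A, OF has_density_add[OF v(1) u(1) v(2) u(2)]]
        differential_eq[OF v(2) A] differential_eq[OF u(2) A] set_lebesgue_integral_def distrib_left)
qed

lemma differential_scale:
  assumes b: "b \<in> Der_b M" and A: "A \<in> sets borel"
  shows "differential (\<lambda>g x. t * b g x) A = t * differential b A"
proof -
  obtain v w where v: "represents b v" "has_density b w" by (rule Der_b_density[OF b])
  show ?thesis
    by (simp add: differential_eq[OF has_density_scale[OF v] A] differential_eq[OF v(2) A])
qed

lemma differential_mult: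
  assumes b: "b \<in> Der_b M" and h: "h \<in> LIP_c" and A: "A \<in> sets borel"
  shows "differential (\<lambda>g x. h x * b g x) A = signed_density h (differential b) A"
proof -
  obtain v w where v: "represents b v" "has_density b w" by (rule Der_b_density[OF b])
  note hw = has_density_mult[OF v h]
  show ?thesis
    unfolding differential_eq[OF hw A]
    by (rule signed_density_density[OF finite_N sets_N has_density_integrable[OF v(2)]
          NN.LIP_c_measurable[OF h] has_density_integrable[OF hw] differential_eq[OF v(2)] A, symmetric])
qed

text \<open>The density is tested with compactly supported functions only; cutoffs increasing to the
  whole space reach the constant \<open>1\<close> on both sides.\<close>

lemma differential_total:
  assumes b: "b \<in> Der_b M"
  shows "differential b UNIV = - (LINT x|M. f x * der_div M b x)"
proof -
  obtain v w where v: "represents b v" "has_density b w" by (rule Der_b_density[OF b])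
  note g = der_div_represents[OF v(1)] and vL = represents_field_Linf[OF v(1)]
  obtain u where u: "\<And>n. u n \<in> Cinf_c" "\<And>n x. 0 \<le> u n x" "\<And>n x. u n x \<le> 1" "\<And>x. (\<lambda>n. u n x) \<longlonglongrightarrow> 1"
    "(\<lambda>n. LINT x|M. f x * (u n x * der_div M b x + grad (u n) x \<bullet> v x)) \<longlonglongrightarrow> (LINT x|M. f x * der_div M b x)"
    by (rule cutoff_divergence_limit[OF vL g], rule that)
  note iw = has_density_integrable[OF v(2)]
  have uL: "u n \<in> LIP_c" for n by (rule Cinf_c_LIP_c[OF u(1)])
  have "(\<lambda>n. LINT x|N. u n x * w x) \<longlonglongrightarrow> (LINT x|N. w x)"
  proof (rule integral_dominated_convergence[of _ _ _ "\<lambda>x. \<bar>w x\<bar>"])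
    show "AE x in N. (\<lambda>n. u n x * w x) \<longlonglongrightarrow> w x"
      using tendsto_mult[OF u(4) tendsto_const[of "w _"]] by (intro AE_I2) simp
    show "AE x in N. norm (u n x * w x) \<le> \<bar>w x\<bar>" for n
      using u(2,3) by (intro AE_I2) (simp add: abs_mult mult_left_le_one_le)
    show "(\<lambda>x. u n x * w x) \<in> borel_measurable N" for n
      using NN.LIP_c_measurable[OF uL] iw by measurable
  qed (use iw in auto)
  moreover have "(LINT x|N. u n x * w x) = - (LINT x|M. f x * (u n x * der_div M b x + grad (u n) x \<bullet> v x))" for n
    using v(2) uL pairing_eq[OF v(1) uL is_div_mult[OF vL g u(1)]] by (simp add: has_density_def)
  ultimately have "(LINT x|N. w x) = - (LINT x|M. f x * der_div M b x)"
    using LIMSEQ_unique[OF _ tendsto_minus[OF u(5)]] by simp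
  then show ?thesis by (simp add: differential_eq[OF v(2)] set_lebesgue_integral_def)
qed

text \<open>The difference of two derivations is itself represented by a field, with norm at most
  \<open>der_norm\<close> a.e.; its density inherits this bound.\<close>

lemma tv_norm_differential_le:
  assumes b: "b \<in> Der_b M" and c: "c \<in> Der_b M"
  shows "tv_norm (\<lambda>A. differential c A - differential b A) \<le> ennreal (der_norm M (\<lambda>g x. c g x - b g x) * measure N UNIV)"
proof -
  obtain v w where v: "represents b v" "has_density b w" by (rule Der_b_density[OF b])
  obtain u z where u: "represents c u" "has_density c z" by (rule Der_b_density[OF c])
  \<comment> \<open>Written as a sum with a multiple by \<open>- 1\<close>, so that additivity and
    homogeneity of the differential apply.\<close>
  let ?d = "\<lambda>g x. c g x + - 1 * b g x"
  note mv = represents_scale[OF v(1), of "- 1"]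
  note d = represents_add[OF u(1) mv der_div_represents[OF u(1)] der_div_represents[OF mv]]
  have d_eq: "?d = (\<lambda>g x. c g x - b g x)" by simp
  have dL: "der_abs M ?d \<in> Linf M" using represents_Der_b[OF d] by (simp add: Der_b_def)
  have n0: "0 \<le> der_norm M ?d" unfolding der_norm_def by (rule Linf_norm_bound(1)[OF dL])
  have "AE x in M. norm (u x + - 1 *\<^sub>R v x) \<le> der_norm M ?d"
    using Linf_norm_bound(2)[OF dL] der_abs_represents(1)[OF d] unfolding der_norm_def
    by eventually_elim simp
  then obtain y where y: "has_density ?d y" "\<And>x. \<bar>y x\<bar> \<le> der_norm M ?d"
    by (rule has_density_exists[OF d n0]) (rule that)
  have "differential c A - differential b A = (LINT x:A|N. y x)" if A: "A \<in> sets borel" for A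
    unfolding differential_eq[OF y(1) A, symmetric]
    using differential_add[OF c represents_Der_b[OF mv] A] differential_scale[OF b A, of "- 1"] by simp
  then have "tv_norm (\<lambda>A. differential c A - differential b A) \<le> ennreal (der_norm M ?d * measure N (space N))"
    using has_density_integrable[OF y(1)] n0 y(2) by (intro tv_norm_density_le[OF finite_N sets_N, where w = y]) auto
  then show ?thesis by (simp only: d_eq space_N)
qed

lemma is_Der_differential_differential: "is_Der_differential M f differential"
  unfolding is_Der_differential_def
proof (intro conjI ballI allI impI)
  fix b assume b: "b \<in> Der_b M"
  obtain v w where v: "represents b v" "has_density b w" by (rule Der_b_density[OF b])
  have "has_density b (SOME w. has_density b w)" by (rule someI[where P = "has_density b", OF v(2)])
  from signed_measure_density[OF finite_N sets_N has_density_integrable[OF this]]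
  show "signed_measure (differential b)" by (simp add: differential_def[abs_def])
  show "differential b UNIV = - (LINT x|M. f x * der_div M b x)" by (rule differential_total[OF b])
  fix A :: "'a set" assume A: "A \<in> sets borel"
  show "differential (\<lambda>g x. t * b g x) A = t * differential b A" for t by (rule differential_scale[OF b A])
  show "differential (\<lambda>g x. h x * b g x) A = signed_density h (differential b) A" if "h \<in> LIP_c" for h
    by (rule differential_mult[OF b that A])
  fix c assume c: "c \<in> Der_b M"
  show "differential (\<lambda>g x. b g x + c g x) A = differential b A + differential c A"
    by (rule differential_add[OF b c A])
  assume "\<forall>g\<in>LIP_c. AE x in M. b g x = c g x"
  then have "represents c v" by (intro represents_cong[OF v(1) c]) blast
  from has_density_cong[OF v(1) this v(2)] show "differential b A = differential c A"
    by (simp add: differential_eq[OF _ A] v(2))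
next
  fix b and \<epsilon> :: real assume b: "b \<in> Der_b M" and \<epsilon>: "0 < \<epsilon>"
  let ?m = "measure N UNIV"
  \<comment> \<open>The mass of \<open>N\<close> may be \<open>0\<close>, hence the summand
    \<open>1\<close>.\<close>
  have m: "0 < 1 + ?m" using measure_nonneg[of N UNIV] by linarith
  show "\<exists>\<delta>>0. \<forall>c\<in>Der_b M. der_norm M (\<lambda>g x. c g x - b g x) < \<delta> \<longrightarrow>
      tv_norm (\<lambda>A. differential c A - differential b A) < ennreal \<epsilon>"
  proof (intro exI[of _ "\<epsilon> / (1 + ?m)"] conjI ballI impI)
    show "0 < \<epsilon> / (1 + ?m)" using \<epsilon> m by simp
    fix c assume c: "c \<in> Der_b M" and "der_norm M (\<lambda>g x. c g x - b g x) < \<epsilon> / (1 + ?m)"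
    then have "der_norm M (\<lambda>g x. c g x - b g x) * ?m \<le> \<epsilon> / (1 + ?m) * ?m"
      by (intro mult_right_mono) auto
    also have "\<dots> < \<epsilon>" using \<epsilon> m by (simp add: divide_simps)
    finally show "tv_norm (\<lambda>A. differential c A - differential b A) < ennreal \<epsilon>"
      by (intro le_less_trans[OF tv_norm_differential_le[OF b c]] ennreal_lessI \<epsilon>)
  qed
qed

lemma is_var_Der_N: "is_var_Der M f N"
  unfolding is_var_Der_def
  using SUP_Der_b_eq_var_open BV_finite by (simp add: sets_N emeasure_N_open BV_seminorm_eq[symmetric])

text \<open>Open sets are stable under intersection and generate the Borel sets, so finite measures
  that agree on them coincide.\<close>

lemma var_Der_eq: "var_Der M f = N"
  unfolding var_Der_def
proof (rule the_equality[where P = "is_var_Der M f", OF is_var_Der_N])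
  fix N' assume N': "is_var_Der M f N'"
  have o: "emeasure N' U = emeasure N U" if "open U" for U
    using N' SUP_Der_b_eq_var_open[OF that] that by (simp add: is_var_Der_def emeasure_N_open)
  show "N' = N"
  proof (rule measure_eqI_generator_eq[where E = "{S. open S}" and \<Omega> = UNIV and A = "\<lambda>_. UNIV"])
    show "sets N' = sigma_sets UNIV {S. open S}" "sets N = sigma_sets UNIV {S. open S}"
      using N' by (simp_all add: is_var_Der_def sets_N borel_def)
    show "emeasure N' UNIV \<noteq> \<infinity>" using N' unfolding is_var_Der_def by (elim conjE) (simp only: less_imp_neq not_False_eq_True)
  qed (auto simp: o Int_stable_def)
qed

lemma relaxations_eq_var: "var_Lip M f B = var M f B" "var_Cinf M f B = var M f B"
  unfolding var_Lip_def var_Cinf_def var_def by (intro outer_ext_cong relaxations_eq_var_open; assumption)+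

lemma BV_function_BV_Lip: "f \<in> BV_Lip M"
proof -
  obtain F where F: "\<And>n. F n \<in> Cinf_c" "(\<lambda>n. LINT x|M. \<bar>F n x - f x\<bar>) \<longlonglongrightarrow> 0"
    "(\<lambda>n. \<integral>\<^sup>+x. ennreal (norm (grad (F n) x)) \<partial>M) \<longlonglongrightarrow> BV_seminorm M f"
    by (rule smooth_approximation[OF BV_finite], rule that)
  have "BV_seminorm M f < BV_seminorm M f + 1" using BV_finite by (cases "BV_seminorm M f") (auto simp: ennreal_less_iff simp flip: ennreal_plus ennreal_1)
  \<comment> \<open>Convergence bounds the energies from the index \<open>k\<close> on; the shifted
    sequence satisfies the bound throughout.\<close>
  from order_tendstoD(2)[OF F(3) this] obtain k where
    k: "\<And>n. k \<le> n \<Longrightarrow> (\<integral>\<^sup>+x. ennreal (norm (grad (F n) x)) \<partial>M) < BV_seminorm M f + 1"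
    by (auto simp: eventually_sequentially)
  have "(\<integral>\<^sup>+x. lip_a (F (n + k)) x \<partial>M) \<le> BV_seminorm M f + 1" for n
    using nn_integral_lip_a_le_grad[OF Cinf_c_Cinf[OF F(1)] open_UNIV, of M "n + k"] k[of "n + k"] by simp
  then have "(SUP n. \<integral>\<^sup>+x. lip_a (F (n + k)) x \<partial>M) \<le> BV_seminorm M f + 1" by (intro SUP_least)
  also have "\<dots> < \<infinity>" using BV_finite by simp
  finally have "(SUP n. \<integral>\<^sup>+x. lip_a (F (n + k)) x \<partial>M) < \<infinity>" .
  moreover have "L1_converges M UNIV (\<lambda>n. F (n + k)) f"
    using LIMSEQ_ignore_initial_segment[OF F(2), of k] LIP_c_integrable[OF Cinf_c_LIP_c[OF F(1)]]
    by (simp add: L1_converges_def set_integrable_def set_lebesgue_integral_def)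
  ultimately show ?thesis
    using f LIP_c_LIP_loc[OF Cinf_c_LIP_c[OF F(1)]] unfolding BV_Lip_def
    by (intro CollectI conjI exI[of _ "\<lambda>n. F (n + k)"]) auto
qed

end

subsection \<open>Equality of the function spaces and of the variations\<close>

context radon
begin

lemma BV_function_iff: "BV_function M f \<longleftrightarrow> f \<in> BV M"
  by (auto simp: BV_def BV_function_def BV_function_axioms_def radon_L1_def radon_L1_axioms_def radon_axioms)

lemma BV_Der_eq: "BV_Der M = BV M"
proof (intro antisym subsetI)
  fix f assume "f \<in> BV_Der M"
  then obtain Df where f: "integrable M f" and D: "is_Der_differential M f Df" by (auto simp: BV_Der_def)
  interpret radon_L1 M f by unfold_locales (rule f)
  show "f \<in> BV M" using f BV_finite_of_differential[OF D] by (simp add: BV_def)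
next
  fix f assume "f \<in> BV M"
  then interpret BV_function M f by (simp add: BV_function_iff)
  show "f \<in> BV_Der M" using f is_Der_differential_differential by (auto simp: BV_Der_def)
qed

lemma BV_Lip_eq: "BV_Lip M = BV M"
proof (intro antisym subsetI)
  fix f assume "f \<in> BV_Lip M"
  then obtain F where f: "integrable M f" and F: "\<forall>n. F n \<in> LIP_loc UNIV" "L1_converges M UNIV F f"
    "(SUP n. \<integral>\<^sup>+x. lip_a (F n) x \<partial>M) < \<infinity>" by (auto simp: BV_Lip_def)
  interpret radon_L1 M f by unfold_locales (rule f)
  have "BV_seminorm M f \<le> var_Lip_open M f UNIV"
    unfolding BV_seminorm_eq by (rule var_open_le_var_Lip_open) simp
  also have "\<dots> \<le> liminf (\<lambda>n. \<integral>\<^sup>+x\<in>UNIV. lip_a (F n) x \<partial>M)"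
    unfolding var_Lip_open_def by (rule INF_lower) (use F in auto)
  also have "\<dots> \<le> (SUP n. \<integral>\<^sup>+x. lip_a (F n) x \<partial>M)"
    by (rule order_trans[OF Liminf_le_Limsup Limsup_bounded])
      (auto intro!: always_eventually SUP_upper)
  finally show "f \<in> BV M" using f F(3) by (simp add: BV_def)
next
  fix f assume "f \<in> BV M"
  then interpret BV_function M f by (simp add: BV_function_iff)
  show "f \<in> BV_Lip M" by (rule BV_function_BV_Lip)
qed

lemma BV_Cinf_eq: "BV_Cinf M = BV M"
proof (intro antisym subsetI)
  fix f assume "f \<in> BV_Cinf M"
  then have f: "integrable M f" and fin: "var_Cinf M f UNIV < \<infinity>" by (auto simp: BV_Cinf_def)
  interpret radon_L1 M f by unfold_locales (rule f)
  \<comment> \<open>The whole space is its only open superset, so the outer extension takes the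
    value of the functional on open sets there.\<close>
  have "{\<Omega>. open \<Omega> \<and> UNIV \<subseteq> \<Omega>} = {UNIV :: 'a set}" by auto
  then have "var_Cinf M f UNIV = var_Cinf_open M f UNIV" by (simp add: var_Cinf_def outer_ext_def)
  then have "BV_seminorm M f < \<infinity>"
    using fin var_open_le_var_Lip_open[OF open_UNIV] var_Lip_open_le_var_Cinf_open[OF open_UNIV, of M f]
    by (auto simp: BV_seminorm_eq intro: le_less_trans order_trans)
  then show "f \<in> BV M" using f by (simp add: BV_def)
next
  fix f assume "f \<in> BV M"
  then interpret BV_function M f by (simp add: BV_function_iff)
  show "f \<in> BV_Cinf M"
    using f finite_borel_measure_var by (simp add: BV_Cinf_def relaxations_eq_var finite_borel_measure_def)
qed

end

theorem theorem5p7: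
  fixes \<mu> :: "'a::euclidean_space measure"
  assumes "radon_measure \<mu>"
  shows "BV \<mu> = BV_Der \<mu> \<and> BV_Der \<mu> = BV_Lip \<mu> \<and> BV_Lip \<mu> = BV_Cinf \<mu> \<and>
    (\<forall>f\<in>BV \<mu>.
       finite_borel_measure (var \<mu> f) \<and> is_var_Der \<mu> f (var_Der \<mu> f) \<and>
       finite_borel_measure (var_Lip \<mu> f) \<and> finite_borel_measure (var_Cinf \<mu> f) \<and>
       (\<forall>B\<in>sets borel. var \<mu> f B = emeasure (var_Der \<mu> f) B \<and>
          emeasure (var_Der \<mu> f) B = var_Lip \<mu> f B \<and>
          var_Lip \<mu> f B = var_Cinf \<mu> f B))"
proof -
  interpret radon \<mu> by unfold_locales (rule assms)
  have "finite_borel_measure (var \<mu> f) \<and> is_var_Der \<mu> f (var_Der \<mu> f) \<and>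
       finite_borel_measure (var_Lip \<mu> f) \<and> finite_borel_measure (var_Cinf \<mu> f) \<and>
       (\<forall>B\<in>sets borel. var \<mu> f B = emeasure (var_Der \<mu> f) B \<and>
          emeasure (var_Der \<mu> f) B = var_Lip \<mu> f B \<and>
          var_Lip \<mu> f B = var_Cinf \<mu> f B)" if "f \<in> BV \<mu>" for f
  proof -
    interpret BV_function \<mu> f using that by (simp add: BV_function_iff)
    have "var_Lip \<mu> f = var \<mu> f" "var_Cinf \<mu> f = var \<mu> f" by (intro ext relaxations_eq_var)+
    then show ?thesis
      using finite_borel_measure_var is_var_Der_N emeasure_N by (simp add: var_Der_eq)
  qed
  then show ?thesis by (simp add: BV_Der_eq BV_Lip_eq BV_Cinf_eq)
qed

end
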